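(* Let $\lambda>0$, $0<\sigma<1$, $0<\alpha<1$, and $\widetilde\lambda=\min\{\lambda,1\}$. (a) If $\alpha+2\sigma<\widetilde\lambda$ and $f\in C^\alpha_+$, then $u=\Delta_\lambda^{-\sigma}f\in C^{\alpha+2\sigma}_+$ and $$\|u\|_{C^{\alpha+2\sigma}_+}\le C\|f\|_{C^\alpha_+}.$$ (b) If $0<\alpha-2\sigma<1$, $\lambda\ge 1$ and $u\in C^\alpha_+\cap L_\sigma$, then $\Delta_\lambda^\sigma u\in C^{\alpha-2\sigma}_+$ and $$\|\Delta_\lambda^\sigma u\|_{C^{\alpha-2\sigma}_+}\le C\|u\|_{C^\alpha_+}.$$ Here $C$ is a positive constant independent of $f$ and $u$.
   Context: $\mathbb{R}_+=(0,\infty)$. For $0<\alpha<1$, $C^\alpha_+$ is the space of continuous functions $f$ on $\mathbb{R}_+$ with finite norm $$\|f\|_{C^\alpha_+}=\sup_{x,y\in\mathbb{R}_+,\,x\ne y}\frac{|f(x)-f(y)|}{|x-y|^\alpha}+\sup_{x\in\mathbb{R}_+}x^{-\alpha}|f(x)|.$$ For $\rho>0$, $L_\rho=\{f:\mathbb{R}_+\to\mathbb{R}:\ \int_0^\infty |f(x)|(1+x)^{-1-2\rho}\,dx<\infty\}$. Bessel operator: $\Delta_\lambda=-\frac{d^2}{dx^2}+\frac{\lambda(\lambda-1)}{x^2}$ on $\mathbb{R}_+$. Heat and Poisson kernels: for $x,y,t>0$, $$W_t^\lambda(x,y)=\frac{\sqrt{xy}}{2t}I_{\lambda-1/2}\Big(\frac{xy}{2t}\Big)e^{-(x^2+y^2)/(4t)},\qquad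 P_t^\lambda(x,y)=\frac{t}{2\sqrt\pi}\int_0^\infty\frac{e^{-t^2/(4s)}}{s^{3/2}}W_s^\lambda(x,y)\,ds,$$ where $I_\nu$ is the modified Bessel function of the first kind, and $P_t^\lambda f(x)=\int_0^\infty P_t^\lambda(x,y)f(y)\,dy$. Negative powers: $\Delta_\lambda^{-\sigma}f(x)=\frac{1}{\Gamma(2\sigma)}\int_0^\infty P_t^\lambda f(x)\,\frac{dt}{t^{1-2\sigma}}$. Positive powers: the Hankel transform is $h_\lambda \phi(x)=\int_0^\infty\sqrt{xy}\,J_{\lambda-1/2}(xy)\phi(y)\,dy$, with $J_\nu$ the Bessel function. $\mathcal{S}_\lambda$ is the space of smooth functions $\phi$ on $\mathbb{R}_+$ with $\sup_{x>0}(1+x)^m|(\frac1x\frac{d}{dx})^k(x^{-\lambda}\phi(x))|<\infty$ for all integers $m,k\ge0$ (a Fréchet space with these seminorms, with dual $\mathcal{S}_\lambda'$). For $\phi\in\mathcal{S}_\lambda$, $\Delta_\lambda^\sigma\phi=h_\lambda(y^{2\sigma}h_\lambda\phi)$. For $u\in L_\sigma$, $\Delta_\lambda^\sigma u\in\mathcal{S}_\lambda'$ is defined by transposition, $(\Delta_\lambda^\sigma u)(\phi)=\int_0^\infty u(x)\,\Delta_\lambda^\sigma\phi(x)\,dx$ for $\phi\in\mathcal{S}_\lambda$; it is identified with a function $g$ when $(\Delta_\lambda^\sigma u)(\phi)=\int_0^\infty g\phi\,dx$ for all $\phi\in\mathcal{S}_\lambda$. *)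

theory Defs
  imports "HOL-Analysis.Analysis"
begin

text \<open>
  Functions on the open half-line \<open>(0, \<infinity>)\<close> are modelled as total functions on the reals;
  every notion below looks only at their values on \<open>{0<..}\<close>.
\<close>

subsection \<open>Function spaces\<close>

definition holder_quots :: "real \<Rightarrow> (real \<Rightarrow> real) \<Rightarrow> real set" where
  "holder_quots \<alpha> f = {\<bar>f x - f y\<bar> / \<bar>x - y\<bar> powr \<alpha> |x y. x > 0 \<and> y > 0 \<and> x \<noteq> y}"

definition growth_quots :: "real \<Rightarrow> (real \<Rightarrow> real) \<Rightarrow> real set" where
  "growth_quots \<alpha> f = {x powr (- \<alpha>) * \<bar>f x\<bar> |x. x > 0}"

definition holder_space :: "real \<Rightarrow> (real \<Rightarrow> real) set" where
  "holder_space \<alpha> =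
     {f. continuous_on {0<..} f \<and> bdd_above (holder_quots \<alpha> f) \<and> bdd_above (growth_quots \<alpha> f)}"

text \<open>Meaningful on \<^const>\<open>holder_space\<close> only, since \<^const>\<open>Sup\<close> is unspecified on unbounded sets.\<close>

definition holder_norm :: "real \<Rightarrow> (real \<Rightarrow> real) \<Rightarrow> real" where
  "holder_norm \<alpha> f = Sup (holder_quots \<alpha> f) + Sup (growth_quots \<alpha> f)"

definition L_space :: "real \<Rightarrow> (real \<Rightarrow> real) set" where
  "L_space \<rho> = {f. set_borel_measurable lborel {0<..} f \<and>
     set_integrable lborel {0<..} (\<lambda>x. \<bar>f x\<bar> * (1 + x) powr (- 1 - 2 * \<rho>))}"


subsection \<open>Bessel functions\<close>

text \<open>The power series define the functions for \<open>z > 0\<close>, the only arguments needed.\<close>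

definition bessel_I :: "real \<Rightarrow> real \<Rightarrow> real" where
  "bessel_I \<nu> z = (\<Sum>k. (z / 2) powr (\<nu> + 2 * real k) * rGamma (\<nu> + real k + 1) / fact k)"

definition bessel_J :: "real \<Rightarrow> real \<Rightarrow> real" where
  "bessel_J \<nu> z =
     (\<Sum>k. (- 1) ^ k * (z / 2) powr (\<nu> + 2 * real k) * rGamma (\<nu> + real k + 1) / fact k)"


subsection \<open>Heat and Poisson kernels and negative powers\<close>

definition heat_kernel :: "real \<Rightarrow> real \<Rightarrow> real \<Rightarrow> real \<Rightarrow> real" where
  "heat_kernel lam t x y =
     sqrt (x * y) / (2 * t) * bessel_I (lam - 1 / 2) (x * y / (2 * t))
       * exp (- (x\<^sup>2 + y\<^sup>2) / (4 * t))"

definition poisson_kernel :: "real \<Rightarrow> real \<Rightarrow> real \<Rightarrow> real \<Rightarrow> real" where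
  "poisson_kernel lam t x y = t / (2 * sqrt pi) *
     (LINT s:{0<..}|lborel. exp (- t\<^sup>2 / (4 * s)) / s powr (3 / 2) * heat_kernel lam s x y)"

definition poisson_op :: "real \<Rightarrow> real \<Rightarrow> (real \<Rightarrow> real) \<Rightarrow> real \<Rightarrow> real" where
  "poisson_op lam t f x = (LINT y:{0<..}|lborel. poisson_kernel lam t x y * f y)"

definition bessel_neg_power :: "real \<Rightarrow> real \<Rightarrow> (real \<Rightarrow> real) \<Rightarrow> real \<Rightarrow> real" where
  "bessel_neg_power lam \<sigma> f x =
     1 / Gamma (2 * \<sigma>) * (LINT t:{0<..}|lborel. poisson_op lam t f x / t powr (1 - 2 * \<sigma>))"

text \<open>
  The integral of a non-integrable function is 0 in the library, so absolute convergence
  of the integrals above is recorded separately.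
\<close>

definition bessel_neg_power_defined :: "real \<Rightarrow> real \<Rightarrow> (real \<Rightarrow> real) \<Rightarrow> bool" where
  "bessel_neg_power_defined lam \<sigma> f \<longleftrightarrow> (\<forall>x>0.
     (\<forall>t>0. set_integrable lborel {0<..} (\<lambda>y. poisson_kernel lam t x y * f y)) \<and>
     set_integrable lborel {0<..} (\<lambda>t. poisson_op lam t f x / t powr (1 - 2 * \<sigma>)))"


subsection \<open>The test space, its dual and positive powers\<close>

definition hankel :: "real \<Rightarrow> (real \<Rightarrow> real) \<Rightarrow> real \<Rightarrow> real" where
  "hankel lam \<phi> x =
     (LINT y:{0<..}|lborel. sqrt (x * y) * bessel_J (lam - 1 / 2) (x * y) * \<phi> y)"

definition S_quots :: "real \<Rightarrow> nat \<Rightarrow> nat \<Rightarrow> (real \<Rightarrow> real) \<Rightarrow> real set" where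
  "S_quots lam m k \<phi> =
     {(1 + x) ^ m * \<bar>((\<lambda>g y. 1 / y * deriv g y) ^^ k) (\<lambda>y. y powr (- lam) * \<phi> y) x\<bar> |x. x > 0}"

definition S_space :: "real \<Rightarrow> (real \<Rightarrow> real) set" where
  "S_space lam = {\<phi>. (\<forall>n. \<forall>x>0. (deriv ^^ n) \<phi> field_differentiable at x) \<and>
     (\<forall>m k. bdd_above (S_quots lam m k \<phi>))}"

definition S_seminorm :: "real \<Rightarrow> nat \<Rightarrow> nat \<Rightarrow> (real \<Rightarrow> real) \<Rightarrow> real" where
  "S_seminorm lam m k \<phi> = Sup (S_quots lam m k \<phi>)"

text \<open>Linear functionals that are continuous for the topology generated by the seminorms.\<close>

definition S_dual :: "real \<Rightarrow> ((real \<Rightarrow> real) \<Rightarrow> real) set" where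
  "S_dual lam = {T.
     (\<forall>\<phi>\<in>S_space lam. \<forall>\<psi>\<in>S_space lam. T (\<lambda>x. \<phi> x + \<psi> x) = T \<phi> + T \<psi>) \<and>
     (\<forall>c. \<forall>\<phi>\<in>S_space lam. T (\<lambda>x. c * \<phi> x) = c * T \<phi>) \<and>
     (\<forall>\<phi>\<in>S_space lam. \<forall>\<epsilon>>0. \<exists>N. \<exists>\<delta>>0. \<forall>\<psi>\<in>S_space lam.
        (\<forall>m\<le>N. \<forall>k\<le>N. S_seminorm lam m k (\<lambda>x. \<psi> x - \<phi> x) < \<delta>) \<longrightarrow> \<bar>T \<psi> - T \<phi>\<bar> < \<epsilon>)}"

definition bessel_pos_power_test :: "real \<Rightarrow> real \<Rightarrow> (real \<Rightarrow> real) \<Rightarrow> real \<Rightarrow> real" where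
  "bessel_pos_power_test lam \<sigma> \<phi> = hankel lam (\<lambda>y. y powr (2 * \<sigma>) * hankel lam \<phi> y)"

definition bessel_pos_power :: "real \<Rightarrow> real \<Rightarrow> (real \<Rightarrow> real) \<Rightarrow> (real \<Rightarrow> real) \<Rightarrow> real" where
  "bessel_pos_power lam \<sigma> u \<phi> =
     (LINT x:{0<..}|lborel. u x * bessel_pos_power_test lam \<sigma> \<phi> x)"

text \<open>As above, convergence of the defining integral is recorded separately.\<close>

definition bessel_pos_power_defined :: "real \<Rightarrow> real \<Rightarrow> (real \<Rightarrow> real) \<Rightarrow> bool" where
  "bessel_pos_power_defined lam \<sigma> u \<longleftrightarrow> (\<forall>\<phi>\<in>S_space lam.
     set_integrable lborel {0<..} (\<lambda>x. u x * bessel_pos_power_test lam \<sigma> \<phi> x))"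

definition identified_with :: "real \<Rightarrow> ((real \<Rightarrow> real) \<Rightarrow> real) \<Rightarrow> (real \<Rightarrow> real) \<Rightarrow> bool" where
  "identified_with lam T g \<longleftrightarrow> (\<forall>\<phi>\<in>S_space lam.
     set_integrable lborel {0<..} (\<lambda>x. g x * \<phi> x) \<and>
     T \<phi> = (LINT x:{0<..}|lborel. g x * \<phi> x))"

end

theory Submission
  imports Defs
begin

text \<open>
  Poisson's integral for the Bessel function writes the heat kernel as a constant times
  \<open>t\<^bsup>-\<lambda>-1/2\<^esup> (x y)\<^bsup>\<lambda>\<^esup> \<integral> exp (- Q / (4 t)) d\<Omega>(s)\<close> with \<open>Q = x\<^sup>2 + y\<^sup>2 - 2 x y s\<close> and \<open>d\<Omega> = (1 - s\<^sup>2)\<^bsup>\<lambda>-1\<^esup> ds\<close>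
  on \<open>(-1, 1)\<close>. Subordination therefore turns both powers of the Bessel operator into operators
  with the homogeneous kernels \<open>K(x, y) = (x y)\<^bsup>\<lambda>\<^esup> \<integral> Q\<^bsup>-(\<lambda> + 1/2 \<plusminus> \<sigma>)\<^esup> d\<Omega>\<close>. By homogeneity the Hoelder bounds
  reduce to comparing the points \<open>1\<close> and \<open>1 + e\<close>, where the size and the gradient of the kernel away from the
  diagonal suffice. For the positive powers, Weber's second exponential integral and the explicit
  moments of the heat kernel give
  \<open>\<Delta>\<^bsup>\<sigma>\<^esup> \<phi>(x) = c \<integral> K(x, y) (\<phi>(x) (y / x)\<^bsup>\<lambda>\<^esup> - \<phi>(y)) dy\<close> for test functions \<open>\<phi>\<close>; no zeroth-order term
  appears because \<open>y\<^bsup>\<lambda>\<^esup>\<close> is annihilated by the Bessel operator. The symmetry of \<open>K\<close> moves this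
  formula from \<open>\<phi>\<close> to \<open>u\<close>.
\<close>

subsection \<open>Integration on the half-line\<close>

text \<open>Three exponents decide every estimate. Between 1 and a point at distance d the kernel is
  at most of order d^(tau - 1); for d >= 1 it gains a further d^(-lam), and near the diagonal the
  gradient costs one more power of d. So a Hoelder increment of order a makes the singularity
  integrable if a + tau > 0, the gradient part is of the right order if a + tau < 1, and the tail
  converges if a + tau < lam.

  For negative tau the integral of the kernel alone diverges at the diagonal. Constants are not
  annihilated, so replacing (y / x)^lam by 1 leaves a fixed multiple of u(x) x^(-2 \<sigma>); that
  multiple is finite because for lam >= 1 the power z^lam is Lipschitz on bounded intervals down to
  0.

  The passage from the Hankel transform to the kernel needs the inversion formula. It is obtained by
  Abel summation with exp(- t y^2): Weber's integral turns the damped inversion into the heat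
  kernel, and the concentration of that kernel at x is read off from three exact moments.\<close>

definition hl :: "real measure" where
  "hl = restrict_space lborel {0<..}"

lemma space_hl [simp]: "space hl = {0<..}"
  by (simp add: hl_def space_restrict_space)

lemma sigma_finite_hl: "sigma_finite_measure hl"
  unfolding hl_def by (rule sigma_finite_measure_restrict_space) (auto intro: lborel.sigma_finite_measure_axioms)

interpretation hl: sigma_finite_measure hl
  by (rule sigma_finite_hl)

interpretation hl_hl: pair_sigma_finite hl hl ..

text \<open>The sigma-algebra of \<open>hl\<close> is a trace, not the Borel one. With these rules
  for the identity and the two projections, formulas in the variables become measurable
  automatically.\<close>

lemma measurable_ident_hl [measurable (raw)]: "(\<lambda>x. x) \<in> borel_measurable hl"
  unfolding hl_def by (rule measurable_restrict_space1) auto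

lemma measurable_fst_hl [measurable (raw)]: "(\<lambda>p. fst p) \<in> borel_measurable (hl \<Otimes>\<^sub>M N)"
  by (rule measurable_compose[OF measurable_fst measurable_ident_hl])

lemma measurable_snd_hl [measurable (raw)]: "(\<lambda>p. snd p) \<in> borel_measurable (N \<Otimes>\<^sub>M hl)"
  by (rule measurable_compose[OF measurable_snd measurable_ident_hl])

lemma measurable_hl_continuous: "continuous_on {0<..} f \<Longrightarrow> f \<in> borel_measurable hl"
  for f :: "real \<Rightarrow> real"
  unfolding hl_def using borel_measurable_continuous_on_restrict[of "{0<..}" f]
  by (simp cong: measurable_cong_sets sets_restrict_space_cong)

lemma nn_integral_hl: "nn_integral hl f = (\<integral>\<^sup>+x. f x * indicator {0<..} x \<partial>lborel)"
  unfolding hl_def by (rule nn_integral_restrict_space) auto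

text \<open>The definitions use set integrals over \<open>{0<..}\<close>. Passing to
  \<open>hl\<close> puts positivity of the variable into \<open>space hl\<close> and makes product
  measures and Fubini directly applicable.\<close>

lemma set_integrable_hl: "set_integrable lborel {0<..} f \<longleftrightarrow> integrable hl f"
  for f :: "real \<Rightarrow> real"
  unfolding hl_def set_integrable_def by (subst integrable_restrict_space) auto

lemma set_integral_hl: "(LINT x:{0<..}|lborel. f x) = integral\<^sup>L hl f"
  for f :: "real \<Rightarrow> real"
  unfolding hl_def set_lebesgue_integral_def by (subst integral_restrict_space) auto

text \<open>The kernel bounds fail on the diagonal, where the singularity sits; as a null set it can
  be discarded.\<close>

lemma AE_hl_neq: "AE y in hl. y \<noteq> (x::real)"
proof -
  have "AE y in lborel. y \<noteq> x" by (rule AE_lborel_singleton)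
  then show ?thesis unfolding hl_def by (subst AE_restrict_space_iff) auto
qed

text \<open>Dilations reduce a homogeneous kernel at a general point x to the kernel at 1, and they
  evaluate the one-parameter integrals below up to a constant.\<close>

lemma
  fixes f :: "real \<Rightarrow> real"
  assumes "r > 0"
  shows integral_hl_scale: "integral\<^sup>L hl f = r * (\<integral>y. f (r * y) \<partial>hl)"
    and integrable_hl_scale: "integrable hl (\<lambda>y. f (r * y)) \<longleftrightarrow> integrable hl f"
proof -
  have ind: "indicator {0<..} (r * y) = (indicator {0<..} y :: real)" for y
    using assms by (simp add: indicator_def zero_less_mult_iff)
  have "integral\<^sup>L hl f = (\<integral>y. indicator {0<..} y * f y \<partial>lborel)"
    by (simp add: hl_def integral_restrict_space)
  also have "\<dots> = r * (\<integral>y. indicator {0<..} (r * y) * f (r * y) \<partial>lborel)"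
    using assms lborel_integral_real_affine[of r "\<lambda>y. indicator {0<..} y * f y" 0] by simp
  also have "\<dots> = r * (\<integral>y. f (r * y) \<partial>hl)"
    by (simp add: hl_def integral_restrict_space ind)
  finally show "integral\<^sup>L hl f = r * (\<integral>y. f (r * y) \<partial>hl)" .
  have "integrable hl (\<lambda>y. f (r * y)) \<longleftrightarrow> integrable lborel (\<lambda>y. indicator {0<..} (r * y) * f (r * y))"
    by (simp add: hl_def integrable_restrict_space ind)
  also have "\<dots> \<longleftrightarrow> integrable lborel (\<lambda>y. indicator {0<..} y * f y)"
    using assms lborel_integrable_real_affine_iff[of r "\<lambda>y. indicator {0<..} y * f y" 0] by simp
  also have "\<dots> \<longleftrightarrow> integrable hl f"
    by (simp add: hl_def integrable_restrict_space)
  finally show "integrable hl (\<lambda>y. f (r * y)) \<longleftrightarrow> integrable hl f" .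
qed

text \<open>Absolute convergence is checked as an iterated nonnegative integral, in whichever order
  the inner integral can be computed or bounded; the consequences used later are collected
  here.\<close>

lemma fubini:
  fixes f :: "'a \<Rightarrow> 'b \<Rightarrow> real"
  assumes "sigma_finite_measure M" "sigma_finite_measure N"
    and [measurable]: "case_prod f \<in> borel_measurable (M \<Otimes>\<^sub>M N)"
    and fin: "(\<integral>\<^sup>+x. \<integral>\<^sup>+y. ennreal \<bar>f x y\<bar> \<partial>N \<partial>M) < \<infinity>"
  shows "integrable (M \<Otimes>\<^sub>M N) (case_prod f)"
    and "integrable M (\<lambda>x. \<integral>y. f x y \<partial>N)"
    and "integrable N (\<lambda>y. \<integral>x. f x y \<partial>M)"
    and "(\<integral>x. \<integral>y. f x y \<partial>N \<partial>M) = (\<integral>y. \<integral>x. f x y \<partial>M \<partial>N)"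
    and "AE x in M. integrable N (f x)"
proof -
  interpret N: sigma_finite_measure N by fact
  interpret M: sigma_finite_measure M by fact
  interpret pair_sigma_finite M N ..
  have "(\<integral>\<^sup>+p. ennreal (norm (case_prod f p)) \<partial>(M \<Otimes>\<^sub>M N)) = (\<integral>\<^sup>+x. \<integral>\<^sup>+y. ennreal \<bar>f x y\<bar> \<partial>N \<partial>M)"
    by (subst N.nn_integral_fst[symmetric]) simp_all
  with fin show i: "integrable (M \<Otimes>\<^sub>M N) (case_prod f)"
    by (intro integrableI_bounded) simp_all
  show "integrable M (\<lambda>x. \<integral>y. f x y \<partial>N)" using integrable_fst'[OF i] by simp
  show "integrable N (\<lambda>y. \<integral>x. f x y \<partial>M)" using integrable_snd[OF i] by simp
  show "(\<integral>x. \<integral>y. f x y \<partial>N \<partial>M) = (\<integral>y. \<integral>x. f x y \<partial>M \<partial>N)"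
    using Fubini_integral[OF i] by simp
  show "AE x in M. integrable N (f x)" using AE_integrable_fst'[OF i] by simp
qed

lemma nn_integral_le_integrable:
  fixes f :: "'a \<Rightarrow> real"
  assumes "f \<in> borel_measurable M" "(\<integral>\<^sup>+x. ennreal \<bar>f x\<bar> \<partial>M) \<le> ennreal B" "0 \<le> B"
  shows "integrable M f" and "\<bar>integral\<^sup>L M f\<bar> \<le> B"
proof -
  show i: "integrable M f"
    using assms(1,2) le_less_trans[OF assms(2) ennreal_less_top] by (intro integrableI_bounded) auto
  have "ennreal \<bar>integral\<^sup>L M f\<bar> \<le> ennreal B"
    using integral_norm_bound_ennreal[OF i] assms(2) by (simp add: order_trans)
  then show "\<bar>integral\<^sup>L M f\<bar> \<le> B" using assms(3) by simp
qed

section \<open>Power integrals around a point and at infinity\<close>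

lemma nn_integral_powr_near:
  fixes a r \<gamma> :: real
  assumes "\<gamma> > 0" "r \<ge> 0"
  shows "(\<integral>\<^sup>+z. ennreal (\<bar>z - a\<bar> powr (\<gamma> - 1)) * indicator {z. \<bar>z - a\<bar> \<le> r} z \<partial>lborel) \<le> ennreal (2 * r powr \<gamma> / \<gamma>)"
proof -
  let ?I = "\<integral>\<^sup>+z. ennreal (z powr (\<gamma> - 1)) * indicator {0..r} z \<partial>lborel"
  have I: "?I = ennreal (r powr \<gamma> / \<gamma>)"
    using nn_integral_has_integral_lebesgue'[OF _ has_integral_powr_from_0[of "\<gamma> - 1" r]] assms by simp
  have "(\<integral>\<^sup>+z. ennreal (\<bar>z - a\<bar> powr (\<gamma> - 1)) * indicator {z. \<bar>z - a\<bar> \<le> r} z \<partial>lborel) =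
      (\<integral>\<^sup>+z. ennreal (\<bar>z\<bar> powr (\<gamma> - 1)) * indicator {z. \<bar>z\<bar> \<le> r} z \<partial>lborel)"
    by (subst nn_integral_real_affine[of _ 1 a]) (auto simp: indicator_def)
  also have "\<dots> \<le> (\<integral>\<^sup>+z. ennreal (z powr (\<gamma> - 1)) * indicator {0..r} z + ennreal ((-z) powr (\<gamma> - 1)) * indicator {0..r} (-z) \<partial>lborel)"
    by (intro nn_integral_mono) (auto simp: indicator_def abs_if)
  also have "\<dots> = ?I + (\<integral>\<^sup>+z. ennreal ((-z) powr (\<gamma> - 1)) * indicator {0..r} (-z) \<partial>lborel)"
    by (rule nn_integral_add) auto
  also have "(\<integral>\<^sup>+z. ennreal ((-z) powr (\<gamma> - 1)) * indicator {0..r} (-z) \<partial>lborel) = ?I"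
    by (subst nn_integral_real_affine[of _ "-1" 0]) auto
  also have "?I + ?I = ennreal (2 * r powr \<gamma> / \<gamma>)"
    unfolding I using assms by (subst ennreal_plus[symmetric]) auto
  finally show ?thesis .
qed

lemma nn_integral_powr_far:
  fixes a r \<gamma> :: real
  assumes "\<gamma> > 0" "r > 0"
  shows "(\<integral>\<^sup>+z. ennreal (\<bar>z - a\<bar> powr (- \<gamma> - 1)) * indicator {z. r \<le> \<bar>z - a\<bar>} z \<partial>lborel) \<le> ennreal (2 * r powr (- \<gamma>) / \<gamma>)"
proof -
  let ?I = "\<integral>\<^sup>+z. ennreal (z powr (- \<gamma> - 1)) * indicator {r..} z \<partial>lborel"
  have I: "?I = ennreal (r powr (- \<gamma>) / \<gamma>)"
    using nn_integral_has_integral_lebesgue'[OF _ has_integral_powr_to_inf[of "- \<gamma> - 1" r]] assms by simp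
  have "(\<integral>\<^sup>+z. ennreal (\<bar>z - a\<bar> powr (- \<gamma> - 1)) * indicator {z. r \<le> \<bar>z - a\<bar>} z \<partial>lborel) =
      (\<integral>\<^sup>+z. ennreal (\<bar>z\<bar> powr (- \<gamma> - 1)) * indicator {z. r \<le> \<bar>z\<bar>} z \<partial>lborel)"
    by (subst nn_integral_real_affine[of _ 1 a]) (auto simp: indicator_def)
  also have "\<dots> \<le> (\<integral>\<^sup>+z. ennreal (z powr (- \<gamma> - 1)) * indicator {r..} z + ennreal ((-z) powr (- \<gamma> - 1)) * indicator {r..} (-z) \<partial>lborel)"
    by (intro nn_integral_mono) (auto simp: indicator_def abs_if)
  also have "\<dots> = ?I + (\<integral>\<^sup>+z. ennreal ((-z) powr (- \<gamma> - 1)) * indicator {r..} (-z) \<partial>lborel)"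
    by (rule nn_integral_add) auto
  also have "(\<integral>\<^sup>+z. ennreal ((-z) powr (- \<gamma> - 1)) * indicator {r..} (-z) \<partial>lborel) = ?I"
    by (subst nn_integral_real_affine[of _ "-1" 0]) auto
  also have "?I + ?I = ennreal (2 * r powr (- \<gamma>) / \<gamma>)"
    unfolding I using assms by (subst ennreal_plus[symmetric]) auto
  finally show ?thesis .
qed

lemma integrable_hl_powr_bound:
  fixes f :: "real \<Rightarrow> real"
  assumes [measurable]: "f \<in> borel_measurable hl" and "a > -1" "b < -1"
    and "\<And>t. 0 < t \<Longrightarrow> t \<le> 1 \<Longrightarrow> \<bar>f t\<bar> \<le> A * t powr a"
    and "\<And>t. t \<ge> 1 \<Longrightarrow> \<bar>f t\<bar> \<le> B * t powr b"
  shows "integrable hl f"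
proof (rule integrableI_bounded)
  \<comment> \<open>Both bounds hold at t = 1, which forces A and B to be nonnegative.\<close>
  have "0 \<le> A * 1 powr a" "0 \<le> B * 1 powr b" using assms(4,5)[of 1] by (smt (verit) zero_less_one)+
  then have pos: "A \<ge> 0" "B \<ge> 0" by simp_all
  let ?g = "\<lambda>t. ennreal A * (ennreal (\<bar>t - 0\<bar> powr ((a + 1) - 1)) * indicator {z. \<bar>z - 0\<bar> \<le> 1} t) +
    ennreal B * (ennreal (\<bar>t - 0\<bar> powr (- (- b - 1) - 1)) * indicator {z. 1 \<le> \<bar>z - 0\<bar>} t)"
  have "(\<integral>\<^sup>+t. ennreal (norm (f t)) \<partial>hl) \<le> (\<integral>\<^sup>+t. ?g t \<partial>lborel)"
    unfolding nn_integral_hl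
  proof (intro nn_integral_mono)
    fix t :: real
    show "ennreal (norm (f t)) * indicator {0<..} t \<le> ?g t"
      using assms(4,5)[of t] pos
      by (cases "t > 0"; cases "t \<le> 1") (auto simp: indicator_def ennreal_mult'[symmetric] intro: add_increasing2 ennreal_leI)
  qed
  also have "\<dots> = ennreal A * (\<integral>\<^sup>+t. ennreal (\<bar>t - 0\<bar> powr ((a + 1) - 1)) * indicator {z. \<bar>z - 0\<bar> \<le> 1} t \<partial>lborel) +
      ennreal B * (\<integral>\<^sup>+t. ennreal (\<bar>t - 0\<bar> powr (- (- b - 1) - 1)) * indicator {z. 1 \<le> \<bar>z - 0\<bar>} t \<partial>lborel)"
    by (subst nn_integral_add) (auto simp: nn_integral_cmult)
  also have "\<dots> \<le> ennreal A * ennreal (2 * 1 powr (a + 1) / (a + 1)) + ennreal B * ennreal (2 * 1 powr (- (- b - 1)) / (- b - 1))"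
    using assms by (intro add_mono mult_left_mono nn_integral_powr_near nn_integral_powr_far) auto
  also have "\<dots> < \<infinity>" by (simp add: ennreal_mult_less_top)
  finally show "(\<integral>\<^sup>+t. ennreal (norm (f t)) \<partial>hl) < \<infinity>" .
qed simp

lemma integral_hl_pos:
  fixes f :: "real \<Rightarrow> real"
  assumes "integrable hl f" "\<And>t. t > 0 \<Longrightarrow> f t > 0"
  shows "integral\<^sup>L hl f > 0"
proof -
  have "integral\<^sup>L hl f \<ge> 0" using assms(2) by (intro integral_nonneg_AE AE_I2) (auto intro: less_imp_le)
  moreover have "integral\<^sup>L hl f \<noteq> 0"
  proof
    assume "integral\<^sup>L hl f = 0"
    then have "AE t in hl. f t = 0"
      using assms by (subst (asm) integral_nonneg_eq_0_iff_AE) (auto intro!: AE_I2 less_imp_le)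
    then have "AE t in hl. False" by (rule AE_mp) (use assms(2) in \<open>fastforce intro!: AE_I2\<close>)
    then have "emeasure hl (space hl) = 0" using sets.top[of hl] by (subst (asm) AE_iff_measurable[of "space hl"]) auto
    then have "emeasure lborel {(0::real)<..} = 0" by (simp add: hl_def emeasure_restrict_space space_restrict_space)
    moreover have "emeasure lborel {(0::real)<..<1} \<le> emeasure lborel {(0::real)<..}" by (intro emeasure_mono) auto
    ultimately show False by simp
  qed
  ultimately show ?thesis by simp
qed

text \<open>For b > 0 the substitution r = 1 / (4 s) shows that this is 4^b Gamma(b).\<close>

definition invgamma_const :: "real \<Rightarrow> real" where
  "invgamma_const b = (\<integral>s. exp (- 1 / (4 * s)) * s powr (- b - 1) \<partial>hl)"

lemma exp_minus_le_power: "exp (- x) \<le> fact n / x ^ n" if "x > 0" for x :: real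
proof -
  have "x ^ n / fact n \<le> exp x"
    using that sum_le_suminf[of "\<lambda>k. x ^ k / fact k" "{n}"] summable_exp_generic[of x]
    by (simp add: exp_def field_simps)
  then show ?thesis using that by (simp add: exp_minus field_simps)
qed

lemma
  assumes "b > 0" "a > 0"
  shows integrable_invgamma: "integrable hl (\<lambda>s. exp (- a / (4 * s)) * s powr (- b - 1))"
    and integral_invgamma: "(\<integral>s. exp (- a / (4 * s)) * s powr (- b - 1) \<partial>hl) = a powr (- b) * invgamma_const b"
proof -
  \<comment> \<open>Near 0 the exponential beats every power: it is bounded by a multiple of s^n,
    and n >= b + 1 leaves a bounded integrand.\<close>
  obtain n :: nat where n: "b + 1 \<le> real n" using real_arch_simple by blast
  let ?f = "\<lambda>s. exp (- 1 / (4 * s)) * s powr (- b - 1)"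
  have i: "integrable hl ?f"
  proof (rule integrable_hl_powr_bound[where a=0 and b="-b-1" and A="fact n * 4 ^ n" and B=1])
    fix t :: real assume t: "0 < t" "t \<le> 1"
    have "exp (- 1 / (4 * t)) \<le> fact n / (1 / (4 * t)) ^ n"
      using exp_minus_le_power[of "1 / (4 * t)" n] t by simp
    also have "\<dots> = fact n * 4 ^ n * t powr n" using t by (simp add: power_divide power_mult_distrib powr_realpow)
    finally have "?f t \<le> fact n * 4 ^ n * t powr n * t powr (- b - 1)"
      by (intro mult_right_mono) auto
    also have "\<dots> = fact n * 4 ^ n * t powr (n - b - 1)" by (simp add: powr_add[symmetric] algebra_simps)
    also have "\<dots> \<le> fact n * 4 ^ n * 1"
      using n t powr_mono'[of 0 "n - b - 1" t] by (intro mult_left_mono) auto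
    finally show "\<bar>?f t\<bar> \<le> fact n * 4 ^ n * t powr 0" using t by simp
  next
    fix t :: real assume t: "t \<ge> 1"
    then show "\<bar>?f t\<bar> \<le> 1 * t powr (- b - 1)" by (simp add: abs_mult mult_left_le_one_le)
  qed (use assms in auto)
  have eq: "exp (- a / (4 * s)) * s powr (- b - 1) = a powr (- b - 1) * ?f (1 / a * s)" if "s > 0" for s
    using that assms by (simp add: powr_mult powr_divide powr_minus field_simps powr_diff)
  have i2: "integrable hl (\<lambda>s. a powr (- b - 1) * ?f (1 / a * s))"
    by (subst integrable_mult_right) (use i assms integrable_hl_scale[of "1/a" ?f] in simp_all)
  show "integrable hl (\<lambda>s. exp (- a / (4 * s)) * s powr (- b - 1))"
    using i2 by (subst Bochner_Integration.integrable_cong[OF refl eq]) auto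
  have "(\<integral>s. exp (- a / (4 * s)) * s powr (- b - 1) \<partial>hl) = (\<integral>s. a powr (- b - 1) * ?f (1 / a * s) \<partial>hl)"
    by (rule Bochner_Integration.integral_cong[OF refl eq]) auto
  also have "\<dots> = a powr (- b - 1) * (\<integral>s. ?f (1 / a * s) \<partial>hl)" by (rule integral_mult_right_zero)
  also have "(\<integral>s. ?f (1 / a * s) \<partial>hl) = a * invgamma_const b"
    using integral_hl_scale[of "1/a" ?f] assms by (simp add: invgamma_const_def)
  also have "a powr (- b - 1) * (a * invgamma_const b) = a powr (- b) * invgamma_const b"
    using assms by (simp add: powr_diff)
  finally show "(\<integral>s. exp (- a / (4 * s)) * s powr (- b - 1) \<partial>hl) = a powr (- b) * invgamma_const b" .
qed

lemma invgamma_const_pos: "b > 0 \<Longrightarrow> invgamma_const b > 0"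
  unfolding invgamma_const_def
  by (rule integral_hl_pos) (use integrable_invgamma[of b 1] in auto)

text \<open>Half the Beta function at (a + 1) / 2 and b - (a + 1) / 2, when these are
  positive.\<close>

definition poisson_const :: "real \<Rightarrow> real \<Rightarrow> real" where
  "poisson_const a b = (\<integral>t. t powr a * (t\<^sup>2 + 1) powr (- b) \<partial>hl)"

lemma
  assumes "a > -1" "a + 1 < 2 * b" "q > 0"
  shows integrable_poisson_scale: "integrable hl (\<lambda>t. t powr a * (t\<^sup>2 + q) powr (- b))"
    and integral_poisson_scale: "(\<integral>t. t powr a * (t\<^sup>2 + q) powr (- b) \<partial>hl) = q powr ((a + 1) / 2 - b) * poisson_const a b"
proof -
  let ?f = "\<lambda>t. t powr a * (t\<^sup>2 + 1) powr (- b)" and ?r = "sqrt q"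
  have b: "b > 0" using assms by simp
  have i: "integrable hl ?f"
  proof (rule integrable_hl_powr_bound[where a=a and b="a-2*b" and A=1 and B=1])
    fix t :: real assume t: "0 < t" "t \<le> 1"
    have "(t\<^sup>2 + 1) powr (- b) \<le> 1 powr (- b)" using b by (intro powr_mono2') auto
    then show "\<bar>?f t\<bar> \<le> 1 * t powr a" using mult_left_mono[of "(t\<^sup>2 + 1) powr (- b)" 1 "t powr a"] by simp
  next
    fix t :: real assume t: "t \<ge> 1"
    have "(t\<^sup>2 + 1) powr (- b) \<le> (t\<^sup>2) powr (- b)" using b t by (intro powr_mono2') auto
    also have "\<dots> = t powr (- 2 * b)" using t by (simp add: powr_powr flip: powr_numeral)
    finally have "?f t \<le> t powr a * t powr (- 2 * b)" by (intro mult_left_mono) auto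
    also have "\<dots> = t powr (a - 2 * b)" by (simp add: powr_add[symmetric])
    finally show "\<bar>?f t\<bar> \<le> 1 * t powr (a - 2 * b)" by simp
  qed (use assms in auto)
  have eq: "t powr a * (t\<^sup>2 + q) powr (- b) = q powr (a / 2 - b) * ?f (1 / ?r * t)" if "t > 0" for t
  proof -
    have "((1 / ?r * t)\<^sup>2 + 1) powr (- b) = ((t\<^sup>2 + q) / q) powr (- b)"
      using assms by (simp add: power_mult_distrib power_divide add_divide_distrib)
    also have "\<dots> = (t\<^sup>2 + q) powr (- b) * q powr b" using assms by (simp add: powr_divide powr_minus divide_simps)
    finally have 1: "((1 / ?r * t)\<^sup>2 + 1) powr (- b) = (t\<^sup>2 + q) powr (- b) * q powr b" .
    have "(1 / ?r * t) powr a = t powr a / (sqrt q) powr a" using that assms by (simp add: powr_divide)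
    also have "\<dots> = t powr a * q powr (- (a / 2))" using assms by (simp add: powr_half_sqrt[symmetric] powr_powr powr_minus divide_simps)
    finally have 2: "(1 / ?r * t) powr a = t powr a * q powr (- (a / 2))" .
    have "q powr (a / 2 - b) * (q powr (- (a / 2)) * q powr b) = 1"
      using assms by (simp add: powr_add[symmetric])
    then show ?thesis unfolding 1 2 by (simp add: mult_ac)
  qed
  have i2: "integrable hl (\<lambda>t. q powr (a / 2 - b) * ?f (1 / ?r * t))"
    by (subst integrable_mult_right) (use i assms integrable_hl_scale[of "1 / ?r" ?f] in simp_all)
  show "integrable hl (\<lambda>t. t powr a * (t\<^sup>2 + q) powr (- b))"
    using i2 by (subst Bochner_Integration.integrable_cong[OF refl eq]) auto
  have "(\<integral>t. t powr a * (t\<^sup>2 + q) powr (- b) \<partial>hl) = (\<integral>t. q powr (a / 2 - b) * ?f (1 / ?r * t) \<partial>hl)"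
    by (rule Bochner_Integration.integral_cong[OF refl eq]) auto
  also have "\<dots> = q powr (a / 2 - b) * (\<integral>t. ?f (1 / ?r * t) \<partial>hl)" by (rule integral_mult_right_zero)
  also have "(\<integral>t. ?f (1 / ?r * t) \<partial>hl) = ?r * poisson_const a b"
    using integral_hl_scale[of "1 / ?r" ?f] assms by (simp add: poisson_const_def)
  also have "q powr (a / 2 - b) * (?r * poisson_const a b) = q powr ((a + 1) / 2 - b) * poisson_const a b"
    using assms by (simp add: powr_half_sqrt[symmetric] powr_add[symmetric] field_simps)
  finally show "(\<integral>t. t powr a * (t\<^sup>2 + q) powr (- b) \<partial>hl) = q powr ((a + 1) / 2 - b) * poisson_const a b" .
qed

subsection \<open>Gegenbauer weight\<close>

text \<open>A measure rather than a weight function: for lam > 0 it is finite even when the weight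
  is singular at the endpoints, so bounded integrands need no further estimate.\<close>

definition Om :: "real \<Rightarrow> real measure" where
  "Om lam = density (restrict_space lborel {-1<..<1}) (\<lambda>s. ennreal ((1 - s\<^sup>2) powr (lam - 1)))"

lemma space_Om [simp]: "space (Om lam) = {-1<..<1}"
  by (simp add: Om_def space_restrict_space)

lemma sets_Om [measurable_cong]: "sets (Om lam) = sets (restrict_space lborel {-1<..<1})"
  by (simp add: Om_def)

lemma measurable_ident_Om [measurable (raw)]: "(\<lambda>x. x) \<in> borel_measurable (Om lam)"
  by (subst measurable_cong_sets[OF sets_Om refl]) (intro measurable_restrict_space1, simp)

lemma measurable_fst_Om [measurable (raw)]: "(\<lambda>p. fst p) \<in> borel_measurable (Om lam \<Otimes>\<^sub>M N)"
  by (rule measurable_compose[OF measurable_fst measurable_ident_Om])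

lemma measurable_snd_Om [measurable (raw)]: "(\<lambda>p. snd p) \<in> borel_measurable (N \<Otimes>\<^sub>M Om lam)"
  by (rule measurable_compose[OF measurable_snd measurable_ident_Om])

lemma measurable_restrict_ident [measurable (raw)]: "(\<lambda>x. x) \<in> borel_measurable (restrict_space lborel (A::real set))"
  by (intro measurable_restrict_space1) simp

lemma nn_integral_Om:
  assumes [measurable]: "f \<in> borel_measurable borel"
  shows "nn_integral (Om lam) f = (\<integral>\<^sup>+s. ennreal ((1 - s\<^sup>2) powr (lam - 1)) * f s * indicator {-1<..<1} s \<partial>lborel)"
proof -
  have [measurable]: "f \<in> borel_measurable (restrict_space lborel {-1<..<1})"
    by (intro measurable_restrict_space1) simp
  show ?thesis
    unfolding Om_def by (subst nn_integral_density) (simp_all add: nn_integral_restrict_space)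
qed

lemma integral_Om:
  fixes f :: "real \<Rightarrow> real"
  assumes [measurable]: "f \<in> borel_measurable borel"
  shows "integral\<^sup>L (Om lam) f = (\<integral>s. indicator {-1<..<1} s * ((1 - s\<^sup>2) powr (lam - 1) * f s) \<partial>lborel)"
    and "integrable (Om lam) f \<longleftrightarrow> integrable lborel (\<lambda>s. indicator {-1<..<1} s * ((1 - s\<^sup>2) powr (lam - 1) * f s))"
proof -
  have [measurable]: "f \<in> borel_measurable (restrict_space lborel {-1<..<1})"
    by (intro measurable_restrict_space1) simp
  show "integral\<^sup>L (Om lam) f = (\<integral>s. indicator {-1<..<1} s * ((1 - s\<^sup>2) powr (lam - 1) * f s) \<partial>lborel)"
    unfolding Om_def by (subst integral_density) (simp_all add: integral_restrict_space)
  show "integrable (Om lam) f \<longleftrightarrow> integrable lborel (\<lambda>s. indicator {-1<..<1} s * ((1 - s\<^sup>2) powr (lam - 1) * f s))"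
    unfolding Om_def by (subst integrable_density) (simp_all add: integrable_restrict_space)
qed

lemma integral_Om_uminus:
  fixes f :: "real \<Rightarrow> real"
  assumes [measurable]: "f \<in> borel_measurable borel"
  shows "(\<integral>s. f (- s) \<partial>Om lam) = integral\<^sup>L (Om lam) f"
proof -
  have "indicator {-1<..<1} (- s) = (indicator {-1<..<1} s :: real)" for s :: real
    by (auto simp: indicator_def)
  then show ?thesis
    using lborel_integral_real_affine[of "-1" "\<lambda>s. indicator {-1<..<1} s * ((1 - s\<^sup>2) powr (lam - 1) * f s)" 0]
    by (simp add: integral_Om)
qed

text \<open>The weight factors into powers of 1 - s and 1 + s. On each half of the interval the
  factor that stays away from 0 has its base in [1, 2] and is at most 2^lam, which leaves r^(lam -
  1) with r the distance to the nearer endpoint.\<close>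

lemma nn_integral_Om_le:
  assumes [measurable]: "f \<in> borel_measurable borel" and lam: "lam > 0"
  shows "nn_integral (Om lam) f \<le> ennreal (2 powr lam) *
    ((\<integral>\<^sup>+r. ennreal (r powr (lam - 1)) * f (1 - r) * indicator {0<..1} r \<partial>lborel) +
     (\<integral>\<^sup>+r. ennreal (r powr (lam - 1)) * f (r - 1) * indicator {0<..1} r \<partial>lborel))"
proof -
  have e: "x powr (lam - 1) \<le> 2 powr lam" if "1 \<le> x" "x \<le> 2" for x :: real
  proof (cases "lam \<ge> 1")
    case True
    then have "x powr (lam - 1) \<le> 2 powr (lam - 1)" using that by (intro powr_mono2) auto
    moreover have "2 powr (lam - 1) \<le> 2 powr lam" by (intro powr_mono) auto
    ultimately show ?thesis by (rule order_trans)
  next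
    case False
    then have "x powr (lam - 1) \<le> 1 powr (lam - 1)" using that by (intro powr_mono2') auto
    moreover have "1 \<le> 2 powr lam" using lam by (simp add: ge_one_powr_ge_zero)
    ultimately show ?thesis by simp
  qed
  have w: "(1 - s\<^sup>2) powr (lam - 1) = (1 - s) powr (lam - 1) * (1 + s) powr (lam - 1)" if "-1 < s" "s < 1" for s
    using that by (subst powr_mult[symmetric]) (auto simp: power2_eq_square algebra_simps)
  let ?A = "\<lambda>s. ennreal ((1 - s) powr (lam - 1)) * f s * indicator {0<..1} (1 - s)"
  let ?B = "\<lambda>s. ennreal ((1 + s) powr (lam - 1)) * f s * indicator {0<..1} (1 + s)"
  have "nn_integral (Om lam) f \<le> (\<integral>\<^sup>+s. ennreal (2 powr lam) * (?A s + ?B s) \<partial>lborel)"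
    unfolding nn_integral_Om[OF assms(1)]
  proof (intro nn_integral_mono)
    fix s :: real
    show "ennreal ((1 - s\<^sup>2) powr (lam - 1)) * f s * indicator {-1<..<1} s \<le> ennreal (2 powr lam) * (?A s + ?B s)"
    proof (cases "-1 < s \<and> s < 1")
      case s: True
      show ?thesis
      proof (cases "s \<ge> 0")
        case True
        have "(1 - s\<^sup>2) powr (lam - 1) \<le> 2 powr lam * (1 - s) powr (lam - 1)"
          using s True e[of "1 + s"] by (simp add: w mult.commute mult_left_mono)
        then have "ennreal ((1 - s\<^sup>2) powr (lam - 1)) * f s \<le> ennreal (2 powr lam * (1 - s) powr (lam - 1)) * f s"
          by (intro mult_right_mono ennreal_leI) auto
        then show ?thesis using s True
          by (auto simp: indicator_def ennreal_mult distrib_left mult.assoc intro: add_increasing2)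
      next
        case False
        have "(1 - s\<^sup>2) powr (lam - 1) \<le> 2 powr lam * (1 + s) powr (lam - 1)"
          using s False e[of "1 - s"] by (simp add: w mult_right_mono)
        then have "ennreal ((1 - s\<^sup>2) powr (lam - 1)) * f s \<le> ennreal (2 powr lam * (1 + s) powr (lam - 1)) * f s"
          by (intro mult_right_mono ennreal_leI) auto
        then show ?thesis using s False
          by (auto simp: indicator_def ennreal_mult distrib_left mult.assoc intro: add_increasing)
      qed
    qed (auto simp: indicator_def)
  qed
  also have "\<dots> = ennreal (2 powr lam) * ((\<integral>\<^sup>+s. ?A s \<partial>lborel) + (\<integral>\<^sup>+s. ?B s \<partial>lborel))"
    by (subst nn_integral_cmult) (auto simp: nn_integral_add)
  also have "(\<integral>\<^sup>+s. ?A s \<partial>lborel) = (\<integral>\<^sup>+r. ennreal (r powr (lam - 1)) * f (1 - r) * indicator {0<..1} r \<partial>lborel)"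
    by (subst nn_integral_real_affine[of _ "-1" 1]) auto
  also have "(\<integral>\<^sup>+s. ?B s \<partial>lborel) = (\<integral>\<^sup>+r. ennreal (r powr (lam - 1)) * f (r - 1) * indicator {0<..1} r \<partial>lborel)"
    by (subst nn_integral_real_affine[of _ "1" "-1"]) (auto simp: add.commute)
  finally show ?thesis .
qed

lemma nn_integral_powr_unit:
  assumes "lam > 0"
  shows "(\<integral>\<^sup>+r. ennreal (r powr (lam - 1)) * indicator {0<..1} r \<partial>lborel) = ennreal (1 / lam)"
proof -
  have "(\<integral>\<^sup>+r. ennreal (r powr (lam - 1)) * indicator {0<..1} r \<partial>lborel) = (\<integral>\<^sup>+r. ennreal (r powr (lam - 1)) * indicator {0..1} r \<partial>lborel)"
    by (intro nn_integral_cong) (auto simp: indicator_def)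
  then show ?thesis
    using nn_integral_has_integral_lebesgue'[OF _ has_integral_powr_from_0[of "lam - 1" 1]] assms by simp
qed

lemma finite_measure_Om: "lam > 0 \<Longrightarrow> finite_measure (Om lam)"
proof
  assume lam: "lam > 0"
  have "emeasure (Om lam) (space (Om lam)) = (\<integral>\<^sup>+s. 1 \<partial>Om lam)" by simp
  also have "\<dots> \<le> ennreal (2 powr lam) * (ennreal (1 / lam) + ennreal (1 / lam))"
    using nn_integral_Om_le[of "\<lambda>_. 1" lam] lam nn_integral_powr_unit[OF lam] by simp
  also have "\<dots> < \<infinity>" by (simp add: ennreal_mult_less_top)
  finally show "emeasure (Om lam) (space (Om lam)) \<noteq> \<infinity>" by simp
qed

lemma integrable_Om_bounded:
  fixes f :: "real \<Rightarrow> real"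
  assumes "lam > 0" and "f \<in> borel_measurable (Om lam)" and "\<And>s. -1 < s \<Longrightarrow> s < 1 \<Longrightarrow> \<bar>f s\<bar> \<le> B"
  shows "integrable (Om lam) f"
proof -
  interpret finite_measure "Om lam" by (rule finite_measure_Om) fact
  show ?thesis using assms by (intro integrable_const_bound[of _ B] AE_I2) auto
qed

text \<open>For lam > 0 this is the Beta function at 1 / 2 and lam.\<close>

definition Om_mass :: "real \<Rightarrow> real" where
  "Om_mass lam = measure (Om lam) {-1<..<1}"

lemma Om_mass_pos: "lam > 0 \<Longrightarrow> Om_mass lam > 0"
proof -
  assume lam: "lam > 0"
  interpret finite_measure "Om lam" by (rule finite_measure_Om) fact
  have "emeasure (Om lam) (space (Om lam)) \<noteq> 0"
  proof
    assume "emeasure (Om lam) (space (Om lam)) = 0"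
    then have "(\<integral>\<^sup>+s. 1 \<partial>Om lam) = 0" by simp
    then have "AE s in lborel. ennreal ((1 - s\<^sup>2) powr (lam - 1)) * 1 * indicator {-1<..<1} s = 0"
      by (subst (asm) nn_integral_Om) (auto simp: nn_integral_0_iff_AE)
    then have "AE s in lborel. s \<notin> {-1<..<1::real}"
    proof eventually_elim
      case (elim s)
      have "1 - s\<^sup>2 > 0" if "-1 < s" "s < 1" using that by (simp add: abs_square_less_1 abs_less_iff)
      then show ?case using elim by (force simp: indicator_def)
    qed
    then have "emeasure lborel {-1<..<1::real} = 0"
      by (subst (asm) AE_iff_measurable[of "{-1<..<1}"]) auto
    then show False by simp
  qed
  then have "measure (Om lam) (space (Om lam)) \<noteq> 0"
    by (simp add: emeasure_eq_measure del: space_Om)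
  then show ?thesis
    unfolding Om_mass_def space_Om using measure_nonneg[of "Om lam" "{-1<..<1}"] by linarith
qed

text \<open>The function s^(2 k + 1) (1 - s^2)^lam vanishes at both endpoints, so its derivative has
  integral 0; expanding the derivative relates the two moments. For lam < 1 that derivative is
  singular at the endpoints, whence the interior form of the fundamental theorem.\<close>

lemma Om_moment_step:
  assumes lam: "lam > 0"
  shows "(2 * real k + 1) * (\<integral>s. s ^ (2 * k) \<partial>Om lam) = (2 * real k + 1 + 2 * lam) * (\<integral>s. s ^ (2 * Suc k) \<partial>Om lam)"
proof -
  let ?W = "\<lambda>s::real. (1 - s\<^sup>2) powr (lam - 1)"
  let ?G = "\<lambda>s::real. s ^ (2 * k + 1) * (1 - s\<^sup>2) powr lam"
  let ?g = "\<lambda>s. (2 * real k + 1) * s ^ (2 * k) - (2 * real k + 1 + 2 * lam) * s ^ (2 * Suc k)"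
  have int: "integrable (Om lam) (\<lambda>s. s ^ n)" for n
    using lam by (intro integrable_Om_bounded[where B=1]) (auto simp: power_abs intro!: power_le_one)
  have d: "(?G has_vector_derivative ?W s * ?g s) (at s)" if "s \<in> {-1<..<1}" for s
  proof -
    have s: "1 - s\<^sup>2 > 0" using that by (simp add: abs_square_less_1 abs_less_iff)
    have d1: "((\<lambda>s. s ^ (2 * k + 1)) has_real_derivative real (2 * k + 1) * s ^ (2 * k)) (at s)"
      by (rule DERIV_cong[OF DERIV_pow]) simp
    have "((\<lambda>s. 1 - s\<^sup>2) has_real_derivative - (2 * s)) (at s)"
      by (auto intro!: derivative_eq_intros)
    from DERIV_chain2[OF has_real_derivative_powr[OF s] this]
    have d2: "((\<lambda>s. (1 - s\<^sup>2) powr lam) has_real_derivative lam * (1 - s\<^sup>2) powr (lam - 1) * (- (2 * s))) (at s)" .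
    have hW: "(1 - s\<^sup>2) powr lam = ?W s * (1 - s\<^sup>2)" using s by (simp add: powr_diff)
    have eq: "real (2 * k + 1) * s ^ (2 * k) * (?W s * (1 - s\<^sup>2)) + lam * ?W s * (- (2 * s)) * s ^ (2 * k + 1) = ?W s * ?g s"
      by (simp add: algebra_simps power2_eq_square)
    have "(?G has_real_derivative ?W s * ?g s) (at s)"
      by (rule DERIV_cong[OF DERIV_mult[OF d1 d2]]) (simp only: hW eq)
    then show ?thesis by (simp only: has_real_derivative_iff_has_vector_derivative)
  qed
  have "((\<lambda>s. ?W s * ?g s) has_integral ?G 1 - ?G (-1)) {-1..1}"
  proof (rule fundamental_theorem_of_calculus_interior)
    show "continuous_on {-1..1} ?G"
      using lam by (intro continuous_intros continuous_on_powr') (auto simp: abs_square_le_1 abs_le_iff)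
  qed (use d in auto)
  then have hk: "((\<lambda>s. ?W s * ?g s) has_integral 0) {-1<..<1}"
    by (subst (asm) has_integral_Icc_iff_Ioo) simp
  have i: "integrable (Om lam) ?g" by (intro Bochner_Integration.integrable_diff integrable_mult_right int)
  then have si: "set_integrable lborel {-1<..<1} (\<lambda>s. ?W s * ?g s)"
    by (subst (asm) integral_Om(2)) (auto simp: set_integrable_def)
  have "integral\<^sup>L (Om lam) ?g = (LINT s:{-1<..<1}|lborel. ?W s * ?g s)"
    by (subst integral_Om) (auto simp: set_lebesgue_integral_def)
  also have "\<dots> = 0"
    unfolding set_borel_integral_eq_integral(2)[OF si] by (rule integral_unique[OF hk])
  finally have "integral\<^sup>L (Om lam) ?g = 0" .
  then show ?thesis
    by (subst (asm) Bochner_Integration.integral_diff[OF integrable_mult_right[OF int] integrable_mult_right[OF int]]) simp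
qed

lemma Om_moment:
  assumes lam: "lam > 0"
  shows "(\<integral>s. s ^ (2 * k) \<partial>Om lam) = Om_mass lam * pochhammer (1 / 2) k / pochhammer (lam + 1 / 2) k"
proof (induction k)
  case (Suc k)
  have "(\<integral>s. s ^ (2 * Suc k) \<partial>Om lam) = (2 * real k + 1) / (2 * real k + 1 + 2 * lam) * (\<integral>s. s ^ (2 * k) \<partial>Om lam)"
    using Om_moment_step[OF lam, of k] lam by (simp add: field_simps)
  also have "(2 * real k + 1) / (2 * real k + 1 + 2 * lam) = (1 / 2 + k) / (lam + 1 / 2 + k)"
  proof -
    have "2 * real k + 1 = 2 * (1 / 2 + k)" "2 * real k + 1 + 2 * lam = 2 * (lam + 1 / 2 + k)" by simp_all
    then show ?thesis by (simp only: mult_divide_mult_cancel_left_if) simp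
  qed
  finally show ?case
    unfolding Suc pochhammer_Suc times_divide_times_eq by (simp only: mult_ac)
qed (simp add: Om_mass_def)

subsection \<open>The Bessel series\<close>

text \<open>The regularised hypergeometric function 0F1(; c; w) / Gamma(c). Up to the power (z /
  2)^\<nu>, both Bessel functions are its values for c = \<nu> + 1: at w = z^2 / 4 for
  \<open>bessel_I\<close> and at w = - z^2 / 4 for \<open>bessel_J\<close>.\<close>

definition besF :: "real \<Rightarrow> real \<Rightarrow> real" where
  "besF c w = (\<Sum>k. rGamma (c + real k) / fact k * w ^ k)"

lemma rGamma_real_pos: "c > 0 \<Longrightarrow> rGamma c > 0" for c :: real
  by (simp add: rGamma_inverse_Gamma Gamma_real_pos)

lemma rGamma_shift: "c > 0 \<Longrightarrow> rGamma (c + real k) = rGamma c / pochhammer c k" for c :: real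
  using pochhammer_rGamma[of c k] pochhammer_pos[of c k] by simp

text \<open>Larger c only increases the Pochhammer symbol, and at c = 1 / 2 its product with k! is
  (2 k)! / 4^k. The series is therefore dominated by that of cosh at 2 sqrt |w|.\<close>

lemma besF_coeff_bound:
  assumes "c \<ge> 1 / 2"
  shows "\<bar>rGamma (c + real k) / fact k\<bar> \<le> rGamma c * 4 ^ k / fact (2 * k)"
proof -
  have "pochhammer (1 / 2) k \<le> pochhammer c k"
    using assms by (induction k) (auto simp: pochhammer_Suc intro!: mult_mono pochhammer_nonneg)
  moreover have p: "pochhammer (1 / 2 :: real) k > 0" by (rule pochhammer_pos) simp
  moreover have "rGamma c > 0" using assms by (intro rGamma_real_pos) auto
  ultimately have "rGamma (c + real k) / fact k \<le> rGamma c / pochhammer (1 / 2) k / fact k"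
    using assms by (simp add: rGamma_shift divide_right_mono frac_le)
  also have "\<dots> = rGamma c * 4 ^ k / fact (2 * k)"
    using p by (simp add: fact_double power_mult)
  finally show ?thesis
    using rGamma_real_pos[of "c + real k"] assms by simp
qed

lemma cosh_sums: "(\<lambda>n. x ^ (2 * n) / fact (2 * n)) sums cosh x" for x :: real
proof -
  have "(\<lambda>n. if even n then x ^ n /\<^sub>R fact n else 0) sums cosh x" by (rule cosh_converges)
  then have "(\<lambda>n. (\<lambda>n. if even n then x ^ n /\<^sub>R fact n else 0) (2 * n)) sums cosh x"
    by (subst sums_mono_reindex) (auto simp: strict_mono_def elim!: evenE)
  then show ?thesis by (simp add: divide_inverse mult.commute)
qed

lemma besF_summable_abs:
  assumes "c \<ge> 1 / 2"
  shows "summable (\<lambda>k. \<bar>rGamma (c + real k) / fact k * w ^ k\<bar>)"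
proof (rule summable_comparison_test[OF exI[of _ 0]], intro allI impI)
  fix k
  have "\<bar>rGamma (c + real k) / fact k * w ^ k\<bar> \<le> rGamma c * 4 ^ k / fact (2 * k) * \<bar>w\<bar> ^ k"
    unfolding abs_mult power_abs by (intro mult_right_mono besF_coeff_bound assms) auto
  also have "\<dots> = rGamma c * ((2 * sqrt \<bar>w\<bar>) ^ (2 * k) / fact (2 * k))"
    by (simp add: power_mult power_mult_distrib)
  finally show "norm \<bar>rGamma (c + real k) / fact k * w ^ k\<bar> \<le> rGamma c * ((2 * sqrt \<bar>w\<bar>) ^ (2 * k) / fact (2 * k))" by simp
qed (intro summable_mult sums_summable[OF cosh_sums])

lemma besF_summable: "c \<ge> 1 / 2 \<Longrightarrow> summable (\<lambda>k. rGamma (c + real k) / fact k * w ^ k)"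
  by (rule summable_rabs_cancel[OF besF_summable_abs])

text \<open>Termwise differentiation: the factor k + 1 cancels against the factorial, and the index
  shift raises c by 1.\<close>

lemma besF_has_derivative:
  assumes "c \<ge> 1 / 2"
  shows "(besF c has_real_derivative besF (c + 1) w) (at w)"
proof -
  have "((\<lambda>x. \<Sum>k. rGamma (c + real k) / fact k * x ^ k) has_field_derivative (\<Sum>k. diffs (\<lambda>k. rGamma (c + real k) / fact k) k * w ^ k)) (at w)"
    by (rule termdiffs_strong_converges_everywhere) (rule besF_summable[OF assms])
  moreover have "diffs (\<lambda>k. rGamma (c + real k) / fact k) = (\<lambda>k. rGamma (c + 1 + real k) / fact k)"
    by (rule ext) (simp add: diffs_def field_simps del: of_nat_Suc, simp add: algebra_simps)
  ultimately show ?thesis unfolding besF_def by simp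
qed

lemma continuous_besF: "c \<ge> 1 / 2 \<Longrightarrow> continuous_on A (besF c)"
  by (meson DERIV_isCont besF_has_derivative continuous_at_imp_continuous_on)

lemma measurable_besF [measurable]: "c \<ge> 1 / 2 \<Longrightarrow> besF c \<in> borel_measurable borel"
  by (intro borel_measurable_continuous_onI continuous_besF)

text \<open>Coefficientwise this is rGamma(v) = v rGamma(v + 1) at v = c + k; the part carrying the
  factor k is the series for c + 2 after an index shift.\<close>

lemma besF_recurrence:
  assumes "c \<ge> 1 / 2"
  shows "besF c w = c * besF (c + 1) w + w * besF (c + 2) w"
proof -
  let ?a = "\<lambda>c k. rGamma (c + real k) / fact k * w ^ k"
  have "(\<lambda>k. ?a (c + 2) k) sums besF (c + 2) w"
    unfolding besF_def using assms by (intro summable_sums besF_summable) auto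
  then have "(\<lambda>k. w * ?a (c + 2) k) sums (w * besF (c + 2) w)" by (rule sums_mult)
  moreover have "w * ?a (c + 2) k = real (Suc k) * ?a (c + 1) (Suc k)" for k
  proof -
    have "c + 1 + real (Suc k) = c + 2 + real k" by simp
    then show ?thesis by (simp only:) (simp add: field_simps del: of_nat_Suc)
  qed
  ultimately have "(\<lambda>k. real (Suc k) * ?a (c + 1) (Suc k)) sums (w * besF (c + 2) w)" by (simp only:)
  then have 1: "(\<lambda>k. real k * ?a (c + 1) k) sums (w * besF (c + 2) w)"
    by (subst (asm) sums_Suc_iff) simp
  have "(\<lambda>k. c * ?a (c + 1) k) sums (c * besF (c + 1) w)"
    unfolding besF_def using assms by (intro sums_mult summable_sums besF_summable) auto
  from sums_add[OF this 1] have "(\<lambda>k. c * ?a (c + 1) k + real k * ?a (c + 1) k) sums (c * besF (c + 1) w + w * besF (c + 2) w)" .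
  moreover have "c * ?a (c + 1) k + real k * ?a (c + 1) k = ?a c k" for k
  proof -
    have "c + 1 + real k = c + real k + 1" by simp
    then have "c * ?a (c + 1) k + real k * ?a (c + 1) k = (c + real k) * rGamma (c + real k + 1) / fact k * w ^ k"
      by (simp only:) (simp add: algebra_simps add_divide_distrib)
    then show ?thesis by (simp only: rGamma_plus1)
  qed
  ultimately show ?thesis unfolding besF_def by (simp add: sums_iff)
qed

text \<open>Termwise integration: the even moments of \<open>Om\<close> turn the coefficients 1 / (2
  k)! into those of \<open>besF\<close>. The sign e treats cosh (e = 1) and cos (e = -1), hence both
  Bessel functions, at once.\<close>

lemma Om_integral_series:
  fixes e w :: real
  assumes lam: "lam > 0" and e: "\<bar>e\<bar> = 1"
    and g: "\<And>s. (\<lambda>k. e ^ k / fact (2 * k) * (w * s) ^ (2 * k)) sums g s"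
  shows "integral\<^sup>L (Om lam) g = Om_mass lam * Gamma (lam + 1 / 2) * besF (lam + 1 / 2) (e * w\<^sup>2 / 4)"
proof -
  let ?c = "lam + 1 / 2"
  let ?f = "\<lambda>k s. e ^ k / fact (2 * k) * (w * s) ^ (2 * k)"
  have ek: "\<bar>e\<bar> ^ k = 1" for k using e by simp
  have int: "integrable (Om lam) (\<lambda>s. s ^ n)" for n
    using lam by (intro integrable_Om_bounded[where B=1]) (auto simp: power_abs intro!: power_le_one)
  have fi: "integrable (Om lam) (?f k)" for k
    unfolding power_mult_distrib mult.assoc[symmetric] by (intro integrable_mult_right int)
  interpret finite_measure "Om lam" by (rule finite_measure_Om) fact
  have nf: "\<bar>?f k s\<bar> \<le> w ^ (2 * k) / fact (2 * k)" if "-1 < s" "s < 1" for k s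
  proof -
    have "(s ^ (2 * k)) \<le> 1" using that by (simp add: power_mult power_le_one abs_square_le_1 abs_le_iff)
    then have "w ^ (2 * k) * s ^ (2 * k) \<le> w ^ (2 * k) * 1" by (intro mult_left_mono) (auto simp: power_mult)
    then show ?thesis by (simp add: abs_mult power_abs ek power_mult_distrib divide_right_mono power_mult)
  qed
  have "(\<lambda>k. integral\<^sup>L (Om lam) (?f k)) sums (\<integral>s. (\<Sum>k. ?f k s) \<partial>Om lam)"
  proof (rule sums_integral)
    show "AE s in Om lam. summable (\<lambda>k. norm (?f k s))"
    proof (rule AE_I2)
      fix s assume "s \<in> space (Om lam)"
      then show "summable (\<lambda>k. norm (?f k s))"
        using nf by (intro summable_comparison_test[OF exI[of _ 0] sums_summable[OF cosh_sums[of w]]]) auto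
    qed
    show "summable (\<lambda>k. \<integral>s. norm (?f k s) \<partial>Om lam)"
    proof (rule summable_comparison_test[OF exI[of _ 0]], intro allI impI)
      fix k
      have "(\<integral>s. norm (?f k s) \<partial>Om lam) \<le> (\<integral>s. w ^ (2 * k) / fact (2 * k) \<partial>Om lam)"
        using nf[of _ k] by (intro integral_mono integrable_norm[OF fi]) auto
      then show "norm (\<integral>s. norm (?f k s) \<partial>Om lam) \<le> Om_mass lam * (w ^ (2 * k) / fact (2 * k))"
        by (simp add: Om_mass_def)
    qed (intro summable_mult sums_summable[OF cosh_sums])
  qed (rule fi)
  moreover have "(\<Sum>k. ?f k s) = g s" for s using g by (simp add: sums_iff)
  moreover have "integral\<^sup>L (Om lam) (?f k) = Om_mass lam * Gamma ?c * (rGamma (?c + real k) / fact k * (e * w\<^sup>2 / 4) ^ k)" for k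
  proof -
    have "integral\<^sup>L (Om lam) (?f k) = e ^ k / fact (2 * k) * w ^ (2 * k) * (Om_mass lam * pochhammer (1 / 2) k / pochhammer ?c k)"
      unfolding Om_moment[OF lam, symmetric] by (simp add: power_mult_distrib)
    also have "\<dots> = Om_mass lam * Gamma ?c * (rGamma ?c / pochhammer ?c k / fact k * (e * w\<^sup>2 / 4) ^ k)"
    proof -
      have "Gamma ?c > 0" using lam by (intro Gamma_real_pos) simp
      then have g: "Gamma ?c \<noteq> 0" "pochhammer (1 / 2 :: real) k \<noteq> 0"
        using pochhammer_pos[of "1 / 2 :: real" k] by simp_all
      have *: "E / (D * P * F) * W * (M * P / Q) = M * G * (inverse G / Q / F * (E * W / D))"
        if "G \<noteq> 0" "P \<noteq> 0" for E P F W M Q G D :: real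
      proof -
        have "M * G * (inverse G / Q / F * (E * W / D)) = (G * inverse G) * (E * W * M / (D * F * Q))"
          by (simp add: divide_inverse)
        then show ?thesis using that by simp
      qed
      show ?thesis
        unfolding fact_double power_mult[of w 2 k] power_mult[of 2 2 k] power_divide power_mult_distrib rGamma_inverse_Gamma
        using *[OF g] by simp
    qed
    finally show ?thesis using lam by (simp add: rGamma_shift)
  qed
  ultimately have "(\<lambda>k. Om_mass lam * Gamma ?c * (rGamma (?c + real k) / fact k * (e * w\<^sup>2 / 4) ^ k)) sums integral\<^sup>L (Om lam) g"
    by simp
  moreover have "(\<lambda>k. Om_mass lam * Gamma ?c * (rGamma (?c + real k) / fact k * (e * w\<^sup>2 / 4) ^ k)) sums (Om_mass lam * Gamma ?c * besF ?c (e * w\<^sup>2 / 4))"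
    unfolding besF_def using lam by (intro sums_mult summable_sums besF_summable) auto
  ultimately show ?thesis by (rule sums_unique2)
qed

lemma Om_integral_cosh:
  assumes "lam > 0"
  shows "(\<integral>s. cosh (w * s) \<partial>Om lam) = Om_mass lam * Gamma (lam + 1 / 2) * besF (lam + 1 / 2) (w\<^sup>2 / 4)"
  using Om_integral_series[OF assms, of 1 w "\<lambda>s. cosh (w * s)"] cosh_sums by simp

lemma Om_integral_cos:
  assumes "lam > 0"
  shows "(\<integral>s. cos (w * s) \<partial>Om lam) = Om_mass lam * Gamma (lam + 1 / 2) * besF (lam + 1 / 2) (- w\<^sup>2 / 4)"
  using Om_integral_series[OF assms, of "-1" w "\<lambda>s. cos (w * s)"] cos_paired[of "w * _"] by simp

text \<open>The odd part of the exponential integrates to 0 against the even weight, so exp may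
  replace cosh. In this form the integrand merges with the Gaussian factor of the heat
  kernel.\<close>

lemma Om_integral_exp:
  assumes lam: "lam > 0"
  shows "(\<integral>s. exp (w * s) \<partial>Om lam) = Om_mass lam * Gamma (lam + 1 / 2) * besF (lam + 1 / 2) (w\<^sup>2 / 4)"
proof -
  have b: "\<bar>exp (v * s)\<bar> \<le> exp \<bar>v\<bar>" if "-1 < s" "s < 1" for s v :: real
  proof -
    have "v * s \<le> \<bar>v\<bar> * \<bar>s\<bar>" by (simp add: abs_mult[symmetric])
    also have "\<dots> \<le> \<bar>v\<bar> * 1" using that by (intro mult_left_mono) auto
    finally show ?thesis by simp
  qed
  have i: "integrable (Om lam) (\<lambda>s. exp (v * s))" for v
    using lam b[of _ v] by (intro integrable_Om_bounded[where B="exp \<bar>v\<bar>"]) auto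
  have "(\<integral>s. cosh (w * s) \<partial>Om lam) = (\<integral>s. (exp (w * s) + exp (- w * s)) / 2 \<partial>Om lam)"
    by (simp add: cosh_field_def)
  also have "\<dots> = ((\<integral>s. exp (w * s) \<partial>Om lam) + (\<integral>s. exp (- w * s) \<partial>Om lam)) / 2"
    using i[of w] i[of "-w"] by (subst integral_divide_zero, subst Bochner_Integration.integral_add) auto
  also have "(\<integral>s. exp (- w * s) \<partial>Om lam) = (\<integral>s. exp (w * s) \<partial>Om lam)"
    using integral_Om_uminus[of "\<lambda>s. exp (w * s)" lam] by simp
  finally show ?thesis using Om_integral_cosh[OF lam, of w] by simp
qed

text \<open>In Poisson's integral the cosine is at most 1 and the exponential at most exp |w|;
  dividing the mass of \<open>Om\<close> by the prefactor leaves \<open>rGamma c\<close>, the value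
  of \<open>besF\<close> at 0.\<close>

lemma
  assumes "c > 1 / 2"
  shows besF_neg_bound: "\<bar>besF c (- w\<^sup>2 / 4)\<bar> \<le> rGamma c"
    and besF_pos_bound: "besF c (w\<^sup>2 / 4) \<le> rGamma c * exp \<bar>w\<bar>"
proof -
  define lam where "lam = c - 1 / 2"
  have lam: "lam > 0" and c: "c = lam + 1 / 2" using assms by (simp_all add: lam_def)
  interpret finite_measure "Om lam" by (rule finite_measure_Om[OF lam])
  have gc: "Gamma c > 0" using assms by (intro Gamma_real_pos) simp
  then have gr: "Om_mass lam * Gamma c * rGamma c = Om_mass lam" by (simp add: rGamma_inverse_Gamma)
  have m: "Om_mass lam * Gamma c > 0" using Om_mass_pos[OF lam] gc by simp
  have "\<bar>\<integral>s. cos (w * s) \<partial>Om lam\<bar> \<le> (\<integral>s. 1 \<partial>Om lam)"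
    using lam by (intro order_trans[OF integral_abs_bound] integral_mono integrable_Om_bounded[where B=1]) auto
  then have "Om_mass lam * Gamma c * \<bar>besF c (- w\<^sup>2 / 4)\<bar> \<le> Om_mass lam"
    using m unfolding Om_integral_cos[OF lam] c[symmetric] by (subst (asm) abs_mult) (simp add: Om_mass_def)
  then have "Om_mass lam * Gamma c * \<bar>besF c (- w\<^sup>2 / 4)\<bar> \<le> Om_mass lam * Gamma c * rGamma c"
    using gc by (simp add: rGamma_inverse_Gamma mult.assoc)
  then show "\<bar>besF c (- w\<^sup>2 / 4)\<bar> \<le> rGamma c" using m by (rule mult_left_le_imp_le)
  have e: "\<bar>exp (w * s)\<bar> \<le> exp \<bar>w\<bar>" if "-1 < s" "s < 1" for s
  proof -
    have "w * s \<le> \<bar>w\<bar> * \<bar>s\<bar>" by (simp add: abs_mult[symmetric])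
    also have "\<dots> \<le> \<bar>w\<bar> * 1" using that by (intro mult_left_mono) auto
    finally show ?thesis by simp
  qed
  have "(\<integral>s. exp (w * s) \<partial>Om lam) \<le> (\<integral>s. exp \<bar>w\<bar> \<partial>Om lam)"
    using lam e by (intro integral_mono integrable_Om_bounded[where B="exp \<bar>w\<bar>"]) auto
  then have "Om_mass lam * Gamma c * besF c (w\<^sup>2 / 4) \<le> Om_mass lam * exp \<bar>w\<bar>"
    unfolding Om_integral_exp[OF lam] c[symmetric] by (simp add: Om_mass_def)
  then have "Om_mass lam * Gamma c * besF c (w\<^sup>2 / 4) \<le> Om_mass lam * Gamma c * (rGamma c * exp \<bar>w\<bar>)"
    unfolding mult.assoc[of _ "rGamma c", symmetric] gr
    unfolding mult.assoc[of "Om_mass lam * Gamma c", symmetric] gr .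
  then show "besF c (w\<^sup>2 / 4) \<le> rGamma c * exp \<bar>w\<bar>" using m by (rule mult_left_le_imp_le)
qed

lemma bessel_I_eq:
  assumes "z > 0" "lam > 0"
  shows "bessel_I (lam - 1 / 2) z = (z / 2) powr (lam - 1 / 2) * besF (lam + 1 / 2) (z\<^sup>2 / 4)"
proof -
  have "(z / 2) powr (lam - 1 / 2 + 2 * real k) * rGamma (lam - 1 / 2 + real k + 1) / fact k =
     (z / 2) powr (lam - 1 / 2) * (rGamma (lam + 1 / 2 + real k) / fact k * (z\<^sup>2 / 4) ^ k)" for k
  proof -
    have "(z / 2) powr (lam - 1 / 2 + 2 * real k) = (z / 2) powr (lam - 1 / 2) * (z / 2) ^ (2 * k)"
      using assms powr_realpow[of "z / 2" "2 * k"] by (simp add: powr_add)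
    moreover have "(z / 2) ^ (2 * k) = (z\<^sup>2 / 4) ^ k" by (simp add: power_mult power_divide)
    moreover have "lam - 1 / 2 + real k + 1 = lam + 1 / 2 + real k" by simp
    ultimately show ?thesis by (simp only:) (simp add: mult_ac)
  qed
  then show ?thesis
    unfolding bessel_I_def besF_def using assms by (simp only:) (intro suminf_mult besF_summable, simp)
qed

lemma bessel_J_eq:
  assumes "z > 0" "lam > 0"
  shows "bessel_J (lam - 1 / 2) z = (z / 2) powr (lam - 1 / 2) * besF (lam + 1 / 2) (- z\<^sup>2 / 4)"
proof -
  have "(-1) ^ k * (z / 2) powr (lam - 1 / 2 + 2 * real k) * rGamma (lam - 1 / 2 + real k + 1) / fact k =
     (z / 2) powr (lam - 1 / 2) * (rGamma (lam + 1 / 2 + real k) / fact k * (- z\<^sup>2 / 4) ^ k)" for k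
  proof -
    have "(z / 2) powr (lam - 1 / 2 + 2 * real k) = (z / 2) powr (lam - 1 / 2) * (z / 2) ^ (2 * k)"
      using assms powr_realpow[of "z / 2" "2 * k"] by (simp add: powr_add)
    moreover have "(-1) ^ k * (z / 2) ^ (2 * k) = (- z\<^sup>2 / 4) ^ k"
    proof -
      have "(- z\<^sup>2 / 4) ^ k = ((-1) * (z / 2)\<^sup>2) ^ k" by (simp add: power_divide)
      then show ?thesis by (simp only: power_mult_distrib power_mult)
    qed
    moreover have "lam - 1 / 2 + real k + 1 = lam + 1 / 2 + real k" by simp
    ultimately show ?thesis by (simp only:) (simp add: mult_ac)
  qed
  then show ?thesis
    unfolding bessel_J_def besF_def using assms by (simp only:) (intro suminf_mult besF_summable, simp)
qed

subsection \<open>The heat kernel\<close>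

lemma heat_kernel_eq:
  assumes "lam > 0" "t > 0" "x > 0" "y > 0"
  shows "heat_kernel lam t x y = t powr (- 1 / 2) * (x * y / (4 * t)) powr lam *
    besF (lam + 1 / 2) ((x * y / (4 * t))\<^sup>2) * exp (- (x\<^sup>2 + y\<^sup>2) / (4 * t))"
proof -
  define u where "u = x * y / (4 * t)"
  have u: "u > 0" using assms by (simp add: u_def)
  have 1: "x * y / (2 * t) / 2 = u" "(x * y / (2 * t))\<^sup>2 / 4 = u\<^sup>2" "x * y = 4 * t * u"
    using assms by (simp_all add: u_def field_simps power2_eq_square)
  have 2: "sqrt (4 * t * u) / (2 * t) * u powr (lam - 1 / 2) = t powr (- 1 / 2) * u powr lam"
    using assms u by (simp add: powr_half_sqrt[symmetric] powr_mult powr_diff powr_minus field_simps real_sqrt_mult flip: powr_add)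
  have "heat_kernel lam t x y = (sqrt (x * y) / (2 * t) * (x * y / (2 * t) / 2) powr (lam - 1 / 2)) *
     besF (lam + 1 / 2) ((x * y / (2 * t))\<^sup>2 / 4) * exp (- (x\<^sup>2 + y\<^sup>2) / (4 * t))"
    unfolding heat_kernel_def using assms by (subst bessel_I_eq) simp_all
  also have "sqrt (x * y) / (2 * t) * (x * y / (2 * t) / 2) powr (lam - 1 / 2) = t powr (- 1 / 2) * u powr lam"
    unfolding 1(1) unfolding 1(3) by (rule 2)
  finally show ?thesis unfolding 1(2) by (simp add: u_def)
qed

text \<open>For s = cos \<theta> this is the squared distance in the plane between points of moduli
  x and y at angle \<theta>.\<close>

definition qd :: "real \<Rightarrow> real \<Rightarrow> real \<Rightarrow> real" where
  "qd x y s = x\<^sup>2 + y\<^sup>2 - 2 * x * y * s"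

lemma qd_eq: "qd x y s = (x - y)\<^sup>2 + 2 * x * y * (1 - s)"
  by (simp add: qd_def power2_eq_square algebra_simps)

lemma qd_ge: "x > 0 \<Longrightarrow> y > 0 \<Longrightarrow> s < 1 \<Longrightarrow> (x - y)\<^sup>2 \<le> qd x y s"
  by (simp add: qd_eq)

lemma qd_pos: "x > 0 \<Longrightarrow> y > 0 \<Longrightarrow> s < 1 \<Longrightarrow> qd x y s > 0"
  unfolding qd_eq by (intro add_nonneg_pos) simp_all

lemma qd_scale: "qd (r * x) (r * y) s = r\<^sup>2 * qd x y s"
  by (simp add: qd_def power2_eq_square algebra_simps)

lemma qd_commute: "qd x y s = qd y x s"
  by (simp add: qd_def algebra_simps)

lemma measurable_qd [measurable (raw)]:
  assumes [measurable]: "f \<in> borel_measurable M" "g \<in> borel_measurable M" "h \<in> borel_measurable M"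
  shows "(\<lambda>x. qd (f x) (g x) (h x)) \<in> borel_measurable M"
  unfolding qd_def by measurable

text \<open>Collects the 4^(-lam) from the power of x y / (4 t) and the inverse of the prefactor in
  Poisson's integral.\<close>

definition heat_const :: "real \<Rightarrow> real" where
  "heat_const lam = 4 powr (- lam) / (Om_mass lam * Gamma (lam + 1 / 2))"

lemma heat_const_pos: "lam > 0 \<Longrightarrow> heat_const lam > 0"
  using Om_mass_pos[of lam] Gamma_real_pos[of "lam + 1 / 2"] by (simp add: heat_const_def)

lemma heat_kernel_Om:
  assumes "lam > 0" "t > 0" "x > 0" "y > 0"
  shows "heat_kernel lam t x y = heat_const lam * t powr (- lam - 1 / 2) * (x * y) powr lam *
    (\<integral>s. exp (- qd x y s / (4 * t)) \<partial>Om lam)"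
proof -
  let ?w = "x * y / (2 * t)"
  have "(\<integral>s. exp (- qd x y s / (4 * t)) \<partial>Om lam) = (\<integral>s. exp (- (x\<^sup>2 + y\<^sup>2) / (4 * t)) * exp (?w * s) \<partial>Om lam)"
    using assms by (intro Bochner_Integration.integral_cong refl) (simp add: qd_def exp_add[symmetric] field_simps)
  also have "\<dots> = exp (- (x\<^sup>2 + y\<^sup>2) / (4 * t)) * (Om_mass lam * Gamma (lam + 1 / 2) * besF (lam + 1 / 2) (?w\<^sup>2 / 4))"
    by (subst integral_mult_right_zero) (simp only: Om_integral_exp[OF assms(1)])
  also have "?w\<^sup>2 / 4 = (x * y / (4 * t))\<^sup>2" by (simp add: power_divide power_mult_distrib)
  finally have 1: "(\<integral>s. exp (- qd x y s / (4 * t)) \<partial>Om lam) = exp (- (x\<^sup>2 + y\<^sup>2) / (4 * t)) * (Om_mass lam * Gamma (lam + 1 / 2) * besF (lam + 1 / 2) ((x * y / (4 * t))\<^sup>2))" .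
  have a: "(x * y / (4 * t)) powr lam = (x * y) powr lam * 4 powr (- lam) * t powr (- lam)"
    using assms by (simp add: powr_divide powr_mult powr_minus field_simps)
  have b: "t powr (- lam - 1 / 2) = t powr (- lam) * t powr (- 1 / 2)"
    using powr_add[of t "-lam" "-1/2"] by simp
  have 2: "t powr (- 1 / 2) * (x * y / (4 * t)) powr lam = t powr (- lam - 1 / 2) * 4 powr (- lam) * (x * y) powr lam"
    unfolding a b by (simp only: mult_ac)
  have g: "Gamma (lam + 1 / 2) > 0" using assms by (intro Gamma_real_pos) simp
  show ?thesis
    unfolding heat_kernel_eq[OF assms] 1 2 heat_const_def
    using Om_mass_pos[OF assms(1)] g by simp
qed

subsection \<open>The homogeneous kernels\<close>

text \<open>The exponent q stays free: one value gives the kernel of an operator, and the value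
  larger by 1 / 2 controls its gradient.\<close>

definition kern :: "real \<Rightarrow> real \<Rightarrow> real \<Rightarrow> real \<Rightarrow> real" where
  "kern lam q x y = (x * y) powr lam * (\<integral>s. qd x y s powr (- q) \<partial>Om lam)"

lemma kern_nonneg: "kern lam q x y \<ge> 0"
  unfolding kern_def by (intro mult_nonneg_nonneg Bochner_Integration.integral_nonneg) auto

lemma kern_commute: "kern lam q x y = kern lam q y x"
  unfolding kern_def by (simp add: qd_commute mult.commute)

lemma kern_scale:
  assumes "r > 0" "x > 0" "y > 0"
  shows "kern lam q (r * x) (r * y) = r powr (2 * lam - 2 * q) * kern lam q x y"
proof -
  have "(\<integral>s. qd (r * x) (r * y) s powr (- q) \<partial>Om lam) = (\<integral>s. r powr (- 2 * q) * qd x y s powr (- q) \<partial>Om lam)"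
  proof (rule Bochner_Integration.integral_cong[OF refl])
    fix s assume "s \<in> space (Om lam)"
    then have "qd x y s > 0" using assms by (intro qd_pos) auto
    then show "qd (r * x) (r * y) s powr (- q) = r powr (- 2 * q) * qd x y s powr (- q)"
      unfolding qd_scale using assms by (simp add: powr_mult powr_powr flip: powr_numeral)
  qed
  also have "\<dots> = r powr (- 2 * q) * (\<integral>s. qd x y s powr (- q) \<partial>Om lam)" by (rule integral_mult_right_zero)
  finally have 1: "(\<integral>s. qd (r * x) (r * y) s powr (- q) \<partial>Om lam) = r powr (- 2 * q) * (\<integral>s. qd x y s powr (- q) \<partial>Om lam)" .
  have 2: "(r * x * (r * y)) powr lam = r powr (2 * lam) * (x * y) powr lam"
  proof -
    have "r powr (2 * lam) = r powr lam * r powr lam" by (simp add: powr_add[symmetric])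
    then show ?thesis using assms by (simp add: powr_mult)
  qed
  show ?thesis unfolding kern_def 1 2 using powr_add[of r "2 * lam" "- 2 * q"] by simp
qed

lemma measurable_kern [measurable (raw)]:
  assumes [measurable]: "f \<in> borel_measurable M" "g \<in> borel_measurable M" and lam: "lam > 0"
  shows "(\<lambda>x. kern lam q (f x) (g x)) \<in> borel_measurable M"
proof -
  interpret finite_measure "Om lam" by (rule finite_measure_Om[OF lam])
  have "(\<lambda>p. \<integral>s. qd (fst p) (snd p) s powr (- q) \<partial>Om lam) \<in> borel_measurable (borel \<Otimes>\<^sub>M borel)"
    by (rule borel_measurable_lebesgue_integral) (simp add: split_beta', measurable)
  then have [measurable]: "(\<lambda>p. \<integral>s. qd (fst p) (snd p) s powr (- q) \<partial>Om lam) \<in> borel_measurable borel"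
    by (simp add: borel_prod)
  have "(\<lambda>x. (\<lambda>p. \<integral>s. qd (fst p) (snd p) s powr (- q) \<partial>Om lam) (f x, g x)) \<in> borel_measurable M"
    by measurable
  then show ?thesis unfolding kern_def by simp
qed

lemma qd_powr_le:
  assumes "x > 0" "y > 0" "x \<noteq> y" "s < 1" "q \<ge> 0"
  shows "qd x y s powr (- q) \<le> \<bar>x - y\<bar> powr (- 2 * q)"
proof -
  have "qd x y s powr (- q) \<le> ((x - y)\<^sup>2) powr (- q)"
    using assms qd_ge[of x y s] by (intro powr_mono2') auto
  also have "((x - y)\<^sup>2) powr (- q) = \<bar>x - y\<bar> powr (- 2 * q)"
  proof -
    have "(x - y)\<^sup>2 = \<bar>x - y\<bar> powr 2" using assms by simp
    then show ?thesis by (simp only: powr_powr) simp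
  qed
  finally show ?thesis .
qed

lemma integrable_qd_powr:
  assumes "lam > 0" "x > 0" "y > 0" "x \<noteq> y" "q \<ge> 0"
  shows "integrable (Om lam) (\<lambda>s. qd x y s powr (- q))"
  using assms qd_powr_le[of x y _ q]
  by (intro integrable_Om_bounded[where B="\<bar>x - y\<bar> powr (- 2 * q)"]) auto

text \<open>Here \<open>qd\<close> is replaced by its lower bound (x - y)^2, its limit as s tends to
  1; this is efficient when x and y are far apart compared with sqrt (x y).\<close>

lemma kern_le_far:
  assumes "lam > 0" "x > 0" "y > 0" "x \<noteq> y" "q \<ge> 0"
  shows "kern lam q x y \<le> Om_mass lam * ((x * y) powr lam * \<bar>x - y\<bar> powr (- 2 * q))"
proof -
  interpret finite_measure "Om lam" by (rule finite_measure_Om) fact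
  have "(\<integral>s. qd x y s powr (- q) \<partial>Om lam) \<le> (\<integral>s. \<bar>x - y\<bar> powr (- 2 * q) \<partial>Om lam)"
    using assms by (intro integral_mono integrable_qd_powr qd_powr_le) auto
  then have "(\<integral>s. qd x y s powr (- q) \<partial>Om lam) \<le> Om_mass lam * \<bar>x - y\<bar> powr (- 2 * q)" by (simp add: Om_mass_def)
  from mult_left_mono[OF this, of "(x * y) powr lam"] show ?thesis unfolding kern_def by (simp add: mult_ac)
qed

text \<open>Distributes the decay of a sum over its two summands, in any chosen proportion of the
  exponents.\<close>

lemma powr_add_le:
  fixes A B :: real
  assumes "A > 0" "B > 0" "0 \<le> a" "0 \<le> b"
  shows "(A + B) powr (- (a + b)) \<le> A powr (- a) * B powr (- b)"
proof -
  have "(A + B) powr (- (a + b)) = (A + B) powr (- a) * (A + B) powr (- b)" by (simp add: powr_add[symmetric])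
  also have "\<dots> \<le> A powr (- a) * B powr (- b)"
    using assms by (intro mult_mono powr_mono2') auto
  finally show ?thesis .
qed

text \<open>The first two summands come from the two ranges of the distance to s = 1 in
  \<open>kern_le_near\<close>, the third from the half of the interval near s = -1.\<close>

definition kern_const :: "real \<Rightarrow> real \<Rightarrow> real" where
  "kern_const lam q = 2 powr lam * (2 / lam + 2 / (q - lam) + 1 / lam)"

lemma kern_const_pos: "0 < lam \<Longrightarrow> lam < q \<Longrightarrow> kern_const lam q > 0"
  unfolding kern_const_def by (intro mult_pos_pos add_pos_pos) auto

text \<open>With d = (x - y)^2 and b = x y, \<open>qd\<close> is d + 2 b r at distance r from s = 1.
  Splitting at r = d / b, where both terms balance, each range contributes a multiple of d^(lam - q)
  b^(-lam); the outer range needs q > lam. The factor (x y)^lam of the kernel then cancels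
  b^(-lam).\<close>

lemma kern_le_near:
  assumes lam: "lam > 0" and q: "q > lam" and xy: "x > 0" "y > 0" "x \<noteq> y"
  shows "kern lam q x y \<le> kern_const lam q * \<bar>x - y\<bar> powr (2 * lam - 2 * q)"
proof -
  define d b r0 where "d = (x - y)\<^sup>2" and "b = x * y" and "r0 = d / b"
  have pos: "d > 0" "b > 0" "r0 > 0" using xy by (simp_all add: d_def b_def r0_def)
  have qd: "qd x y s = d + 2 * b * (1 - s)" for s by (simp add: qd_eq d_def b_def)
  let ?A = "\<integral>\<^sup>+r. ennreal (r powr (lam - 1)) * ennreal (qd x y (1 - r) powr (- q)) * indicator {0<..1} r \<partial>lborel"
  let ?B = "\<integral>\<^sup>+r. ennreal (r powr (lam - 1)) * ennreal (qd x y (r - 1) powr (- q)) * indicator {0<..1} r \<partial>lborel"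
  let ?D = "d powr (lam - q) * b powr (- lam)"
  have "?A \<le> (\<integral>\<^sup>+r. ennreal (d powr (- q)) * (ennreal (\<bar>r - 0\<bar> powr (lam - 1)) * indicator {z. \<bar>z - 0\<bar> \<le> r0} r)
      + ennreal (b powr (- q)) * (ennreal (\<bar>r - 0\<bar> powr (- (q - lam) - 1)) * indicator {z. r0 \<le> \<bar>z - 0\<bar>} r) \<partial>lborel)"
  proof (rule nn_integral_mono)
    fix r :: real
    consider "r \<notin> {0<..1}" | "r \<in> {0<..1}" "r \<le> r0" | "r \<in> {0<..1}" "r \<ge> r0" by linarith
    then show "ennreal (r powr (lam - 1)) * ennreal (qd x y (1 - r) powr (- q)) * indicator {0<..1} r \<le>
       ennreal (d powr (- q)) * (ennreal (\<bar>r - 0\<bar> powr (lam - 1)) * indicator {z. \<bar>z - 0\<bar> \<le> r0} r)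
      + ennreal (b powr (- q)) * (ennreal (\<bar>r - 0\<bar> powr (- (q - lam) - 1)) * indicator {z. r0 \<le> \<bar>z - 0\<bar>} r)"
    proof cases
      case 2
      have "qd x y (1 - r) powr (- q) \<le> d powr (- q)"
        using 2 pos q lam unfolding qd by (intro powr_mono2') auto
      then have "r powr (lam - 1) * qd x y (1 - r) powr (- q) \<le> d powr (- q) * r powr (lam - 1)"
        by (subst mult.commute) (rule mult_right_mono, simp_all)
      then show ?thesis using 2
        by (intro add_increasing2) (auto simp: ennreal_mult'[symmetric] intro!: ennreal_leI)
    next
      case 3
      have "qd x y (1 - r) powr (- q) \<le> (b * r) powr (- q)"
        using 3 pos q lam unfolding qd by (intro powr_mono2') auto
      then have "r powr (lam - 1) * qd x y (1 - r) powr (- q) \<le> r powr (lam - 1) * (b * r) powr (- q)"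
        by (intro mult_left_mono) auto
      also have "\<dots> = b powr (- q) * r powr (- (q - lam) - 1)"
        using 3 pos powr_add[of r "lam - 1" "- q"] by (simp add: powr_mult algebra_simps)
      finally show ?thesis using 3 pos
        by (intro add_increasing) (auto simp: ennreal_mult'[symmetric] intro!: ennreal_leI)
    qed auto
  qed
  also have "\<dots> = ennreal (d powr (- q)) * (\<integral>\<^sup>+r. (ennreal (\<bar>r - 0\<bar> powr (lam - 1)) * indicator {z. \<bar>z - 0\<bar> \<le> r0} r) \<partial>lborel)
      + ennreal (b powr (- q)) * (\<integral>\<^sup>+r. (ennreal (\<bar>r - 0\<bar> powr (- (q - lam) - 1)) * indicator {z. r0 \<le> \<bar>z - 0\<bar>} r) \<partial>lborel)"
    by (subst nn_integral_add) (auto simp: nn_integral_cmult)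
  also have "\<dots> \<le> ennreal (d powr (- q)) * ennreal (2 * r0 powr lam / lam) + ennreal (b powr (- q)) * ennreal (2 * r0 powr (- (q - lam)) / (q - lam))"
    using pos lam q by (intro add_mono mult_left_mono nn_integral_powr_near nn_integral_powr_far) auto
  also have "\<dots> = ennreal (?D * (2 / lam + 2 / (q - lam)))"
  proof -
    have 1: "d powr (- q) * r0 powr lam = ?D"
      using pos powr_add[of d lam "- q"] by (simp add: r0_def powr_divide powr_minus divide_simps)
    have 2: "b powr (- q) * r0 powr (- (q - lam)) = ?D"
    proof -
      have "r0 powr (- (q - lam)) = d powr (lam - q) * b powr (q - lam)"
        using pos by (simp add: r0_def powr_divide powr_minus divide_simps powr_diff)
      then show ?thesis using powr_add[of b "- q" "q - lam"] by (simp add: mult_ac)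
    qed
    have "d powr (- q) * (2 * r0 powr lam / lam) = ?D * (2 / lam)"
      by (simp only: 1[symmetric]) simp
    moreover have "b powr (- q) * (2 * r0 powr (- (q - lam)) / (q - lam)) = ?D * (2 / (q - lam))"
      by (simp only: 2[symmetric]) simp
    ultimately show ?thesis using lam q pos
      by (simp only: ennreal_mult'[symmetric] powr_ge_zero distrib_left) (subst ennreal_plus[symmetric], auto)
  qed
  finally have A: "?A \<le> ennreal (?D * (2 / lam + 2 / (q - lam)))" .
  \<comment> \<open>Near s = -1 there is no singularity: \<open>qd\<close> is at least d + b, and
    distributing the exponent q as (q - lam) + lam gives the same product.\<close>
  have "?B \<le> (\<integral>\<^sup>+r. ennreal ?D * (ennreal (r powr (lam - 1)) * indicator {0<..1} r) \<partial>lborel)"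
  proof (rule nn_integral_mono)
    fix r :: real
    have "qd x y (r - 1) powr (- q) \<le> ?D" if "0 < r" "r \<le> 1"
    proof -
      have "b * 2 \<le> 2 * b * (2 - r)" using that pos by simp
      then have "qd x y (r - 1) powr (- q) \<le> (d + b) powr (- ((q - lam) + lam))"
        using pos q lam that unfolding qd by simp (intro powr_mono2', auto)
      also have "\<dots> \<le> d powr (- (q - lam)) * b powr (- lam)" using pos q lam by (intro powr_add_le) auto
      finally show ?thesis by simp
    qed
    then show "ennreal (r powr (lam - 1)) * ennreal (qd x y (r - 1) powr (- q)) * indicator {0<..1} r \<le>
        ennreal ?D * (ennreal (r powr (lam - 1)) * indicator {0<..1} r)"
      by (auto simp: indicator_def mult.commute[of "ennreal ?D"] intro!: mult_left_mono ennreal_leI)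
  qed
  also have "\<dots> = ennreal (?D * (1 / lam))"
    using lam by (subst nn_integral_cmult) (simp_all add: nn_integral_powr_unit ennreal_mult'[symmetric])
  finally have B: "?B \<le> ennreal (?D * (1 / lam))" .
  have "(\<integral>\<^sup>+s. ennreal (qd x y s powr (- q)) \<partial>Om lam) \<le> ennreal (2 powr lam) * (?A + ?B)"
    by (rule nn_integral_Om_le[OF _ lam]) simp
  also have "\<dots> \<le> ennreal (2 powr lam) * (ennreal (?D * (2 / lam + 2 / (q - lam))) + ennreal (?D * (1 / lam)))"
    by (intro mult_left_mono add_mono A B) auto
  also have "\<dots> = ennreal (kern_const lam q * ?D)"
  proof -
    have "0 \<le> ?D * (2 / lam + 2 / (q - lam))" "0 \<le> ?D * (1 / lam)" using lam q by auto
    then show ?thesis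
      by (simp add: ennreal_plus[symmetric] ennreal_mult'[symmetric] kern_const_def distrib_left mult_ac del: ennreal_plus)
  qed
  finally have "(\<integral>\<^sup>+s. ennreal (qd x y s powr (- q)) \<partial>Om lam) \<le> ennreal (kern_const lam q * ?D)" .
  moreover have "(\<integral>\<^sup>+s. ennreal (qd x y s powr (- q)) \<partial>Om lam) = ennreal (\<integral>s. qd x y s powr (- q) \<partial>Om lam)"
    using lam q xy by (intro nn_integral_eq_integral integrable_qd_powr) auto
  ultimately have "(\<integral>s. qd x y s powr (- q) \<partial>Om lam) \<le> kern_const lam q * ?D"
    using kern_const_pos[OF lam q] by simp
  then have "kern lam q x y \<le> b powr lam * (kern_const lam q * ?D)"
    unfolding kern_def b_def by (intro mult_left_mono) auto
  also have "\<dots> = kern_const lam q * d powr (lam - q)" using pos by (simp add: powr_minus)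
  also have "d powr (lam - q) = \<bar>x - y\<bar> powr (2 * lam - 2 * q)"
  proof -
    have "d = \<bar>x - y\<bar> powr 2" using xy by (simp add: d_def)
    moreover have "2 * (lam - q) = 2 * lam - 2 * q" by simp
    ultimately show ?thesis by (simp only: powr_powr)
  qed
  finally show ?thesis .
qed

section \<open>Moving the first variable of the kernel\<close>

lemma powr_le_two_powr:
  fixes x :: real
  assumes "1 \<le> x" "x \<le> 2" "lam > 0"
  shows "x powr (lam - 1) \<le> 2 powr lam" "x powr lam \<le> 2 powr lam"
proof -
  have "x powr (lam - 1) \<le> x powr lam" using assms by (intro powr_mono) auto
  moreover show *: "x powr lam \<le> 2 powr lam" using assms by (intro powr_mono2) auto
  ultimately show "x powr (lam - 1) \<le> 2 powr lam" by linarith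
qed

text \<open>A triangle inequality: the square root of \<open>qd\<close> is a planar distance, the
  shift moves one point by e, and e is at most half the original distance. So the distance at most
  halves and \<open>qd\<close> loses at most a factor 4.\<close>

lemma qd_shift:
  assumes "0 \<le> e" "2 * e \<le> \<bar>z - 1\<bar>" "z > 0" "-1 < s" "s < 1"
  shows "qd 1 z s / 4 \<le> qd (1 + e) z s"
proof -
  let ?A = "1 + e - z * s" and ?B = "z\<^sup>2 * (1 - s\<^sup>2)"
  have s: "s\<^sup>2 \<le> 1" using assms by (simp add: abs_square_le_1 abs_le_iff)
  have q: "qd (1 + e) z s = ?A\<^sup>2 + ?B" by (simp add: qd_def power2_eq_square algebra_simps)
  have q1: "qd 1 z s = (?A - e)\<^sup>2 + ?B" by (simp add: qd_def power2_eq_square algebra_simps)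
  have "0 \<le> (?A + e)\<^sup>2" by simp
  then have "(?A - e)\<^sup>2 \<le> 2 * ?A\<^sup>2 + 2 * e\<^sup>2" by (simp add: power2_eq_square algebra_simps)
  moreover have "(2 * e)\<^sup>2 \<le> (z - 1)\<^sup>2" using assms by (intro abs_le_square_iff[THEN iffD1]) auto
  then have "4 * e\<^sup>2 \<le> qd 1 z s" using qd_ge[of 1 z s] assms by (simp add: power2_commute[of z 1] power_mult_distrib)
  moreover have "0 \<le> ?B" using s by simp
  ultimately show ?thesis unfolding q using q1 by linarith
qed

text \<open>Mean value theorem in the first variable. Differentiating \<open>qd\<close> produces a
  factor bounded by its square root, so the derivative costs half a power, which is the exponent q +
  1 / 2. The factor 4^(q + 1) comes from returning from the intermediate point to 1 by
  \<open>qd_shift\<close>.\<close>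

lemma qd_diff_bound:
  assumes lam: "lam > 0" and q: "q > 0" and e: "0 < e" "e \<le> 1" "2 * e \<le> \<bar>z - 1\<bar>" "z > 0" and s: "-1 < s" "s < 1"
  shows "\<bar>(1 + e) powr lam * qd (1 + e) z s powr (- q) - qd 1 z s powr (- q)\<bar> \<le>
     2 powr lam * (lam + 2 * q) * 4 powr (q + 1) * e * (qd 1 z s powr (- q) + qd 1 z s powr (- (q + 1 / 2)))"
proof -
  let ?h = "\<lambda>u. u powr lam * qd u z s powr (- q)"
  let ?h' = "\<lambda>u. lam * u powr (lam - 1) * qd u z s powr (- q) + (- q) * qd u z s powr (- q - 1) * (2 * u - 2 * z * s) * u powr lam"
  have d: "(?h has_real_derivative ?h' u) (at u)" if "u \<ge> 1" for u
  proof -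
    have "((\<lambda>u. qd u z s) has_real_derivative (2 * u - 2 * z * s)) (at u)"
      unfolding qd_def by (auto intro!: derivative_eq_intros)
    moreover have "qd u z s > 0" using that e s by (intro qd_pos) auto
    ultimately have "((\<lambda>u. qd u z s powr (- q)) has_real_derivative (- q) * qd u z s powr (- q - 1) * (2 * u - 2 * z * s)) (at u)"
      by (rule DERIV_chain2[OF has_real_derivative_powr, rotated])
    moreover have "((\<lambda>u. u powr lam) has_real_derivative lam * u powr (lam - 1)) (at u)"
      using that by (intro has_real_derivative_powr) auto
    ultimately show ?thesis by (intro DERIV_mult)
  qed
  obtain u where u: "1 < u" "u < 1 + e" "?h (1 + e) - ?h 1 = (1 + e - 1) * ?h' u"
    using MVT2[of 1 "1 + e" ?h ?h'] d e by auto
  let ?Q = "qd 1 z s" and ?R = "qd u z s"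
  have Q: "?Q > 0" using e s by (intro qd_pos) auto
  have R: "?R > 0" using u e s by (intro qd_pos) auto
  have QR: "?Q / 4 \<le> ?R" using qd_shift[of "u - 1" z s] u e s by auto
  have p: "?R powr (- a) \<le> 4 powr a * ?Q powr (- a)" if "a \<ge> 0" for a
  proof -
    have "?R powr (- a) \<le> (?Q / 4) powr (- a)" using QR Q that by (intro powr_mono2') auto
    also have "\<dots> = 4 powr a * ?Q powr (- a)" using Q by (simp add: powr_divide powr_minus divide_simps)
    finally show ?thesis .
  qed
  have four: "4 powr a \<le> 4 powr (q + 1)" if "a \<le> q + 1" for a :: real using that by (intro powr_mono) auto
  have "\<bar>lam * u powr (lam - 1) * ?R powr (- q)\<bar> \<le> lam * 2 powr lam * (4 powr (q + 1) * ?Q powr (- q))"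
  proof -
    have "?R powr (- q) \<le> 4 powr (q + 1) * ?Q powr (- q)"
      using p[of q] q mult_right_mono[OF four[of q], of "?Q powr (- q)"] by auto
    moreover have "u powr (lam - 1) \<le> 2 powr lam" using u e lam by (intro powr_le_two_powr) auto
    ultimately show ?thesis using lam by (simp add: abs_mult mult_mono)
  qed
  moreover have "\<bar>(- q) * ?R powr (- q - 1) * (2 * u - 2 * z * s) * u powr lam\<bar> \<le> 2 * q * 2 powr lam * (4 powr (q + 1) * ?Q powr (- (q + 1 / 2)))"
  proof -
    \<comment> \<open>\<open>qd\<close> is a sum of two squares, one of which is the square of half
      its own derivative.\<close>
    have "(u - z * s)\<^sup>2 + z\<^sup>2 * (1 - s\<^sup>2) = ?R" by (simp add: qd_def power2_eq_square algebra_simps)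
    moreover have "s\<^sup>2 \<le> 1" using s by (simp add: abs_square_le_1 abs_le_iff)
    ultimately have "(u - z * s)\<^sup>2 \<le> ?R" by (smt (verit) mult_nonneg_nonneg zero_le_power2)
    then have "\<bar>u - z * s\<bar> \<le> sqrt ?R" by (simp add: real_le_rsqrt)
    then have "?R powr (- q - 1) * \<bar>u - z * s\<bar> \<le> ?R powr (- q - 1) * ?R powr (1 / 2)"
      using R by (intro mult_left_mono) (auto simp: powr_half_sqrt)
    also have "\<dots> = ?R powr (- (q + 1 / 2))"
    proof -
      have "- q - 1 + 1 / 2 = - (q + 1 / 2)" by simp
      then show ?thesis by (simp only: powr_add[symmetric])
    qed
    also have "\<dots> \<le> 4 powr (q + 1 / 2) * ?Q powr (- (q + 1 / 2))" using q by (intro p) auto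
    also have "\<dots> \<le> 4 powr (q + 1) * ?Q powr (- (q + 1 / 2))" by (intro mult_right_mono four) auto
    finally have 1: "?R powr (- q - 1) * \<bar>u - z * s\<bar> \<le> 4 powr (q + 1) * ?Q powr (- (q + 1 / 2))" .
    have 2: "u powr lam \<le> 2 powr lam" using u e lam by (intro powr_le_two_powr) auto
    have "\<bar>(- q) * ?R powr (- q - 1) * (2 * u - 2 * z * s) * u powr lam\<bar> = 2 * q * (u powr lam * (?R powr (- q - 1) * \<bar>u - z * s\<bar>))"
    proof -
      have "2 * u - 2 * z * s = 2 * (u - z * s)" by simp
      then show ?thesis using q by (simp only: abs_mult) (simp add: mult_ac)
    qed
    also have "\<dots> \<le> 2 * q * (2 powr lam * (4 powr (q + 1) * ?Q powr (- (q + 1 / 2))))"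
      using q by (intro mult_left_mono mult_mono 1 2) auto
    finally show ?thesis by (simp add: mult.assoc)
  qed
  ultimately have "\<bar>?h' u\<bar> \<le> lam * 2 powr lam * (4 powr (q + 1) * ?Q powr (- q)) + 2 * q * 2 powr lam * (4 powr (q + 1) * ?Q powr (- (q + 1 / 2)))"
    by (rule order_trans[OF abs_triangle_ineq add_mono])
  also have "\<dots> \<le> 2 powr lam * (lam + 2 * q) * 4 powr (q + 1) * (?Q powr (- q) + ?Q powr (- (q + 1 / 2)))"
  proof -
    define T X Y where "T = 2 powr lam * 4 powr (q + 1)" and "X = ?Q powr (- q)" and "Y = ?Q powr (- (q + 1 / 2))"
    have "0 \<le> T * (lam * Y)" "0 \<le> T * (2 * q * X)" using lam q by (auto simp: T_def X_def Y_def intro!: mult_nonneg_nonneg)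
    then have "T * (lam * X) + T * (2 * q * Y) \<le> T * (lam + 2 * q) * (X + Y)" by (simp add: algebra_simps)
    then show ?thesis unfolding T_def X_def Y_def by (simp add: mult_ac)
  qed
  finally have "e * \<bar>?h' u\<bar> \<le> e * (2 powr lam * (lam + 2 * q) * 4 powr (q + 1) * (?Q powr (- q) + ?Q powr (- (q + 1 / 2))))"
    using e by (intro mult_left_mono) auto
  moreover have "\<bar>?h (1 + e) - ?h 1\<bar> = e * \<bar>?h' u\<bar>" unfolding u(3) using e by (simp add: abs_mult)
  ultimately show ?thesis by (simp add: mult_ac)
qed

lemma kern_diff_bound:
  assumes lam: "lam > 0" and q: "q > 0" and e: "0 < e" "e \<le> 1" "2 * e \<le> \<bar>z - 1\<bar>" "z > 0"
  shows "\<bar>kern lam q (1 + e) z - kern lam q 1 z\<bar> \<le>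
     2 powr lam * (lam + 2 * q) * 4 powr (q + 1) * e * (kern lam q 1 z + kern lam (q + 1 / 2) 1 z)"
proof -
  let ?C = "2 powr lam * (lam + 2 * q) * 4 powr (q + 1) * e"
  have z: "z \<noteq> 1" "1 + e \<noteq> z" using e by auto
  have i1: "integrable (Om lam) (\<lambda>s. qd 1 z s powr (- q))" and i2: "integrable (Om lam) (\<lambda>s. qd (1 + e) z s powr (- q))"
    and i3: "integrable (Om lam) (\<lambda>s. qd 1 z s powr (- (q + 1 / 2)))"
    using lam q e z integrable_qd_powr[of lam 1 z "q + 1 / 2"] by (auto intro!: integrable_qd_powr)
  have eq: "kern lam q (1 + e) z - kern lam q 1 z = z powr lam * (\<integral>s. (1 + e) powr lam * qd (1 + e) z s powr (- q) - qd 1 z s powr (- q) \<partial>Om lam)"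
  proof -
    have "((1 + e) * z) powr lam = z powr lam * (1 + e) powr lam" using e by (simp add: powr_mult mult.commute)
    then show ?thesis unfolding kern_def using i1 i2 by (simp add: right_diff_distrib)
  qed
  have "\<bar>\<integral>s. (1 + e) powr lam * qd (1 + e) z s powr (- q) - qd 1 z s powr (- q) \<partial>Om lam\<bar> \<le>
     (\<integral>s. \<bar>(1 + e) powr lam * qd (1 + e) z s powr (- q) - qd 1 z s powr (- q)\<bar> \<partial>Om lam)"
    by (rule integral_abs_bound)
  also have "\<dots> \<le> (\<integral>s. ?C * (qd 1 z s powr (- q) + qd 1 z s powr (- (q + 1 / 2))) \<partial>Om lam)"
  proof (rule integral_mono)
    fix s assume "s \<in> space (Om lam)"
    then show "\<bar>(1 + e) powr lam * qd (1 + e) z s powr (- q) - qd 1 z s powr (- q)\<bar> \<le> ?C * (qd 1 z s powr (- q) + qd 1 z s powr (- (q + 1 / 2)))"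
      using qd_diff_bound[OF lam q e, of s] by simp
  qed (use i1 i2 i3 in simp_all)
  also have "\<dots> = ?C * ((\<integral>s. qd 1 z s powr (- q) \<partial>Om lam) + (\<integral>s. qd 1 z s powr (- (q + 1 / 2)) \<partial>Om lam))"
    using i1 i3 by simp
  finally have "z powr lam * \<bar>\<integral>s. (1 + e) powr lam * qd (1 + e) z s powr (- q) - qd 1 z s powr (- q) \<partial>Om lam\<bar> \<le>
     z powr lam * (?C * ((\<integral>s. qd 1 z s powr (- q) \<partial>Om lam) + (\<integral>s. qd 1 z s powr (- (q + 1 / 2)) \<partial>Om lam)))"
    by (intro mult_left_mono) auto
  then show ?thesis unfolding eq unfolding kern_def by (simp add: abs_mult algebra_simps)
qed

subsection \<open>Hoelder bounds for homogeneous kernels\<close>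

text \<open>A single constant for both parts of the norm. Working with explicit bounds avoids
  \<open>Sup\<close> on possibly unbounded sets and makes every estimate linear in N.\<close>

definition Hol :: "real \<Rightarrow> real \<Rightarrow> (real \<Rightarrow> real) \<Rightarrow> bool" where
  "Hol N a f \<longleftrightarrow> 0 \<le> N \<and> (\<forall>x>0. \<forall>y>0. \<bar>f x - f y\<bar> \<le> N * \<bar>x - y\<bar> powr a) \<and> (\<forall>x>0. \<bar>f x\<bar> \<le> N * x powr a)"

lemma
  assumes "Hol N a f"
  shows Hol_nonneg: "0 \<le> N"
    and Hol_diff: "x > 0 \<Longrightarrow> y > 0 \<Longrightarrow> \<bar>f x - f y\<bar> \<le> N * \<bar>x - y\<bar> powr a"
    and Hol_bound: "x > 0 \<Longrightarrow> \<bar>f x\<bar> \<le> N * x powr a"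
  using assms unfolding Hol_def by auto

lemma Hol_continuous:
  assumes "Hol N a f" "a > 0"
  shows "continuous_on {0<..} f"
proof (rule continuous_on_eq_continuous_at[THEN iffD2, rule_format])
  fix x :: real assume "x \<in> {0<..}"
  then have x: "x > 0" by simp
  have "((\<lambda>y. N * \<bar>y - x\<bar> powr a) \<longlongrightarrow> N * 0) (at x)"
    by (intro tendsto_mult tendsto_const tendsto_zero_powrI[of _ _ _ a] tendsto_rabs_zero) (use assms in \<open>auto intro!: tendsto_eq_intros\<close>)
  then have 1: "((\<lambda>y. N * \<bar>y - x\<bar> powr a) \<longlongrightarrow> 0) (at x)" by simp
  have "\<forall>\<^sub>F y in at x. y > 0" using x eventually_at_in_open'[of "{0<..}" x] by simp
  then have "\<forall>\<^sub>F y in at x. norm (f y - f x) \<le> N * \<bar>y - x\<bar> powr a"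
    by eventually_elim (use Hol_diff[OF assms(1)] x in auto)
  then have "((\<lambda>y. f y - f x) \<longlongrightarrow> 0) (at x)" by (rule Lim_null_comparison[OF _ 1])
  then show "isCont f x" unfolding isCont_def by (rule LIM_zero_cancel)
qed simp

lemma Hol_measurable: "Hol N a f \<Longrightarrow> a > 0 \<Longrightarrow> f \<in> borel_measurable hl"
  by (intro measurable_hl_continuous Hol_continuous)

lemma Hol_scale: "Hol N a f \<Longrightarrow> r > 0 \<Longrightarrow> Hol (N * r powr a) a (\<lambda>z. f (r * z))"
proof -
  assume f: "Hol N a f" and r: "r > 0"
  have "\<bar>f (r * x) - f (r * y)\<bar> \<le> N * r powr a * \<bar>x - y\<bar> powr a" if "x > 0" "y > 0" for x y
  proof -
    have "\<bar>r * x - r * y\<bar> powr a = r powr a * \<bar>x - y\<bar> powr a"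
      using r by (simp add: right_diff_distrib[symmetric] abs_mult powr_mult)
    then show ?thesis using Hol_diff[OF f, of "r * x" "r * y"] that r by simp
  qed
  moreover have "\<bar>f (r * x)\<bar> \<le> N * r powr a * x powr a" if "x > 0" for x
    using Hol_bound[OF f, of "r * x"] that r by (simp add: powr_mult)
  ultimately show ?thesis using Hol_nonneg[OF f] unfolding Hol_def by simp
qed

lemma holder_space_Hol:
  assumes "f \<in> holder_space a"
  shows "Hol (holder_norm a f) a f"
proof -
  have b: "bdd_above (holder_quots a f)" "bdd_above (growth_quots a f)" using assms by (auto simp: holder_space_def)
  have g: "x powr (- a) * \<bar>f x\<bar> \<le> Sup (growth_quots a f)" if "x > 0" for x
    by (rule cSup_upper[OF _ b(2)]) (use that in \<open>auto simp: growth_quots_def\<close>)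
  have h: "\<bar>f x - f y\<bar> / \<bar>x - y\<bar> powr a \<le> Sup (holder_quots a f)" if "x > 0" "y > 0" "x \<noteq> y" for x y
    by (rule cSup_upper[OF _ b(1)]) (use that in \<open>auto simp: holder_quots_def\<close>)
  have g0: "0 \<le> Sup (growth_quots a f)" using g[of 1] by (rule order_trans[rotated]) auto
  have h0: "0 \<le> Sup (holder_quots a f)" using h[of 1 2] by (rule order_trans[rotated]) auto
  have "\<bar>f x - f y\<bar> \<le> holder_norm a f * \<bar>x - y\<bar> powr a" if "x > 0" "y > 0" for x y
  proof (cases "x = y")
    case False
    have "\<bar>f x - f y\<bar> \<le> Sup (holder_quots a f) * \<bar>x - y\<bar> powr a"
      using h[OF that False] False by (simp add: divide_le_eq)
    also have "\<dots> \<le> holder_norm a f * \<bar>x - y\<bar> powr a" using g0 unfolding holder_norm_def by (intro mult_right_mono) auto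
    finally show ?thesis .
  qed auto
  moreover have "\<bar>f x\<bar> \<le> holder_norm a f * x powr a" if "x > 0" for x
  proof -
    have "\<bar>f x\<bar> \<le> Sup (growth_quots a f) * x powr a"
      using g[OF that] that by (simp add: powr_minus field_simps)
    also have "\<dots> \<le> holder_norm a f * x powr a" using h0 unfolding holder_norm_def by (intro mult_right_mono) auto
    finally show ?thesis .
  qed
  ultimately show ?thesis using g0 h0 unfolding Hol_def holder_norm_def by auto
qed

lemma Hol_holder_space:
  assumes f: "Hol A a f" and a: "a > 0"
  shows "f \<in> holder_space a" "holder_norm a f \<le> 2 * A"
proof -
  have h: "q \<le> A" if "q \<in> holder_quots a f" for q
    using that Hol_diff[OF f] by (auto simp: holder_quots_def divide_le_eq)
  have g: "q \<le> A" if "q \<in> growth_quots a f" for q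
  proof -
    from that have "\<exists>x>0. q = x powr (- a) * \<bar>f x\<bar>" unfolding growth_quots_def by auto
    then obtain x where x: "x > 0" "q = x powr (- a) * \<bar>f x\<bar>" by auto
    have "q \<le> x powr (- a) * (A * x powr a)" unfolding x(2) using Hol_bound[OF f x(1)] by (intro mult_left_mono) auto
    also have "\<dots> = A" using x by (simp add: powr_minus)
    finally show ?thesis .
  qed
  have "bdd_above (holder_quots a f)" by (rule bdd_aboveI) (rule h)
  moreover have "bdd_above (growth_quots a f)" by (rule bdd_aboveI) (rule g)
  ultimately show "f \<in> holder_space a" using Hol_continuous[OF f a] by (simp add: holder_space_def)
  \<comment> \<open>A supremum inherits the bound A only for a nonempty set; the points 1 and 2
    supply an element.\<close>
  have "\<bar>f 1 - f 2\<bar> / \<bar>1 - 2\<bar> powr a \<in> holder_quots a f"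
    unfolding holder_quots_def by (rule CollectI, rule exI[of _ 1], rule exI[of _ 2]) simp
  then have "holder_quots a f \<noteq> {}" by auto
  moreover have "growth_quots a f \<noteq> {}" unfolding growth_quots_def by (auto intro!: exI[of _ 1])
  ultimately show "holder_norm a f \<le> 2 * A" unfolding holder_norm_def
    using cSup_least[of "holder_quots a f" A] cSup_least[of "growth_quots a f" A] g h by auto
qed

text \<open>By homogeneity the point x may be taken to be 1. Close points then differ by a factor 1
  + e with e <= 1 / 2 and fall under \<open>step\<close>. Otherwise x <= 2 |x - y| and y <= 3 |x -
  y|, so the growth bound at both points suffices; since a + t <= 1 these factors add up to 2 + 3 =
  5.\<close>

lemma homogeneous_operator_Hol:
  fixes T :: "(real \<Rightarrow> real) \<Rightarrow> real \<Rightarrow> real"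
  assumes scale: "\<And>N f r x. Hol N a f \<Longrightarrow> r > 0 \<Longrightarrow> x > 0 \<Longrightarrow> T f (r * x) = r powr t * T (\<lambda>z. f (r * z)) x"
    and one: "\<And>N f. Hol N a f \<Longrightarrow> \<bar>T f 1\<bar> \<le> C * N"
    and step: "\<And>N f e. Hol N a f \<Longrightarrow> 0 < e \<Longrightarrow> e \<le> 1 / 2 \<Longrightarrow> \<bar>T f (1 + e) - T f 1\<bar> \<le> C * N * e powr (a + t)"
    and C: "C \<ge> 0" and at: "a + t > 0" "a + t \<le> 1"
    and f: "Hol N a f"
  shows "Hol (5 * C * N) (a + t) (T f)"
proof -
  let ?b = "a + t"
  have N: "N \<ge> 0" using f by (rule Hol_nonneg)
  have bound: "\<bar>T f x\<bar> \<le> C * N * x powr ?b" if x: "x > 0" for x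
  proof -
    have "\<bar>T f (x * 1)\<bar> = x powr t * \<bar>T (\<lambda>z. f (x * z)) 1\<bar>"
      by (subst scale[OF f x]) (simp_all add: abs_mult)
    also have "\<dots> \<le> x powr t * (C * (N * x powr a))"
      by (intro mult_left_mono one Hol_scale f x) auto
    finally show ?thesis by (simp add: powr_add mult_ac)
  qed
  have diff: "\<bar>T f x - T f y\<bar> \<le> 5 * C * N * \<bar>x - y\<bar> powr ?b" if xy: "0 < x" "x < y" for x y
  proof (cases "y - x \<le> x / 2")
    case True
    define e where "e = (y - x) / x"
    have e: "0 < e" "e \<le> 1 / 2" using xy True by (simp_all add: e_def field_simps)
    have y: "y = x * (1 + e)" using xy by (simp add: e_def field_simps)
    have "\<bar>T f (x * (1 + e)) - T f (x * 1)\<bar> = x powr t * \<bar>T (\<lambda>z. f (x * z)) (1 + e) - T (\<lambda>z. f (x * z)) 1\<bar>"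
      using xy e by (simp add: scale[OF f, of x "1 + e"] scale[OF f, of x 1, simplified] right_diff_distrib[symmetric] abs_mult)
    also have "\<dots> \<le> x powr t * (C * (N * x powr a) * e powr ?b)"
      using xy e by (intro mult_left_mono step Hol_scale f) auto
    also have "\<dots> = C * N * (x powr ?b * e powr ?b)" by (simp add: powr_add mult_ac)
    also have "x powr ?b * e powr ?b = \<bar>x - y\<bar> powr ?b"
    proof -
      have "\<bar>x - y\<bar> = x * e" using xy by (simp add: e_def)
      then show ?thesis using xy e by (simp add: powr_mult)
    qed
    finally have "\<bar>T f x - T f y\<bar> \<le> C * N * \<bar>x - y\<bar> powr ?b" using y by (simp add: abs_minus_commute)
    also have "\<dots> \<le> 5 * C * N * \<bar>x - y\<bar> powr ?b" using C N by (intro mult_right_mono) (auto simp: mult_right_mono)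
    finally show ?thesis .
  next
    case False
    have s: "(c * \<bar>x - y\<bar>) powr ?b \<le> c * \<bar>x - y\<bar> powr ?b" if "c \<ge> 1" for c
    proof -
      have "c powr ?b \<le> c powr 1" using that at by (intro powr_mono) auto
      then show ?thesis using that by (simp add: powr_mult mult_right_mono)
    qed
    have "x powr ?b \<le> (2 * \<bar>x - y\<bar>) powr ?b" "y powr ?b \<le> (3 * \<bar>x - y\<bar>) powr ?b"
      using False xy at by (auto intro!: powr_mono2)
    then have "x powr ?b + y powr ?b \<le> 5 * \<bar>x - y\<bar> powr ?b" using s[of 2] s[of 3] by simp
    then have "C * N * (x powr ?b + y powr ?b) \<le> C * N * (5 * \<bar>x - y\<bar> powr ?b)" using C N by (intro mult_left_mono) auto
    moreover have "\<bar>T f x - T f y\<bar> \<le> C * N * x powr ?b + C * N * y powr ?b"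
      using bound[of x] bound[of y] xy by linarith
    ultimately show ?thesis by (simp add: algebra_simps)
  qed
  have "\<bar>T f x - T f y\<bar> \<le> 5 * C * N * \<bar>x - y\<bar> powr ?b" if xy: "0 < x" "0 < y" for x y
    using diff[of x y] diff[of y x] xy by (cases x y rule: linorder_cases) (auto simp: abs_minus_commute)
  moreover have "\<bar>T f x\<bar> \<le> 5 * C * N * x powr ?b" if "x > 0" for x
  proof -
    have "C * N * x powr ?b \<le> 5 * C * N * x powr ?b" using C N by (intro mult_right_mono) (auto simp: mult_right_mono)
    then show ?thesis using bound[OF that] by linarith
  qed
  ultimately show ?thesis using C N unfolding Hol_def by simp
qed

text \<open>\<open>tau = 2 * \<sigma>\<close> gives the negative and \<open>tau = - 2 * \<sigma>\<close> the positive powers.\<close>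

locale frac_kernel =
  fixes lam tau a :: real
  assumes lam: "lam > 0" and tau: "-1 < tau" "tau < 1" and a: "0 < a" "a < 1"
    and b: "0 < a + tau" "a + tau < 1" "a + tau < lam"
begin

text \<open>Chosen so that 2 lam - 2 p = tau - 1: the kernel is homogeneous of that degree, and its
  integral against a function of order a is of order a + tau.\<close>

definition "p = lam + 1 / 2 - tau / 2"

definition "K x y = kern lam p x y"

lemma p: "lam < p" "0 < p" using lam tau by (auto simp: p_def)

lemma K_nonneg: "K x y \<ge> 0" unfolding K_def by (rule kern_nonneg)

lemma K_commute: "K x y = K y x" unfolding K_def by (rule kern_commute)

lemma K_scale: "r > 0 \<Longrightarrow> x > 0 \<Longrightarrow> y > 0 \<Longrightarrow> K (r * x) (r * y) = r powr (tau - 1) * K x y"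
  unfolding K_def using kern_scale[of r x y lam p] by (simp add: p_def algebra_simps)

lemma measurable_K [measurable (raw)]:
  assumes "f \<in> borel_measurable M" "g \<in> borel_measurable M"
  shows "(\<lambda>x. K (f x) (g x)) \<in> borel_measurable M"
  unfolding K_def using assms lam by (rule measurable_kern)

text \<open>\<open>C1\<close> bounds the singularity at the diagonal, \<open>C2\<close> the decay
  away from it, and \<open>C3\<close> the gradient. The summands of \<open>C3\<close> let one
  constant cover both ranges; \<open>2 * C2\<close> is there because two kernels, with exponents
  \<open>p\<close> and \<open>p + 1 / 2\<close>, are bounded at once.\<close>

definition "C1 = kern_const lam p"
definition "C2 = Om_mass lam * 2 powr lam"
definition "C3 = 2 powr lam * (lam + 2 * p) * 4 powr (p + 1) * (kern_const lam p + kern_const lam (p + 1 / 2) + 2 * C2)"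

lemma C1: "C1 > 0" unfolding C1_def by (rule kern_const_pos[OF lam p(1)])
lemma C2: "C2 > 0" unfolding C2_def using Om_mass_pos[OF lam] by simp
lemma C3: "C3 > 0" unfolding C3_def using C2 lam p
  by (intro mult_pos_pos add_pos_pos kern_const_pos) auto

lemma K_near:
  assumes "x > 0" "y > 0" "x \<noteq> y"
  shows "K x y \<le> C1 * \<bar>x - y\<bar> powr (tau - 1)"
proof -
  have "2 * lam - 2 * p = tau - 1" by (simp add: p_def)
  then show ?thesis using kern_le_near[OF lam p(1) assms] unfolding K_def C1_def by simp
qed

text \<open>With the first point fixed at 1, the factor (x y)^lam compensates only half of the 2 lam
  contained in 2 p. The surplus |z - 1|^(-lam) over the bound of \<open>K_near\<close> is what
  admits growth of order a < lam - tau.\<close>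

lemma kern_far:
  assumes z: "z > 0" "\<bar>z - 1\<bar> \<ge> 1" and q: "q \<ge> p"
  shows "kern lam q 1 z \<le> C2 * \<bar>z - 1\<bar> powr (tau - 1 - lam)"
proof -
  have "z powr lam \<le> (2 * \<bar>z - 1\<bar>) powr lam" using z lam by (intro powr_mono2) auto
  also have "\<dots> = 2 powr lam * \<bar>z - 1\<bar> powr lam" by (rule powr_mult)
  finally have "z powr lam * \<bar>z - 1\<bar> powr (- 2 * q) \<le> 2 powr lam * \<bar>z - 1\<bar> powr lam * \<bar>z - 1\<bar> powr (- 2 * q)"
    by (intro mult_right_mono) auto
  also have "\<dots> = 2 powr lam * \<bar>z - 1\<bar> powr (lam - 2 * q)" by (simp add: powr_add[symmetric])
  also have "\<dots> \<le> 2 powr lam * \<bar>z - 1\<bar> powr (tau - 1 - lam)"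
    using z q by (intro mult_left_mono powr_mono) (auto simp: p_def)
  finally have "Om_mass lam * (z powr lam * \<bar>z - 1\<bar> powr (- 2 * q)) \<le> Om_mass lam * (2 powr lam * \<bar>z - 1\<bar> powr (tau - 1 - lam))"
    using Om_mass_pos[OF lam] by (intro mult_left_mono) auto
  moreover have "kern lam q 1 z \<le> Om_mass lam * (z powr lam * \<bar>z - 1\<bar> powr (- 2 * q))"
    using kern_le_far[OF lam, of 1 z q] z p q by (auto simp: abs_minus_commute)
  ultimately show ?thesis unfolding C2_def by (simp add: mult_ac)
qed

text \<open>The gradient estimate adds the kernels of exponent \<open>p\<close> and
  \<open>p + 1 / 2\<close>. For |z - 1| < 1 the second dominates, of order |z - 1|^(tau - 2); for |z
  - 1| >= 1 both have the decay of \<open>kern_far\<close>.\<close>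

lemma K_diff:
  assumes e: "0 < e" "e \<le> 1 / 2" "2 * e \<le> \<bar>z - 1\<bar>" "z > 0"
  shows "\<bar>K (1 + e) z - K 1 z\<bar> \<le> C3 * e * (\<bar>z - 1\<bar> powr (tau - 2) + (if \<bar>z - 1\<bar> \<ge> 1 then \<bar>z - 1\<bar> powr (tau - 1 - lam) else 0))"
proof -
  let ?m = "\<bar>z - 1\<bar> powr (tau - 2) + (if \<bar>z - 1\<bar> \<ge> 1 then \<bar>z - 1\<bar> powr (tau - 1 - lam) else 0)"
  let ?D = "kern_const lam p + kern_const lam (p + 1 / 2) + 2 * C2"
  have z: "z \<noteq> 1" using e by auto
  have pos: "kern_const lam p > 0" "kern_const lam (p + 1 / 2) > 0" using lam p by (auto intro!: kern_const_pos)
  have "kern lam p 1 z + kern lam (p + 1 / 2) 1 z \<le> ?D * ?m"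
  proof (cases "\<bar>z - 1\<bar> \<ge> 1")
    case True
    have "kern lam p 1 z + kern lam (p + 1 / 2) 1 z \<le> 2 * C2 * \<bar>z - 1\<bar> powr (tau - 1 - lam)"
      using kern_far[of z p] kern_far[of z "p + 1 / 2"] True e by auto
    also have "\<dots> \<le> ?D * ?m" using True pos C2 by (intro mult_mono) auto
    finally show ?thesis .
  next
    case False
    have "kern lam p 1 z \<le> kern_const lam p * \<bar>1 - z\<bar> powr (2 * lam - 2 * p)"
      using e z by (intro kern_le_near lam p) auto
    also have "2 * lam - 2 * p = tau - 1" by (simp add: p_def)
    also have "\<bar>1 - z\<bar> powr (tau - 1) \<le> \<bar>z - 1\<bar> powr (tau - 2)"
      unfolding abs_minus_commute[of 1 z] using False z by (intro powr_mono') auto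
    finally have 1: "kern lam p 1 z \<le> kern_const lam p * \<bar>z - 1\<bar> powr (tau - 2)"
      using pos by (auto intro: mult_left_mono)
    have "kern lam (p + 1 / 2) 1 z \<le> kern_const lam (p + 1 / 2) * \<bar>1 - z\<bar> powr (2 * lam - 2 * (p + 1 / 2))"
      using e z p by (intro kern_le_near lam) auto
    also have "2 * lam - 2 * (p + 1 / 2) = tau - 2" by (simp add: p_def)
    finally have "kern lam p 1 z + kern lam (p + 1 / 2) 1 z \<le> (kern_const lam p + kern_const lam (p + 1 / 2)) * \<bar>z - 1\<bar> powr (tau - 2)"
      using 1 by (simp add: abs_minus_commute distrib_right)
    also have "\<dots> \<le> ?D * ?m" using pos C2 by (intro mult_mono) auto
    finally show ?thesis .
  qed
  then have "2 powr lam * (lam + 2 * p) * 4 powr (p + 1) * e * (kern lam p 1 z + kern lam (p + 1 / 2) 1 z) \<le>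
     2 powr lam * (lam + 2 * p) * 4 powr (p + 1) * e * (?D * ?m)"
    using lam p e by (intro mult_left_mono mult_nonneg_nonneg) auto
  also have "\<dots> = C3 * e * ?m" unfolding C3_def by (simp only: mult_ac)
  finally show ?thesis using kern_diff_bound[OF lam p(2) e(1) _ e(3,4)] e unfolding K_def by linarith
qed

text \<open>The kernel is of order |z - 1|^(tau - 1) near 1 and |z - 1|^(tau - 1 - lam) at infinity,
  so a factor of order g and d there must satisfy g + tau > 0 and d + tau < lam. For tau > 0 one may
  take g = 0; for negative tau the factor has to vanish at 1.\<close>

lemma integrable_K1:
  assumes [measurable]: "w \<in> borel_measurable hl" and g: "0 < g + tau" "d + tau < lam"
    and near: "\<And>z. z > 0 \<Longrightarrow> z \<noteq> 1 \<Longrightarrow> \<bar>z - 1\<bar> \<le> 1 \<Longrightarrow> \<bar>w z\<bar> \<le> D * \<bar>z - 1\<bar> powr g"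
    and far: "\<And>z. z > 0 \<Longrightarrow> \<bar>z - 1\<bar> \<ge> 1 \<Longrightarrow> \<bar>w z\<bar> \<le> D * \<bar>z - 1\<bar> powr d"
  shows "integrable hl (\<lambda>z. K 1 z * w z)"
proof (rule integrableI_bounded)
  \<comment> \<open>The point z = 2 lies in the near range, which forces D to be
    nonnegative.\<close>
  have "0 \<le> D * \<bar>2 - 1\<bar> powr g" using near[of 2] by (intro order_trans[OF abs_ge_zero]) auto
  then have D: "D \<ge> 0" by simp
  let ?T1 = "\<lambda>z::real. ennreal (\<bar>z - 1\<bar> powr ((g + tau) - 1)) * indicator {z. \<bar>z - 1\<bar> \<le> 1} z"
  let ?T2 = "\<lambda>z::real. ennreal (\<bar>z - 1\<bar> powr (- (lam - d - tau) - 1)) * indicator {z. 1 \<le> \<bar>z - 1\<bar>} z"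
  have "(\<integral>\<^sup>+z. ennreal (norm (K 1 z * w z)) \<partial>hl) \<le> (\<integral>\<^sup>+z. (ennreal (D * C1) * ?T1 z + ennreal (D * C2) * ?T2 z) * indicator {0<..} z \<partial>lborel)"
    unfolding nn_integral_hl
  proof (rule nn_integral_mono_AE)
    have "AE z in lborel. z \<noteq> (1::real)" by (rule AE_lborel_singleton)
    then show "AE z in lborel. ennreal (norm (K 1 z * w z)) * indicator {0<..} z \<le> (ennreal (D * C1) * ?T1 z + ennreal (D * C2) * ?T2 z) * indicator {0<..} z"
    proof eventually_elim
      case (elim z)
      show ?case
      proof (cases "z > 0")
        case z: True
        show ?thesis
        proof (cases "\<bar>z - 1\<bar> \<le> 1")
          case True
          have "\<bar>K 1 z * w z\<bar> \<le> (C1 * \<bar>z - 1\<bar> powr (tau - 1)) * (D * \<bar>z - 1\<bar> powr g)"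
            unfolding abs_mult abs_of_nonneg[OF K_nonneg]
            using K_near[of 1 z] near[of z] z True elim C1 K_nonneg by (intro mult_mono) (auto simp: abs_minus_commute)
          also have "\<dots> = D * C1 * \<bar>z - 1\<bar> powr ((g + tau) - 1)"
            using powr_add[of "\<bar>z - 1\<bar>" "tau - 1" g] by (simp add: algebra_simps)
          finally show ?thesis using z True D C1
            by (auto simp: ennreal_mult'[symmetric] intro!: add_increasing2 ennreal_leI)
        next
          case False
          have "\<bar>K 1 z * w z\<bar> \<le> (C2 * \<bar>z - 1\<bar> powr (tau - 1 - lam)) * (D * \<bar>z - 1\<bar> powr d)"
            unfolding abs_mult abs_of_nonneg[OF K_nonneg]
            using kern_far[of z p] far[of z] z False C2 K_nonneg[of 1 z] by (intro mult_mono) (auto simp: K_def)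
          also have "\<dots> = D * C2 * \<bar>z - 1\<bar> powr (- (lam - d - tau) - 1)"
            using powr_add[of "\<bar>z - 1\<bar>" "tau - 1 - lam" d] by (simp add: algebra_simps)
          finally show ?thesis using z False D C2
            by (auto simp: ennreal_mult'[symmetric] intro!: add_increasing ennreal_leI)
        qed
      qed auto
    qed
  qed
  also have "\<dots> \<le> (\<integral>\<^sup>+z. ennreal (D * C1) * ?T1 z + ennreal (D * C2) * ?T2 z \<partial>lborel)"
    by (intro nn_integral_mono) (auto simp: indicator_def)
  also have "\<dots> = ennreal (D * C1) * (\<integral>\<^sup>+z. ?T1 z \<partial>lborel) + ennreal (D * C2) * (\<integral>\<^sup>+z. ?T2 z \<partial>lborel)"
    by (subst nn_integral_add) (auto simp: nn_integral_cmult)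
  also have "\<dots> \<le> ennreal (D * C1) * ennreal (2 * 1 powr (g + tau) / (g + tau)) + ennreal (D * C2) * ennreal (2 * 1 powr (- (lam - d - tau)) / (lam - d - tau))"
    using g by (intro add_mono mult_left_mono nn_integral_powr_near nn_integral_powr_far) auto
  also have "\<dots> < \<infinity>" by (simp add: ennreal_mult_less_top)
  finally show "(\<integral>\<^sup>+z. ennreal (norm (K 1 z * w z)) \<partial>hl) < \<infinity>" .
qed measurable

text \<open>The degree tau - 1 of the kernel and the Jacobian x combine to x^tau.\<close>

lemma
  assumes "x > 0"
  shows integrable_K_scale: "integrable hl (\<lambda>y. K x y * w y) \<longleftrightarrow> integrable hl (\<lambda>z. K 1 z * w (x * z))"
    and integral_K_scale: "(\<integral>y. K x y * w y \<partial>hl) = x powr tau * (\<integral>z. K 1 z * w (x * z) \<partial>hl)"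
proof -
  have eq: "K x (x * z) * w (x * z) = x powr (tau - 1) * (K 1 z * w (x * z))" if "z > 0" for z
    using K_scale[of x 1 z] assms that by simp
  have "integrable hl (\<lambda>y. K x y * w y) \<longleftrightarrow> integrable hl (\<lambda>z. K x (x * z) * w (x * z))"
    using integrable_hl_scale[OF assms, of "\<lambda>y. K x y * w y"] by simp
  also have "\<dots> \<longleftrightarrow> integrable hl (\<lambda>z. x powr (tau - 1) * (K 1 z * w (x * z)))"
    by (intro Bochner_Integration.integrable_cong refl) (simp add: eq)
  also have "\<dots> \<longleftrightarrow> integrable hl (\<lambda>z. K 1 z * w (x * z))"
    using assms by (subst integrable_mult_left_iff) auto
  finally show "integrable hl (\<lambda>y. K x y * w y) \<longleftrightarrow> integrable hl (\<lambda>z. K 1 z * w (x * z))" .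
  have "(\<integral>y. K x y * w y \<partial>hl) = x * (\<integral>z. K x (x * z) * w (x * z) \<partial>hl)"
    by (rule integral_hl_scale) fact
  also have "(\<integral>z. K x (x * z) * w (x * z) \<partial>hl) = (\<integral>z. x powr (tau - 1) * (K 1 z * w (x * z)) \<partial>hl)"
    by (intro Bochner_Integration.integral_cong refl) (simp add: eq)
  also have "\<dots> = x powr (tau - 1) * (\<integral>z. K 1 z * w (x * z) \<partial>hl)" by (rule integral_mult_right_zero)
  finally show "(\<integral>y. K x y * w y \<partial>hl) = x powr tau * (\<integral>z. K 1 z * w (x * z) \<partial>hl)"
    using assms by (simp add: powr_diff)
qed

text \<open>Near the diagonal each of the two singularities has to be compensated by its own value of \<open>f\<close>.\<close>

definition Phi :: "(real \<Rightarrow> real) \<Rightarrow> real \<Rightarrow> real \<Rightarrow> real" where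
  "Phi f e z = (if \<bar>z - 1\<bar> < 2 * e then K (1 + e) z * (f z - f (1 + e)) - K 1 z * (f z - f 1)
     else (K (1 + e) z - K 1 z) * (f z - f 1))"

text \<open>Four integrals enter \<open>Phi_bound\<close>: 10 = 2 * 2 + 2 * 3 stems from the
  intervals of radius 2 e around 1 and 3 e around 1 + e, and the other two summands from the ranges
  |z - 1| >= 2 e and |z - 1| >= 1.\<close>

definition "C4 = (C1 + C3) * (10 / (a + tau) + 2 / (1 - (a + tau)) + 2 / (lam - (a + tau)))"

lemma C4: "C4 > 0"
proof -
  have "0 < 10 / (a + tau)" "0 < 2 / (1 - (a + tau))" "0 < 2 / (lam - (a + tau))" using b by simp_all
  then show ?thesis unfolding C4_def by (rule mult_pos_pos[OF add_pos_pos[OF C1 C3] add_pos_pos[OF add_pos_pos]])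
qed

text \<open>Put b = a + tau. For |z - 1| < 2 e both compensated terms have an integrable singularity
  of exponent b - 1 on intervals of radius at most 3 e, giving e^b. Beyond, the gradient gives e |z
  - 1|^(b - 2), which for b < 1 integrates to order e * e^(b - 1) outside 2 e, while the tail,
  convergent for b < lam, contributes e <= e^b.\<close>

lemma Phi_bound:
  assumes f: "Hol N a f" and e: "0 < e" "e \<le> 1 / 2"
  shows "integrable hl (Phi f e)" "\<bar>integral\<^sup>L hl (Phi f e)\<bar> \<le> C4 * N * e powr (a + tau)"
proof -
  let ?b = "a + tau"
  note [measurable] = Hol_measurable[OF f a(1)]
  have N: "N \<ge> 0" using f by (rule Hol_nonneg)
  let ?T1 = "\<lambda>z::real. ennreal (\<bar>z - 1\<bar> powr (?b - 1)) * indicator {z. \<bar>z - 1\<bar> \<le> 2 * e} z"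
  let ?T2 = "\<lambda>z::real. ennreal (\<bar>z - (1 + e)\<bar> powr (?b - 1)) * indicator {z. \<bar>z - (1 + e)\<bar> \<le> 3 * e} z"
  let ?T3 = "\<lambda>z::real. ennreal (\<bar>z - 1\<bar> powr (- (1 - ?b) - 1)) * indicator {z. 2 * e \<le> \<bar>z - 1\<bar>} z"
  let ?T4 = "\<lambda>z::real. ennreal (\<bar>z - 1\<bar> powr (- (lam - ?b) - 1)) * indicator {z. 1 \<le> \<bar>z - 1\<bar>} z"
  let ?g = "\<lambda>z. ennreal (N * (C1 + C3)) * (?T1 z + ?T2 z + (ennreal e * ?T3 z + ennreal e * ?T4 z))"
  have "(\<integral>\<^sup>+z. ennreal \<bar>Phi f e z\<bar> \<partial>hl) \<le> (\<integral>\<^sup>+z. ?g z \<partial>lborel)"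
    unfolding nn_integral_hl
  proof (rule nn_integral_mono_AE)
    have "AE z in lborel. z \<noteq> (1::real)" "AE z in lborel. z \<noteq> 1 + e" by (rule AE_lborel_singleton)+
    then show "AE z in lborel. ennreal \<bar>Phi f e z\<bar> * indicator {0<..} z \<le> ?g z"
    proof eventually_elim
      case (elim z)
      show ?case
      proof (cases "z > 0")
        case z: True
        show ?thesis
        proof (cases "\<bar>z - 1\<bar> < 2 * e")
          case True
          have "\<bar>K (1 + e) z * (f z - f (1 + e))\<bar> \<le> (C1 * \<bar>z - (1 + e)\<bar> powr (tau - 1)) * (N * \<bar>z - (1 + e)\<bar> powr a)"
            unfolding abs_mult abs_of_nonneg[OF K_nonneg]
            using K_near[of "1 + e" z] Hol_diff[OF f, of z "1 + e"] z e elim C1 K_nonneg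
            by (intro mult_mono) (auto simp: abs_minus_commute)
          also have "\<dots> = N * C1 * \<bar>z - (1 + e)\<bar> powr (?b - 1)"
            using powr_add[of "\<bar>z - (1 + e)\<bar>" "tau - 1" a] by (simp add: algebra_simps)
          also have "\<dots> \<le> N * (C1 + C3) * \<bar>z - (1 + e)\<bar> powr (?b - 1)"
            using N C3 by (intro mult_right_mono mult_left_mono) auto
          finally have 1: "\<bar>K (1 + e) z * (f z - f (1 + e))\<bar> \<le> N * (C1 + C3) * \<bar>z - (1 + e)\<bar> powr (?b - 1)" .
          have "\<bar>K 1 z * (f z - f 1)\<bar> \<le> (C1 * \<bar>z - 1\<bar> powr (tau - 1)) * (N * \<bar>z - 1\<bar> powr a)"
            unfolding abs_mult abs_of_nonneg[OF K_nonneg]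
            using K_near[of 1 z] Hol_diff[OF f, of z 1] z elim C1 K_nonneg by (intro mult_mono) (auto simp: abs_minus_commute)
          also have "\<dots> = N * C1 * \<bar>z - 1\<bar> powr (?b - 1)"
            using powr_add[of "\<bar>z - 1\<bar>" "tau - 1" a] by (simp add: algebra_simps)
          also have "\<dots> \<le> N * (C1 + C3) * \<bar>z - 1\<bar> powr (?b - 1)"
            using N C3 by (intro mult_right_mono mult_left_mono) auto
          finally have 2: "\<bar>K 1 z * (f z - f 1)\<bar> \<le> N * (C1 + C3) * \<bar>z - 1\<bar> powr (?b - 1)" .
          have "\<bar>Phi f e z\<bar> \<le> N * (C1 + C3) * (\<bar>z - 1\<bar> powr (?b - 1) + \<bar>z - (1 + e)\<bar> powr (?b - 1))"
            unfolding Phi_def using True 1 2 by (auto simp: distrib_left)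
          then have "ennreal \<bar>Phi f e z\<bar> \<le> ennreal (N * (C1 + C3)) * (ennreal (\<bar>z - 1\<bar> powr (?b - 1)) + ennreal (\<bar>z - (1 + e)\<bar> powr (?b - 1)))"
            using N C1 C3 by (simp add: ennreal_mult'[symmetric] ennreal_plus[symmetric] ennreal_leI del: ennreal_plus)
          also have "\<dots> \<le> ?g z"
          proof -
            have "\<bar>z - (1 + e)\<bar> \<le> 3 * e" "\<bar>z - 1\<bar> \<le> 2 * e" using True e by linarith+
            then show ?thesis by (intro mult_left_mono, intro add_increasing2[OF _ add_mono]) auto
          qed
          finally show ?thesis using z by simp
        next
          case False
          let ?m4 = "if \<bar>z - 1\<bar> \<ge> 1 then \<bar>z - 1\<bar> powr (- (lam - ?b) - 1) else 0"
          have "\<bar>Phi f e z\<bar> = \<bar>K (1 + e) z - K 1 z\<bar> * \<bar>f z - f 1\<bar>"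
            unfolding Phi_def using False by (simp add: abs_mult)
          also have "\<dots> \<le> (C3 * e * (\<bar>z - 1\<bar> powr (tau - 2) + (if \<bar>z - 1\<bar> \<ge> 1 then \<bar>z - 1\<bar> powr (tau - 1 - lam) else 0))) * (N * \<bar>z - 1\<bar> powr a)"
            using False K_diff[of e z] Hol_diff[OF f, of z 1] e z C3 by (intro mult_mono) auto
          also have "\<dots> = N * C3 * (e * \<bar>z - 1\<bar> powr (- (1 - ?b) - 1) + e * ?m4)"
            using powr_add[of "\<bar>z - 1\<bar>" "tau - 2" a] powr_add[of "\<bar>z - 1\<bar>" "tau - 1 - lam" a] by (simp add: algebra_simps)
          also have "\<dots> \<le> N * (C1 + C3) * (e * \<bar>z - 1\<bar> powr (- (1 - ?b) - 1) + e * ?m4)"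
            using N C1 e by (intro mult_right_mono mult_left_mono) auto
          finally have "ennreal \<bar>Phi f e z\<bar> \<le> ennreal (N * (C1 + C3)) * (ennreal e * ennreal (\<bar>z - 1\<bar> powr (- (1 - ?b) - 1)) + ennreal e * ennreal ?m4)"
            using N C1 C3 e by (simp add: ennreal_mult'[symmetric] ennreal_plus[symmetric] ennreal_leI del: ennreal_plus)
          also have "\<dots> \<le> ?g z" using False by (intro mult_left_mono add_increasing[of "?T1 z + ?T2 z"]) auto
          finally show ?thesis using z by simp
        qed
      qed auto
    qed
  qed
  also have "\<dots> = ennreal (N * (C1 + C3)) * ((\<integral>\<^sup>+z. ?T1 z \<partial>lborel) + (\<integral>\<^sup>+z. ?T2 z \<partial>lborel) + (ennreal e * (\<integral>\<^sup>+z. ?T3 z \<partial>lborel) + ennreal e * (\<integral>\<^sup>+z. ?T4 z \<partial>lborel)))"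
    by (simp add: nn_integral_cmult nn_integral_add)
  also have "\<dots> \<le> ennreal (N * (C1 + C3)) * (ennreal (2 * (2 * e) powr ?b / ?b) + ennreal (2 * (3 * e) powr ?b / ?b) +
     (ennreal e * ennreal (2 * (2 * e) powr (- (1 - ?b)) / (1 - ?b)) + ennreal e * ennreal (2 * 1 powr (- (lam - ?b)) / (lam - ?b))))"
    using b e by (intro add_mono mult_left_mono nn_integral_powr_near nn_integral_powr_far) auto
  also have "\<dots> = ennreal (N * (C1 + C3) * (2 * (2 * e) powr ?b / ?b + 2 * (3 * e) powr ?b / ?b +
     (e * (2 * (2 * e) powr (- (1 - ?b)) / (1 - ?b)) + e * (2 / (lam - ?b)))))"
    using N C1 C3 b e by (simp add: ennreal_mult'[symmetric] ennreal_plus[symmetric] del: ennreal_plus)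
  also have "\<dots> \<le> ennreal (C4 * N * e powr ?b)"
  proof (rule ennreal_leI)
    have c: "c powr ?b \<le> c" if "c \<ge> 1" for c using powr_mono[of ?b 1 c] that b by auto
    have "(2 * e) powr ?b \<le> 2 * e powr ?b" "(3 * e) powr ?b \<le> 3 * e powr ?b"
      using c[of 2] c[of 3] e by (auto simp: powr_mult intro!: mult_right_mono)
    then have "(2 * (2 * e) powr ?b + 2 * (3 * e) powr ?b) / ?b \<le> (e powr ?b * 10) / ?b"
      using b by (intro divide_right_mono) auto
    then have 12: "2 * (2 * e) powr ?b / ?b + 2 * (3 * e) powr ?b / ?b \<le> e powr ?b * (10 / ?b)"
      by (simp only: add_divide_distrib times_divide_eq_right)
    have "e * (2 * e) powr (- (1 - ?b)) \<le> e powr ?b"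
    proof -
      have "(2 * e) powr (- (1 - ?b)) \<le> e powr (- (1 - ?b))" using e b by (intro powr_mono2') auto
      then have "e * (2 * e) powr (- (1 - ?b)) \<le> e * e powr (- (1 - ?b))" using e by (intro mult_left_mono) auto
      also have "\<dots> = e powr ?b" using e by (simp add: powr_diff)
      finally show ?thesis .
    qed
    then have "2 * (e * (2 * e) powr (- (1 - ?b))) / (1 - ?b) \<le> 2 * (e powr ?b) / (1 - ?b)"
      using b by (intro divide_right_mono mult_left_mono) auto
    then have 3: "e * (2 * (2 * e) powr (- (1 - ?b)) / (1 - ?b)) \<le> e powr ?b * (2 / (1 - ?b))"
      by (simp only: times_divide_eq_right mult.left_commute mult.commute)
    have "e \<le> e powr ?b" using powr_mono'[of ?b 1 e] e b by auto
    then have "e * (2 / (lam - ?b)) \<le> e powr ?b * (2 / (lam - ?b))" using b by (intro mult_right_mono) auto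
    then have "2 * (2 * e) powr ?b / ?b + 2 * (3 * e) powr ?b / ?b + (e * (2 * (2 * e) powr (- (1 - ?b)) / (1 - ?b)) + e * (2 / (lam - ?b)))
       \<le> e powr ?b * (10 / ?b + 2 / (1 - ?b) + 2 / (lam - ?b))"
      using 12 3 by (simp add: distrib_left)
    from mult_left_mono[OF this, of "N * (C1 + C3)"]
    show "N * (C1 + C3) * (2 * (2 * e) powr ?b / ?b + 2 * (3 * e) powr ?b / ?b +
     (e * (2 * (2 * e) powr (- (1 - ?b)) / (1 - ?b)) + e * (2 / (lam - ?b)))) \<le> C4 * N * e powr ?b"
      unfolding C4_def using N C1 C3 by (simp add: mult_ac)
  qed
  finally have fin: "(\<integral>\<^sup>+z. ennreal \<bar>Phi f e z\<bar> \<partial>hl) \<le> ennreal (C4 * N * e powr ?b)" .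
  have m: "Phi f e \<in> borel_measurable hl" unfolding Phi_def by measurable
  show "integrable hl (Phi f e)" "\<bar>integral\<^sup>L hl (Phi f e)\<bar> \<le> C4 * N * e powr ?b"
    using nn_integral_le_integrable[OF m fin] N C4 by auto
qed

lemma integrable_K1_const:
  assumes "tau > 0" shows "integrable hl (K 1)"
  using integrable_K1[of "\<lambda>_. 1" 0 0 1] assms b a by (auto simp: powr_zero_eq_one)

lemma powr_a_le: "c powr a \<le> c" if "c \<ge> 1" for c
  using powr_mono[of a 1 c] that a by auto

lemma integrable_K1_growth:
  assumes "tau > 0" and [measurable]: "w \<in> borel_measurable hl" and w: "\<And>z. z > 0 \<Longrightarrow> \<bar>w z\<bar> \<le> D * z powr a" and D: "D \<ge> 0"
  shows "integrable hl (\<lambda>z. K 1 z * w z)"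
proof (rule integrable_K1[where g=0 and d=a and D="2 * D"])
  fix z :: real assume z: "z > 0" "z \<noteq> 1" "\<bar>z - 1\<bar> \<le> 1"
  have "z powr a \<le> 2 powr a" using z a by (intro powr_mono2) auto
  then have "D * z powr a \<le> D * 2" using D powr_a_le[of 2] by (intro mult_left_mono) auto
  then show "\<bar>w z\<bar> \<le> 2 * D * \<bar>z - 1\<bar> powr 0" using w[of z] z by simp
next
  fix z :: real assume z: "z > 0" "\<bar>z - 1\<bar> \<ge> 1"
  have "z powr a \<le> (2 * \<bar>z - 1\<bar>) powr a" using z a by (intro powr_mono2) auto
  also have "\<dots> = 2 powr a * \<bar>z - 1\<bar> powr a" by (rule powr_mult)
  also have "\<dots> \<le> 2 * \<bar>z - 1\<bar> powr a" using powr_a_le[of 2] by (intro mult_right_mono) auto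
  finally have "D * z powr a \<le> D * (2 * \<bar>z - 1\<bar> powr a)" using D by (intro mult_left_mono) auto
  then show "\<bar>w z\<bar> \<le> 2 * D * \<bar>z - 1\<bar> powr a" using w[of z] z by simp
qed (use assms b in auto)

lemma e_le: "e \<le> e powr (a + tau)" if "0 < e" "e \<le> 1 / 2"
  using powr_mono'[of "a + tau" 1 e] that b by auto

section \<open>Positive \<open>tau\<close>: an absolutely convergent integral operator\<close>

definition U :: "(real \<Rightarrow> real) \<Rightarrow> real \<Rightarrow> real" where
  "U f x = (\<integral>y. K x y * f y \<partial>hl)"

lemma U_scale: "r > 0 \<Longrightarrow> x > 0 \<Longrightarrow> U f (r * x) = r powr tau * U (\<lambda>z. f (r * z)) x"
  unfolding U_def by (simp add: integral_K_scale[of "r * x"] integral_K_scale[of x] powr_mult mult.assoc)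

lemma U_integrable:
  assumes "tau > 0" "Hol N a f" "x > 0"
  shows "integrable hl (\<lambda>y. K x y * f y)"
proof -
  note h = Hol_scale[OF assms(2,3)]
  show ?thesis
    unfolding integrable_K_scale[OF assms(3)]
    using assms(1) Hol_measurable[OF h a(1)] Hol_bound[OF h] Hol_nonneg[OF h] by (rule integrable_K1_growth)
qed

text \<open>The integrand of the increment differs from \<open>Phi\<close> by f(1) times the
  increment of the kernel and, on the near set, by f(1 + e) - f(1) times the kernel. Homogeneity
  evaluates the first through (1 + e)^tau - 1 <= e; the second is e^a times the mass of the kernel
  near its singularity, of order e^tau.\<close>

lemma U_step:
  assumes t: "tau > 0" and f: "Hol N a f" and e: "0 < e" "e \<le> 1 / 2"
  shows "\<bar>U f (1 + e) - U f 1\<bar> \<le> (C4 + integral\<^sup>L hl (K 1) + 6 * C1 / tau) * N * e powr (a + tau)"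
proof -
  let ?n = "\<lambda>z. indicator {z. \<bar>z - 1\<bar> < 2 * e} z * K (1 + e) z :: real"
  let ?c = "integral\<^sup>L hl (K 1)"
  have N: "N \<ge> 0" using f by (rule Hol_nonneg)
  have m [measurable]: "?n \<in> borel_measurable hl"
    by (intro borel_measurable_times borel_measurable_indicator' measurable_K) measurable
  have "(\<integral>\<^sup>+z. ennreal \<bar>?n z\<bar> \<partial>hl) \<le> (\<integral>\<^sup>+z. ennreal C1 * (ennreal (\<bar>z - (1 + e)\<bar> powr (tau - 1)) * indicator {z. \<bar>z - (1 + e)\<bar> \<le> 3 * e} z) \<partial>lborel)"
    unfolding nn_integral_hl
  proof (rule nn_integral_mono_AE)
    have "AE z in lborel. z \<noteq> 1 + e" by (rule AE_lborel_singleton)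
    then show "AE z in lborel. ennreal \<bar>?n z\<bar> * indicator {0<..} z \<le> ennreal C1 * (ennreal (\<bar>z - (1 + e)\<bar> powr (tau - 1)) * indicator {z. \<bar>z - (1 + e)\<bar> \<le> 3 * e} z)"
    proof eventually_elim
      case (elim z)
      show ?case
      proof (cases "z > 0 \<and> \<bar>z - 1\<bar> < 2 * e")
        case True
        then have "\<bar>z - (1 + e)\<bar> \<le> 3 * e" by linarith
        moreover have "K (1 + e) z \<le> C1 * \<bar>z - (1 + e)\<bar> powr (tau - 1)"
          using K_near[of "1 + e" z] True e elim by (auto simp: abs_minus_commute)
        ultimately show ?thesis using True C1 K_nonneg[of "1 + e" z]
          by (simp add: ennreal_mult'[symmetric] ennreal_leI)
      qed (auto simp: indicator_def)
    qed
  qed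
  also have "\<dots> = ennreal C1 * (\<integral>\<^sup>+z. ennreal (\<bar>z - (1 + e)\<bar> powr (tau - 1)) * indicator {z. \<bar>z - (1 + e)\<bar> \<le> 3 * e} z \<partial>lborel)"
    by (rule nn_integral_cmult) simp
  also have "\<dots> \<le> ennreal C1 * ennreal (2 * (3 * e) powr tau / tau)"
    using t e by (intro mult_left_mono nn_integral_powr_near) auto
  also have "\<dots> \<le> ennreal (6 * C1 / tau * e powr tau)"
  proof -
    have "(3 * e) powr tau = 3 powr tau * e powr tau" by (rule powr_mult)
    also have "\<dots> \<le> 3 * e powr tau" using powr_mono[of tau 1 3] tau by (intro mult_right_mono) auto
    finally have "C1 * (2 * (3 * e) powr tau / tau) \<le> C1 * (2 * (3 * e powr tau) / tau)"
      using C1 t by (intro mult_left_mono divide_right_mono) auto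
    then show ?thesis using C1 by (simp add: ennreal_mult'[symmetric] ennreal_leI algebra_simps)
  qed
  finally have n: "integrable hl ?n" "\<bar>integral\<^sup>L hl ?n\<bar> \<le> 6 * C1 / tau * e powr tau"
    using nn_integral_le_integrable[OF m] C1 t by (auto intro!: mult_nonneg_nonneg divide_nonneg_nonneg)
  have iKf: "integrable hl (\<lambda>z. K x z * f z)" if "x > 0" for x by (rule U_integrable[OF t f that])
  have iK: "integrable hl (K (1 + e))" "integral\<^sup>L hl (K (1 + e)) = (1 + e) powr tau * ?c"
    using integrable_K_scale[of "1 + e" "\<lambda>_. 1"] integral_K_scale[of "1 + e" "\<lambda>_. 1"] e integrable_K1_const[OF t] by simp_all
  have iK1: "integrable hl (K 1)" by (rule integrable_K1_const[OF t])
  have "Phi f e = (\<lambda>z. K (1 + e) z * f z - K 1 z * f z - (f 1 * (K (1 + e) z - K 1 z) + (f (1 + e) - f 1) * ?n z))"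
    by (rule ext) (simp add: Phi_def algebra_simps)
  then have "integral\<^sup>L hl (Phi f e) = (\<integral>z. K (1 + e) z * f z - K 1 z * f z - (f 1 * (K (1 + e) z - K 1 z) + (f (1 + e) - f 1) * ?n z) \<partial>hl)"
    by (simp only:)
  also have "\<dots> = U f (1 + e) - U f 1 - (f 1 * ((1 + e) powr tau * ?c - ?c) + (f (1 + e) - f 1) * integral\<^sup>L hl ?n)"
    unfolding U_def using iKf[of "1 + e"] iKf[of 1] iK iK1 n(1) e by simp
  finally have eq: "U f (1 + e) - U f 1 = integral\<^sup>L hl (Phi f e) + (f 1 * ((1 + e) powr tau * ?c - ?c) + (f (1 + e) - f 1) * integral\<^sup>L hl ?n)" by simp
  have c: "?c \<ge> 0" by (intro Bochner_Integration.integral_nonneg K_nonneg)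
  have 1: "\<bar>f 1 * ((1 + e) powr tau * ?c - ?c)\<bar> \<le> ?c * N * e powr (a + tau)"
  proof -
    have "(1 + e) powr tau \<le> 1 + e" using powr_mono[of tau 1 "1 + e"] tau e by auto
    moreover have "(1 + e) powr tau \<ge> 1" using e t by (simp add: ge_one_powr_ge_zero)
    ultimately have "\<bar>(1 + e) powr tau - 1\<bar> \<le> e powr (a + tau)" using e_le[OF e] by linarith
    moreover have "\<bar>f 1\<bar> \<le> N" using Hol_bound[OF f, of 1] by simp
    ultimately have "\<bar>f 1\<bar> * (\<bar>(1 + e) powr tau - 1\<bar> * ?c) \<le> N * (e powr (a + tau) * ?c)"
      using c N by (intro mult_mono) auto
    moreover have "f 1 * ((1 + e) powr tau * ?c - ?c) = f 1 * (((1 + e) powr tau - 1) * ?c)" by (simp add: algebra_simps)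
    then have "\<bar>f 1 * ((1 + e) powr tau * ?c - ?c)\<bar> = \<bar>f 1\<bar> * (\<bar>(1 + e) powr tau - 1\<bar> * ?c)"
      by (simp only: abs_mult abs_of_nonneg[OF c])
    moreover have "N * (e powr (a + tau) * ?c) = ?c * N * e powr (a + tau)" by (simp only: mult_ac)
    ultimately show ?thesis by linarith
  qed
  have 2: "\<bar>(f (1 + e) - f 1) * integral\<^sup>L hl ?n\<bar> \<le> 6 * C1 / tau * N * e powr (a + tau)"
  proof -
    have "\<bar>f (1 + e) - f 1\<bar> \<le> N * e powr a" using Hol_diff[OF f, of "1 + e" 1] e by simp
    then have "\<bar>f (1 + e) - f 1\<bar> * \<bar>integral\<^sup>L hl ?n\<bar> \<le> (N * e powr a) * (6 * C1 / tau * e powr tau)"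
      using n(2) N by (intro mult_mono) auto
    then show ?thesis by (simp add: abs_mult powr_add mult_ac)
  qed
  show ?thesis unfolding eq using Phi_bound(2)[OF f e] 1 2 by (simp add: distrib_right)
qed

lemma U_Hol:
  assumes t: "tau > 0"
  shows "\<exists>C\<ge>0. \<forall>N f. Hol N a f \<longrightarrow> Hol (C * N) (a + tau) (U f)"
proof -
  let ?c = "integral\<^sup>L hl (K 1)"
  let ?cA = "\<integral>z. K 1 z * z powr a \<partial>hl"
  let ?C = "C4 + ?c + 6 * C1 / tau + ?cA"
  have pos: "?c \<ge> 0" "?cA \<ge> 0" "C4 \<ge> 0" "6 * C1 / tau \<ge> 0"
    using C4 C1 t by (auto intro!: Bochner_Integration.integral_nonneg mult_nonneg_nonneg K_nonneg)
  have iA: "integrable hl (\<lambda>z. K 1 z * z powr a)"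
    by (rule integrable_K1_growth[where D=1]) (use t in auto)
  have one: "\<bar>U f 1\<bar> \<le> ?C * N" if f: "Hol N a f" for N f
  proof -
    have "\<bar>U f 1\<bar> \<le> (\<integral>z. \<bar>K 1 z * f z\<bar> \<partial>hl)" unfolding U_def by (rule integral_abs_bound)
    also have "\<dots> \<le> (\<integral>z. N * (K 1 z * z powr a) \<partial>hl)"
    proof (rule integral_mono)
      show "integrable hl (\<lambda>z. \<bar>K 1 z * f z\<bar>)" using U_integrable[OF t f, of 1] by (intro integrable_abs) simp
      show "integrable hl (\<lambda>z. N * (K 1 z * z powr a))" using iA by (intro integrable_mult_right)
      fix z assume "z \<in> space hl"
      then have "K 1 z * \<bar>f z\<bar> \<le> K 1 z * (N * z powr a)" using Hol_bound[OF f] K_nonneg by (intro mult_left_mono) auto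
      then show "\<bar>K 1 z * f z\<bar> \<le> N * (K 1 z * z powr a)" by (simp add: abs_mult K_nonneg mult.left_commute)
    qed
    also have "\<dots> = ?cA * N" by simp
    also have "\<dots> \<le> ?C * N" using pos Hol_nonneg[OF f] by (intro mult_right_mono) auto
    finally show ?thesis .
  qed
  have step: "\<bar>U f (1 + e) - U f 1\<bar> \<le> ?C * N * e powr (a + tau)" if f: "Hol N a f" and e: "0 < e" "e \<le> 1 / 2" for N f e
  proof -
    have "(C4 + ?c + 6 * C1 / tau) * N * e powr (a + tau) \<le> ?C * N * e powr (a + tau)"
      using pos Hol_nonneg[OF f] by (intro mult_right_mono) auto
    then show ?thesis using U_step[OF t f e] by linarith
  qed
  have "Hol (5 * ?C * N) (a + tau) (U f)" if "Hol N a f" for N f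
    by (rule homogeneous_operator_Hol[OF U_scale one step _ _ _ that]) (use pos b in auto)
  then show ?thesis using pos by (intro exI[of _ "5 * ?C"]) auto
qed

section \<open>Negative \<open>tau\<close>: a compensated singular integral\<close>

definition V :: "(real \<Rightarrow> real) \<Rightarrow> real \<Rightarrow> real" where
  "V f x = (\<integral>y. K x y * (f x * (y / x) powr lam - f y) \<partial>hl)"

text \<open>The value at 1 of \<open>V\<close> on the constant function 1. Splitting off this
  multiple leaves the plain increment f(x) - f(y), which Hoelder continuity controls.\<close>

definition "VB = (\<integral>z. K 1 z * (z powr lam - 1) \<partial>hl)"

text \<open>Near 1 the power z^lam has a bounded difference quotient; lam >= 1 keeps its derivative
  bounded down to 0. At infinity it grows exactly like z^lam, and the integral converges because tau
  < 0.\<close>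

lemma VB_integrable:
  assumes t: "tau < 0" and l: "lam \<ge> 1"
  shows "integrable hl (\<lambda>z. K 1 z * (z powr lam - 1))"
proof (rule integrable_K1[where g=1 and d=lam and D="lam * 2 powr lam"])
  fix z :: real assume z: "z > 0" "z \<noteq> 1" "\<bar>z - 1\<bar> \<le> 1"
  have mvt: "\<bar>y powr lam - x powr lam\<bar> \<le> lam * 2 powr lam * (y - x)" if xy: "0 < x" "x < y" "y \<le> 2" for x y :: real
  proof -
    have "\<exists>u>x. u < y \<and> y powr lam - x powr lam = (y - x) * (lam * u powr (lam - 1))"
      using xy by (intro MVT2 has_real_derivative_powr) auto
    then obtain u where u: "x < u" "u < y" "y powr lam - x powr lam = (y - x) * (lam * u powr (lam - 1))" by blast
    have "u powr (lam - 1) \<le> 2 powr (lam - 1)" using u xy l by (intro powr_mono2) auto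
    moreover have "(2::real) powr (lam - 1) \<le> 2 powr lam" by (intro powr_mono) auto
    ultimately have "u powr (lam - 1) \<le> 2 powr lam" by linarith
    then have "(y - x) * (lam * u powr (lam - 1)) \<le> (y - x) * (lam * 2 powr lam)"
      using xy l by (intro mult_left_mono) auto
    then show ?thesis unfolding u(3) using xy l by (simp add: abs_mult mult_ac)
  qed
  show "\<bar>z powr lam - 1\<bar> \<le> lam * 2 powr lam * \<bar>z - 1\<bar> powr 1"
    using mvt[of z 1] mvt[of 1 z] z by (cases z "1::real" rule: linorder_cases) (auto simp: abs_minus_commute)
next
  fix z :: real assume z: "z > 0" "\<bar>z - 1\<bar> \<ge> 1"
  have "1 \<le> z powr lam" using z l by (intro ge_one_powr_ge_zero) auto
  then have "\<bar>z powr lam - 1\<bar> \<le> z powr lam" by simp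
  also have "\<dots> \<le> (2 * \<bar>z - 1\<bar>) powr lam" using z l by (intro powr_mono2) auto
  also have "\<dots> = 2 powr lam * \<bar>z - 1\<bar> powr lam" by (rule powr_mult)
  also have "\<dots> \<le> lam * 2 powr lam * \<bar>z - 1\<bar> powr lam" using l by (intro mult_right_mono) auto
  finally show "\<bar>z powr lam - 1\<bar> \<le> lam * 2 powr lam * \<bar>z - 1\<bar> powr lam" .
qed (use t tau in auto)

lemma V_diff_integrable:
  assumes "Hol N a f" "x > 0"
  shows "integrable hl (\<lambda>y. K x y * (f x - f y))"
proof -
  note h = Hol_scale[OF assms]
  have m: "(\<lambda>z. f x - f (x * z)) \<in> borel_measurable hl"
    using Hol_measurable[OF h a(1)] by simp
  show ?thesis
    unfolding integrable_K_scale[OF assms(2)]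
  proof (rule integrable_K1[OF m, where g=a and d=a and D="N * x powr a"])
    fix z :: real assume "z > 0"
    then show "\<bar>f x - f (x * z)\<bar> \<le> N * x powr a * \<bar>z - 1\<bar> powr a"
      "\<bar>f x - f (x * z)\<bar> \<le> N * x powr a * \<bar>z - 1\<bar> powr a"
      using Hol_diff[OF h, of 1 z] by (simp_all add: abs_minus_commute)
  qed (use b in auto)
qed

lemma V_integrand_scaled: "x > 0 \<Longrightarrow> (\<integral>y. K x y * (c * (y / x) powr lam - f y) \<partial>hl) = x powr tau * (\<integral>z. K 1 z * (c * z powr lam - f (x * z)) \<partial>hl)"
  using integral_K_scale[of x "\<lambda>y. c * (y / x) powr lam - f y"] by simp

lemma V_scale:
  assumes "r > 0" "x > 0"
  shows "V f (r * x) = r powr tau * V (\<lambda>z. f (r * z)) x"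
  unfolding V_def using assms by (simp add: V_integrand_scaled[of "r * x"] V_integrand_scaled[of x] powr_mult mult.assoc)

lemma
  assumes t: "tau < 0" and l: "lam \<ge> 1" and f: "Hol N a f" and x: "x > 0"
  shows V_integrable: "integrable hl (\<lambda>y. K x y * (f x * (y / x) powr lam - f y))"
    and V_eq: "V f x = f x * x powr tau * VB + (\<integral>y. K x y * (f x - f y) \<partial>hl)"
proof -
  have eq: "K x y * (f x * (y / x) powr lam - f y) = f x * (K x y * ((y / x) powr lam - 1)) + K x y * (f x - f y)" for y
    by (simp add: algebra_simps)
  have i: "integrable hl (\<lambda>y. K x y * ((y / x) powr lam - 1))"
    unfolding integrable_K_scale[OF x] using VB_integrable[OF t l] x by simp
  show "integrable hl (\<lambda>y. K x y * (f x * (y / x) powr lam - f y))"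
    unfolding eq by (intro Bochner_Integration.integrable_add integrable_mult_right i V_diff_integrable[OF f x])
  have "(\<integral>y. K x y * ((y / x) powr lam - 1) \<partial>hl) = x powr tau * VB"
    using integral_K_scale[OF x, of "\<lambda>y. (y / x) powr lam - 1"] x by (simp add: VB_def)
  then show "V f x = f x * x powr tau * VB + (\<integral>y. K x y * (f x - f y) \<partial>hl)"
    unfolding V_def eq using i V_diff_integrable[OF f x] by simp
qed

text \<open>For tau < 0 the kernel has infinite mass near its singularity, so the correction to
  \<open>Phi\<close> now lives on the far set, at distance at least e from 1 + e, where the mass is
  of order e^tau. Times the increment e^a of f this is the required order; the term with
  \<open>VB\<close> changes by at most that order as well.\<close>

lemma V_step:
  assumes t: "tau < 0" and l: "lam \<ge> 1" and f: "Hol N a f" and e: "0 < e" "e \<le> 1 / 2"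
  shows "\<bar>V f (1 + e) - V f 1\<bar> \<le> (C4 + 2 * \<bar>VB\<bar> + 2 * C1 / (- tau)) * N * e powr (a + tau)"
proof -
  let ?n = "\<lambda>z. indicator {z. 2 * e \<le> \<bar>z - 1\<bar>} z * K (1 + e) z :: real"
  have N: "N \<ge> 0" using f by (rule Hol_nonneg)
  have m [measurable]: "?n \<in> borel_measurable hl"
    by (intro borel_measurable_times borel_measurable_indicator' measurable_K) measurable
  have "(\<integral>\<^sup>+z. ennreal \<bar>?n z\<bar> \<partial>hl) \<le> (\<integral>\<^sup>+z. ennreal C1 * (ennreal (\<bar>z - (1 + e)\<bar> powr (- (- tau) - 1)) * indicator {z. e \<le> \<bar>z - (1 + e)\<bar>} z) \<partial>lborel)"
    unfolding nn_integral_hl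
  proof (rule nn_integral_mono)
    fix z :: real
    show "ennreal \<bar>?n z\<bar> * indicator {0<..} z \<le> ennreal C1 * (ennreal (\<bar>z - (1 + e)\<bar> powr (- (- tau) - 1)) * indicator {z. e \<le> \<bar>z - (1 + e)\<bar>} z)"
    proof (cases "z > 0 \<and> 2 * e \<le> \<bar>z - 1\<bar>")
      case True
      then have "e \<le> \<bar>z - (1 + e)\<bar>" using e by linarith
      moreover have "K (1 + e) z \<le> C1 * \<bar>z - (1 + e)\<bar> powr (- (- tau) - 1)"
        using K_near[of "1 + e" z] True e by (auto simp: abs_minus_commute)
      ultimately show ?thesis using True C1 K_nonneg[of "1 + e" z]
        by (simp add: ennreal_mult'[symmetric] ennreal_leI)
    qed (auto simp: indicator_def)
  qed
  also have "\<dots> = ennreal C1 * (\<integral>\<^sup>+z. ennreal (\<bar>z - (1 + e)\<bar> powr (- (- tau) - 1)) * indicator {z. e \<le> \<bar>z - (1 + e)\<bar>} z \<partial>lborel)"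
    by (rule nn_integral_cmult) simp
  also have "\<dots> \<le> ennreal C1 * ennreal (2 * e powr (- (- tau)) / (- tau))"
    using t e by (intro mult_left_mono nn_integral_powr_far) auto
  also have "\<dots> = ennreal (2 * C1 / (- tau) * e powr tau)"
    using C1 by (simp add: ennreal_mult'[symmetric] mult_ac)
  finally have fin: "(\<integral>\<^sup>+z. ennreal \<bar>?n z\<bar> \<partial>hl) \<le> ennreal (2 * C1 / (- tau) * e powr tau)" .
  have "0 \<le> 2 * C1 / (- tau) * e powr tau"
    using C1 t by (intro mult_nonneg_nonneg divide_nonneg_pos) auto
  note n = nn_integral_le_integrable[OF m fin this]
  let ?I = "\<lambda>x. \<integral>y. K x y * (f x - f y) \<partial>hl"
  have i: "integrable hl (\<lambda>y. K x y * (f x - f y))" if "x > 0" for x by (rule V_diff_integrable[OF f that])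
  have "K (1 + e) z * (f (1 + e) - f z) - K 1 z * (f 1 - f z) = (f (1 + e) - f 1) * ?n z - Phi f e z" for z
    by (simp add: Phi_def indicator_def algebra_simps)
  then have "(\<integral>z. K (1 + e) z * (f (1 + e) - f z) - K 1 z * (f 1 - f z) \<partial>hl) = (\<integral>z. (f (1 + e) - f 1) * ?n z - Phi f e z \<partial>hl)"
    by simp
  then have I: "?I (1 + e) - ?I 1 = (f (1 + e) - f 1) * integral\<^sup>L hl ?n - integral\<^sup>L hl (Phi f e)"
    using i[of "1 + e"] i[of 1] n(1) Phi_bound(1)[OF f e] e by simp
  have eq: "V f (1 + e) - V f 1 = (f (1 + e) * (1 + e) powr tau - f 1) * VB + (f (1 + e) - f 1) * integral\<^sup>L hl ?n - integral\<^sup>L hl (Phi f e)"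
    using I V_eq[OF t l f, of "1 + e"] V_eq[OF t l f, of 1] e by (simp add: algebra_simps)
  have fd: "\<bar>f (1 + e) - f 1\<bar> \<le> N * e powr a" using Hol_diff[OF f, of "1 + e" 1] e by simp
  have 1: "\<bar>(f (1 + e) * (1 + e) powr tau - f 1) * VB\<bar> \<le> 2 * \<bar>VB\<bar> * N * e powr (a + tau)"
  proof -
    \<comment> \<open>As tau lies between -1 and 0, the power (1 + e)^tau lies between 1 / (1 + e)
      >= 1 - e and 1.\<close>
    have "(1 + e) powr (-1) \<le> (1 + e) powr tau" using tau e by (intro powr_mono) auto
    moreover have "(1 + e) powr (-1) \<ge> 1 - e" using e by (simp add: powr_minus field_simps)
    moreover have le1: "(1 + e) powr tau \<le> 1" using powr_mono[of tau 0 "1 + e"] e t by simp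
    ultimately have "\<bar>(1 + e) powr tau - 1\<bar> \<le> e powr (a + tau)" using e_le[OF e] by linarith
    moreover have "\<bar>f 1\<bar> \<le> N" using Hol_bound[OF f, of 1] by simp
    ultimately have A: "\<bar>f 1 * ((1 + e) powr tau - 1)\<bar> \<le> N * e powr (a + tau)"
      unfolding abs_mult using N by (intro mult_mono) auto
    have "\<bar>(f (1 + e) - f 1) * (1 + e) powr tau\<bar> \<le> N * e powr a * 1"
      unfolding abs_mult using fd le1 N by (intro mult_mono) auto
    also have "N * e powr a * 1 \<le> N * e powr (a + tau)"
      using powr_mono'[of "a + tau" a e] e t N by (simp add: mult_left_mono)
    finally have B: "\<bar>(f (1 + e) - f 1) * (1 + e) powr tau\<bar> \<le> N * e powr (a + tau)" .
    have "f (1 + e) * (1 + e) powr tau - f 1 = (f (1 + e) - f 1) * (1 + e) powr tau + f 1 * ((1 + e) powr tau - 1)"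
      by (simp add: algebra_simps)
    then have "\<bar>f (1 + e) * (1 + e) powr tau - f 1\<bar> \<le> 2 * N * e powr (a + tau)" using A B by linarith
    then have "\<bar>f (1 + e) * (1 + e) powr tau - f 1\<bar> * \<bar>VB\<bar> \<le> 2 * N * e powr (a + tau) * \<bar>VB\<bar>" by (intro mult_right_mono) auto
    then show ?thesis by (simp add: abs_mult mult_ac)
  qed
  have 2: "\<bar>(f (1 + e) - f 1) * integral\<^sup>L hl ?n\<bar> \<le> 2 * C1 / (- tau) * N * e powr (a + tau)"
  proof -
    have "\<bar>f (1 + e) - f 1\<bar> * \<bar>integral\<^sup>L hl ?n\<bar> \<le> (N * e powr a) * (2 * C1 / (- tau) * e powr tau)"
      using fd n(2) N by (intro mult_mono) auto
    then show ?thesis by (simp add: abs_mult powr_add mult_ac)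
  qed
  have "(C4 + 2 * \<bar>VB\<bar> + 2 * C1 / (- tau)) * N * e powr (a + tau) =
     C4 * N * e powr (a + tau) + 2 * \<bar>VB\<bar> * N * e powr (a + tau) + 2 * C1 / (- tau) * N * e powr (a + tau)"
    by (simp only: distrib_right)
  then show ?thesis unfolding eq using Phi_bound(2)[OF f e] 1 2 by linarith
qed

lemma V_Hol:
  assumes t: "tau < 0" and l: "lam \<ge> 1"
  shows "\<exists>C\<ge>0. \<forall>N f. Hol N a f \<longrightarrow> Hol (C * N) (a + tau) (V f)"
proof -
  let ?cD = "\<integral>z. K 1 z * \<bar>z - 1\<bar> powr a \<partial>hl"
  let ?C = "C4 + 2 * \<bar>VB\<bar> + 2 * C1 / (- tau) + ?cD"
  have "2 * C1 / (- tau) \<ge> 0" using C1 t by (intro divide_nonneg_pos) auto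
  then have pos: "?cD \<ge> 0" "C4 \<ge> 0" "2 * C1 / (- tau) \<ge> 0"
    using C4 by (auto intro!: Bochner_Integration.integral_nonneg mult_nonneg_nonneg K_nonneg)
  have iD: "integrable hl (\<lambda>z. K 1 z * \<bar>z - 1\<bar> powr a)"
    by (rule integrable_K1[where g=a and d=a and D=1]) (use b in auto)
  have one: "\<bar>V f 1\<bar> \<le> ?C * N" if f: "Hol N a f" for N f
  proof -
    have N: "N \<ge> 0" using f by (rule Hol_nonneg)
    have "\<bar>\<integral>z. K 1 z * (f 1 - f z) \<partial>hl\<bar> \<le> (\<integral>z. \<bar>K 1 z * (f 1 - f z)\<bar> \<partial>hl)" by (rule integral_abs_bound)
    also have "\<dots> \<le> (\<integral>z. N * (K 1 z * \<bar>z - 1\<bar> powr a) \<partial>hl)"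
    proof (rule integral_mono)
      show "integrable hl (\<lambda>z. \<bar>K 1 z * (f 1 - f z)\<bar>)" using V_diff_integrable[OF f, of 1] by (intro integrable_abs) simp
      show "integrable hl (\<lambda>z. N * (K 1 z * \<bar>z - 1\<bar> powr a))" using iD by (intro integrable_mult_right)
      fix z assume "z \<in> space hl"
      then have "K 1 z * \<bar>f 1 - f z\<bar> \<le> K 1 z * (N * \<bar>z - 1\<bar> powr a)"
        using Hol_diff[OF f, of 1 z] K_nonneg by (intro mult_left_mono) (auto simp: abs_minus_commute)
      then show "\<bar>K 1 z * (f 1 - f z)\<bar> \<le> N * (K 1 z * \<bar>z - 1\<bar> powr a)" by (simp add: abs_mult K_nonneg mult.left_commute)
    qed
    also have "\<dots> = ?cD * N" by simp
    finally have "\<bar>\<integral>z. K 1 z * (f 1 - f z) \<partial>hl\<bar> \<le> ?cD * N" .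
    moreover have "\<bar>f 1 * VB\<bar> \<le> 2 * \<bar>VB\<bar> * N"
    proof -
      have "\<bar>f 1\<bar> * \<bar>VB\<bar> \<le> N * \<bar>VB\<bar>" using Hol_bound[OF f, of 1] by (intro mult_right_mono) auto
      moreover have "0 \<le> N * \<bar>VB\<bar>" using N by simp
      moreover have "2 * \<bar>VB\<bar> * N = 2 * (N * \<bar>VB\<bar>)" by simp
      ultimately show ?thesis unfolding abs_mult by linarith
    qed
    ultimately have "\<bar>V f 1\<bar> \<le> (2 * \<bar>VB\<bar> + ?cD) * N" unfolding V_eq[OF t l f zero_less_one] by (simp add: distrib_right)
    also have "\<dots> \<le> ?C * N" using pos N by (intro mult_right_mono) auto
    finally show ?thesis .
  qed
  have step: "\<bar>V f (1 + e) - V f 1\<bar> \<le> ?C * N * e powr (a + tau)" if f: "Hol N a f" and e: "0 < e" "e \<le> 1 / 2" for N f e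
  proof -
    have "(C4 + 2 * \<bar>VB\<bar> + 2 * C1 / (- tau)) * N * e powr (a + tau) \<le> ?C * N * e powr (a + tau)"
      using pos Hol_nonneg[OF f] by (intro mult_right_mono) auto
    then show ?thesis using V_step[OF t l f e] by linarith
  qed
  have "Hol (5 * ?C * N) (a + tau) (V f)" if "Hol N a f" for N f
    by (rule homogeneous_operator_Hol[OF V_scale one step _ _ _ that]) (use pos b in auto)
  then show ?thesis using pos by (intro exI[of _ "5 * ?C"]) auto
qed

end

subsection \<open>Negative powers\<close>

lemma integrable_nn_less_top:
  fixes f :: "'a \<Rightarrow> real"
  assumes "integrable M f"
  shows "(\<integral>\<^sup>+x. ennreal (f x) \<partial>M) < \<infinity>"
proof -
  have "(\<integral>\<^sup>+x. ennreal (f x) \<partial>M) \<le> (\<integral>\<^sup>+x. ennreal (norm (f x)) \<partial>M)"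
    by (intro nn_integral_mono ennreal_leI) auto
  then show ?thesis using assms unfolding integrable_iff_bounded by (auto intro: le_less_trans)
qed

definition poisson_factor :: "real \<Rightarrow> real" where
  "poisson_factor lam = heat_const lam * invgamma_const (lam + 1) / (2 * sqrt pi)"

lemma poisson_factor_pos: "lam > 0 \<Longrightarrow> poisson_factor lam > 0"
  unfolding poisson_factor_def using heat_const_pos[of lam] invgamma_const_pos[of "lam + 1"] by simp

text \<open>Subordination combines the exponents to - (t^2 + qd) / (4 s) and the powers of s to
  s^(-(lam + 1) - 1). After exchanging the integrals the one in s is
  \<open>integral_invgamma\<close>.\<close>

lemma poisson_kernel_eq:
  assumes lam: "lam > 0" and t: "t > 0" and xy: "x > 0" "y > 0"
  shows "poisson_kernel lam t x y = poisson_factor lam * t * (x * y) powr lam * (\<integral>s. (t\<^sup>2 + qd x y s) powr (- (lam + 1)) \<partial>Om lam)"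
proof -
  let ?G = "\<lambda>s u. exp (- (t\<^sup>2 + qd x y u) / (4 * s)) * s powr (- (lam + 1) - 1)"
  interpret finite_measure "Om lam" by (rule finite_measure_Om[OF lam])
  have fin: "(\<integral>\<^sup>+s. \<integral>\<^sup>+u. ennreal \<bar>?G s u\<bar> \<partial>Om lam \<partial>hl) < \<infinity>"
  proof -
    \<comment> \<open>The term t^2 alone gives convergence at s = 0, so \<open>qd\<close> may be
      dropped from the exponent.\<close>
    have "(\<integral>\<^sup>+s. \<integral>\<^sup>+u. ennreal \<bar>?G s u\<bar> \<partial>Om lam \<partial>hl) \<le> (\<integral>\<^sup>+s. \<integral>\<^sup>+u. ennreal (exp (- t\<^sup>2 / (4 * s)) * s powr (- (lam + 1) - 1)) \<partial>Om lam \<partial>hl)"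
    proof (intro nn_integral_mono)
      fix s u assume su: "s \<in> space hl" "u \<in> space (Om lam)"
      then have "qd x y u > 0" using xy by (intro qd_pos) auto
      then have "- (t\<^sup>2 + qd x y u) / (4 * s) \<le> - t\<^sup>2 / (4 * s)" using su by (intro divide_right_mono) auto
      then have "exp (- (t\<^sup>2 + qd x y u) / (4 * s)) \<le> exp (- t\<^sup>2 / (4 * s))" by (rule exp_le_cancel_iff[THEN iffD2])
      then show "ennreal \<bar>?G s u\<bar> \<le> ennreal (exp (- t\<^sup>2 / (4 * s)) * s powr (- (lam + 1) - 1))"
        by (intro ennreal_leI) (simp add: abs_mult mult_right_mono)
    qed
    also have "\<dots> = (\<integral>\<^sup>+s. ennreal (exp (- t\<^sup>2 / (4 * s)) * s powr (- (lam + 1) - 1)) \<partial>hl) * emeasure (Om lam) (space (Om lam))"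
      by (simp add: nn_integral_multc)
    also have "\<dots> < \<infinity>"
    proof -
      have "(\<integral>\<^sup>+s. ennreal (exp (- t\<^sup>2 / (4 * s)) * s powr (- (lam + 1) - 1)) \<partial>hl) = ennreal (\<integral>s. exp (- t\<^sup>2 / (4 * s)) * s powr (- (lam + 1) - 1) \<partial>hl)"
        using lam t by (intro nn_integral_eq_integral integrable_invgamma) auto
      then show ?thesis by (simp add: ennreal_mult_less_top emeasure_eq_measure del: space_Om)
    qed
    finally show ?thesis .
  qed
  have m: "case_prod ?G \<in> borel_measurable (hl \<Otimes>\<^sub>M Om lam)"
    unfolding split_beta' by measurable
  note F = fubini[OF sigma_finite_hl sigma_finite_measure_axioms m fin]
  have "(\<integral>s. exp (- t\<^sup>2 / (4 * s)) / s powr (3 / 2) * heat_kernel lam s x y \<partial>hl) =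
     (\<integral>s. heat_const lam * (x * y) powr lam * (\<integral>u. ?G s u \<partial>Om lam) \<partial>hl)"
  proof (rule Bochner_Integration.integral_cong[OF refl])
    fix s :: real assume "s \<in> space hl"
    then have s: "s > 0" by simp
    have eq: "?G s u = exp (- t\<^sup>2 / (4 * s)) * s powr (- (lam + 1) - 1) * exp (- qd x y u / (4 * s))" for u
      by (simp add: exp_add[symmetric] add_divide_distrib diff_divide_distrib)
    have "s powr (- (lam + 1) - 1) = s powr (- (3 / 2)) * s powr (- lam - 1 / 2)"
      by (simp add: powr_add[symmetric])
    also have "\<dots> = s powr (- lam - 1 / 2) / s powr (3 / 2)" by (simp add: powr_minus_divide)
    finally have p: "s powr (- (lam + 1) - 1) = s powr (- lam - 1 / 2) / s powr (3 / 2)" .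
    have key: "(\<integral>u. ?G s u \<partial>Om lam) = exp (- t\<^sup>2 / (4 * s)) * (s powr (- lam - 1 / 2) / s powr (3 / 2)) * (\<integral>u. exp (- qd x y u / (4 * s)) \<partial>Om lam)"
      unfolding eq unfolding p by (rule integral_mult_right_zero)
    show "exp (- t\<^sup>2 / (4 * s)) / s powr (3 / 2) * heat_kernel lam s x y = heat_const lam * (x * y) powr lam * (\<integral>u. ?G s u \<partial>Om lam)"
      unfolding heat_kernel_Om[OF lam s xy] key by (simp only: times_divide_eq_right times_divide_eq_left mult_ac)
  qed
  also have "\<dots> = heat_const lam * (x * y) powr lam * (\<integral>s. \<integral>u. ?G s u \<partial>Om lam \<partial>hl)" by (rule integral_mult_right_zero)
  also have "(\<integral>s. \<integral>u. ?G s u \<partial>Om lam \<partial>hl) = (\<integral>u. \<integral>s. ?G s u \<partial>hl \<partial>Om lam)" by (rule F(4))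
  also have "\<dots> = (\<integral>u. (t\<^sup>2 + qd x y u) powr (- (lam + 1)) * invgamma_const (lam + 1) \<partial>Om lam)"
  proof (rule Bochner_Integration.integral_cong[OF refl])
    fix u assume "u \<in> space (Om lam)"
    then have "qd x y u > 0" using xy by (intro qd_pos) auto
    then show "(\<integral>s. ?G s u \<partial>hl) = (t\<^sup>2 + qd x y u) powr (- (lam + 1)) * invgamma_const (lam + 1)"
      using lam t by (intro integral_invgamma) (auto simp: add_pos_pos)
  qed
  also have "\<dots> = (\<integral>u. (t\<^sup>2 + qd x y u) powr (- (lam + 1)) \<partial>Om lam) * invgamma_const (lam + 1)"
    by (rule integral_mult_left_zero)
  finally show ?thesis
    unfolding poisson_kernel_def set_integral_hl poisson_factor_def by simp
qed

lemma measurable_poisson_form [measurable (raw)]: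
  assumes lam: "lam > 0" and [measurable]: "f \<in> borel_measurable M" "g \<in> borel_measurable M" "h \<in> borel_measurable M"
  shows "(\<lambda>x. \<integral>s. ((f x)\<^sup>2 + qd (g x) (h x) s) powr (- b) \<partial>Om lam) \<in> borel_measurable M"
proof -
  interpret finite_measure "Om lam" by (rule finite_measure_Om[OF lam])
  have "(\<lambda>p. \<integral>s. ((fst p)\<^sup>2 + qd (fst (snd p)) (snd (snd p)) s) powr (- b) \<partial>Om lam) \<in> borel_measurable (borel \<Otimes>\<^sub>M borel \<Otimes>\<^sub>M borel)"
    by (rule borel_measurable_lebesgue_integral) (simp add: split_beta', measurable)
  then have [measurable]: "(\<lambda>p. \<integral>s. ((fst p)\<^sup>2 + qd (fst (snd p)) (snd (snd p)) s) powr (- b) \<partial>Om lam) \<in> borel_measurable borel"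
    by (simp add: borel_prod)
  have "(\<lambda>x. (\<lambda>p. \<integral>s. ((fst p)\<^sup>2 + qd (fst (snd p)) (snd (snd p)) s) powr (- b) \<partial>Om lam) (f x, g x, h x)) \<in> borel_measurable M"
    by measurable
  then show ?thesis by simp
qed

context
  fixes lam \<sigma> \<alpha> :: real
  assumes lam: "lam > 0" and \<sigma>: "0 < \<sigma>" and \<alpha>: "0 < \<alpha>" "\<alpha> < 1" and b: "\<alpha> + 2 * \<sigma> < min lam 1"
begin

interpretation frac_kernel lam "2 * \<sigma>" \<alpha>
  using lam \<sigma> \<alpha> b by unfold_locales auto

abbreviation "pform t x y \<equiv> poisson_factor lam * t * (x * y) powr lam * (\<integral>s. (t\<^sup>2 + qd x y s) powr (- (lam + 1)) \<partial>Om lam)"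

lemma P_nonneg: "t > 0 \<Longrightarrow> pform t x y \<ge> 0"
  using poisson_factor_pos[OF lam] by (intro mult_nonneg_nonneg Bochner_Integration.integral_nonneg) auto

text \<open>Distributing the exponent lam + 1 = (1 / 2 + \<sigma>) + p over t^2 and
  \<open>qd\<close> bounds the Poisson kernel at fixed t by a multiple of K, whose integrability
  against f is known.\<close>

lemma P_le:
  assumes "t > 0" "x > 0" "y > 0" "x \<noteq> y"
  shows "pform t x y \<le> poisson_factor lam * t * (t\<^sup>2) powr (- (1 / 2 + \<sigma>)) * K x y"
proof -
  have q: "(t\<^sup>2 + qd x y s) powr (- (lam + 1)) \<le> (t\<^sup>2) powr (- (1 / 2 + \<sigma>)) * qd x y s powr (- p)" if "s < 1" for s
  proof -
    have "qd x y s > 0" using assms that by (intro qd_pos)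
    then have "(t\<^sup>2 + qd x y s) powr (- ((1 / 2 + \<sigma>) + p)) \<le> (t\<^sup>2) powr (- (1 / 2 + \<sigma>)) * qd x y s powr (- p)"
      using assms \<sigma> p by (intro powr_add_le) auto
    moreover have "(1 / 2 + \<sigma>) + p = lam + 1" by (simp add: p_def)
    ultimately show ?thesis by simp
  qed
  have "(\<integral>s. (t\<^sup>2 + qd x y s) powr (- (lam + 1)) \<partial>Om lam) \<le> (\<integral>s. (t\<^sup>2) powr (- (1 / 2 + \<sigma>)) * qd x y s powr (- p) \<partial>Om lam)"
  proof (rule integral_mono)
    show i: "integrable (Om lam) (\<lambda>s. (t\<^sup>2) powr (- (1 / 2 + \<sigma>)) * qd x y s powr (- p))"
      using assms lam p by (intro integrable_mult_right integrable_qd_powr) auto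
    show "integrable (Om lam) (\<lambda>s. (t\<^sup>2 + qd x y s) powr (- (lam + 1)))"
      using q by (intro Bochner_Integration.integrable_bound[OF i] AE_I2) auto
  qed (use q in auto)
  also have "\<dots> = (t\<^sup>2) powr (- (1 / 2 + \<sigma>)) * (\<integral>s. qd x y s powr (- p) \<partial>Om lam)" by (rule integral_mult_right_zero)
  finally have "poisson_factor lam * t * (x * y) powr lam * (\<integral>s. (t\<^sup>2 + qd x y s) powr (- (lam + 1)) \<partial>Om lam) \<le>
     poisson_factor lam * t * (x * y) powr lam * ((t\<^sup>2) powr (- (1 / 2 + \<sigma>)) * (\<integral>s. qd x y s powr (- p) \<partial>Om lam))"
    using poisson_factor_pos[OF lam] assms by (intro mult_left_mono) auto
  then show ?thesis unfolding K_def kern_def by (simp only: mult_ac)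
qed

definition "cP = poisson_factor lam * poisson_const (2 * \<sigma>) (lam + 1)"

text \<open>For each s, scaling by the square root of \<open>qd\<close> evaluates the integral in t;
  it yields exactly the power -p because (2 \<sigma> + 1) / 2 - (lam + 1) = - p.\<close>

lemma
  assumes xy: "x > 0" "y > 0" "x \<noteq> y"
  shows P_t_integrable: "integrable hl (\<lambda>t. pform t x y / t powr (1 - 2 * \<sigma>))"
    and P_t_integral: "(\<integral>t. pform t x y / t powr (1 - 2 * \<sigma>) \<partial>hl) = cP * K x y"
proof -
  let ?G = "\<lambda>s t. t powr (2 * \<sigma>) * (t\<^sup>2 + qd x y s) powr (- (lam + 1))"
  interpret finite_measure "Om lam" by (rule finite_measure_Om[OF lam])
  have s2: "2 * \<sigma> > -1" "2 * \<sigma> + 1 < 2 * (lam + 1)" using \<sigma> \<alpha> b lam by auto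
  have pe: "(2 * \<sigma> + 1) / 2 - (lam + 1) = - p" by (simp add: p_def)
  have inner: "(\<integral>t. ?G s t \<partial>hl) = qd x y s powr (- p) * poisson_const (2 * \<sigma>) (lam + 1)" "integrable hl (?G s)" if "s \<in> space (Om lam)" for s
    using integral_poisson_scale[OF s2, of "qd x y s"] integrable_poisson_scale[OF s2, of "qd x y s"] qd_pos[of x y s] xy that
    unfolding pe by auto
  have iq: "integrable (Om lam) (\<lambda>s. qd x y s powr (- p) * poisson_const (2 * \<sigma>) (lam + 1))"
    using xy lam p by (intro integrable_mult_left integrable_qd_powr) auto
  have fin: "(\<integral>\<^sup>+s. \<integral>\<^sup>+t. ennreal \<bar>?G s t\<bar> \<partial>hl \<partial>Om lam) < \<infinity>"
  proof -
    have "(\<integral>\<^sup>+s. \<integral>\<^sup>+t. ennreal \<bar>?G s t\<bar> \<partial>hl \<partial>Om lam) = (\<integral>\<^sup>+s. ennreal (qd x y s powr (- p) * poisson_const (2 * \<sigma>) (lam + 1)) \<partial>Om lam)"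
    proof (rule nn_integral_cong)
      fix s assume s: "s \<in> space (Om lam)"
      have "(\<integral>\<^sup>+t. ennreal \<bar>?G s t\<bar> \<partial>hl) = (\<integral>\<^sup>+t. ennreal (?G s t) \<partial>hl)" by simp
      also have "\<dots> = ennreal (\<integral>t. ?G s t \<partial>hl)" by (rule nn_integral_eq_integral[OF inner(2)[OF s]]) simp
      finally show "(\<integral>\<^sup>+t. ennreal \<bar>?G s t\<bar> \<partial>hl) = ennreal (qd x y s powr (- p) * poisson_const (2 * \<sigma>) (lam + 1))"
        unfolding inner(1)[OF s] .
    qed
    also have "\<dots> < \<infinity>" by (rule integrable_nn_less_top[OF iq])
    finally show ?thesis .
  qed
  have m: "case_prod ?G \<in> borel_measurable (Om lam \<Otimes>\<^sub>M hl)"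
    unfolding split_beta' by measurable
  note F = fubini[OF sigma_finite_measure_axioms sigma_finite_hl m fin]
  have eq: "pform t x y / t powr (1 - 2 * \<sigma>) = poisson_factor lam * (x * y) powr lam * (\<integral>s. ?G s t \<partial>Om lam)" if "t \<in> space hl" for t
  proof -
    have "t / t powr (1 - 2 * \<sigma>) = t powr (2 * \<sigma>)" using that by (simp add: powr_diff)
    then have "poisson_factor lam * t * (x * y) powr lam * I / t powr (1 - 2 * \<sigma>) = poisson_factor lam * (x * y) powr lam * (t powr (2 * \<sigma>) * I)" for I
      by (metis (no_types, opaque_lifting) mult.commute mult.left_commute times_divide_eq_left)
    then show ?thesis by simp
  qed
  show "integrable hl (\<lambda>t. pform t x y / t powr (1 - 2 * \<sigma>))"
    by (subst Bochner_Integration.integrable_cong[OF refl eq], assumption) (intro integrable_mult_right F(3))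
  have "(\<integral>t. pform t x y / t powr (1 - 2 * \<sigma>) \<partial>hl) = poisson_factor lam * (x * y) powr lam * (\<integral>t. \<integral>s. ?G s t \<partial>Om lam \<partial>hl)"
    by (subst Bochner_Integration.integral_cong[OF refl eq], assumption) (rule integral_mult_right_zero)
  also have "(\<integral>t. \<integral>s. ?G s t \<partial>Om lam \<partial>hl) = (\<integral>s. qd x y s powr (- p) * poisson_const (2 * \<sigma>) (lam + 1) \<partial>Om lam)"
    unfolding F(4)[symmetric] by (intro Bochner_Integration.integral_cong refl inner)
  also have "\<dots> = (\<integral>s. qd x y s powr (- p) \<partial>Om lam) * poisson_const (2 * \<sigma>) (lam + 1)"
    by (rule integral_mult_left_zero)
  finally show "(\<integral>t. pform t x y / t powr (1 - 2 * \<sigma>) \<partial>hl) = cP * K x y"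
    unfolding cP_def K_def kern_def by (simp only: mult_ac)
qed

text \<open>All kernels are nonnegative, so the absolute double integral is the one just computed,
  with |f| in place of f. Fubini then gives convergence of the outer integral together with its
  value.\<close>

lemma
  assumes f: "Hol N \<alpha> f" and x: "x > 0"
  shows poisson_f_integrable: "t > 0 \<Longrightarrow> integrable hl (\<lambda>y. poisson_kernel lam t x y * f y)"
    and neg_power_integrable: "integrable hl (\<lambda>t. poisson_op lam t f x / t powr (1 - 2 * \<sigma>))"
    and neg_power_eq: "bessel_neg_power lam \<sigma> f x = cP / Gamma (2 * \<sigma>) * U f x"
proof -
  have fm [measurable]: "f \<in> borel_measurable hl" using Hol_measurable[OF f] \<alpha> by simp
  have t2: "2 * \<sigma> > 0" using \<sigma> by simp
  have iK: "integrable hl (\<lambda>y. K x y * f y)" by (rule U_integrable[OF t2 f x])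
  note pk = poisson_kernel_eq[OF lam _ x]
  show "integrable hl (\<lambda>y. poisson_kernel lam t x y * f y)" if t: "t > 0"
  proof -
    have "integrable hl (\<lambda>y. pform t x y * f y)"
    proof (rule Bochner_Integration.integrable_bound)
      show "integrable hl (\<lambda>y. poisson_factor lam * t * (t\<^sup>2) powr (- (1 / 2 + \<sigma>)) * (K x y * f y))"
        by (intro integrable_mult_right iK)
      show "(\<lambda>y. pform t x y * f y) \<in> borel_measurable hl" using lam by measurable
      show "AE y in hl. norm (pform t x y * f y) \<le> norm (poisson_factor lam * t * (t\<^sup>2) powr (- (1 / 2 + \<sigma>)) * (K x y * f y))"
        using AE_hl_neq[of x] AE_space
      proof eventually_elim
        case (elim y)
        then have le: "pform t x y \<le> poisson_factor lam * t * (t\<^sup>2) powr (- (1 / 2 + \<sigma>)) * K x y"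
          using t x by (intro P_le) auto
        then have "pform t x y * \<bar>f y\<bar> \<le> poisson_factor lam * t * (t\<^sup>2) powr (- (1 / 2 + \<sigma>)) * K x y * \<bar>f y\<bar>"
          by (intro mult_right_mono) auto
        moreover have "norm (pform t x y * f y) = pform t x y * \<bar>f y\<bar>"
          by (simp only: real_norm_def abs_mult[of "pform t x y" "f y"] abs_of_nonneg[OF P_nonneg[OF t]])
        moreover have "norm (poisson_factor lam * t * (t\<^sup>2) powr (- (1 / 2 + \<sigma>)) * (K x y * f y)) = poisson_factor lam * t * (t\<^sup>2) powr (- (1 / 2 + \<sigma>)) * K x y * \<bar>f y\<bar>"
          using poisson_factor_pos[OF lam] t K_nonneg[of x y] by (simp add: abs_mult)
        ultimately show ?case by linarith
      qed
    qed
    then show ?thesis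
      by (subst Bochner_Integration.integrable_cong[OF refl]) (use pk[OF t] in auto)
  qed
  let ?G = "\<lambda>y t. pform t x y * f y / t powr (1 - 2 * \<sigma>)"
  have m: "case_prod ?G \<in> borel_measurable (hl \<Otimes>\<^sub>M hl)"
    unfolding split_beta' using lam measurable_compose[OF measurable_fst fm] by measurable
  have fin: "(\<integral>\<^sup>+y. \<integral>\<^sup>+t. ennreal \<bar>?G y t\<bar> \<partial>hl \<partial>hl) < \<infinity>"
  proof -
    have "(\<integral>\<^sup>+y. \<integral>\<^sup>+t. ennreal \<bar>?G y t\<bar> \<partial>hl \<partial>hl) = (\<integral>\<^sup>+y. ennreal (cP * \<bar>K x y * f y\<bar>) \<partial>hl)"
    proof (rule nn_integral_cong_AE)
      show "AE y in hl. (\<integral>\<^sup>+t. ennreal \<bar>?G y t\<bar> \<partial>hl) = ennreal (cP * \<bar>K x y * f y\<bar>)"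
        using AE_hl_neq[of x] AE_space
      proof eventually_elim
        case (elim y)
        then have y: "y > 0" "x \<noteq> y" by auto
        have "(\<integral>\<^sup>+t. ennreal \<bar>?G y t\<bar> \<partial>hl) = (\<integral>\<^sup>+t. ennreal (\<bar>f y\<bar> * (pform t x y / t powr (1 - 2 * \<sigma>))) \<partial>hl)"
        proof (rule nn_integral_cong)
          fix t assume "t \<in> space hl"
          then have "pform t x y \<ge> 0" by (intro P_nonneg) simp
          then have "\<bar>?G y t\<bar> = \<bar>f y\<bar> * (pform t x y / t powr (1 - 2 * \<sigma>))"
            by (simp only: abs_divide abs_mult[of "pform t x y" "f y"] abs_of_nonneg powr_ge_zero times_divide_eq_right mult.commute[of "\<bar>f y\<bar>"])
          then show "ennreal \<bar>?G y t\<bar> = ennreal (\<bar>f y\<bar> * (pform t x y / t powr (1 - 2 * \<sigma>)))" by (simp only:)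
        qed
        also have "\<dots> = ennreal (\<integral>t. \<bar>f y\<bar> * (pform t x y / t powr (1 - 2 * \<sigma>)) \<partial>hl)"
        proof (rule nn_integral_eq_integral)
          show "integrable hl (\<lambda>t. \<bar>f y\<bar> * (pform t x y / t powr (1 - 2 * \<sigma>)))"
            by (intro integrable_mult_right P_t_integrable[OF x y])
          show "AE t in hl. 0 \<le> \<bar>f y\<bar> * (pform t x y / t powr (1 - 2 * \<sigma>))"
          proof (rule AE_I2)
            fix t assume "t \<in> space hl"
            then have "pform t x y \<ge> 0" by (intro P_nonneg) simp
            then show "0 \<le> \<bar>f y\<bar> * (pform t x y / t powr (1 - 2 * \<sigma>))"
              by (rule mult_nonneg_nonneg[OF abs_ge_zero divide_nonneg_nonneg[OF _ powr_ge_zero]])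
          qed
        qed
        also have "(\<integral>t. \<bar>f y\<bar> * (pform t x y / t powr (1 - 2 * \<sigma>)) \<partial>hl) = \<bar>f y\<bar> * (cP * K x y)"
          using P_t_integral[OF x y] by (subst integral_mult_right_zero) (simp only:)
        finally show ?case using K_nonneg[of x y] by (simp add: abs_mult mult_ac)
      qed
    qed
    also have "\<dots> < \<infinity>"
    proof -
      have "integrable hl (\<lambda>y. cP * \<bar>K x y * f y\<bar>)" using iK by (intro integrable_mult_right integrable_abs)
      then show ?thesis by (rule integrable_nn_less_top)
    qed
    finally show ?thesis .
  qed
  note F = fubini[OF sigma_finite_hl sigma_finite_hl m fin]
  have op: "poisson_op lam t f x / t powr (1 - 2 * \<sigma>) = (\<integral>y. ?G y t \<partial>hl)" if "t \<in> space hl" for t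
  proof -
    have "poisson_op lam t f x = (\<integral>y. pform t x y * f y \<partial>hl)"
      unfolding poisson_op_def set_integral_hl using that pk[of t] by (intro Bochner_Integration.integral_cong refl) auto
    then show ?thesis by simp
  qed
  show "integrable hl (\<lambda>t. poisson_op lam t f x / t powr (1 - 2 * \<sigma>))"
    by (subst Bochner_Integration.integrable_cong[OF refl op], assumption) (rule F(3))
  have "(\<integral>t. poisson_op lam t f x / t powr (1 - 2 * \<sigma>) \<partial>hl) = (\<integral>y. \<integral>t. ?G y t \<partial>hl \<partial>hl)"
    unfolding F(4) by (intro Bochner_Integration.integral_cong refl op)
  also have "\<dots> = (\<integral>y. cP * (K x y * f y) \<partial>hl)"
  proof (rule integral_cong_AE)
    show "AE y in hl. (\<integral>t. ?G y t \<partial>hl) = cP * (K x y * f y)"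
      using AE_hl_neq[of x] AE_space
    proof eventually_elim
      case (elim y)
      then have y: "y > 0" "x \<noteq> y" by auto
      have "(\<integral>t. ?G y t \<partial>hl) = (\<integral>t. f y * (pform t x y / t powr (1 - 2 * \<sigma>)) \<partial>hl)"
        by (intro Bochner_Integration.integral_cong refl) (simp only: times_divide_eq_right mult.commute[of "f y"])
      also have "\<dots> = f y * (cP * K x y)"
        using P_t_integral[OF x y] by (subst integral_mult_right_zero) (simp only:)
      finally show ?case by (simp only: mult_ac)
    qed
    show "(\<lambda>y. \<integral>t. ?G y t \<partial>hl) \<in> borel_measurable hl" using F(2) by (rule borel_measurable_integrable)
  qed measurable
  also have "\<dots> = cP * U f x" unfolding U_def by (rule integral_mult_right_zero)
  finally show "bessel_neg_power lam \<sigma> f x = cP / Gamma (2 * \<sigma>) * U f x"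
    unfolding bessel_neg_power_def set_integral_hl by simp
qed

lemma neg_power_bound:
  "\<exists>C>0. \<forall>f\<in>holder_space \<alpha>.
     bessel_neg_power_defined lam \<sigma> f \<and>
     bessel_neg_power lam \<sigma> f \<in> holder_space (\<alpha> + 2 * \<sigma>) \<and>
     holder_norm (\<alpha> + 2 * \<sigma>) (bessel_neg_power lam \<sigma> f) \<le> C * holder_norm \<alpha> f"
proof -
  have t2: "2 * \<sigma> > 0" using \<sigma> by simp
  obtain C where C: "C \<ge> 0" "\<And>N f. Hol N \<alpha> f \<Longrightarrow> Hol (C * N) (\<alpha> + 2 * \<sigma>) (U f)"
    using U_Hol[OF t2] by blast
  let ?c = "cP / Gamma (2 * \<sigma>)"
  have H: "Hol (\<bar>?c\<bar> * (C * N)) (\<alpha> + 2 * \<sigma>) (bessel_neg_power lam \<sigma> f)" if f: "Hol N \<alpha> f" for N f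
  proof -
    have eq: "bessel_neg_power lam \<sigma> f x = ?c * U f x" if "x > 0" for x by (rule neg_power_eq[OF f that])
    note h = C(2)[OF f]
    show ?thesis unfolding Hol_def
    proof (intro conjI allI impI)
      show "0 \<le> \<bar>?c\<bar> * (C * N)" using Hol_nonneg[OF h] by simp
      fix x :: real assume x: "x > 0"
      show "\<bar>bessel_neg_power lam \<sigma> f x\<bar> \<le> \<bar>?c\<bar> * (C * N) * x powr (\<alpha> + 2 * \<sigma>)"
        using mult_left_mono[OF Hol_bound[OF h x], of "\<bar>?c\<bar>"] by (simp only: eq[OF x] abs_mult mult.assoc abs_ge_zero)
      fix y :: real assume y: "y > 0"
      show "\<bar>bessel_neg_power lam \<sigma> f x - bessel_neg_power lam \<sigma> f y\<bar> \<le> \<bar>?c\<bar> * (C * N) * \<bar>x - y\<bar> powr (\<alpha> + 2 * \<sigma>)"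
        using mult_left_mono[OF Hol_diff[OF h x y], of "\<bar>?c\<bar>"]
        by (simp only: eq[OF x] eq[OF y] right_diff_distrib[symmetric] abs_mult mult.assoc abs_ge_zero)
    qed
  qed
  show ?thesis
  \<comment> \<open>The 2 accounts for the two suprema in the norm; the added 1 makes the constant
    strictly positive in every case.\<close>
  proof (intro exI[of _ "2 * (\<bar>?c\<bar> * C) + 1"] conjI ballI)
    show "2 * (\<bar>?c\<bar> * C) + 1 > 0" using C(1) by (intro add_nonneg_pos) auto
    fix f assume "f \<in> holder_space \<alpha>"
    then have f: "Hol (holder_norm \<alpha> f) \<alpha> f" by (rule holder_space_Hol)
    show "bessel_neg_power_defined lam \<sigma> f"
      unfolding bessel_neg_power_defined_def set_integrable_hl
      using poisson_f_integrable[OF f] neg_power_integrable[OF f] by auto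
    have ab: "\<alpha> + 2 * \<sigma> > 0" using \<alpha> \<sigma> by simp
    show "bessel_neg_power lam \<sigma> f \<in> holder_space (\<alpha> + 2 * \<sigma>)" by (rule Hol_holder_space(1)[OF H[OF f] ab])
    have "holder_norm (\<alpha> + 2 * \<sigma>) (bessel_neg_power lam \<sigma> f) \<le> 2 * (\<bar>?c\<bar> * (C * holder_norm \<alpha> f))"
      by (rule Hol_holder_space(2)[OF H[OF f] ab])
    also have "\<dots> \<le> (2 * (\<bar>?c\<bar> * C) + 1) * holder_norm \<alpha> f"
      using Hol_nonneg[OF f] by (simp add: distrib_right)
    finally show "holder_norm (\<alpha> + 2 * \<sigma>) (bessel_neg_power lam \<sigma> f) \<le> (2 * (\<bar>?c\<bar> * C) + 1) * holder_norm \<alpha> f" .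
  qed
qed

end

subsection \<open>Gaussian integrals\<close>

lemma hl_absolutely_integrable:
  fixes f :: "real \<Rightarrow> real"
  assumes [measurable]: "f \<in> borel_measurable borel" and f: "f absolutely_integrable_on {0<..}"
  shows "integrable hl f" "integral\<^sup>L hl f = integral {0<..} f"
proof -
  have "set_integrable lborel {0<..} f"
    using f unfolding set_integrable_def by (subst (asm) integrable_completion) auto
  then show "integrable hl f" "integral\<^sup>L hl f = integral {0<..} f"
    using set_borel_integral_eq_integral(2)[of "{0<..}" f] by (simp_all add: set_integrable_hl set_integral_hl)
qed

text \<open>Substitution u = t y^2 in the Gamma integral, left in the raw form in which the change
  of variables delivers it.\<close>

lemma gauss_abs:
  fixes b t :: real
  assumes b: "b > 0" and t: "t > 0"
  shows "(\<lambda>y. \<bar>2 * t * y\<bar> * ((t * y\<^sup>2) powr (b - 1) / exp (t * y\<^sup>2))) absolutely_integrable_on {0<..}"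
    "integral {0<..} (\<lambda>y. \<bar>2 * t * y\<bar> * ((t * y\<^sup>2) powr (b - 1) / exp (t * y\<^sup>2))) = Gamma b"
proof -
  let ?f = "\<lambda>u::real. u powr (b - 1) / exp u" and ?g = "\<lambda>y::real. t * y\<^sup>2"
  have hi: "(?f has_integral Gamma b) {0<..}"
  proof -
    \<comment> \<open>The endpoint makes no difference: \<open>powr\<close> with base 0 is
      0.\<close>
    have "(\<lambda>x::real. if x \<in> {0..} then ?f x else 0) = (\<lambda>x. if x \<in> {0<..} then ?f x else 0)"
      by (rule ext) auto
    then show ?thesis
      using Gamma_integral_real[OF b] has_integral_restrict_UNIV[of "{0..}" ?f] has_integral_restrict_UNIV[of "{0<..}" ?f] by simp
  qed
  have ai: "?f absolutely_integrable_on {0<..}"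
    using hi by (intro nonnegative_absolutely_integrable_1) (auto simp: has_integral_integrable)
  have im: "?g ` {0<..} = {0<..}"
  proof (intro equalityI subsetI)
    fix u :: real assume "u \<in> {0<..}"
    then have "u = ?g (sqrt (u / t))" "sqrt (u / t) \<in> {0<..}" using t by auto
    then show "u \<in> ?g ` {0<..}" by blast
  qed (use t in auto)
  have "(\<lambda>y. \<bar>2 * t * y\<bar> * ?f (?g y)) absolutely_integrable_on {0<..} \<and> integral {0<..} (\<lambda>y. \<bar>2 * t * y\<bar> * ?f (?g y)) = Gamma b
     \<longleftrightarrow> ?f absolutely_integrable_on (?g ` {0<..}) \<and> integral (?g ` {0<..}) ?f = Gamma b"
  proof (rule has_absolute_integral_change_of_variables_1')
    show "inj_on ?g {0<..}" using t by (auto intro!: inj_onI simp: power2_eq_iff_nonneg)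
    fix x :: real assume "x \<in> {0<..}"
    show "(?g has_field_derivative 2 * t * x) (at x within {0<..})" by (auto intro!: derivative_eq_intros)
  qed simp
  then show "(\<lambda>y. \<bar>2 * t * y\<bar> * ((t * y\<^sup>2) powr (b - 1) / exp (t * y\<^sup>2))) absolutely_integrable_on {0<..}"
    "integral {0<..} (\<lambda>y. \<bar>2 * t * y\<bar> * ((t * y\<^sup>2) powr (b - 1) / exp (t * y\<^sup>2))) = Gamma b"
    unfolding im using ai hi by (auto simp: integral_unique)
qed

lemma
  fixes b t :: real
  assumes b: "b > 0" and t: "t > 0"
  shows gauss_integrable: "integrable hl (\<lambda>y. y powr (2 * b - 1) * exp (- t * y\<^sup>2))"
    and gauss_integral: "(\<integral>y. y powr (2 * b - 1) * exp (- t * y\<^sup>2) \<partial>hl) = Gamma b / 2 * t powr (- b)"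
proof -
  let ?h = "\<lambda>y. \<bar>2 * t * y\<bar> * ((t * y\<^sup>2) powr (b - 1) / exp (t * y\<^sup>2))"
  have i: "integrable hl ?h" and I: "integral\<^sup>L hl ?h = Gamma b"
    using hl_absolutely_integrable[OF _ gauss_abs(1)[OF b t]] gauss_abs(2)[OF b t] by auto
  have eq: "y powr (2 * b - 1) * exp (- t * y\<^sup>2) = t powr (- b) / 2 * ?h y" if "y \<in> space hl" for y
  proof -
    have y: "y > 0" using that by simp
    have "(t * y\<^sup>2) powr (b - 1) = t powr (b - 1) * (y powr 2) powr (b - 1)" using y by (simp add: powr_mult)
    also have "(y powr 2) powr (b - 1) = y powr (2 * (b - 1))" by (rule powr_powr)
    also have "\<dots> = y powr (2 * b - 1) / y" using y powr_diff[of y "2 * b - 1" 1] by (simp add: algebra_simps)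
    also have "t powr (b - 1) = t powr b / t" using t by (simp add: powr_diff)
    finally have "(t * y\<^sup>2) powr (b - 1) = t powr b / t * (y powr (2 * b - 1) / y)" .
    then have "?h y = 2 * t * y * (t powr b / t * (y powr (2 * b - 1) / y) * exp (- t * y\<^sup>2))" using y t by (simp add: exp_minus divide_inverse)
    also have "\<dots> = 2 * t powr b * (y powr (2 * b - 1) * exp (- t * y\<^sup>2))" using y t by simp
    finally show ?thesis using t by (simp add: powr_minus)
  qed
  show "integrable hl (\<lambda>y. y powr (2 * b - 1) * exp (- t * y\<^sup>2))"
    by (subst Bochner_Integration.integrable_cong[OF refl eq], assumption) (intro integrable_mult_right i)
  have "(\<integral>y. y powr (2 * b - 1) * exp (- t * y\<^sup>2) \<partial>hl) = t powr (- b) / 2 * integral\<^sup>L hl ?h"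
    by (subst Bochner_Integration.integral_cong[OF refl eq], assumption) (rule integral_mult_right_zero)
  then show "(\<integral>y. y powr (2 * b - 1) * exp (- t * y\<^sup>2) \<partial>hl) = Gamma b / 2 * t powr (- b)" unfolding I by simp
qed

section \<open>Laguerre polynomials and the moments of the heat kernel\<close>

lemma powr_minus_add_nat:
  fixes t :: real
  assumes "t > 0"
  shows "t powr (- (a + real k)) = t powr (- a) / t ^ k"
proof -
  have "- (a + real k) = - a - real k" by simp
  then show ?thesis using assms by (simp only: powr_diff powr_realpow)
qed

text \<open>In terms of Laguerre polynomials, this is \<open>k! L\<^sub>k\<close> with parameter \<open>c - 1\<close> at \<open>- x\<close>.\<close>

definition lag :: "real \<Rightarrow> nat \<Rightarrow> real \<Rightarrow> real" where
  "lag c k x = (\<Sum>n\<le>k. real (k choose n) * x ^ n * pochhammer (c + real n) (k - n))"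

text \<open>Pascal's rule splits the binomial coefficient. In one part the last factor of the
  Pochhammer symbol is c + k; in the other the index shift yields x and the parameter c + 1.\<close>

lemma lag_Suc: "lag c (Suc k) x = (c + real k) * lag c k x + x * lag (c + 1) k x"
proof -
  have step: "real (Suc k choose Suc n) * x ^ Suc n * pochhammer (c + real (Suc n)) (k - n) =
     (c + real k) * (real (k choose Suc n) * x ^ Suc n * pochhammer (c + real (Suc n)) (k - Suc n)) +
     x * (real (k choose n) * x ^ n * pochhammer (c + 1 + real n) (k - n))" if "n \<le> k" for n
  proof (cases "n = k")
    case False
    then have "k - n = Suc (k - Suc n)" using that by simp
    then have "pochhammer (c + real (Suc n)) (k - n) = pochhammer (c + real (Suc n)) (k - Suc n) * (c + real (Suc n) + real (k - Suc n))"
      by (simp only: pochhammer_Suc)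
    moreover have "real (Suc n) + real (k - Suc n) = real k" using that False by simp
    ultimately have 1: "pochhammer (c + real (Suc n)) (k - n) = pochhammer (c + real (Suc n)) (k - Suc n) * (c + real k)"
      by (simp add: algebra_simps)
    have 2: "c + 1 + real n = c + real (Suc n)" by simp
    show ?thesis unfolding 2 unfolding 1 by (simp add: algebra_simps)
  qed simp
  have "lag c (Suc k) x = pochhammer c (Suc k) + (\<Sum>n\<le>k. real (Suc k choose Suc n) * x ^ Suc n * pochhammer (c + real (Suc n)) (k - n))"
    unfolding lag_def by (subst sum.atMost_Suc_shift) simp
  also have "\<dots> = pochhammer c (Suc k) + ((c + real k) * (\<Sum>n\<le>k. real (k choose Suc n) * x ^ Suc n * pochhammer (c + real (Suc n)) (k - Suc n)) + x * lag (c + 1) k x)"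
    unfolding lag_def sum_distrib_left sum.distrib[symmetric] by (intro arg_cong2[where f="(+)"] sum.cong refl step) auto
  also have "(\<Sum>n\<le>k. real (k choose Suc n) * x ^ Suc n * pochhammer (c + real (Suc n)) (k - Suc n)) = lag c k x - pochhammer c k"
  proof -
    have "lag c k x + real (k choose Suc k) * x ^ Suc k * pochhammer (c + real (Suc k)) (k - Suc k) =
       (\<Sum>n\<le>Suc k. real (k choose n) * x ^ n * pochhammer (c + real n) (k - n))"
      unfolding lag_def by simp
    also have "\<dots> = pochhammer c k + (\<Sum>n\<le>k. real (k choose Suc n) * x ^ Suc n * pochhammer (c + real (Suc n)) (k - Suc n))"
      by (subst sum.atMost_Suc_shift) simp
    finally have "lag c k x + real (k choose Suc k) * x ^ Suc k * pochhammer (c + real (Suc k)) (k - Suc k) =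
      pochhammer c k + (\<Sum>n\<le>k. real (k choose Suc n) * x ^ Suc n * pochhammer (c + real (Suc n)) (k - Suc n))" .
    moreover have "real (k choose Suc k) = 0" by (simp add: binomial_eq_0)
    ultimately show ?thesis by simp
  qed
  finally show ?thesis by (simp add: pochhammer_Suc algebra_simps)
qed

text \<open>Kummer's transformation in a terminating case: the left side is a multiple of 1F1(c + k;
  c; x), hence exp(x) times a polynomial. The induction splits the new factor c + j + k into c + k
  and j, and the j is absorbed by an index shift to c + 1.\<close>

lemma lag_sums: "(\<lambda>j. x ^ j / fact j * pochhammer (c + real j) k) sums (exp x * lag c k x)"
proof (induction k arbitrary: c)
  case 0
  have "(\<lambda>j. x ^ j / fact j) sums exp x" using exp_converges[of x] by (simp add: divide_inverse mult.commute)
  then show ?case by (simp add: lag_def)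
next
  case (Suc k)
  let ?a = "\<lambda>c j. x ^ j / fact j * pochhammer (c + real j) k"
  have "(\<lambda>j. x * ?a (c + 1) j) sums (x * (exp x * lag (c + 1) k x))" by (intro sums_mult Suc)
  moreover have "x * ?a (c + 1) j = real (Suc j) * ?a c (Suc j)" for j
  proof -
    have 1: "c + 1 + real j = c + real (Suc j)" by simp
    have "x ^ Suc j / fact (Suc j) * real (Suc j) = x * (x ^ j / fact j)"
      by (simp add: field_simps del: of_nat_Suc)
    then have 2: "real (Suc j) * (x ^ Suc j / fact (Suc j)) = x * (x ^ j / fact j)" by (simp only: mult.commute)
    have "real (Suc j) * ?a c (Suc j) = real (Suc j) * (x ^ Suc j / fact (Suc j)) * pochhammer (c + real (Suc j)) k"
      by (simp only: mult.assoc)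
    then show ?thesis unfolding 1 unfolding 2 by (simp only: mult.assoc)
  qed
  ultimately have "(\<lambda>j. real (Suc j) * ?a c (Suc j)) sums (x * (exp x * lag (c + 1) k x))" by (simp only:)
  then have "(\<lambda>j. real j * ?a c j) sums (x * (exp x * lag (c + 1) k x))" by (subst (asm) sums_Suc_iff) simp
  from sums_add[OF sums_mult[OF Suc, of "c + real k"] this]
  have "(\<lambda>j. (c + real k) * ?a c j + real j * ?a c j) sums (exp x * lag c (Suc k) x)"
    unfolding lag_Suc by (simp add: algebra_simps)
  moreover have "(c + real k) * ?a c j + real j * ?a c j = x ^ j / fact j * pochhammer (c + real j) (Suc k)" for j
  proof -
    have "(c + real k) * ?a c j + real j * ?a c j = ?a c j * (c + real j + real k)" by (simp only: distrib_right distrib_left mult.commute)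
    then show ?thesis by (simp only: pochhammer_Suc mult.assoc)
  qed
  ultimately show ?case by (simp only:)
qed

text \<open>Termwise integration against Gaussian moments:
  \<open>Gamma (c + real j + real k)\<close> times \<open>rGamma (c + real j)\<close> is the
  Pochhammer symbol of \<open>lag_sums\<close>. Replacing w by |w| gives the absolute integrals
  needed for the exchange. Positive w serves the heat moments, negative w Weber's integral.\<close>

lemma
  fixes lam t w :: real
  assumes lam: "lam > 0" and t: "t > 0"
  defines "c \<equiv> lam + 1 / 2"
  shows gauss_besF_integrable: "integrable hl (\<lambda>y. y powr (2 * lam + 2 * real k) * exp (- t * y\<^sup>2) * besF c (w * y\<^sup>2))"
    and gauss_besF_integral: "(\<integral>y. y powr (2 * lam + 2 * real k) * exp (- t * y\<^sup>2) * besF c (w * y\<^sup>2) \<partial>hl) =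
      t powr (- c - real k) / 2 * (exp (w / t) * lag c k (w / t))"
proof -
  have c: "c > 1 / 2" using lam by (simp add: c_def)
  let ?f = "\<lambda>j y. y powr (2 * lam + 2 * real k) * exp (- t * y\<^sup>2) * (rGamma (c + real j) / fact j * (w * y\<^sup>2) ^ j)"
  let ?I = "\<lambda>w j. t powr (- c - real k) / 2 * ((w / t) ^ j / fact j * pochhammer (c + real j) k)"
  have eq: "?f j y = rGamma (c + real j) / fact j * w ^ j * (y powr (2 * (c + real j + real k) - 1) * exp (- t * y\<^sup>2))" if "y \<in> space hl" for j y
  proof -
    have y: "y > 0" using that by simp
    have "(w * y\<^sup>2) ^ j = w ^ j * y powr (2 * real j)"
      using y powr_realpow[of y "2 * j"] by (simp add: power_mult_distrib power_mult)
    moreover have "2 * (c + real j + real k) - 1 = (2 * lam + 2 * real k) + 2 * real j" by (simp add: c_def)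
    ultimately show ?thesis by (simp only: powr_add) simp
  qed
  have pos: "c + real j + real k > 0" for j using c by simp
  have fi: "integrable hl (?f j)" for j
    by (subst Bochner_Integration.integrable_cong[OF refl eq], assumption) (intro integrable_mult_right gauss_integrable pos t)
  have val: "rGamma (c + real j) / fact j * v ^ j * (Gamma (c + real j + real k) / 2 * t powr (- (c + real j + real k))) = ?I v j" for j v
  proof -
    have cj: "c + real j > 0" using c by simp
    have r1: "rGamma (c + real j) = rGamma (c + real j + real k) * pochhammer (c + real j) k"
      using rGamma_shift[OF cj, of k] pochhammer_pos[OF cj, of k] by simp
    have r2: "rGamma (c + real j + real k) * Gamma (c + real j + real k) = 1"
      using Gamma_real_pos[OF pos[of j]] by (simp add: rGamma_inverse_Gamma)
    have "rGamma (c + real j) * Gamma (c + real j + real k) = (rGamma (c + real j + real k) * Gamma (c + real j + real k)) * pochhammer (c + real j) k"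
      unfolding r1 by (simp only: mult_ac)
    then have gg: "rGamma (c + real j) * Gamma (c + real j + real k) = pochhammer (c + real j) k"
      unfolding r2 by simp
    have tt: "t powr (- (c + real j + real k)) = t powr (- c - real k) / t ^ j"
      using powr_minus_add_nat[OF t, of "c + real k" j] by (simp add: algebra_simps)
    have "rGamma (c + real j) / fact j * v ^ j * (Gamma (c + real j + real k) / 2 * t powr (- (c + real j + real k))) =
        (rGamma (c + real j) * Gamma (c + real j + real k)) * (t powr (- c - real k) / 2 * (v ^ j / t ^ j / fact j))"
      unfolding tt by (simp only: mult_ac times_divide_eq_right times_divide_eq_left divide_divide_eq_left)
    also have "\<dots> = pochhammer (c + real j) k * (t powr (- c - real k) / 2 * (v ^ j / t ^ j / fact j))"
      by (simp only: gg)
    finally show ?thesis by (simp only: power_divide mult_ac)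
  qed
  have fI: "integral\<^sup>L hl (?f j) = ?I w j" for j
  proof -
    have "integral\<^sup>L hl (?f j) = rGamma (c + real j) / fact j * w ^ j * (Gamma (c + real j + real k) / 2 * t powr (- (c + real j + real k)))"
      by (subst Bochner_Integration.integral_cong[OF refl eq], assumption) (simp only: integral_mult_right_zero gauss_integral[OF pos t])
    then show ?thesis unfolding val .
  qed
  have nI: "(\<integral>y. norm (?f j y) \<partial>hl) = ?I \<bar>w\<bar> j" for j
  proof -
    have "(\<integral>y. norm (?f j y) \<partial>hl) = (\<integral>y. rGamma (c + real j) / fact j * \<bar>w\<bar> ^ j * (y powr (2 * (c + real j + real k) - 1) * exp (- t * y\<^sup>2)) \<partial>hl)"
    proof (rule Bochner_Integration.integral_cong[OF refl])
      fix y assume y: "y \<in> space hl"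
      have "rGamma (c + real j) > 0" using c by (intro rGamma_real_pos) auto
      then show "norm (?f j y) = rGamma (c + real j) / fact j * \<bar>w\<bar> ^ j * (y powr (2 * (c + real j + real k) - 1) * exp (- t * y\<^sup>2))"
        unfolding eq[OF y] by (simp add: abs_mult power_abs)
    qed
    also have "\<dots> = rGamma (c + real j) / fact j * \<bar>w\<bar> ^ j * (Gamma (c + real j + real k) / 2 * t powr (- (c + real j + real k)))"
      by (simp only: integral_mult_right_zero gauss_integral[OF pos t])
    finally show ?thesis unfolding val .
  qed
  have s1: "AE y in hl. summable (\<lambda>j. norm (?f j y))"
  proof (rule AE_I2)
    fix y assume "y \<in> space hl"
    have "summable (\<lambda>j. y powr (2 * lam + 2 * real k) * exp (- t * y\<^sup>2) * \<bar>rGamma (c + real j) / fact j * (w * y\<^sup>2) ^ j\<bar>)"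
      using c by (intro summable_mult besF_summable_abs) simp
    then show "summable (\<lambda>j. norm (?f j y))" by (simp add: abs_mult)
  qed
  have s2: "summable (\<lambda>j. \<integral>y. norm (?f j y) \<partial>hl)"
    unfolding nI by (intro summable_mult sums_summable[OF lag_sums])
  have sum: "(\<Sum>j. ?f j y) = y powr (2 * lam + 2 * real k) * exp (- t * y\<^sup>2) * besF c (w * y\<^sup>2)" for y
    unfolding besF_def using c by (intro suminf_mult besF_summable) simp
  show "integrable hl (\<lambda>y. y powr (2 * lam + 2 * real k) * exp (- t * y\<^sup>2) * besF c (w * y\<^sup>2))"
    using integrable_suminf[OF fi s1 s2] unfolding sum .
  have "(\<lambda>j. integral\<^sup>L hl (?f j)) sums (\<integral>y. y powr (2 * lam + 2 * real k) * exp (- t * y\<^sup>2) * besF c (w * y\<^sup>2) \<partial>hl)"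
    using sums_integral[OF fi s1 s2] unfolding sum .
  moreover have "(\<lambda>j. integral\<^sup>L hl (?f j)) sums (t powr (- c - real k) / 2 * (exp (w / t) * lag c k (w / t)))"
    unfolding fI by (intro sums_mult lag_sums)
  ultimately show "(\<integral>y. y powr (2 * lam + 2 * real k) * exp (- t * y\<^sup>2) * besF c (w * y\<^sup>2) \<partial>hl) =
      t powr (- c - real k) / 2 * (exp (w / t) * lag c k (w / t))"
    by (rule sums_unique2)
qed

text \<open>As a function of y the heat kernel is y^lam times a Gaussian and \<open>besF\<close> of
  a multiple of y^2, so these moments are instances of \<open>gauss_besF_integral\<close>. The
  factor exp(x^2 / (4 t)) which that produces cancels the Gaussian in x.\<close>

lemma
  assumes lam: "lam > 0" and t: "t > 0" and x: "x > 0"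
  shows heat_moment_integrable: "integrable hl (\<lambda>y. heat_kernel lam t x y * y powr lam * y ^ (2 * m))"
    and heat_moment: "(\<integral>y. heat_kernel lam t x y * y powr lam * y ^ (2 * m) \<partial>hl) = x powr lam * (4 * t) ^ m * lag (lam + 1 / 2) m (x\<^sup>2 / (4 * t))"
proof -
  let ?c = "lam + 1 / 2" and ?w = "(x / (4 * t))\<^sup>2" and ?u = "1 / (4 * t)"
  let ?F = "t powr (- 1 / 2) * (x / (4 * t)) powr lam * exp (- x\<^sup>2 / (4 * t))"
  let ?g = "\<lambda>y. y powr (2 * lam + 2 * real m) * exp (- ?u * y\<^sup>2) * besF ?c (?w * y\<^sup>2)"
  have u: "?u > 0" using t by simp
  have eq: "heat_kernel lam t x y * y powr lam * y ^ (2 * m) = ?F * ?g y" if "y \<in> space hl" for y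
  proof -
    have y: "y > 0" using that by simp
    have 1: "(x * y / (4 * t)) powr lam = (x / (4 * t)) powr lam * y powr lam"
      using x y t by (simp add: powr_mult powr_divide)
    have 2: "(x * y / (4 * t))\<^sup>2 = ?w * y\<^sup>2" by (simp add: power_divide power_mult_distrib)
    have 3: "exp (- (x\<^sup>2 + y\<^sup>2) / (4 * t)) = exp (- x\<^sup>2 / (4 * t)) * exp (- ?u * y\<^sup>2)"
      by (simp add: exp_add[symmetric] add_divide_distrib diff_divide_distrib)
    have 4: "y powr lam * y powr lam * y ^ (2 * m) = y powr (2 * lam + 2 * real m)"
      using y powr_realpow[of y "2 * m"] powr_add[of y lam lam] by (simp add: powr_add)
    have "heat_kernel lam t x y * y powr lam * y ^ (2 * m) =
      t powr (- 1 / 2) * ((x / (4 * t)) powr lam * y powr lam) * besF ?c (?w * y\<^sup>2) * (exp (- x\<^sup>2 / (4 * t)) * exp (- ?u * y\<^sup>2)) * y powr lam * y ^ (2 * m)"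
      unfolding heat_kernel_eq[OF lam t x y] 1 2 3 ..
    also have "\<dots> = ?F * (y powr lam * y powr lam * y ^ (2 * m) * exp (- ?u * y\<^sup>2) * besF ?c (?w * y\<^sup>2))" by (simp only: mult_ac)
    finally show ?thesis unfolding 4 .
  qed
  show "integrable hl (\<lambda>y. heat_kernel lam t x y * y powr lam * y ^ (2 * m))"
    by (subst Bochner_Integration.integrable_cong[OF refl eq], assumption) (intro integrable_mult_right gauss_besF_integrable lam u)
  have "(\<integral>y. heat_kernel lam t x y * y powr lam * y ^ (2 * m) \<partial>hl) = ?F * (?u powr (- ?c - real m) / 2 * (exp (?w / ?u) * lag ?c m (?w / ?u)))"
    by (subst Bochner_Integration.integral_cong[OF refl eq], assumption) (simp only: integral_mult_right_zero gauss_besF_integral[OF lam u])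
  also have "?w / ?u = x\<^sup>2 / (4 * t)" using t by (simp add: power_divide power2_eq_square)
  also have "?F * (?u powr (- ?c - real m) / 2 * (exp (x\<^sup>2 / (4 * t)) * lag ?c m (x\<^sup>2 / (4 * t)))) =
     (t powr (- 1 / 2) * (x / (4 * t)) powr lam * ?u powr (- ?c - real m) / 2) * (exp (- x\<^sup>2 / (4 * t)) * exp (x\<^sup>2 / (4 * t))) * lag ?c m (x\<^sup>2 / (4 * t))"
    by (simp only: mult_ac times_divide_eq_right times_divide_eq_left)
  also have "exp (- x\<^sup>2 / (4 * t)) * exp (x\<^sup>2 / (4 * t)) = 1" by (simp add: exp_add[symmetric])
  also have "t powr (- 1 / 2) * (x / (4 * t)) powr lam * ?u powr (- ?c - real m) / 2 = x powr lam * (4 * t) ^ m"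
  proof -
    have "?u powr (- ?c - real m) = (4 * t) powr (lam + 1 / 2 + real m)"
    proof -
      have "?u = (4 * t) powr (-1)" using t by (simp add: powr_neg_one)
      then have "?u powr (- ?c - real m) = (4 * t) powr (-1 * (- ?c - real m))" by (simp only: powr_powr)
      also have "-1 * (- ?c - real m) = lam + 1 / 2 + real m" by simp
      finally show ?thesis .
    qed
    also have "\<dots> = (4 * t) powr lam * (4 * t) powr (1 / 2) * (4 * t) ^ m"
      using t powr_realpow[of "4 * t" m] by (simp only: powr_add)
    also have "(4 * t) powr (1 / 2) = 2 * t powr (1 / 2)"
      using t by (simp add: powr_half_sqrt real_sqrt_mult)
    finally have 1: "?u powr (- ?c - real m) = (4 * t) powr lam * (2 * t powr (1 / 2)) * (4 * t) ^ m" .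
    have 2: "(x / (4 * t)) powr lam = x powr lam / (4 * t) powr lam" using x t by (simp add: powr_divide)
    have 3: "t powr (- 1 / 2) * t powr (1 / 2) = 1" using t by (simp add: powr_add[symmetric])
    have "t powr (- 1 / 2) * (x powr lam / (4 * t) powr lam) * ((4 * t) powr lam * (2 * t powr (1 / 2)) * (4 * t) ^ m) / 2 =
      x powr lam * (4 * t) ^ m * (t powr (- 1 / 2) * t powr (1 / 2)) * ((4 * t) powr lam / (4 * t) powr lam)"
      by (simp only: mult_ac times_divide_eq_right times_divide_eq_left) simp
    then show ?thesis unfolding 1 2 3 using t by simp
  qed
  finally show "(\<integral>y. heat_kernel lam t x y * y powr lam * y ^ (2 * m) \<partial>hl) = x powr lam * (4 * t) ^ m * lag (lam + 1 / 2) m (x\<^sup>2 / (4 * t))"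
    by simp
qed

text \<open>These come from the moments m = 0, 1, 2. In the mean square of y^2 - x^2 the terms
  without a factor t cancel, so it is of order t as t tends to 0: the heat kernel concentrates at
  x.\<close>

lemma
  assumes lam: "lam > 0" and t: "t > 0" and x: "x > 0"
  defines "c \<equiv> lam + 1 / 2"
  shows heat_mass_integrable: "integrable hl (\<lambda>y. heat_kernel lam t x y * y powr lam)"
    and heat_mass: "(\<integral>y. heat_kernel lam t x y * y powr lam \<partial>hl) = x powr lam"
    and heat_variance_integrable: "integrable hl (\<lambda>y. heat_kernel lam t x y * y powr lam * (y\<^sup>2 - x\<^sup>2)\<^sup>2)"
    and heat_variance: "(\<integral>y. heat_kernel lam t x y * y powr lam * (y\<^sup>2 - x\<^sup>2)\<^sup>2 \<partial>hl) = x powr lam * (8 * t * x\<^sup>2 + 16 * t\<^sup>2 * (c * (c + 1)))"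
proof -
  note i = heat_moment_integrable[OF lam t x] and m = heat_moment[OF lam t x]
  show "integrable hl (\<lambda>y. heat_kernel lam t x y * y powr lam)" using i[of 0] by simp
  show "(\<integral>y. heat_kernel lam t x y * y powr lam \<partial>hl) = x powr lam" using m[of 0] by (simp add: lag_def)
  let ?g = "\<lambda>m y. heat_kernel lam t x y * y powr lam * y ^ (2 * m)"
  have eq: "heat_kernel lam t x y * y powr lam * (y\<^sup>2 - x\<^sup>2)\<^sup>2 = ?g 2 y - 2 * x\<^sup>2 * ?g 1 y + x ^ 4 * ?g 0 y" for y
    by (simp add: power2_eq_square power4_eq_xxxx algebra_simps)
  show "integrable hl (\<lambda>y. heat_kernel lam t x y * y powr lam * (y\<^sup>2 - x\<^sup>2)\<^sup>2)"
    unfolding eq by (intro Bochner_Integration.integrable_add Bochner_Integration.integrable_diff integrable_mult_right i)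
  have "(\<integral>y. heat_kernel lam t x y * y powr lam * (y\<^sup>2 - x\<^sup>2)\<^sup>2 \<partial>hl) = integral\<^sup>L hl (?g 2) - 2 * x\<^sup>2 * integral\<^sup>L hl (?g 1) + x ^ 4 * integral\<^sup>L hl (?g 0)"
    unfolding eq
    by (simp only: Bochner_Integration.integral_add[OF Bochner_Integration.integrable_diff[OF i integrable_mult_right[OF i]] integrable_mult_right[OF i]]
      Bochner_Integration.integral_diff[OF i integrable_mult_right[OF i]] integral_mult_right_zero)
  also have "\<dots> = x powr lam * ((4 * t)\<^sup>2 * lag c 2 (x\<^sup>2 / (4 * t)) - 2 * x\<^sup>2 * (4 * t) * lag c 1 (x\<^sup>2 / (4 * t)) + x ^ 4)"
    unfolding m c_def by (simp add: lag_def algebra_simps)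
  also have "(4 * t)\<^sup>2 * lag c 2 (x\<^sup>2 / (4 * t)) - 2 * x\<^sup>2 * (4 * t) * lag c 1 (x\<^sup>2 / (4 * t)) + x ^ 4 = 8 * t * x\<^sup>2 + 16 * t\<^sup>2 * (c * (c + 1))"
  proof -
    \<comment> \<open>In terms of A and t both sides are polynomials, so the cancellation is pure
      algebra.\<close>
    define A where "A = x\<^sup>2 / (4 * t)"
    have x2: "x\<^sup>2 = 4 * t * A" using t by (simp add: A_def)
    have x4: "x ^ 4 = (4 * t * A)\<^sup>2" unfolding x2[symmetric] by simp
    have l1: "lag c 1 A = c + A" by (simp add: lag_def)
    have l2: "lag c 2 A = c * (c + 1) + 2 * A * (c + 1) + A\<^sup>2"
      unfolding lag_def numeral_2_eq_2 by (simp add: pochhammer_Suc pochhammer_rec algebra_simps)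
    show ?thesis unfolding A_def[symmetric] l1 l2 unfolding x4 x2 by (simp add: power2_eq_square algebra_simps)
  qed
  finally show "(\<integral>y. heat_kernel lam t x y * y powr lam * (y\<^sup>2 - x\<^sup>2)\<^sup>2 \<partial>hl) = x powr lam * (8 * t * x\<^sup>2 + 16 * t\<^sup>2 * (c * (c + 1)))" .
qed

subsection \<open>Weber's second exponential integral\<close>

text \<open>The kernel of the Hankel transform with its power of z pulled out; the remaining factor
  is entire in z and bounded for real z.\<close>

definition ker_e :: "real \<Rightarrow> real \<Rightarrow> real" where
  "ker_e lam z = sqrt 2 * (z / 2) powr lam * besF (lam + 1 / 2) (- z\<^sup>2 / 4)"

lemma hankel_kernel_eq:
  assumes "lam > 0" "z > 0"
  shows "sqrt z * bessel_J (lam - 1 / 2) z = ker_e lam z"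
proof -
  have "sqrt z = sqrt 2 * (z / 2) powr (1 / 2)" using assms by (simp add: powr_half_sqrt real_sqrt_mult[symmetric])
  moreover have "(z / 2) powr (1 / 2) * (z / 2) powr (lam - 1 / 2) = (z / 2) powr lam" by (simp add: powr_add[symmetric])
  ultimately show ?thesis unfolding bessel_J_eq[OF assms(2,1)] ker_e_def by simp
qed

lemma measurable_ker_e [measurable (raw)]:
  assumes "lam > 0" and [measurable]: "f \<in> borel_measurable M"
  shows "(\<lambda>x. ker_e lam (f x)) \<in> borel_measurable M"
proof -
  have [measurable]: "besF (lam + 1 / 2) \<in> borel_measurable borel" using assms by (intro measurable_besF) simp
  show ?thesis unfolding ker_e_def by measurable
qed

lemma ker_e_bound:
  assumes "lam > 0" "z > 0"
  shows "\<bar>ker_e lam z\<bar> \<le> sqrt 2 * rGamma (lam + 1 / 2) * z powr lam"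
proof -
  have "(z / 2) powr lam \<le> z powr lam" using assms by (intro powr_mono2) auto
  moreover have "\<bar>besF (lam + 1 / 2) (- z\<^sup>2 / 4)\<bar> \<le> rGamma (lam + 1 / 2)" using assms by (intro besF_neg_bound) simp
  ultimately have "sqrt 2 * ((z / 2) powr lam * \<bar>besF (lam + 1 / 2) (- z\<^sup>2 / 4)\<bar>) \<le> sqrt 2 * (z powr lam * rGamma (lam + 1 / 2))"
    by (intro mult_left_mono mult_mono) auto
  then show ?thesis unfolding ker_e_def by (simp add: abs_mult mult_ac)
qed

text \<open>Only the factor in z is expanded; the Bessel factor in x is kept and bounded by
  \<open>rGamma\<close>, which gives the domination. Termwise integration produces the polynomials
  \<open>lag\<close> at - A, and their sum rearranges into a product of two series, with A = x^2 /
  (4 t) and B = z^2 / (4 t).\<close>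

lemma weber:
  assumes lam: "lam > 0" and t: "t > 0" and xz: "x > 0" "z > 0"
  shows "(\<integral>y. ker_e lam (x * y) * exp (- t * y\<^sup>2) * ker_e lam (z * y) \<partial>hl) = heat_kernel lam t x z"
proof -
  let ?c = "lam + 1 / 2"
  define A B where "A = x\<^sup>2 / (4 * t)" and "B = z\<^sup>2 / (4 * t)"
  have c: "?c > 1 / 2" using lam by simp
  let ?h = "\<lambda>k y. y powr (2 * lam + 2 * real k) * exp (- t * y\<^sup>2) * besF ?c ((- x\<^sup>2 / 4) * y\<^sup>2)"
  let ?r = "\<lambda>k. rGamma (?c + real k) / fact k"
  let ?f = "\<lambda>k y. ?r k * (- z\<^sup>2 / 4) ^ k * ?h k y"
  have hi: "integrable hl (?h k)" for k by (rule gauss_besF_integrable[OF lam t])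
  have fi: "integrable hl (?f k)" for k by (intro integrable_mult_right hi)
  have f_eq: "?f k y = y powr (2 * lam) * exp (- t * y\<^sup>2) * besF ?c ((- x\<^sup>2 / 4) * y\<^sup>2) * (?r k * ((- z\<^sup>2 / 4) * y\<^sup>2) ^ k)" if "y \<in> space hl" for k y
  proof -
    have "y powr (2 * lam + 2 * real k) = y powr (2 * lam) * (y\<^sup>2) ^ k"
      using that powr_realpow[of y "2 * k"] by (simp add: powr_add power_mult)
    moreover have "((- z\<^sup>2 / 4) * y\<^sup>2) ^ k = (- z\<^sup>2 / 4) ^ k * (y\<^sup>2) ^ k" by (rule power_mult_distrib)
    ultimately show ?thesis by (simp only: mult_ac)
  qed
  have s1: "AE y in hl. summable (\<lambda>k. norm (?f k y))"
  proof (rule AE_I2)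
    fix y assume y: "y \<in> space hl"
    have "summable (\<lambda>k. \<bar>y powr (2 * lam) * exp (- t * y\<^sup>2) * besF ?c ((- x\<^sup>2 / 4) * y\<^sup>2)\<bar> * \<bar>?r k * ((- z\<^sup>2 / 4) * y\<^sup>2) ^ k\<bar>)"
      using c by (intro summable_mult besF_summable_abs) simp
    then show "summable (\<lambda>k. norm (?f k y))" unfolding f_eq[OF y] real_norm_def abs_mult[of "_ * besF _ _"] .
  qed
  have s2: "summable (\<lambda>k. \<integral>y. norm (?f k y) \<partial>hl)"
  proof (rule summable_comparison_test[OF exI[of _ 0]], intro allI impI)
    fix k
    have pk: "?c + real k > 0" using c by simp
    have "(\<integral>y. norm (?f k y) \<partial>hl) \<le> (\<integral>y. ?r k * (z\<^sup>2 / 4) ^ k * rGamma ?c * (y powr (2 * (?c + real k) - 1) * exp (- t * y\<^sup>2)) \<partial>hl)"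
    proof (rule integral_mono)
      show "integrable hl (\<lambda>y. norm (?f k y))" by (intro integrable_norm fi)
      show "integrable hl (\<lambda>y. ?r k * (z\<^sup>2 / 4) ^ k * rGamma ?c * (y powr (2 * (?c + real k) - 1) * exp (- t * y\<^sup>2)))"
        by (intro integrable_mult_right gauss_integrable pk t)
      fix y assume y: "y \<in> space hl"
      have "\<bar>besF ?c (- (x * y)\<^sup>2 / 4)\<bar> \<le> rGamma ?c" by (rule besF_neg_bound[OF c])
      then have b: "\<bar>besF ?c ((- x\<^sup>2 / 4) * y\<^sup>2)\<bar> \<le> rGamma ?c" by (simp add: power_mult_distrib)
      have "\<bar>?f k y\<bar> = ?r k * (z\<^sup>2 / 4) ^ k * (y powr (2 * lam + 2 * real k) * exp (- t * y\<^sup>2)) * \<bar>besF ?c ((- x\<^sup>2 / 4) * y\<^sup>2)\<bar>"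
        using rGamma_real_pos[OF pk] by (simp add: abs_mult power_abs)
      also have "\<dots> \<le> ?r k * (z\<^sup>2 / 4) ^ k * (y powr (2 * lam + 2 * real k) * exp (- t * y\<^sup>2)) * rGamma ?c"
        using rGamma_real_pos[OF pk] by (intro mult_left_mono b) auto
      also have "\<dots> = ?r k * (z\<^sup>2 / 4) ^ k * rGamma ?c * (y powr (2 * (?c + real k) - 1) * exp (- t * y\<^sup>2))"
        by (simp add: algebra_simps)
      finally show "norm (?f k y) \<le> ?r k * (z\<^sup>2 / 4) ^ k * rGamma ?c * (y powr (2 * (?c + real k) - 1) * exp (- t * y\<^sup>2))" by simp
    qed
    also have "\<dots> = ?r k * (z\<^sup>2 / 4) ^ k * rGamma ?c * (Gamma (?c + real k) / 2 * t powr (- (?c + real k)))"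
      by (simp only: integral_mult_right_zero gauss_integral[OF pk t])
    also have "\<dots> = rGamma ?c * t powr (- ?c) / 2 * (B ^ k / fact k)"
    proof -
      have 1: "rGamma (?c + real k) * Gamma (?c + real k) = 1" using Gamma_real_pos[OF pk] by (simp add: rGamma_inverse_Gamma)
      have "t powr (- (?c + real k)) = t powr (- ?c) / t ^ k"
        by (rule powr_minus_add_nat[OF t])
      then have "?r k * (z\<^sup>2 / 4) ^ k * rGamma ?c * (Gamma (?c + real k) / 2 * t powr (- (?c + real k))) =
        (rGamma (?c + real k) * Gamma (?c + real k)) * (rGamma ?c * t powr (- ?c) / 2 * ((z\<^sup>2 / 4) ^ k / t ^ k / fact k))"
        by (simp only: mult_ac times_divide_eq_right times_divide_eq_left divide_divide_eq_left)
      also have "(z\<^sup>2 / 4) ^ k / t ^ k = B ^ k" by (simp add: B_def power_divide power_mult_distrib)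
      finally show ?thesis unfolding 1 by simp
    qed
    finally show "norm (\<integral>y. norm (?f k y) \<partial>hl) \<le> rGamma ?c * t powr (- ?c) / 2 * (B ^ k / fact k)" by simp
  qed (intro summable_mult, use summable_exp_generic[of B] in \<open>simp add: divide_inverse mult.commute\<close>)
  let ?a = "\<lambda>n. rGamma (?c + real n) / fact n * (A * B) ^ n" and ?b = "\<lambda>m. (- B) ^ m / fact m"
  have fI: "integral\<^sup>L hl (?f k) = t powr (- ?c) / 2 * exp (- A) * (\<Sum>n\<le>k. ?a n * ?b (k - n))" for k
  proof -
    have w: "(- x\<^sup>2 / 4) / t = - A" by (simp add: A_def)
    have "integral\<^sup>L hl (?f k) = ?r k * (- z\<^sup>2 / 4) ^ k * (t powr (- ?c - real k) / 2 * (exp (- A) * lag ?c k (- A)))"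
      by (simp only: integral_mult_right_zero gauss_besF_integral[OF lam t] w)
    also have "\<dots> = t powr (- ?c) / 2 * exp (- A) * (?r k * (- B) ^ k * lag ?c k (- A))"
    proof -
      have "t powr (- ?c - real k) = t powr (- ?c) / t ^ k"
        using t by (simp add: powr_diff powr_realpow)
      moreover have "(- z\<^sup>2 / 4) ^ k = (- B) ^ k * t ^ k" unfolding power_mult_distrib[symmetric] using t by (simp add: B_def)
      ultimately have "?r k * (- z\<^sup>2 / 4) ^ k * (t powr (- ?c - real k) / 2 * (exp (- A) * lag ?c k (- A))) =
        (t ^ k / t ^ k) * (t powr (- ?c) / 2 * exp (- A) * (?r k * (- B) ^ k * lag ?c k (- A)))"
        by (simp only: mult_ac times_divide_eq_right times_divide_eq_left divide_divide_eq_left)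
      then show ?thesis using t by simp
    qed
    also have "?r k * (- B) ^ k * lag ?c k (- A) = (\<Sum>n\<le>k. ?a n * ?b (k - n))"
      unfolding lag_def sum_distrib_left
    proof (rule sum.cong[OF refl])
      fix n assume "n \<in> {..k}"
      then have n: "n \<le> k" by simp
      have cn: "?c + real n > 0" using c by simp
      have 1: "rGamma (?c + real k) * pochhammer (?c + real n) (k - n) = rGamma (?c + real n)"
      proof -
        have "?c + real k = ?c + real n + real (k - n)" using n by simp
        then have "rGamma (?c + real k) = rGamma (?c + real n) / pochhammer (?c + real n) (k - n)"
          using rGamma_shift[OF cn, of "k - n"] by (simp only:)
        then show ?thesis using pochhammer_pos[OF cn, of "k - n"] by simp
      qed
      have 2: "real (k choose n) / fact k = 1 / (fact n * fact (k - n))" using n by (simp add: binomial_fact)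
      have 3: "(- B) ^ k * (- A) ^ n = (A * B) ^ n * (- B) ^ (k - n)"
      proof -
        have a: "(- B) ^ k = (- B) ^ n * (- B) ^ (k - n)" using n by (simp add: power_add[symmetric])
        have b: "(- B) ^ n * (- A) ^ n = (A * B) ^ n" by (simp add: power_mult_distrib[symmetric] mult.commute)
        have "(- B) ^ k * (- A) ^ n = ((- B) ^ n * (- A) ^ n) * (- B) ^ (k - n)" unfolding a by (simp only: mult_ac)
        then show ?thesis unfolding b .
      qed
      have "?r k * (- B) ^ k * (real (k choose n) * (- A) ^ n * pochhammer (?c + real n) (k - n)) =
        (rGamma (?c + real k) * pochhammer (?c + real n) (k - n)) * (real (k choose n) / fact k) * ((- B) ^ k * (- A) ^ n)"
        by (simp only: mult_ac times_divide_eq_right times_divide_eq_left)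
      also have "\<dots> = ?a n * ?b (k - n)" unfolding 1 2 3 by simp
      finally show "?r k * (- B) ^ k * (real (k choose n) * (- A) ^ n * pochhammer (?c + real n) (k - n)) = ?a n * ?b (k - n)" .
    qed
    finally show ?thesis .
  qed
  \<comment> \<open>The inner sums are the Cauchy product of the series of \<open>besF\<close> at A
    B and of exp(- B).\<close>
  have "(\<lambda>k. \<Sum>n\<le>k. ?a n * ?b (k - n)) sums ((\<Sum>n. ?a n) * (\<Sum>m. ?b m))"
  proof (rule Cauchy_product_sums)
    show "summable (\<lambda>n. norm (?a n))" using besF_summable_abs[of ?c "A * B"] c by simp
    show "summable (\<lambda>m. norm (?b m))" using summable_norm_exp[of "- B"] by (simp add: divide_inverse mult.commute)
  qed
  moreover have "(\<Sum>n. ?a n) = besF ?c (A * B)" unfolding besF_def ..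
  moreover have "(\<Sum>m. ?b m) = exp (- B)" unfolding exp_def by (simp add: divide_inverse mult.commute)
  ultimately have S: "(\<lambda>k. integral\<^sup>L hl (?f k)) sums (t powr (- ?c) / 2 * exp (- A) * (besF ?c (A * B) * exp (- B)))"
    unfolding fI by (intro sums_mult) simp
  have "(\<integral>y. (\<Sum>k. ?f k y) \<partial>hl) = t powr (- ?c) / 2 * exp (- A) * (besF ?c (A * B) * exp (- B))"
    using sums_unique2[OF sums_integral[OF fi s1 s2] S] .
  moreover have "(\<integral>y. ker_e lam (x * y) * exp (- t * y\<^sup>2) * ker_e lam (z * y) \<partial>hl) = (\<integral>y. 2 * (x * z / 4) powr lam * (\<Sum>k. ?f k y) \<partial>hl)"
  proof (rule Bochner_Integration.integral_cong[OF refl])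
    fix y assume y: "y \<in> space hl"
    have "(\<Sum>k. ?f k y) = y powr (2 * lam) * exp (- t * y\<^sup>2) * besF ?c ((- x\<^sup>2 / 4) * y\<^sup>2) * besF ?c ((- z\<^sup>2 / 4) * y\<^sup>2)"
      unfolding f_eq[OF y] besF_def[of ?c "(- z\<^sup>2 / 4) * y\<^sup>2"] using c by (intro suminf_mult besF_summable) simp
    moreover have "- (x * y)\<^sup>2 / 4 = (- x\<^sup>2 / 4) * y\<^sup>2" "- (z * y)\<^sup>2 / 4 = (- z\<^sup>2 / 4) * y\<^sup>2" by (simp_all add: power_mult_distrib)
    moreover have "(x * y / 2) powr lam * (z * y / 2) powr lam = (x * z / 4) powr lam * y powr (2 * lam)"
    proof -
      have "(x * y / 2) powr lam * (z * y / 2) powr lam = ((x * z / 4) * (y * y)) powr lam"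
        by (simp add: powr_mult[symmetric] mult_ac)
      also have "\<dots> = (x * z / 4) powr lam * (y powr lam * y powr lam)" by (simp only: powr_mult)
      also have "y powr lam * y powr lam = y powr (2 * lam)" by (simp add: powr_add[symmetric])
      finally show ?thesis .
    qed
    moreover have "ker_e lam (x * y) * exp (- t * y\<^sup>2) * ker_e lam (z * y) =
       (sqrt 2 * sqrt 2) * ((x * y / 2) powr lam * (z * y / 2) powr lam) * exp (- t * y\<^sup>2) * besF ?c (- (x * y)\<^sup>2 / 4) * besF ?c (- (z * y)\<^sup>2 / 4)"
      unfolding ker_e_def by (simp only: mult_ac)
    ultimately show "ker_e lam (x * y) * exp (- t * y\<^sup>2) * ker_e lam (z * y) = 2 * (x * z / 4) powr lam * (\<Sum>k. ?f k y)"
      by (simp only:) simp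
  qed
  moreover have "2 * (x * z / 4) powr lam * (t powr (- ?c) / 2 * exp (- A) * (besF ?c (A * B) * exp (- B))) = heat_kernel lam t x z"
  proof -
    have 1: "(x * z / (4 * t))\<^sup>2 = A * B" by (simp add: A_def B_def power_divide power_mult_distrib power2_eq_square)
    have 2: "exp (- (x\<^sup>2 + z\<^sup>2) / (4 * t)) = exp (- A) * exp (- B)"
      unfolding A_def B_def by (simp add: exp_add[symmetric] add_divide_distrib diff_divide_distrib)
    have "- ?c = - 1 / 2 + - lam" by simp
    then have 3: "t powr (- ?c) = t powr (- 1 / 2) * t powr (- lam)" by (simp only: powr_add)
    have 4: "(x * z / (4 * t)) powr lam = (x * z / 4) powr lam * t powr (- lam)"
      using powr_mult[of "x * z / 4" "1 / t" lam] t by (simp add: powr_divide powr_minus divide_simps)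
    show ?thesis unfolding heat_kernel_eq[OF lam t xz] 1 2 3 4 by simp
  qed
  ultimately show ?thesis by (simp only: integral_mult_right_zero)
qed

subsection \<open>The test space\<close>

text \<open>Recursion through \<open>deriv f\<close> instead of the iterates of
  \<open>deriv\<close>: sums and products are then handled by induction with the functions
  generalised.\<close>

primrec smo :: "nat \<Rightarrow> (real \<Rightarrow> real) \<Rightarrow> bool" where
  "smo 0 f \<longleftrightarrow> True"
| "smo (Suc n) f \<longleftrightarrow> (\<forall>x>0. f field_differentiable at x) \<and> smo n (deriv f)"

lemma eventually_pos_nhds: "x > 0 \<Longrightarrow> (\<And>y. y > 0 \<Longrightarrow> P y) \<Longrightarrow> \<forall>\<^sub>F y in nhds x. P y" for x :: real
  using eventually_nhds_in_open[of "{0<..}" x] by (auto elim: eventually_mono)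

lemma deriv_cong_pos: "x > 0 \<Longrightarrow> (\<And>y. y > 0 \<Longrightarrow> f y = g y) \<Longrightarrow> deriv f x = deriv g x" for x :: real
  by (intro deriv_cong_ev eventually_pos_nhds) auto

lemma field_differentiable_cong_pos:
  fixes x :: real
  assumes "x > 0" "\<And>y. y > 0 \<Longrightarrow> f y = g y" "f field_differentiable at x"
  shows "g field_differentiable at x"
  using assms DERIV_cong_ev[OF refl eventually_pos_nhds[of x "\<lambda>y. f y = g y"] refl]
  unfolding field_differentiable_def by blast

lemma smo_cong: "smo n f \<Longrightarrow> (\<And>y. y > 0 \<Longrightarrow> f y = g y) \<Longrightarrow> smo n g"
proof (induction n arbitrary: f g)
  case (Suc n)
  have "smo n (deriv g)" by (rule Suc.IH[of "deriv f"]) (use Suc.prems deriv_cong_pos[of _ f g] in auto)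
  moreover have "g field_differentiable at x" if "x > 0" for x
    using Suc.prems field_differentiable_cong_pos[OF that, of f g] that by auto
  ultimately show ?case by simp
qed simp

lemma smo_SucD: "smo (Suc n) f \<Longrightarrow> smo n f"
  by (induction n arbitrary: f) auto

lemma smo_lin: "smo n f \<Longrightarrow> smo n g \<Longrightarrow> smo n (\<lambda>x. a * f x + b * g x)"
proof (induction n arbitrary: f g)
  case (Suc n)
  have d: "((\<lambda>x. a * f x + b * g x) has_field_derivative a * deriv f x + b * deriv g x) (at x)" if "x > 0" for x
    using Suc.prems that by (intro DERIV_add DERIV_cmult) (auto simp: DERIV_deriv_iff_field_differentiable)
  have "smo n (deriv (\<lambda>x. a * f x + b * g x))"
    by (rule smo_cong[OF Suc.IH[of "deriv f" "deriv g"]]) (use Suc.prems DERIV_imp_deriv[OF d] in auto)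
  then show ?case using d by (auto simp: field_differentiable_def)
qed simp

lemma smo_mult: "smo n f \<Longrightarrow> smo n g \<Longrightarrow> smo n (\<lambda>x. f x * g x)"
proof (induction n arbitrary: f g)
  case (Suc n)
  have d: "((\<lambda>x. f x * g x) has_field_derivative 1 * (deriv f x * g x) + 1 * (f x * deriv g x)) (at x)" if "x > 0" for x
  proof -
    have "(f has_field_derivative deriv f x) (at x)" "(g has_field_derivative deriv g x) (at x)"
      using Suc.prems that by (auto simp: DERIV_deriv_iff_field_differentiable)
    from DERIV_mult[OF this] show ?thesis by (simp add: mult.commute)
  qed
  have "smo n (\<lambda>x. deriv f x * g x)" "smo n (\<lambda>x. f x * deriv g x)"
    using Suc.prems smo_SucD[of n f] smo_SucD[of n g] by (auto intro!: Suc.IH)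
  then have "smo n (\<lambda>x. 1 * (deriv f x * g x) + 1 * (f x * deriv g x))" by (rule smo_lin)
  then have "smo n (deriv (\<lambda>x. f x * g x))"
    by (rule smo_cong) (use DERIV_imp_deriv[OF d] in simp)
  then show ?case using d by (auto simp: field_differentiable_def)
qed simp

text \<open>The factor c is carried along to absorb the exponents that differentiation brings
  down.\<close>

lemma smo_powr: "smo n (\<lambda>x. c * x powr r)"
proof (induction n arbitrary: c r)
  case (Suc n)
  have d: "((\<lambda>x. c * x powr r) has_field_derivative (c * r) * x powr (r - 1)) (at x)" if "x > 0" for x
    using DERIV_cmult[OF has_real_derivative_powr[OF that, of r], of c] by (simp add: mult.assoc)
  have "smo n (deriv (\<lambda>x. c * x powr r))"
    by (rule smo_cong[OF Suc.IH[of "c * r" "r - 1"]]) (use DERIV_imp_deriv[OF d] in simp)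
  then show ?case using d by (auto simp: field_differentiable_def)
qed simp

lemma smo_all_iff: "(\<forall>n. smo n f) \<longleftrightarrow> (\<forall>n. \<forall>x>0. (deriv ^^ n) f field_differentiable at x)"
proof
  assume "\<forall>n. smo n f"
  moreover have "\<forall>x>0. (deriv ^^ n) f field_differentiable at x" if "smo (Suc n) f" for n
    using that by (induction n arbitrary: f) (auto simp: funpow_Suc_right simp del: funpow.simps)
  ultimately show "\<forall>n. \<forall>x>0. (deriv ^^ n) f field_differentiable at x" by blast
next
  assume *: "\<forall>n. \<forall>x>0. (deriv ^^ n) f field_differentiable at x"
  have "smo n f" if "\<forall>n. \<forall>x>0. (deriv ^^ n) f field_differentiable at x" for n
    using that
  proof (induction n arbitrary: f)
    case (Suc n)
    have "\<forall>x>0. (deriv ^^ m) (deriv f) field_differentiable at x" for m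
      using Suc.prems[rule_format, of _ "Suc m"] by (simp add: funpow_Suc_right del: funpow.simps)
    then show ?case using Suc.IH[of "deriv f"] Suc.prems[rule_format, of _ 0] by simp
  qed simp
  with * show "\<forall>n. smo n f" by blast
qed

abbreviation Dx :: "(real \<Rightarrow> real) \<Rightarrow> real \<Rightarrow> real" where
  "Dx \<equiv> \<lambda>g y. 1 / y * deriv g y"

lemma smo_Dx: "\<forall>n. smo n f \<Longrightarrow> \<forall>n. smo n (Dx f)"
proof
  fix n assume f: "\<forall>n. smo n f"
  have "smo n (deriv f)" using f[rule_format, of "Suc n"] by simp
  then have "smo n (\<lambda>y. (1 * y powr (-1)) * deriv f y)" by (intro smo_mult smo_powr)
  then show "smo n (Dx f)" by (rule smo_cong) (simp add: powr_neg_one)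
qed

lemma smo_Dx_pow: "\<forall>n. smo n f \<Longrightarrow> \<forall>n. smo n ((Dx ^^ k) f)"
proof (induction k)
  case (Suc k)
  from smo_Dx[OF Suc.IH[OF Suc.prems]] show ?case unfolding funpow.simps comp_apply .
qed simp

lemma Dx_pow_lin:
  assumes f: "\<forall>n. smo n f" and g: "\<forall>n. smo n g" and x: "x > 0"
  shows "(Dx ^^ k) (\<lambda>y. a * f y + b * g y) x = a * (Dx ^^ k) f x + b * (Dx ^^ k) g x"
  using x
proof (induction k arbitrary: x)
  case (Suc k)
  have "smo (Suc 0) ((Dx ^^ k) f)" "smo (Suc 0) ((Dx ^^ k) g)" using smo_Dx_pow[OF f] smo_Dx_pow[OF g] by blast+
  then have d: "((\<lambda>y. a * (Dx ^^ k) f y + b * (Dx ^^ k) g y) has_field_derivative a * deriv ((Dx ^^ k) f) x + b * deriv ((Dx ^^ k) g) x) (at x)"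
    using Suc.prems by (intro DERIV_add DERIV_cmult) (auto simp: DERIV_deriv_iff_field_differentiable)
  have "deriv ((Dx ^^ k) (\<lambda>y. a * f y + b * g y)) x = deriv (\<lambda>y. a * (Dx ^^ k) f y + b * (Dx ^^ k) g y) x"
    by (rule deriv_cong_pos[OF Suc.prems Suc.IH])
  also have "\<dots> = a * deriv ((Dx ^^ k) f) x + b * deriv ((Dx ^^ k) g) x" by (rule DERIV_imp_deriv[OF d])
  finally show ?case by (simp add: add_divide_distrib)
qed simp

lemma S_space_iff:
  "\<phi> \<in> S_space lam \<longleftrightarrow> (\<forall>n. smo n \<phi>) \<and> (\<forall>m k. bdd_above (S_quots lam m k \<phi>))"
  unfolding S_space_def smo_all_iff by simp

lemma smo_weighted: "\<phi> \<in> S_space lam \<Longrightarrow> \<forall>n. smo n (\<lambda>y. y powr (- lam) * \<phi> y)"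
  unfolding S_space_iff using smo_mult[OF smo_powr[of _ 1 "- lam"]] by simp

lemma S_seminorm_bound:
  assumes "\<phi> \<in> S_space lam" "x > 0"
  shows "(1 + x) ^ m * \<bar>(Dx ^^ k) (\<lambda>y. y powr (- lam) * \<phi> y) x\<bar> \<le> S_seminorm lam m k \<phi>"
  unfolding S_seminorm_def
proof (rule cSup_upper)
  show "bdd_above (S_quots lam m k \<phi>)" using assms by (simp add: S_space_iff)
  show "(1 + x) ^ m * \<bar>(Dx ^^ k) (\<lambda>y. y powr (- lam) * \<phi> y) x\<bar> \<in> S_quots lam m k \<phi>"
    unfolding S_quots_def using assms(2) by blast
qed

lemma S_space_lin:
  assumes f: "\<phi> \<in> S_space lam" and g: "\<psi> \<in> S_space lam"
  shows "(\<lambda>x. a * \<phi> x + b * \<psi> x) \<in> S_space lam"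
  unfolding S_space_iff
proof (intro conjI allI)
  show "smo n (\<lambda>x. a * \<phi> x + b * \<psi> x)" for n using f g unfolding S_space_iff by (intro smo_lin) auto
  fix m k
  show "bdd_above (S_quots lam m k (\<lambda>x. a * \<phi> x + b * \<psi> x))"
  proof (rule bdd_aboveI[of _ "\<bar>a\<bar> * S_seminorm lam m k \<phi> + \<bar>b\<bar> * S_seminorm lam m k \<psi>"])
    fix q assume "q \<in> S_quots lam m k (\<lambda>x. a * \<phi> x + b * \<psi> x)"
    then obtain x where x: "x > 0" "q = (1 + x) ^ m * \<bar>(Dx ^^ k) (\<lambda>y. y powr (- lam) * (a * \<phi> y + b * \<psi> y)) x\<bar>"
      unfolding S_quots_def by blast
    let ?f = "\<lambda>y. y powr (- lam) * \<phi> y" and ?g = "\<lambda>y. y powr (- lam) * \<psi> y"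
    have "(\<lambda>y. y powr (- lam) * (a * \<phi> y + b * \<psi> y)) = (\<lambda>y. a * ?f y + b * ?g y)" by (simp add: algebra_simps)
    then have "(Dx ^^ k) (\<lambda>y. y powr (- lam) * (a * \<phi> y + b * \<psi> y)) x = a * (Dx ^^ k) ?f x + b * (Dx ^^ k) ?g x"
      using Dx_pow_lin[OF smo_weighted[OF f] smo_weighted[OF g] x(1)] by simp
    then have "q = (1 + x) ^ m * \<bar>a * (Dx ^^ k) ?f x + b * (Dx ^^ k) ?g x\<bar>" using x(2) by (simp only:)
    also have "\<dots> \<le> (1 + x) ^ m * (\<bar>a\<bar> * \<bar>(Dx ^^ k) ?f x\<bar> + \<bar>b\<bar> * \<bar>(Dx ^^ k) ?g x\<bar>)"
      using x(1) by (intro mult_left_mono order_trans[OF abs_triangle_ineq]) (auto simp: abs_mult)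
    also have "\<dots> = \<bar>a\<bar> * ((1 + x) ^ m * \<bar>(Dx ^^ k) ?f x\<bar>) + \<bar>b\<bar> * ((1 + x) ^ m * \<bar>(Dx ^^ k) ?g x\<bar>)"
      by (simp only: distrib_left mult.left_commute)
    also have "\<dots> \<le> \<bar>a\<bar> * S_seminorm lam m k \<phi> + \<bar>b\<bar> * S_seminorm lam m k \<psi>"
      by (intro add_mono mult_left_mono S_seminorm_bound f g x(1)) auto
    finally show "q \<le> \<bar>a\<bar> * S_seminorm lam m k \<phi> + \<bar>b\<bar> * S_seminorm lam m k \<psi>" .
  qed
qed

text \<open>For \<open>\<phi>\<close> in the test space, \<open>Ps k\<close> is \<open>((1 / x) d/dx)\<^bsup>k\<^esup>\<close> applied to \<open>x\<^bsup>-\<lambda>\<^esup> \<phi>\<close>.\<close>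

definition Sch :: "(nat \<Rightarrow> real \<Rightarrow> real) \<Rightarrow> bool" where
  "Sch Ps \<longleftrightarrow> (\<forall>k. \<forall>x>0. (Ps k has_real_derivative x * Ps (Suc k) x) (at x)) \<and>
     (\<forall>m k. \<exists>C. \<forall>x>0. (1 + x) ^ m * \<bar>Ps k x\<bar> \<le> C)"

lemma S_space_Sch:
  assumes "\<phi> \<in> S_space lam"
  shows "Sch (\<lambda>k. (Dx ^^ k) (\<lambda>y. y powr (- lam) * \<phi> y))"
  unfolding Sch_def
proof (intro conjI allI impI)
  fix k and x :: real assume x: "x > 0"
  have "smo (Suc 0) ((Dx ^^ k) (\<lambda>y. y powr (- lam) * \<phi> y))" using smo_Dx_pow[OF smo_weighted[OF assms]] by blast
  then show "((Dx ^^ k) (\<lambda>y. y powr (- lam) * \<phi> y) has_real_derivative x * (Dx ^^ Suc k) (\<lambda>y. y powr (- lam) * \<phi> y) x) (at x)"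
    using x by (simp add: DERIV_deriv_iff_field_differentiable)
next
  fix m k
  show "\<exists>C. \<forall>x>0. (1 + x) ^ m * \<bar>(Dx ^^ k) (\<lambda>y. y powr (- lam) * \<phi> y) x\<bar> \<le> C"
    using S_seminorm_bound[OF assms] by blast
qed

lemma Sch_deriv: "Sch Ps \<Longrightarrow> x > 0 \<Longrightarrow> (Ps k has_real_derivative x * Ps (Suc k) x) (at x)"
  unfolding Sch_def by blast

lemma Sch_isCont: "Sch Ps \<Longrightarrow> x > 0 \<Longrightarrow> isCont (Ps k) x"
  by (rule DERIV_isCont[OF Sch_deriv])

lemma Sch_measurable: "Sch Ps \<Longrightarrow> Ps k \<in> borel_measurable hl"
  by (intro measurable_hl_continuous continuous_at_imp_continuous_on) (auto intro: Sch_isCont)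

lemma Sch_bound:
  assumes "Sch Ps"
  obtains C where "C \<ge> 0" "\<And>x. x > 0 \<Longrightarrow> \<bar>Ps k x\<bar> \<le> C" "\<And>x. x \<ge> 1 \<Longrightarrow> \<bar>Ps k x\<bar> \<le> C * x powr (- r)"
proof -
  obtain m :: nat where m: "r \<le> real m" using real_arch_simple by blast
  obtain C where C: "\<And>x. x > 0 \<Longrightarrow> (1 + x) ^ m * \<bar>Ps k x\<bar> \<le> C" using assms unfolding Sch_def by blast
  have b: "\<bar>Ps k x\<bar> \<le> C" if "x > 0" for x
  proof -
    have "1 * \<bar>Ps k x\<bar> \<le> (1 + x) ^ m * \<bar>Ps k x\<bar>" using that by (intro mult_right_mono one_le_power) auto
    then show ?thesis using C[OF that] by simp
  qed
  have C0: "C \<ge> 0" using b[of 1] by simp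
  have "\<bar>Ps k x\<bar> \<le> C * x powr (- r)" if x: "x \<ge> 1" for x
  proof -
    have "x powr r \<le> x powr real m" using x m by (intro powr_mono) auto
    also have "\<dots> = x ^ m" using x by (simp add: powr_realpow)
    also have "\<dots> \<le> (1 + x) ^ m" using x by (intro power_mono) auto
    finally have "x powr r * \<bar>Ps k x\<bar> \<le> (1 + x) ^ m * \<bar>Ps k x\<bar>" by (intro mult_right_mono) auto
    then have "x powr r * \<bar>Ps k x\<bar> \<le> C" using C[of x] x by linarith
    then show ?thesis using x by (simp add: powr_minus field_simps)
  qed
  then show ?thesis using that[OF C0 b] by blast
qed

text \<open>Boundedness of \<open>Ps k\<close> suffices near 0 since a > -1; at infinity its decay
  of order a + 2 leaves x^(-2).\<close>

lemma Sch_integrable: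
  assumes S: "Sch Ps" and [measurable]: "w \<in> borel_measurable hl" and a: "a > -1" and C: "C \<ge> 0"
    and w: "\<And>x. x > 0 \<Longrightarrow> \<bar>w x\<bar> \<le> C * x powr a * \<bar>Ps k x\<bar>"
  shows "integrable hl w"
proof -
  obtain D where D: "D \<ge> 0" "\<And>x. x > 0 \<Longrightarrow> \<bar>Ps k x\<bar> \<le> D" "\<And>x. x \<ge> 1 \<Longrightarrow> \<bar>Ps k x\<bar> \<le> D * x powr (- (a + 2))"
    using Sch_bound[OF S, of k "a + 2"] by blast
  show ?thesis
  proof (rule integrable_hl_powr_bound[where a=a and b="-2" and A="C * D" and B="C * D"])
    fix x :: real assume x: "0 < x" "x \<le> 1"
    have "C * x powr a * \<bar>Ps k x\<bar> \<le> C * x powr a * D" using D(2)[of x] x C by (intro mult_left_mono) auto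
    then show "\<bar>w x\<bar> \<le> C * D * x powr a" using w[of x] x by (simp add: mult_ac)
  next
    fix x :: real assume x: "x \<ge> 1"
    have "C * x powr a * \<bar>Ps k x\<bar> \<le> C * x powr a * (D * x powr (- (a + 2)))" using D(3)[of x] x C by (intro mult_left_mono) auto
    also have "\<dots> = C * D * x powr (-2)" using powr_add[of x a "- (a + 2)"] by (simp add: mult_ac)
    finally show "\<bar>w x\<bar> \<le> C * D * x powr (-2)" using w[of x] x by simp
  qed (use a in auto)
qed

text \<open>The derivative of \<open>Ps 0\<close> is x times a bounded function, which is a bounded
  derivative with respect to x^2 / 2.\<close>

lemma Sch_diff:
  assumes S: "Sch Ps"
  obtains D where "D \<ge> 0" "\<And>x y. x > 0 \<Longrightarrow> y > 0 \<Longrightarrow> \<bar>Ps 0 y - Ps 0 x\<bar> \<le> D * \<bar>y\<^sup>2 - x\<^sup>2\<bar>"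
proof -
  obtain D where D: "D \<ge> 0" "\<And>x. x > 0 \<Longrightarrow> \<bar>Ps (Suc 0) x\<bar> \<le> D"
    "\<And>x. x \<ge> 1 \<Longrightarrow> \<bar>Ps (Suc 0) x\<bar> \<le> D * x powr (- 0)"
    using Sch_bound[OF S, of "Suc 0" 0] by blast
  have lt: "\<bar>Ps 0 y - Ps 0 x\<bar> \<le> D * \<bar>y\<^sup>2 - x\<^sup>2\<bar>" if xy: "0 < x" "x < y" for x y
  proof -
    have "\<exists>u>x. u < y \<and> Ps 0 y - Ps 0 x = (y - x) * (u * Ps (Suc 0) u)"
      using xy by (intro MVT2 Sch_deriv[OF S]) auto
    then obtain u where u: "x < u" "u < y" "Ps 0 y - Ps 0 x = (y - x) * (u * Ps (Suc 0) u)" by blast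
    have "u * \<bar>Ps (Suc 0) u\<bar> \<le> (y + x) * D" using u xy D(1) D(2)[of u] by (intro mult_mono) auto
    then have "(y - x) * (u * \<bar>Ps (Suc 0) u\<bar>) \<le> (y - x) * ((y + x) * D)" using xy by (intro mult_left_mono) auto
    moreover have "\<bar>Ps 0 y - Ps 0 x\<bar> = (y - x) * (u * \<bar>Ps (Suc 0) u\<bar>)" unfolding u(3) using u xy by (simp add: abs_mult)
    moreover have "\<bar>y\<^sup>2 - x\<^sup>2\<bar> = (y - x) * (y + x)"
      using xy power_strict_mono[of x y 2] by (simp add: power2_eq_square algebra_simps)
    ultimately show ?thesis by (simp add: mult_ac)
  qed
  have "\<bar>Ps 0 y - Ps 0 x\<bar> \<le> D * \<bar>y\<^sup>2 - x\<^sup>2\<bar>" if "x > 0" "y > 0" for x y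
    using lt[of x y] lt[of y x] that by (cases x y rule: linorder_cases) (auto simp: abs_minus_commute)
  then show ?thesis using that D(1) by blast
qed

subsection \<open>Decay of the Hankel transform\<close>

lemma FTC_hl:
  fixes G g :: "real \<Rightarrow> real"
  assumes G: "\<And>x. x > 0 \<Longrightarrow> (G has_real_derivative g x) (at x)" and g: "\<And>x. x > 0 \<Longrightarrow> isCont g x"
    and i: "integrable hl g" and l0: "(G \<longlongrightarrow> 0) (at_right 0)" and l1: "(G \<longlongrightarrow> 0) at_top"
  shows "integral\<^sup>L hl g = 0"
proof -
  have e: "einterval 0 \<infinity> = {0<..}" by (auto simp: einterval_def)
  have "(LBINT x=0..\<infinity>. g x) = 0 - 0"
  proof (rule interval_integral_FTC_integrable[where F=G])
    show "set_integrable lborel (einterval 0 \<infinity>) g" unfolding e set_integrable_hl by (rule i)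
    show "((G \<circ> real_of_ereal) \<longlongrightarrow> 0) (at_right 0)"
      using l0 by (simp add: zero_ereal_def ereal_tendsto_simps)
    show "((G \<circ> real_of_ereal) \<longlongrightarrow> 0) (at_left \<infinity>)"
      using l1 by (simp add: ereal_tendsto_simps)
    fix x :: real assume "0 < ereal x"
    then have x: "x > 0" by simp
    show "(G has_vector_derivative g x) (at x)"
      using G[OF x] by (simp add: has_real_derivative_iff_has_vector_derivative)
    show "isCont g x" by (rule g[OF x])
  qed auto
  then show ?thesis
    by (simp add: interval_lebesgue_integral_def e set_integral_hl)
qed

text \<open>Solved for its last term, the recurrence at - z^2 / 4 reads z^2 besF(d + 2) = 4 (d
  besF(d + 1) - besF(d)): raising the parameter by 2 gains z^(-2). The quantifier over c sits inside
  the induction because the step uses both c and c + 1.\<close>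

lemma besF_decay: "\<forall>c>1 / 2. \<exists>C. \<forall>z>0. z ^ (2 * j) * \<bar>besF (c + 2 * real j) (- z\<^sup>2 / 4)\<bar> \<le> C"
proof (induction j)
  case 0
  show ?case using besF_neg_bound by (auto intro!: exI[of _ "rGamma _"])
next
  case (Suc j)
  show ?case
  proof (intro allI impI)
    fix c :: real assume c: "c > 1 / 2"
    obtain A where A: "\<And>z. z > 0 \<Longrightarrow> z ^ (2 * j) * \<bar>besF (c + 2 * real j) (- z\<^sup>2 / 4)\<bar> \<le> A" using Suc c by blast
    have "c + 1 > 1 / 2" using c by simp
    then obtain B where B: "\<And>z. z > 0 \<Longrightarrow> z ^ (2 * j) * \<bar>besF (c + 1 + 2 * real j) (- z\<^sup>2 / 4)\<bar> \<le> B" using Suc by blast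
    let ?d = "c + 2 * real j"
    have "z ^ (2 * Suc j) * \<bar>besF (c + 2 * real (Suc j)) (- z\<^sup>2 / 4)\<bar> \<le> 4 * (?d * B + A)" if z: "z > 0" for z
    proof -
      have "besF ?d (- z\<^sup>2 / 4) = ?d * besF (?d + 1) (- z\<^sup>2 / 4) + (- z\<^sup>2 / 4) * besF (?d + 2) (- z\<^sup>2 / 4)"
        using c by (intro besF_recurrence) simp
      then have eq: "z\<^sup>2 * besF (?d + 2) (- z\<^sup>2 / 4) = 4 * (?d * besF (?d + 1) (- z\<^sup>2 / 4) - besF ?d (- z\<^sup>2 / 4))"
        by (simp add: field_simps)
      have "z ^ (2 * Suc j) * \<bar>besF (?d + 2) (- z\<^sup>2 / 4)\<bar> = z ^ (2 * j) * \<bar>z\<^sup>2 * besF (?d + 2) (- z\<^sup>2 / 4)\<bar>"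
        by (simp add: abs_mult power_add power2_eq_square)
      also have "\<dots> \<le> z ^ (2 * j) * (4 * (?d * \<bar>besF (?d + 1) (- z\<^sup>2 / 4)\<bar> + \<bar>besF ?d (- z\<^sup>2 / 4)\<bar>))"
      proof (rule mult_left_mono)
        have "\<bar>?d * besF (?d + 1) (- z\<^sup>2 / 4) - besF ?d (- z\<^sup>2 / 4)\<bar> \<le> ?d * \<bar>besF (?d + 1) (- z\<^sup>2 / 4)\<bar> + \<bar>besF ?d (- z\<^sup>2 / 4)\<bar>"
          using abs_triangle_ineq4[of "?d * besF (?d + 1) (- z\<^sup>2 / 4)" "besF ?d (- z\<^sup>2 / 4)"] c by (simp add: abs_mult)
        then show "\<bar>z\<^sup>2 * besF (?d + 2) (- z\<^sup>2 / 4)\<bar> \<le> 4 * (?d * \<bar>besF (?d + 1) (- z\<^sup>2 / 4)\<bar> + \<bar>besF ?d (- z\<^sup>2 / 4)\<bar>)"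
          unfolding eq by (subst abs_mult) simp
      qed (use z in simp)
      also have "\<dots> = 4 * (?d * (z ^ (2 * j) * \<bar>besF (c + 1 + 2 * real j) (- z\<^sup>2 / 4)\<bar>) + z ^ (2 * j) * \<bar>besF ?d (- z\<^sup>2 / 4)\<bar>)"
        by (simp add: algebra_simps)
      also have "\<dots> \<le> 4 * (?d * B + A)"
        using A[OF z] B[OF z] c by (intro mult_left_mono add_mono) auto
      finally show ?thesis by (simp add: algebra_simps)
    qed
    then show "\<exists>C. \<forall>z>0. z ^ (2 * Suc j) * \<bar>besF (c + 2 * real (Suc j)) (- z\<^sup>2 / 4)\<bar> \<le> C" by blast
  qed
qed

text \<open>Up to a constant, the Hankel integral after N integrations by parts: each one applies (1
  / x) d/dx to the test function and raises the parameter of \<open>besF\<close> by 1.\<close>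

definition hmom :: "real \<Rightarrow> (nat \<Rightarrow> real \<Rightarrow> real) \<Rightarrow> nat \<Rightarrow> real \<Rightarrow> real" where
  "hmom lam Ps N y = (\<integral>x. x powr (2 * lam + 2 * real N) * besF (lam + 1 / 2 + real N) (- (x * y)\<^sup>2 / 4) * Ps N x \<partial>hl)"

text \<open>By \<open>besF_recurrence\<close>, the derivative of x^(2 c) besF(c + 1) is 2 x^(2 c -
  1) besF(c), both \<open>besF\<close> taken at - (x y)^2 / 4; so this is an integration by parts.
  The boundary terms vanish because 2 c > 0 at 0 and by the decay of \<open>Ps N\<close> at
  infinity.\<close>

lemma hmom_step:
  assumes lam: "lam > 0" and S: "Sch Ps" and y: "y > 0"
  shows "hmom lam Ps N y = - (1 / 2) * hmom lam Ps (Suc N) y"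
proof -
  define c where "c = lam + 1 / 2 + real N"
  have c: "c > 1 / 2" using lam by (simp add: c_def)
  note [measurable] = Sch_measurable[OF S]
  have [measurable]: "besF c \<in> borel_measurable borel" "besF (c + 1) \<in> borel_measurable borel" using c by (auto intro!: measurable_besF)
  let ?v = "\<lambda>x. - (x * y)\<^sup>2 / 4"
  let ?p = "\<lambda>x. x powr (2 * c - 1) * besF c (?v x) * Ps N x"
  let ?q = "\<lambda>x. x powr (2 * c + 1) * besF (c + 1) (?v x) * Ps (Suc N) x"
  let ?G = "\<lambda>x. x powr (2 * c) * besF (c + 1) (?v x) * Ps N x"
  have ip: "integrable hl ?p"
  proof (rule Sch_integrable[OF S, where a="2 * c - 1" and C="rGamma c" and k=N])
    fix x :: real assume "x > 0"
    have "x powr (2 * c - 1) * \<bar>besF c (?v x)\<bar> * \<bar>Ps N x\<bar> \<le> x powr (2 * c - 1) * rGamma c * \<bar>Ps N x\<bar>"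
      using besF_neg_bound[OF c] by (intro mult_right_mono mult_left_mono) auto
    then show "\<bar>?p x\<bar> \<le> rGamma c * x powr (2 * c - 1) * \<bar>Ps N x\<bar>" by (simp add: abs_mult mult_ac)
  qed (use c rGamma_real_pos[of c] in \<open>auto\<close>)
  have iq: "integrable hl ?q"
  proof (rule Sch_integrable[OF S, where a="2 * c + 1" and C="rGamma (c + 1)" and k="Suc N"])
    fix x :: real assume "x > 0"
    have "x powr (2 * c + 1) * \<bar>besF (c + 1) (?v x)\<bar> * \<bar>Ps (Suc N) x\<bar> \<le> x powr (2 * c + 1) * rGamma (c + 1) * \<bar>Ps (Suc N) x\<bar>"
      using besF_neg_bound[of "c + 1"] c by (intro mult_right_mono mult_left_mono) auto
    then show "\<bar>?q x\<bar> \<le> rGamma (c + 1) * x powr (2 * c + 1) * \<bar>Ps (Suc N) x\<bar>" by (simp add: abs_mult mult_ac)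
  qed (use c rGamma_real_pos[of "c + 1"] in \<open>auto\<close>)
  have Gb: "\<bar>?G x\<bar> \<le> rGamma (c + 1) * (x powr (2 * c) * \<bar>Ps N x\<bar>)" for x
  proof -
    have "x powr (2 * c) * \<bar>besF (c + 1) (?v x)\<bar> * \<bar>Ps N x\<bar> \<le> x powr (2 * c) * rGamma (c + 1) * \<bar>Ps N x\<bar>"
      using besF_neg_bound[of "c + 1"] c by (intro mult_right_mono mult_left_mono) auto
    then show ?thesis by (simp add: abs_mult mult_ac)
  qed
  obtain D where D: "D \<ge> 0" "\<And>x. x > 0 \<Longrightarrow> \<bar>Ps N x\<bar> \<le> D" "\<And>x. x \<ge> 1 \<Longrightarrow> \<bar>Ps N x\<bar> \<le> D * x powr (- (2 * c + 1))"
    using Sch_bound[OF S, of N "2 * c + 1"] by blast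
  have g1: "rGamma (c + 1) \<ge> 0" using rGamma_real_pos[of "c + 1"] c by simp
  have "(\<integral>x. 2 * ?p x + ?q x \<partial>hl) = 0"
  proof (rule FTC_hl[where G="?G"])
    fix x :: real assume x: "x > 0"
    have d1: "((\<lambda>x. x powr (2 * c)) has_real_derivative 2 * c * x powr (2 * c - 1)) (at x)"
      by (rule has_real_derivative_powr[OF x])
    have dv: "(?v has_real_derivative - (x * y\<^sup>2 / 2)) (at x)"
      by (auto intro!: derivative_eq_intros simp: power2_eq_square)
    have d2: "((\<lambda>x. besF (c + 1) (?v x)) has_real_derivative besF (c + 2) (?v x) * (- (x * y\<^sup>2 / 2))) (at x)"
      using DERIV_chain2[OF besF_has_derivative dv, of "c + 1"] c by (simp add: add.assoc)
    have e1: "x powr (2 * c) = x powr (2 * c - 1) * x" "x powr (2 * c + 1) = x powr (2 * c) * x"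
      using x by (simp_all add: powr_diff powr_add)
    have rec: "besF c (?v x) = c * besF (c + 1) (?v x) + ?v x * besF (c + 2) (?v x)"
      using c by (intro besF_recurrence) simp
    have "(2 * c * x powr (2 * c - 1)) * besF (c + 1) (?v x) + besF (c + 2) (?v x) * (- (x * y\<^sup>2 / 2)) * x powr (2 * c) = 2 * (x powr (2 * c - 1) * besF c (?v x))"
      unfolding rec e1(1) by (simp add: power2_eq_square algebra_simps)
    then have d3: "((\<lambda>x. x powr (2 * c) * besF (c + 1) (?v x)) has_real_derivative 2 * (x powr (2 * c - 1) * besF c (?v x))) (at x)"
      by (rule DERIV_cong[OF DERIV_mult[OF d1 d2]])
    show "(?G has_real_derivative 2 * ?p x + ?q x) (at x)"
      by (rule DERIV_cong[OF DERIV_mult[OF d3 Sch_deriv[OF S x, of N]]]) (simp only: e1(2), simp add: algebra_simps)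
    have "isCont (\<lambda>x. besF c (?v x)) x"
      using c by (intro DERIV_isCont[OF DERIV_chain2[OF besF_has_derivative dv]]) simp
    moreover have "isCont (\<lambda>x. besF (c + 1) (?v x)) x"
      using c by (intro DERIV_isCont[OF DERIV_chain2[OF besF_has_derivative dv]]) simp
    moreover have "isCont (Ps N) x" "isCont (Ps (Suc N)) x" using Sch_isCont[OF S x] by blast+
    ultimately show "isCont (\<lambda>x. 2 * ?p x + ?q x) x" using x by (intro continuous_intros) auto
  next
    show "integrable hl (\<lambda>x. 2 * ?p x + ?q x)" using ip iq by simp
  next
    have "((\<lambda>x. x powr (2 * c)) \<longlongrightarrow> 0) (at_right 0)"
      using c by (intro tendsto_zero_powrI[of _ _ _ "2 * c"]) (auto intro!: tendsto_eq_intros eventually_at_rightI[of 0 1])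
    then have l: "((\<lambda>x. rGamma (c + 1) * D * x powr (2 * c)) \<longlongrightarrow> 0) (at_right 0)" by (rule tendsto_mult_right_zero)
    have "\<forall>\<^sub>F x in at_right 0. norm (?G x) \<le> rGamma (c + 1) * D * x powr (2 * c)"
    proof (rule eventually_at_rightI[of 0 1])
      fix x :: real assume "x \<in> {0<..<1}"
      then have "x powr (2 * c) * \<bar>Ps N x\<bar> \<le> x powr (2 * c) * D" using D(2)[of x] by (intro mult_left_mono) auto
      from mult_left_mono[OF this g1] show "norm (?G x) \<le> rGamma (c + 1) * D * x powr (2 * c)" using Gb[of x] by (simp add: mult_ac)
    qed simp
    then show "(?G \<longlongrightarrow> 0) (at_right 0)" by (rule Lim_null_comparison[OF _ l])
  next
    have l: "((\<lambda>x. rGamma (c + 1) * D * x powr (- 1)) \<longlongrightarrow> 0) at_top"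
      by (intro tendsto_mult_right_zero tendsto_neg_powr filterlim_ident) simp
    have "\<forall>\<^sub>F x in at_top. norm (?G x) \<le> rGamma (c + 1) * D * x powr (- 1)"
      using eventually_ge_at_top[of 1]
    proof eventually_elim
      case (elim x)
      have "x powr (2 * c) * \<bar>Ps N x\<bar> \<le> x powr (2 * c) * (D * x powr (- (2 * c + 1)))" using D(3)[OF elim] by (intro mult_left_mono) auto
      also have "\<dots> = D * x powr (- 1)" using powr_add[of x "2 * c" "- (2 * c + 1)"] by (simp add: mult_ac)
      finally have "rGamma (c + 1) * (x powr (2 * c) * \<bar>Ps N x\<bar>) \<le> rGamma (c + 1) * (D * x powr (- 1))" using g1 by (rule mult_left_mono)
      then show ?case using Gb[of x] by (simp add: mult_ac)
    qed
    then show "(?G \<longlongrightarrow> 0) at_top" by (rule Lim_null_comparison[OF _ l])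
  qed
  then have "2 * integral\<^sup>L hl ?p + integral\<^sup>L hl ?q = 0" using ip iq by simp
  moreover have "2 * c - 1 = 2 * lam + 2 * real N" "2 * c + 1 = 2 * lam + 2 * real (Suc N)" "c + 1 = lam + 1 / 2 + real (Suc N)"
    by (simp_all add: c_def)
  ultimately show ?thesis unfolding hmom_def c_def[symmetric] by (simp only:)
qed

text \<open>After 2 j integrations by parts the parameter has grown by 2 j, and
  \<open>besF_decay\<close> yields (x y)^(-2 j). The power of y is the gain; that of x reduces the
  weight to x^(2 lam + 2 j), still integrable at 0.\<close>

lemma hmom_bound:
  assumes lam: "lam > 0" and S: "Sch Ps"
  shows "\<exists>C\<ge>0. \<forall>y>0. \<bar>hmom lam Ps 0 y\<bar> \<le> C * y powr (- 2 * real j)"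
proof -
  have it: "hmom lam Ps 0 y = (- (1 / 2)) ^ N * hmom lam Ps N y" if "y > 0" for y N
  proof (induction N)
    case (Suc N)
    then show ?case unfolding hmom_step[OF lam S that, of N] by simp
  qed simp
  let ?d = "lam + 1 / 2 + real (2 * j)"
  have "lam + 1 / 2 > 1 / 2" using lam by simp
  then obtain B where B: "\<And>z. z > 0 \<Longrightarrow> z ^ (2 * j) * \<bar>besF (lam + 1 / 2 + 2 * real j) (- z\<^sup>2 / 4)\<bar> \<le> B"
    using besF_decay[of j] by blast
  have B0: "B \<ge> 0" using B[of 1] by (rule order_trans[rotated]) auto
  note [measurable] = Sch_measurable[OF S]
  have [measurable]: "besF ?d \<in> borel_measurable borel" using lam by (intro measurable_besF) simp
  let ?w = "\<lambda>x. x powr (2 * lam + 2 * real j) * \<bar>Ps (2 * j) x\<bar>"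
  have iw: "integrable hl ?w"
    by (rule Sch_integrable[OF S, where a="2 * lam + 2 * real j" and C=1 and k="2 * j"]) (use lam in auto)
  have "\<bar>hmom lam Ps 0 y\<bar> \<le> B * integral\<^sup>L hl ?w * y powr (- 2 * real j)" if y: "y > 0" for y
  proof -
    let ?f = "\<lambda>x. x powr (2 * lam + 2 * real (2 * j)) * besF ?d (- (x * y)\<^sup>2 / 4) * Ps (2 * j) x"
    have le: "\<bar>?f x\<bar> \<le> B * y powr (- 2 * real j) * ?w x" if x: "x > 0" for x
    proof -
      have "(x * y) ^ (2 * j) * \<bar>besF ?d (- (x * y)\<^sup>2 / 4)\<bar> \<le> B" using B[of "x * y"] x y by simp
      moreover have "(x * y) ^ (2 * j) = x powr (2 * real j) * y powr (2 * real j)"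
        using x y powr_realpow[of x "2 * j"] powr_realpow[of y "2 * j"] by (simp add: power_mult_distrib)
      ultimately have "x powr (2 * real j) * \<bar>besF ?d (- (x * y)\<^sup>2 / 4)\<bar> * y powr (2 * real j) \<le> B" by (simp only: mult_ac)
      then have "x powr (2 * real j) * \<bar>besF ?d (- (x * y)\<^sup>2 / 4)\<bar> \<le> B / y powr (2 * real j)" using y by (subst pos_le_divide_eq) auto
      also have "\<dots> = B * y powr (- 2 * real j)" by (simp add: powr_minus divide_inverse)
      finally have "?w x * (x powr (2 * real j) * \<bar>besF ?d (- (x * y)\<^sup>2 / 4)\<bar>) \<le> ?w x * (B * y powr (- 2 * real j))"
        by (intro mult_left_mono) auto
      moreover have "\<bar>?f x\<bar> = ?w x * (x powr (2 * real j) * \<bar>besF ?d (- (x * y)\<^sup>2 / 4)\<bar>)"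
      proof -
        have "2 * lam + 2 * real (2 * j) = (2 * lam + 2 * real j) + 2 * real j" by simp
        then have "x powr (2 * lam + 2 * real (2 * j)) = x powr (2 * lam + 2 * real j) * x powr (2 * real j)" by (simp only: powr_add)
        then show ?thesis by (simp only: abs_mult abs_of_nonneg powr_ge_zero mult_ac)
      qed
      ultimately show ?thesis by (simp only: mult_ac)
    qed
    have iB: "integrable hl (\<lambda>x. B * y powr (- 2 * real j) * ?w x)" by (intro integrable_mult_right iw)
    have if': "integrable hl ?f"
    proof (rule Bochner_Integration.integrable_bound[OF iB])
      show "?f \<in> borel_measurable hl" by measurable
      show "AE x in hl. norm (?f x) \<le> norm (B * y powr (- 2 * real j) * ?w x)"
      proof (rule AE_I2)
        fix x assume "x \<in> space hl"
        then have "x > 0" by simp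
        then show "norm (?f x) \<le> norm (B * y powr (- 2 * real j) * ?w x)"
          unfolding real_norm_def by (intro order_trans[OF le abs_ge_self])
      qed
    qed
    have "\<bar>hmom lam Ps 0 y\<bar> = (1 / 2) ^ (2 * j) * \<bar>hmom lam Ps (2 * j) y\<bar>"
      unfolding it[OF y, of "2 * j"] abs_mult power_abs by simp
    also have "\<dots> \<le> 1 * \<bar>hmom lam Ps (2 * j) y\<bar>" by (intro mult_right_mono power_le_one) auto
    also have "1 * \<bar>hmom lam Ps (2 * j) y\<bar> \<le> (\<integral>x. \<bar>?f x\<bar> \<partial>hl)" unfolding hmom_def by (simp only: mult_1) (rule integral_abs_bound)
    also have "\<dots> \<le> (\<integral>x. B * y powr (- 2 * real j) * ?w x \<partial>hl)"
      by (intro integral_mono integrable_abs if' iB le) auto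
    also have "\<dots> = B * y powr (- 2 * real j) * integral\<^sup>L hl ?w" by (rule integral_mult_right_zero)
    finally show ?thesis by (simp only: mult_ac)
  qed
  moreover have "B * integral\<^sup>L hl ?w \<ge> 0" using B0 by (intro mult_nonneg_nonneg Bochner_Integration.integral_nonneg) auto
  ultimately show ?thesis by blast
qed

subsection \<open>Pointwise formula for the positive powers of test functions\<close>

lemma heat_kernel_nonneg:
  assumes "lam > 0" "t > 0" "x > 0" "y > 0"
  shows "heat_kernel lam t x y \<ge> 0"
  unfolding heat_kernel_Om[OF assms] using heat_const_pos[OF assms(1)]
  by (intro mult_nonneg_nonneg Bochner_Integration.integral_nonneg) auto

lemma measurable_heat_kernel:
  assumes lam: "lam > 0" and x: "x > 0"
  shows "(\<lambda>(t, y). heat_kernel lam t x y) \<in> borel_measurable (hl \<Otimes>\<^sub>M hl)"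
    and "t > 0 \<Longrightarrow> (\<lambda>y. heat_kernel lam t x y) \<in> borel_measurable hl"
proof -
  let ?h = "\<lambda>t y. t powr (- 1 / 2) * (x * y / (4 * t)) powr lam * besF (lam + 1 / 2) ((x * y / (4 * t))\<^sup>2) * exp (- (x\<^sup>2 + y\<^sup>2) / (4 * t))"
  have [measurable]: "besF (lam + 1 / 2) \<in> borel_measurable borel" using lam by (intro measurable_besF) simp
  have eq: "heat_kernel lam t x y = ?h t y" if "t > 0" "y > 0" for t y by (rule heat_kernel_eq[OF lam that(1) x that(2)])
  have "(\<lambda>p. ?h (fst p) (snd p)) \<in> borel_measurable (hl \<Otimes>\<^sub>M hl)" by measurable
  then show "(\<lambda>(t, y). heat_kernel lam t x y) \<in> borel_measurable (hl \<Otimes>\<^sub>M hl)"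
    by (subst measurable_cong[of _ _ "\<lambda>p. ?h (fst p) (snd p)"]) (auto simp: space_pair_measure eq)
  show "(\<lambda>y. heat_kernel lam t x y) \<in> borel_measurable hl" if t: "t > 0"
    by (subst measurable_cong[of _ _ "?h t"]) (use t in \<open>auto simp: eq\<close>)
qed

text \<open>The powers of t combine to t^(-b - 1), so for each s the time integral is
  \<open>integral_invgamma\<close>, with the power -b of \<open>qd\<close> as its result.\<close>

lemma
  assumes lam: "lam > 0" and s: "\<sigma> > 0" and xz: "x > 0" "z > 0" "x \<noteq> z"
  defines "b \<equiv> lam + 1 / 2 + \<sigma>"
  shows heat_t_integrable: "integrable hl (\<lambda>t. t powr (- 1 - \<sigma>) * heat_kernel lam t x z)"
    and heat_t_integral: "(\<integral>t. t powr (- 1 - \<sigma>) * heat_kernel lam t x z \<partial>hl) = heat_const lam * invgamma_const b * kern lam b x z"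
proof -
  let ?G = "\<lambda>s t. exp (- qd x z s / (4 * t)) * t powr (- b - 1)"
  interpret finite_measure "Om lam" by (rule finite_measure_Om[OF lam])
  have b: "b > 0" using lam s by (simp add: b_def)
  have inner: "(\<integral>t. ?G s t \<partial>hl) = qd x z s powr (- b) * invgamma_const b" "integrable hl (?G s)" if "s \<in> space (Om lam)" for s
    using integral_invgamma[OF b, of "qd x z s"] integrable_invgamma[OF b, of "qd x z s"] qd_pos[of x z s] xz that by auto
  have iq: "integrable (Om lam) (\<lambda>s. qd x z s powr (- b) * invgamma_const b)"
    using xz lam b by (intro integrable_mult_left integrable_qd_powr) auto
  have fin: "(\<integral>\<^sup>+s. \<integral>\<^sup>+t. ennreal \<bar>?G s t\<bar> \<partial>hl \<partial>Om lam) < \<infinity>"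
  proof -
    have "(\<integral>\<^sup>+s. \<integral>\<^sup>+t. ennreal \<bar>?G s t\<bar> \<partial>hl \<partial>Om lam) = (\<integral>\<^sup>+s. ennreal (qd x z s powr (- b) * invgamma_const b) \<partial>Om lam)"
    proof (rule nn_integral_cong)
      fix s assume s: "s \<in> space (Om lam)"
      have "(\<integral>\<^sup>+t. ennreal \<bar>?G s t\<bar> \<partial>hl) = (\<integral>\<^sup>+t. ennreal (?G s t) \<partial>hl)" by simp
      also have "\<dots> = ennreal (\<integral>t. ?G s t \<partial>hl)" by (rule nn_integral_eq_integral[OF inner(2)[OF s]]) simp
      finally show "(\<integral>\<^sup>+t. ennreal \<bar>?G s t\<bar> \<partial>hl) = ennreal (qd x z s powr (- b) * invgamma_const b)"
        unfolding inner(1)[OF s] .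
    qed
    also have "\<dots> < \<infinity>" by (rule integrable_nn_less_top[OF iq])
    finally show ?thesis .
  qed
  have m: "case_prod ?G \<in> borel_measurable (Om lam \<Otimes>\<^sub>M hl)"
    unfolding split_beta' by measurable
  note F = fubini[OF sigma_finite_measure_axioms sigma_finite_hl m fin]
  have eq: "t powr (- 1 - \<sigma>) * heat_kernel lam t x z = heat_const lam * (x * z) powr lam * (\<integral>s. ?G s t \<partial>Om lam)" if "t \<in> space hl" for t
  proof -
    have t: "t > 0" using that by simp
    have "- b - 1 = (- 1 - \<sigma>) + (- lam - 1 / 2)" by (simp add: b_def)
    then have p: "t powr (- b - 1) = t powr (- 1 - \<sigma>) * t powr (- lam - 1 / 2)" by (simp only: powr_add)
    have "(\<integral>s. ?G s t \<partial>Om lam) = (\<integral>s. exp (- qd x z s / (4 * t)) \<partial>Om lam) * t powr (- b - 1)" by (rule integral_mult_left_zero)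
    then show ?thesis unfolding heat_kernel_Om[OF lam t xz(1,2)] p by (simp only: mult_ac)
  qed
  show "integrable hl (\<lambda>t. t powr (- 1 - \<sigma>) * heat_kernel lam t x z)"
    by (subst Bochner_Integration.integrable_cong[OF refl eq], assumption) (intro integrable_mult_right F(3))
  have "(\<integral>t. t powr (- 1 - \<sigma>) * heat_kernel lam t x z \<partial>hl) = heat_const lam * (x * z) powr lam * (\<integral>t. \<integral>s. ?G s t \<partial>Om lam \<partial>hl)"
    by (subst Bochner_Integration.integral_cong[OF refl eq], assumption) (rule integral_mult_right_zero)
  also have "(\<integral>t. \<integral>s. ?G s t \<partial>Om lam \<partial>hl) = (\<integral>s. qd x z s powr (- b) * invgamma_const b \<partial>Om lam)"
    unfolding F(4)[symmetric] by (intro Bochner_Integration.integral_cong refl inner)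
  also have "\<dots> = (\<integral>s. qd x z s powr (- b) \<partial>Om lam) * invgamma_const b" by (rule integral_mult_left_zero)
  finally show "(\<integral>t. t powr (- 1 - \<sigma>) * heat_kernel lam t x z \<partial>hl) = heat_const lam * invgamma_const b * kern lam b x z"
    unfolding kern_def by (simp only: mult_ac)
qed

text \<open>Equal to Gamma(1 - \<sigma>) / \<sigma> for 0 < \<sigma> < 1, by integration by
  parts.\<close>

definition frac_const :: "real \<Rightarrow> real" where
  "frac_const \<sigma> = (\<integral>t. (1 - exp (- t)) * t powr (- 1 - \<sigma>) \<partial>hl)"

text \<open>Writes the symbol y^(2 \<sigma>) as a superposition of 1 - exp(- t y^2); through it the
  fractional power reaches the heat kernel.\<close>

lemma
  assumes s: "0 < \<sigma>" "\<sigma> < 1" and y: "y > 0"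
  shows frac_integrable: "integrable hl (\<lambda>t. (1 - exp (- t * y\<^sup>2)) * t powr (- 1 - \<sigma>))"
    and frac_integral: "(\<integral>t. (1 - exp (- t * y\<^sup>2)) * t powr (- 1 - \<sigma>) \<partial>hl) = frac_const \<sigma> * y powr (2 * \<sigma>)"
    and frac_const_pos: "frac_const \<sigma> > 0"
proof -
  let ?f = "\<lambda>t::real. (1 - exp (- t)) * t powr (- 1 - \<sigma>)"
  have i: "integrable hl ?f"
  proof (rule integrable_hl_powr_bound[where a="- \<sigma>" and b="- 1 - \<sigma>" and A=1 and B=1])
    fix t :: real assume t: "0 < t" "t \<le> 1"
    have "1 - exp (- t) \<le> t" using exp_ge_add_one_self[of "- t"] by simp
    then have "(1 - exp (- t)) * t powr (- 1 - \<sigma>) \<le> t * t powr (- 1 - \<sigma>)" by (intro mult_right_mono) auto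
    also have "\<dots> = t powr (- \<sigma>)" using t powr_add[of t 1 "- 1 - \<sigma>"] by simp
    finally show "\<bar>?f t\<bar> \<le> 1 * t powr (- \<sigma>)" using t by (simp add: abs_mult)
  next
    fix t :: real assume t: "t \<ge> 1"
    have "(1 - exp (- t)) * t powr (- 1 - \<sigma>) \<le> 1 * t powr (- 1 - \<sigma>)" by (intro mult_right_mono) auto
    then show "\<bar>?f t\<bar> \<le> 1 * t powr (- 1 - \<sigma>)" using t by (simp add: abs_mult)
  qed (use s in auto)
  have y2: "y\<^sup>2 > 0" using y by simp
  have eq: "(1 - exp (- t * y\<^sup>2)) * t powr (- 1 - \<sigma>) = (y\<^sup>2) powr (1 + \<sigma>) * ?f (y\<^sup>2 * t)" for t
  proof -
    have "(y\<^sup>2 * t) powr (- 1 - \<sigma>) = (y\<^sup>2) powr (- (1 + \<sigma>)) * t powr (- 1 - \<sigma>)" by (simp add: powr_mult)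
    moreover have "(y\<^sup>2) powr (1 + \<sigma>) * (y\<^sup>2) powr (- (1 + \<sigma>)) = 1" using y2 by (simp only: powr_add[symmetric]) simp
    ultimately show ?thesis by (simp add: mult.commute)
  qed
  show "integrable hl (\<lambda>t. (1 - exp (- t * y\<^sup>2)) * t powr (- 1 - \<sigma>))"
    unfolding eq using integrable_hl_scale[OF y2, of ?f] i by simp
  have "(\<integral>t. (1 - exp (- t * y\<^sup>2)) * t powr (- 1 - \<sigma>) \<partial>hl) = (y\<^sup>2) powr (1 + \<sigma>) * (\<integral>t. ?f (y\<^sup>2 * t) \<partial>hl)"
    unfolding eq by (rule integral_mult_right_zero)
  also have "(\<integral>t. ?f (y\<^sup>2 * t) \<partial>hl) = frac_const \<sigma> / y\<^sup>2"
    using integral_hl_scale[OF y2, of ?f] y2 by (simp add: frac_const_def)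
  also have "(y\<^sup>2) powr (1 + \<sigma>) = y\<^sup>2 * y powr (2 * \<sigma>)"
  proof -
    have "y\<^sup>2 = y powr 2" using y by simp
    then have "(y\<^sup>2) powr \<sigma> = y powr (2 * \<sigma>)" by (simp only: powr_powr)
    then show ?thesis using y2 by (simp add: powr_add)
  qed
  finally show "(\<integral>t. (1 - exp (- t * y\<^sup>2)) * t powr (- 1 - \<sigma>) \<partial>hl) = frac_const \<sigma> * y powr (2 * \<sigma>)" using y2 by simp
  show "frac_const \<sigma> > 0" unfolding frac_const_def by (rule integral_hl_pos[OF i]) simp
qed

text \<open>The prefactor of the heat kernel integrated in time, divided by that of the symbol y^(2
  \<sigma>).\<close>

definition pos_const :: "real \<Rightarrow> real \<Rightarrow> real" where
  "pos_const lam \<sigma> = heat_const lam * invgamma_const (lam + 1 / 2 + \<sigma>) / frac_const \<sigma>"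

locale test_function =
  fixes lam :: real and Ps :: "nat \<Rightarrow> real \<Rightarrow> real" and \<phi> :: "real \<Rightarrow> real"
  assumes lam: "lam > 0" and S: "Sch Ps" and phi: "\<And>x. x > 0 \<Longrightarrow> \<phi> x = x powr lam * Ps 0 x"
begin

lemma Ps_measurable [measurable]: "Ps k \<in> borel_measurable hl" by (rule Sch_measurable[OF S])

lemma phi_measurable [measurable]: "\<phi> \<in> borel_measurable hl"
proof -
  have "(\<lambda>x. x powr lam * Ps 0 x) \<in> borel_measurable hl" by measurable
  then show ?thesis by (subst measurable_cong[of _ _ "\<lambda>x. x powr lam * Ps 0 x"]) (auto simp: phi)
qed

abbreviation "H \<equiv> hankel lam \<phi>"
definition "E = sqrt 2 * rGamma (lam + 1 / 2)"

lemma E: "E \<ge> 0" unfolding E_def using rGamma_real_pos[of "lam + 1 / 2"] lam by simp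

lemma ker_e_le: "z > 0 \<Longrightarrow> \<bar>ker_e lam z\<bar> \<le> E * z powr lam"
  unfolding E_def by (rule ker_e_bound[OF lam])

lemma hankel_ker_e: "y > 0 \<Longrightarrow> hankel lam f y = (\<integral>x. ker_e lam (y * x) * f x \<partial>hl)"
  unfolding hankel_def set_integral_hl
  by (intro Bochner_Integration.integral_cong refl) (simp add: hankel_kernel_eq[OF lam])

lemma H_measurable [measurable]: "H \<in> borel_measurable hl"
proof -
  have "(\<lambda>y. \<integral>x. ker_e lam (y * x) * \<phi> x \<partial>hl) \<in> borel_measurable hl"
    using lam measurable_compose[OF measurable_snd phi_measurable]
    by (intro hl.borel_measurable_lebesgue_integral) (simp add: split_beta', measurable)
  then show ?thesis
    by (subst measurable_cong[of _ _ "\<lambda>y. \<integral>x. ker_e lam (y * x) * \<phi> x \<partial>hl"]) (auto simp: hankel_ker_e)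
qed

lemma H_eq: "y > 0 \<Longrightarrow> H y = sqrt 2 * (y / 2) powr lam * hmom lam Ps 0 y"
proof -
  assume y: "y > 0"
  have "H y = (\<integral>x. sqrt 2 * (y / 2) powr lam * (x powr (2 * lam + 2 * real 0) * besF (lam + 1 / 2 + real 0) (- (x * y)\<^sup>2 / 4) * Ps 0 x) \<partial>hl)"
    unfolding hankel_ker_e[OF y]
  proof (intro Bochner_Integration.integral_cong refl)
    fix x assume "x \<in> space hl"
    then have x: "x > 0" by simp
    have 1: "(y * x / 2) powr lam = (y / 2) powr lam * x powr lam" using powr_mult[of "y / 2" x lam] by simp
    have 2: "x powr (2 * lam + 2 * real 0) = x powr lam * x powr lam" by (simp add: powr_add[symmetric])
    show "ker_e lam (y * x) * \<phi> x = sqrt 2 * (y / 2) powr lam * (x powr (2 * lam + 2 * real 0) * besF (lam + 1 / 2 + real 0) (- (x * y)\<^sup>2 / 4) * Ps 0 x)"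
      unfolding ker_e_def phi[OF x] 1 2 by (simp add: mult.commute[of y x])
  qed
  then show ?thesis unfolding hmom_def by (simp only: integral_mult_right_zero)
qed

lemma H_bound: "\<exists>C\<ge>0. \<forall>y>0. \<bar>H y\<bar> \<le> C * y powr (lam - 2 * real j)"
proof -
  obtain C where C: "C \<ge> 0" "\<And>y. y > 0 \<Longrightarrow> \<bar>hmom lam Ps 0 y\<bar> \<le> C * y powr (- 2 * real j)"
    using hmom_bound[OF lam S, of j] by blast
  have "\<bar>H y\<bar> \<le> sqrt 2 * C * y powr (lam - 2 * real j)" if y: "y > 0" for y
  proof -
    have "(y / 2) powr lam \<le> y powr lam" using y lam by (intro powr_mono2) auto
    then have "(y / 2) powr lam * \<bar>hmom lam Ps 0 y\<bar> \<le> y powr lam * (C * y powr (- 2 * real j))"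
      using C(2)[OF y] by (intro mult_mono) auto
    also have "\<dots> = C * y powr (lam - 2 * real j)" using powr_add[of y lam "- 2 * real j"] by simp
    finally have "sqrt 2 * ((y / 2) powr lam * \<bar>hmom lam Ps 0 y\<bar>) \<le> sqrt 2 * (C * y powr (lam - 2 * real j))" by (intro mult_left_mono) auto
    then show ?thesis unfolding H_eq[OF y] by (simp add: abs_mult mult.assoc)
  qed
  then show ?thesis using C(1) by (intro exI[of _ "sqrt 2 * C"]) auto
qed

text \<open>\<open>H_bound\<close> is used twice: with j = 0 near 0, and with a large j at
  infinity.\<close>

lemma ker_H_integrable:
  assumes x: "x > 0" and [measurable]: "w \<in> borel_measurable hl" and r: "r \<ge> 0" and A: "A \<ge> 0"
    and w: "\<And>y. y > 0 \<Longrightarrow> \<bar>w y\<bar> \<le> A * y powr r"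
  shows "integrable hl (\<lambda>y. ker_e lam (x * y) * H y * w y)"
proof -
  \<comment> \<open>Makes the exponent 2 lam + r - 2 j smaller than -1.\<close>
  obtain j :: nat where j: "lam + r + 1 < real j" using reals_Archimedean2 by blast
  obtain C0 where C0: "C0 \<ge> 0" "\<And>y. y > 0 \<Longrightarrow> \<bar>H y\<bar> \<le> C0 * y powr (lam - 2 * real 0)" using H_bound[of 0] by blast
  obtain Cj where Cj: "Cj \<ge> 0" "\<And>y. y > 0 \<Longrightarrow> \<bar>H y\<bar> \<le> Cj * y powr (lam - 2 * real j)" using H_bound[of j] by blast
  have bd: "\<bar>ker_e lam (x * y) * H y * w y\<bar> \<le> E * x powr lam * C * A * y powr (2 * lam + r - 2 * real k)"
    if y: "y > 0" and C: "\<bar>H y\<bar> \<le> C * y powr (lam - 2 * real k)" for y C k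
  proof -
    have "\<bar>ker_e lam (x * y)\<bar> * \<bar>H y\<bar> * \<bar>w y\<bar> \<le> (E * (x * y) powr lam) * (C * y powr (lam - 2 * real k)) * (A * y powr r)"
      using ker_e_le[of "x * y"] C w[OF y] x y E by (intro mult_mono mult_nonneg_nonneg order_trans[OF _ C]) auto
    also have "(x * y) powr lam = x powr lam * y powr lam" by (rule powr_mult)
    also have "E * (x powr lam * y powr lam) * (C * y powr (lam - 2 * real k)) * (A * y powr r) =
        E * x powr lam * C * A * (y powr lam * y powr (lam - 2 * real k) * y powr r)" by (simp only: mult_ac)
    also have "y powr lam * y powr (lam - 2 * real k) * y powr r = y powr (2 * lam + r - 2 * real k)"
    proof -
      have "2 * lam + r - 2 * real k = (lam + (lam - 2 * real k)) + r" by simp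
      then show ?thesis by (simp only: powr_add)
    qed
    finally show ?thesis by (simp only: abs_mult)
  qed
  have m: "(\<lambda>y. ker_e lam (x * y) * H y * w y) \<in> borel_measurable hl" using lam by measurable
  show ?thesis
  proof (rule integrable_hl_powr_bound[OF m])
    show "\<bar>ker_e lam (x * y) * H y * w y\<bar> \<le> E * x powr lam * C0 * A * y powr (2 * lam + r - 2 * real 0)" if "0 < y" "y \<le> 1" for y
      by (rule bd[OF that(1) C0(2)[OF that(1)]])
    show "\<bar>ker_e lam (x * y) * H y * w y\<bar> \<le> E * x powr lam * Cj * A * y powr (2 * lam + r - 2 * real j)" if "1 \<le> y" for y
      using bd[OF _ Cj(2), of y] that by simp
  qed (use lam r j in auto)
qed

text \<open>The Gaussian makes the double integral absolutely convergent with no more than the bound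
  \<open>ker_e_le\<close>. So the two Hankel kernels may be integrated first, and Weber's integral
  turns them into the heat kernel.\<close>

lemma heat_transform:
  assumes t: "t > 0" and x: "x > 0"
  shows "(\<integral>y. ker_e lam (x * y) * H y * exp (- t * y\<^sup>2) \<partial>hl) = (\<integral>z. heat_kernel lam t x z * \<phi> z \<partial>hl)"
proof -
  let ?f = "\<lambda>y z. ker_e lam (x * y) * exp (- t * y\<^sup>2) * (ker_e lam (y * z) * \<phi> z)"
  let ?g = "\<lambda>y. E * E * x powr lam * (y powr (2 * (lam + 1 / 2) - 1) * exp (- t * y\<^sup>2))" and ?h = "\<lambda>z. z powr lam * \<bar>\<phi> z\<bar>"
  have ig: "integrable hl ?g" using lam t by (intro integrable_mult_right gauss_integrable) auto
  have ih: "integrable hl ?h"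
  proof (rule Sch_integrable[OF S, where a="2 * lam" and C=1 and k=0])
    show "\<bar>?h z\<bar> \<le> 1 * z powr (2 * lam) * \<bar>Ps 0 z\<bar>" if "z > 0" for z
      using powr_add[of z lam lam] by (simp add: phi[OF that] abs_mult)
  qed (use lam in auto)
  have m: "case_prod ?f \<in> borel_measurable (hl \<Otimes>\<^sub>M hl)"
    unfolding split_beta' using lam measurable_compose[OF measurable_snd phi_measurable] by measurable
  have fin: "(\<integral>\<^sup>+y. \<integral>\<^sup>+z. ennreal \<bar>?f y z\<bar> \<partial>hl \<partial>hl) < \<infinity>"
  proof -
    have "(\<integral>\<^sup>+y. \<integral>\<^sup>+z. ennreal \<bar>?f y z\<bar> \<partial>hl \<partial>hl) \<le> (\<integral>\<^sup>+y. \<integral>\<^sup>+z. ennreal (?g y) * ennreal (?h z) \<partial>hl \<partial>hl)"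
    proof (intro nn_integral_mono)
      fix y z assume "y \<in> space hl" "z \<in> space hl"
      then have yz: "y > 0" "z > 0" by auto
      have "\<bar>ker_e lam (x * y)\<bar> * exp (- t * y\<^sup>2) * (\<bar>ker_e lam (y * z)\<bar> * \<bar>\<phi> z\<bar>) \<le>
         (E * (x * y) powr lam) * exp (- t * y\<^sup>2) * ((E * (y * z) powr lam) * \<bar>\<phi> z\<bar>)"
        using ker_e_le[of "x * y"] ker_e_le[of "y * z"] x yz E by (intro mult_mono mult_right_mono) auto
      also have "\<dots> = E * E * x powr lam * ((y powr lam * y powr lam) * exp (- t * y\<^sup>2)) * ?h z"
        by (simp only: powr_mult mult_ac)
      also have "y powr lam * y powr lam = y powr (2 * (lam + 1 / 2) - 1)" by (simp add: powr_add[symmetric])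
      finally have "\<bar>?f y z\<bar> \<le> ?g y * ?h z" by (simp only: abs_mult abs_exp_cancel)
      then show "ennreal \<bar>?f y z\<bar> \<le> ennreal (?g y) * ennreal (?h z)"
        using E by (subst ennreal_mult[symmetric]) (auto intro!: ennreal_leI)
    qed
    also have "\<dots> = (\<integral>\<^sup>+y. ennreal (?g y) \<partial>hl) * (\<integral>\<^sup>+z. ennreal (?h z) \<partial>hl)"
      by (simp add: nn_integral_cmult nn_integral_multc)
    also have "\<dots> < \<infinity>" using integrable_nn_less_top[OF ig] integrable_nn_less_top[OF ih] by (simp add: ennreal_mult_less_top)
    finally show ?thesis .
  qed
  note F = fubini[OF sigma_finite_hl sigma_finite_hl m fin]
  have "(\<integral>y. ker_e lam (x * y) * H y * exp (- t * y\<^sup>2) \<partial>hl) = (\<integral>y. \<integral>z. ?f y z \<partial>hl \<partial>hl)"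
  proof (intro Bochner_Integration.integral_cong refl)
    fix y assume "y \<in> space hl"
    then show "ker_e lam (x * y) * H y * exp (- t * y\<^sup>2) = (\<integral>z. ?f y z \<partial>hl)"
      by (subst integral_mult_right_zero) (simp add: hankel_ker_e)
  qed
  also have "\<dots> = (\<integral>z. \<integral>y. ?f y z \<partial>hl \<partial>hl)" by (rule F(4))
  also have "\<dots> = (\<integral>z. heat_kernel lam t x z * \<phi> z \<partial>hl)"
  proof (intro Bochner_Integration.integral_cong refl)
    fix z assume "z \<in> space hl"
    then have z: "z > 0" by simp
    have "(\<integral>y. ?f y z \<partial>hl) = (\<integral>y. ker_e lam (x * y) * exp (- t * y\<^sup>2) * ker_e lam (z * y) * \<phi> z \<partial>hl)"
      by (simp only: mult.commute[of z] mult.assoc)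
    also have "\<dots> = heat_kernel lam t x z * \<phi> z"
      unfolding weber[OF lam t x z, symmetric] by (rule integral_mult_left_zero)
    finally show "(\<integral>y. ?f y z \<partial>hl) = heat_kernel lam t x z * \<phi> z" .
  qed
  finally show ?thesis .
qed

text \<open>The heat evolution fixes y^lam, so \<phi>(x) = x^lam \<open>Ps 0 x\<close> can be
  written as \<open>Ps 0 x\<close> times an integral of the heat kernel and subtracted under the
  integral sign.\<close>

lemma heat_diff:
  assumes t: "t > 0" and x: "x > 0"
  shows "integrable hl (\<lambda>z. heat_kernel lam t x z * z powr lam * (Ps 0 x - Ps 0 z))"
    and "\<phi> x - (\<integral>z. heat_kernel lam t x z * \<phi> z \<partial>hl) = (\<integral>z. heat_kernel lam t x z * z powr lam * (Ps 0 x - Ps 0 z) \<partial>hl)"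
proof -
  obtain M where M: "M \<ge> 0" "\<And>x. x > 0 \<Longrightarrow> \<bar>Ps 0 x\<bar> \<le> M" "\<And>x. x \<ge> 1 \<Longrightarrow> \<bar>Ps 0 x\<bar> \<le> M * x powr (- 0)"
    using Sch_bound[OF S, of 0 0] by blast
  note hm = heat_mass_integrable[OF lam t x] heat_mass[OF lam t x]
  note [measurable] = measurable_heat_kernel(2)[OF lam x t]
  have i: "integrable hl (\<lambda>z. heat_kernel lam t x z * z powr lam * Ps 0 z)"
  proof (rule Bochner_Integration.integrable_bound)
    show "integrable hl (\<lambda>z. M * (heat_kernel lam t x z * z powr lam))" by (intro integrable_mult_right hm)
    show "AE z in hl. norm (heat_kernel lam t x z * z powr lam * Ps 0 z) \<le> norm (M * (heat_kernel lam t x z * z powr lam))"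
    proof (rule AE_I2)
      fix z assume "z \<in> space hl"
      then have z: "z > 0" by simp
      have "\<bar>heat_kernel lam t x z * z powr lam\<bar> * \<bar>Ps 0 z\<bar> \<le> \<bar>heat_kernel lam t x z * z powr lam\<bar> * M" by (intro mult_left_mono M z) auto
      then show "norm (heat_kernel lam t x z * z powr lam * Ps 0 z) \<le> norm (M * (heat_kernel lam t x z * z powr lam))"
        using M(1) by (simp add: abs_mult mult.commute)
    qed
  qed measurable
  have eq: "heat_kernel lam t x z * z powr lam * (Ps 0 x - Ps 0 z) = Ps 0 x * (heat_kernel lam t x z * z powr lam) - heat_kernel lam t x z * z powr lam * Ps 0 z" for z
    by (simp add: algebra_simps)
  show "integrable hl (\<lambda>z. heat_kernel lam t x z * z powr lam * (Ps 0 x - Ps 0 z))"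
    unfolding eq by (intro Bochner_Integration.integrable_diff integrable_mult_right hm i)
  have "(\<integral>z. heat_kernel lam t x z * z powr lam * (Ps 0 x - Ps 0 z) \<partial>hl) = Ps 0 x * x powr lam - (\<integral>z. heat_kernel lam t x z * z powr lam * Ps 0 z \<partial>hl)"
    unfolding eq using hm i by simp
  also have "(\<integral>z. heat_kernel lam t x z * z powr lam * Ps 0 z \<partial>hl) = (\<integral>z. heat_kernel lam t x z * \<phi> z \<partial>hl)"
    by (intro Bochner_Integration.integral_cong refl) (simp add: phi)
  finally show "\<phi> x - (\<integral>z. heat_kernel lam t x z * \<phi> z \<partial>hl) = (\<integral>z. heat_kernel lam t x z * z powr lam * (Ps 0 x - Ps 0 z) \<partial>hl)"
    by (simp add: phi[OF x])
qed

text \<open>The moments of the heat kernel against \<open>y powr lam\<close> are explicit, so Lipschitz continuity in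
  \<open>y\<^sup>2\<close> and the arithmetic-geometric mean inequality give a rate of convergence without kernel bounds.\<close>

lemma heat_diff_bound:
  assumes x: "x > 0"
  obtains A where "A \<ge> 0"
    "\<And>t. 0 < t \<Longrightarrow> t \<le> 1 \<Longrightarrow> (\<integral>z. \<bar>heat_kernel lam t x z * z powr lam * (Ps 0 x - Ps 0 z)\<bar> \<partial>hl) \<le> A * sqrt t"
    "\<And>t. t > 0 \<Longrightarrow> (\<integral>z. \<bar>heat_kernel lam t x z * z powr lam * (Ps 0 x - Ps 0 z)\<bar> \<partial>hl) \<le> A"
proof -
  obtain M where M: "M \<ge> 0" "\<And>x. x > 0 \<Longrightarrow> \<bar>Ps 0 x\<bar> \<le> M" "\<And>x. x \<ge> 1 \<Longrightarrow> \<bar>Ps 0 x\<bar> \<le> M * x powr (- 0)"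
    using Sch_bound[OF S, of 0 0] by blast
  obtain D where D: "D \<ge> 0" "\<And>x y. x > 0 \<Longrightarrow> y > 0 \<Longrightarrow> \<bar>Ps 0 y - Ps 0 x\<bar> \<le> D * \<bar>y\<^sup>2 - x\<^sup>2\<bar>"
    using Sch_diff[OF S] by blast
  let ?c = "lam + 1 / 2"
  let ?W = "\<lambda>t z. heat_kernel lam t x z * z powr lam"
  let ?I = "\<lambda>t. \<integral>z. \<bar>?W t z * (Ps 0 x - Ps 0 z)\<bar> \<partial>hl"
  let ?A1 = "D * x powr lam * (1 / 2 + 4 * x\<^sup>2 + 8 * (?c * (?c + 1)))" and ?A2 = "2 * M * x powr lam"
  have W: "?W t z \<ge> 0" if "t > 0" "z > 0" for t z
    using heat_kernel_nonneg[OF lam that(1) x that(2)] by simp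
  have A12: "?A1 \<ge> 0" "?A2 \<ge> 0" using D M lam by (auto intro!: mult_nonneg_nonneg add_nonneg_nonneg)
  have ii: "integrable hl (\<lambda>z. \<bar>?W t z * (Ps 0 x - Ps 0 z)\<bar>)" if "t > 0" for t
    using heat_diff(1)[OF that x] by (rule integrable_abs)
  have small: "?I t \<le> ?A1 * sqrt t" if t: "0 < t" "t \<le> 1" for t
  proof -
    note hm = heat_mass_integrable[OF lam t(1) x] heat_mass[OF lam t(1) x]
    note hv = heat_variance_integrable[OF lam t(1) x] heat_variance[OF lam t(1) x]
    have st: "sqrt t > 0" "sqrt t * sqrt t = t" using t by auto
    have "?I t \<le> (\<integral>z. D * (sqrt t / 2) * ?W t z + D / (2 * sqrt t) * (?W t z * (z\<^sup>2 - x\<^sup>2)\<^sup>2) \<partial>hl)"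
    proof (rule integral_mono[OF ii[OF t(1)]])
      show "integrable hl (\<lambda>z. D * (sqrt t / 2) * ?W t z + D / (2 * sqrt t) * (?W t z * (z\<^sup>2 - x\<^sup>2)\<^sup>2))"
        by (intro Bochner_Integration.integrable_add integrable_mult_right hm hv)
      fix z assume "z \<in> space hl"
      then have z: "z > 0" by simp
      let ?u = "\<bar>z\<^sup>2 - x\<^sup>2\<bar>"
      \<comment> \<open>The weight sqrt t balances the two sides: the mean square of z^2 - x^2 is of
        order t, so both resulting terms are of order sqrt t.\<close>
      have "0 \<le> (sqrt t - ?u)\<^sup>2" by simp
      then have "2 * sqrt t * ?u \<le> sqrt t * sqrt t + ?u\<^sup>2" unfolding power2_diff by (simp add: power2_eq_square)
      then have "?u \<le> sqrt t / 2 + 1 / (2 * sqrt t) * (z\<^sup>2 - x\<^sup>2)\<^sup>2" using st by (simp add: field_simps)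
      then have "D * ?u \<le> D * (sqrt t / 2 + 1 / (2 * sqrt t) * (z\<^sup>2 - x\<^sup>2)\<^sup>2)" using D(1) by (intro mult_left_mono)
      then have "\<bar>Ps 0 x - Ps 0 z\<bar> \<le> D * (sqrt t / 2 + 1 / (2 * sqrt t) * (z\<^sup>2 - x\<^sup>2)\<^sup>2)"
        using D(2)[OF x z] by (simp add: abs_minus_commute)
      then have "?W t z * \<bar>Ps 0 x - Ps 0 z\<bar> \<le> ?W t z * (D * (sqrt t / 2 + 1 / (2 * sqrt t) * (z\<^sup>2 - x\<^sup>2)\<^sup>2))"
        using W[OF t(1) z] by (intro mult_left_mono)
      also have "\<dots> = D * (sqrt t / 2) * ?W t z + D / (2 * sqrt t) * (?W t z * (z\<^sup>2 - x\<^sup>2)\<^sup>2)"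
        by (simp add: algebra_simps)
      finally show "\<bar>?W t z * (Ps 0 x - Ps 0 z)\<bar> \<le> D * (sqrt t / 2) * ?W t z + D / (2 * sqrt t) * (?W t z * (z\<^sup>2 - x\<^sup>2)\<^sup>2)"
        using W[OF t(1) z] by (simp only: abs_mult[of "?W t z"] abs_of_nonneg)
    qed
    also have "\<dots> = D * (sqrt t / 2) * x powr lam + D / (2 * sqrt t) * (x powr lam * (8 * t * x\<^sup>2 + 16 * t\<^sup>2 * (?c * (?c + 1))))"
      using hm hv by simp
    also have "\<dots> = D * x powr lam * sqrt t * (1 / 2 + 4 * x\<^sup>2 + 8 * t * (?c * (?c + 1)))"
    proof -
      have e: "1 / (2 * sqrt t) * (8 * t * x\<^sup>2 + 16 * t\<^sup>2 * (?c * (?c + 1))) = sqrt t * (4 * x\<^sup>2 + 8 * t * (?c * (?c + 1)))"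
      proof -
        have "8 * t * x\<^sup>2 + 16 * t\<^sup>2 * (?c * (?c + 1)) = (2 * sqrt t) * (sqrt t * (4 * x\<^sup>2 + 8 * t * (?c * (?c + 1))))"
        proof -
          have "(2 * sqrt t) * (sqrt t * Z) = 2 * t * Z" for Z using st(2) by (simp add: mult.assoc[symmetric])
          moreover have "8 * t * X + 16 * t\<^sup>2 * Y = 2 * t * (4 * X + 8 * t * Y)" for X Y
            by (simp add: power2_eq_square algebra_simps)
          ultimately show ?thesis by (simp only:)
        qed
        then show ?thesis using st(1) by simp
      qed
      have "D / (2 * sqrt t) * (x powr lam * (8 * t * x\<^sup>2 + 16 * t\<^sup>2 * (?c * (?c + 1)))) = D * x powr lam * (sqrt t * (4 * x\<^sup>2 + 8 * t * (?c * (?c + 1))))"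
      proof -
        have "D / u * (v * w) = D * v * (1 / u * w)" for u v w :: real by simp
        then have "D / (2 * sqrt t) * (x powr lam * (8 * t * x\<^sup>2 + 16 * t\<^sup>2 * (?c * (?c + 1)))) =
          D * x powr lam * (1 / (2 * sqrt t) * (8 * t * x\<^sup>2 + 16 * t\<^sup>2 * (?c * (?c + 1))))" .
        then show ?thesis unfolding e .
      qed
      then show ?thesis by (simp add: algebra_simps)
    qed
    also have "\<dots> \<le> D * x powr lam * sqrt t * (1 / 2 + 4 * x\<^sup>2 + 8 * (?c * (?c + 1)))"
    proof (rule mult_left_mono)
      have "t * (?c * (?c + 1)) \<le> 1 * (?c * (?c + 1))" using t lam by (intro mult_right_mono) auto
      then show "1 / 2 + 4 * x\<^sup>2 + 8 * t * (?c * (?c + 1)) \<le> 1 / 2 + 4 * x\<^sup>2 + 8 * (?c * (?c + 1))" by simp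
    qed (use D st in auto)
    finally show ?thesis by (simp only: mult_ac)
  qed
  have all: "?I t \<le> ?A2" if t: "0 < t" for t
  proof -
    note hm = heat_mass_integrable[OF lam t x] heat_mass[OF lam t x]
    have "?I t \<le> (\<integral>z. 2 * M * ?W t z \<partial>hl)"
    proof (rule integral_mono[OF ii[OF t]])
      show "integrable hl (\<lambda>z. 2 * M * ?W t z)" by (intro integrable_mult_right hm)
      fix z assume "z \<in> space hl"
      then have z: "z > 0" by simp
      have "\<bar>Ps 0 x - Ps 0 z\<bar> \<le> 2 * M" using M(2)[OF x] M(2)[OF z] by linarith
      then have "?W t z * \<bar>Ps 0 x - Ps 0 z\<bar> \<le> ?W t z * (2 * M)" using W[OF t z] by (intro mult_left_mono)
      moreover have "\<bar>?W t z * (Ps 0 x - Ps 0 z)\<bar> = ?W t z * \<bar>Ps 0 x - Ps 0 z\<bar>"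
        using W[OF t z] by (simp only: abs_mult[of "?W t z"] abs_of_nonneg)
      moreover have "?W t z * (2 * M) = 2 * M * ?W t z" by (rule mult.commute)
      ultimately show "\<bar>?W t z * (Ps 0 x - Ps 0 z)\<bar> \<le> 2 * M * ?W t z" by linarith
    qed
    also have "\<dots> = ?A2" using hm by simp
    finally show ?thesis .
  qed
  show ?thesis
  proof (rule that[of "?A1 + ?A2"])
    show "?A1 + ?A2 \<ge> 0" using A12 by simp
    show "?I t \<le> (?A1 + ?A2) * sqrt t" if t: "0 < t" "t \<le> 1" for t
    proof -
      have "0 \<le> ?A2 * sqrt t" using t by (intro mult_nonneg_nonneg A12) auto
      then show ?thesis using small[OF t] unfolding distrib_right by linarith
    qed
    show "?I t \<le> ?A1 + ?A2" if t: "0 < t" for t using all[OF t] A12 by linarith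
  qed
qed

text \<open>Abel summation: the damped integral, at t = 1 / (n + 1), has two limits. Dominated
  convergence removes the damping, while \<open>heat_transform\<close> and
  \<open>heat_diff_bound\<close> bring it to \<phi>(x) at rate sqrt t.\<close>

lemma hankel_inversion:
  assumes x: "x > 0"
  shows "(\<integral>y. ker_e lam (x * y) * H y \<partial>hl) = \<phi> x"
proof -
  let ?t = "\<lambda>n. 1 / real (Suc n)"
  obtain A where A: "A \<ge> 0" "\<And>t. 0 < t \<Longrightarrow> t \<le> 1 \<Longrightarrow> (\<integral>z. \<bar>heat_kernel lam t x z * z powr lam * (Ps 0 x - Ps 0 z)\<bar> \<partial>hl) \<le> A * sqrt t"
    "\<And>t. t > 0 \<Longrightarrow> (\<integral>z. \<bar>heat_kernel lam t x z * z powr lam * (Ps 0 x - Ps 0 z)\<bar> \<partial>hl) \<le> A"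
    using heat_diff_bound[OF x] by blast
  have i: "integrable hl (\<lambda>y. ker_e lam (x * y) * H y * 1)"
    by (rule ker_H_integrable[OF x, where A=1 and r=0]) auto
  have t0: "?t \<longlonglongrightarrow> 0" using LIMSEQ_inverse_real_of_nat by (simp add: divide_inverse)
  have l1: "(\<lambda>n. \<integral>y. ker_e lam (x * y) * H y * exp (- ?t n * y\<^sup>2) \<partial>hl) \<longlonglongrightarrow> (\<integral>y. ker_e lam (x * y) * H y \<partial>hl)"
  proof (rule integral_dominated_convergence[where w="\<lambda>y. \<bar>ker_e lam (x * y) * H y\<bar>"])
    show "(\<lambda>y. ker_e lam (x * y) * H y) \<in> borel_measurable hl" using lam by measurable
    show "(\<lambda>y. ker_e lam (x * y) * H y * exp (- ?t n * y\<^sup>2)) \<in> borel_measurable hl" for n using lam by measurable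
    show "integrable hl (\<lambda>y. \<bar>ker_e lam (x * y) * H y\<bar>)" using i by (intro integrable_abs) simp
    show "AE y in hl. (\<lambda>n. ker_e lam (x * y) * H y * exp (- ?t n * y\<^sup>2)) \<longlonglongrightarrow> ker_e lam (x * y) * H y"
    proof (rule AE_I2)
      fix y :: real
      have "(\<lambda>n. ker_e lam (x * y) * H y * exp (- ?t n * y\<^sup>2)) \<longlonglongrightarrow> ker_e lam (x * y) * H y * exp (- 0 * y\<^sup>2)"
        by (intro tendsto_intros t0)
      then show "(\<lambda>n. ker_e lam (x * y) * H y * exp (- ?t n * y\<^sup>2)) \<longlonglongrightarrow> ker_e lam (x * y) * H y" by simp
    qed
    fix n
    show "AE y in hl. norm (ker_e lam (x * y) * H y * exp (- ?t n * y\<^sup>2)) \<le> \<bar>ker_e lam (x * y) * H y\<bar>"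
    proof (rule AE_I2)
      fix y :: real
      have "exp (- ?t n * y\<^sup>2) \<le> 1" by simp
      then have "\<bar>ker_e lam (x * y) * H y\<bar> * exp (- ?t n * y\<^sup>2) \<le> \<bar>ker_e lam (x * y) * H y\<bar> * 1" by (intro mult_left_mono) auto
      then show "norm (ker_e lam (x * y) * H y * exp (- ?t n * y\<^sup>2)) \<le> \<bar>ker_e lam (x * y) * H y\<bar>"
        by (simp only: real_norm_def abs_mult abs_exp_cancel mult_1_right)
    qed
  qed
  have l2: "(\<lambda>n. \<integral>y. ker_e lam (x * y) * H y * exp (- ?t n * y\<^sup>2) \<partial>hl) \<longlonglongrightarrow> \<phi> x"
  proof (rule LIM_zero_cancel, rule Lim_null_comparison)
    have "(\<lambda>n. A * sqrt (?t n)) \<longlonglongrightarrow> A * sqrt 0" by (intro tendsto_intros t0)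
    then show "(\<lambda>n. A * sqrt (?t n)) \<longlonglongrightarrow> 0" by simp
    show "\<forall>\<^sub>F n in sequentially. norm ((\<integral>y. ker_e lam (x * y) * H y * exp (- ?t n * y\<^sup>2) \<partial>hl) - \<phi> x) \<le> A * sqrt (?t n)"
    proof (rule always_eventually, rule allI)
      fix n
      have t: "?t n > 0" "?t n \<le> 1" by simp_all
      have "norm ((\<integral>y. ker_e lam (x * y) * H y * exp (- ?t n * y\<^sup>2) \<partial>hl) - \<phi> x) = \<bar>\<phi> x - (\<integral>z. heat_kernel lam (?t n) x z * \<phi> z \<partial>hl)\<bar>"
        unfolding heat_transform[OF t(1) x] by (simp only: real_norm_def abs_minus_commute)
      also have "\<dots> \<le> (\<integral>z. \<bar>heat_kernel lam (?t n) x z * z powr lam * (Ps 0 x - Ps 0 z)\<bar> \<partial>hl)"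
        unfolding heat_diff(2)[OF t(1) x] by (rule integral_abs_bound)
      also have "\<dots> \<le> A * sqrt (?t n)" by (rule A(2)[OF t])
      finally show "norm ((\<integral>y. ker_e lam (x * y) * H y * exp (- ?t n * y\<^sup>2) \<partial>hl) - \<phi> x) \<le> A * sqrt (?t n)" .
    qed
  qed
  show ?thesis by (rule LIMSEQ_unique[OF l1 l2])
qed

text \<open>\<open>frac_integral\<close> replaces y^(2 \<sigma>) by damped differences, which
  inversion and \<open>heat_transform\<close> turn into \<phi> minus its heat evolution; the time
  integral of the heat kernel is then \<open>kern\<close>. The exchange of integrals rests on the
  rate sqrt t, which is integrable at 0 against t^(-1 - \<sigma>) exactly for \<sigma> < 1 / 2; in
  the application this follows from 2 \<sigma> < \<alpha> < 1.\<close>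

lemma pos_power_test_eq:
  assumes s: "0 < \<sigma>" "\<sigma> < 1 / 2" and x: "x > 0"
  shows "bessel_pos_power_test lam \<sigma> \<phi> x =
    pos_const lam \<sigma> * (\<integral>z. kern lam (lam + 1 / 2 + \<sigma>) x z * (z powr lam * (Ps 0 x - Ps 0 z)) \<partial>hl)"
proof -
  have s1: "\<sigma> < 1" using s by simp
  note fi = frac_integrable[OF s(1) s1] and fI = frac_integral[OF s(1) s1] and fp = frac_const_pos[OF s(1) s1 zero_less_one]
  let ?eH = "\<lambda>y. ker_e lam (x * y) * H y"
  have eHm [measurable]: "?eH \<in> borel_measurable hl" using lam by measurable
  let ?f = "\<lambda>y t. ?eH y * ((1 - exp (- t * y\<^sup>2)) * t powr (- 1 - \<sigma>))"
  have i2s: "integrable hl (\<lambda>y. ?eH y * y powr (2 * \<sigma>))"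
    by (rule ker_H_integrable[OF x, where A=1 and r="2 * \<sigma>"]) (use s in auto)
  have i0: "integrable hl ?eH" using ker_H_integrable[OF x, of "\<lambda>_. 1" 0 1] by simp
  have it: "integrable hl (\<lambda>y. ?eH y * exp (- t * y\<^sup>2))" if "t > 0" for t
    by (rule ker_H_integrable[OF x, where A=1 and r=0]) (use that in auto)
  have m: "case_prod ?f \<in> borel_measurable (hl \<Otimes>\<^sub>M hl)"
    unfolding split_beta' using measurable_compose[OF measurable_fst eHm] by measurable
  have fin: "(\<integral>\<^sup>+y. \<integral>\<^sup>+t. ennreal \<bar>?f y t\<bar> \<partial>hl \<partial>hl) < \<infinity>"
  proof -
    have "(\<integral>\<^sup>+y. \<integral>\<^sup>+t. ennreal \<bar>?f y t\<bar> \<partial>hl \<partial>hl) = (\<integral>\<^sup>+y. ennreal (frac_const \<sigma> * \<bar>?eH y * y powr (2 * \<sigma>)\<bar>) \<partial>hl)"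
    proof (rule nn_integral_cong)
      fix y assume "y \<in> space hl"
      then have y: "y > 0" by simp
      have nn: "(1 - exp (- t * y\<^sup>2)) * t powr (- 1 - \<sigma>) \<ge> 0" if "t > 0" for t
        using that by (intro mult_nonneg_nonneg) auto
      have "(\<integral>\<^sup>+t. ennreal \<bar>?f y t\<bar> \<partial>hl) = (\<integral>\<^sup>+t. ennreal (\<bar>?eH y\<bar> * ((1 - exp (- t * y\<^sup>2)) * t powr (- 1 - \<sigma>))) \<partial>hl)"
        using nn by (intro nn_integral_cong) (simp add: abs_mult[of "?eH y"])
      also have "\<dots> = ennreal (\<integral>t. \<bar>?eH y\<bar> * ((1 - exp (- t * y\<^sup>2)) * t powr (- 1 - \<sigma>)) \<partial>hl)"
        using nn by (intro nn_integral_eq_integral integrable_mult_right fi[OF y] AE_I2) auto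
      also have "(\<integral>t. \<bar>?eH y\<bar> * ((1 - exp (- t * y\<^sup>2)) * t powr (- 1 - \<sigma>)) \<partial>hl) = frac_const \<sigma> * \<bar>?eH y * y powr (2 * \<sigma>)\<bar>"
        by (simp only: integral_mult_right_zero fI[OF y]) (simp add: abs_mult)
      finally show "(\<integral>\<^sup>+t. ennreal \<bar>?f y t\<bar> \<partial>hl) = ennreal (frac_const \<sigma> * \<bar>?eH y * y powr (2 * \<sigma>)\<bar>)" .
    qed
    also have "\<dots> < \<infinity>" by (intro integrable_nn_less_top integrable_mult_right integrable_abs i2s)
    finally show ?thesis .
  qed
  note F = fubini[OF sigma_finite_hl sigma_finite_hl m fin]
  have "bessel_pos_power_test lam \<sigma> \<phi> x = (\<integral>y. ?eH y * y powr (2 * \<sigma>) \<partial>hl)"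
    unfolding bessel_pos_power_test_def hankel_ker_e[OF x] by (simp only: mult_ac)
  then have "frac_const \<sigma> * bessel_pos_power_test lam \<sigma> \<phi> x = (\<integral>y. frac_const \<sigma> * (?eH y * y powr (2 * \<sigma>)) \<partial>hl)"
    by (simp only: integral_mult_right_zero)
  also have "\<dots> = (\<integral>y. \<integral>t. ?f y t \<partial>hl \<partial>hl)"
  proof (intro Bochner_Integration.integral_cong refl)
    fix y assume "y \<in> space hl"
    then have y: "y > 0" by simp
    show "frac_const \<sigma> * (?eH y * y powr (2 * \<sigma>)) = (\<integral>t. ?f y t \<partial>hl)"
      by (simp only: integral_mult_right_zero fI[OF y]) (simp only: mult_ac)
  qed
  also have "\<dots> = (\<integral>t. \<integral>y. ?f y t \<partial>hl \<partial>hl)" by (rule F(4))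
  also have "\<dots> = (\<integral>t. \<integral>z. t powr (- 1 - \<sigma>) * (heat_kernel lam t x z * z powr lam * (Ps 0 x - Ps 0 z)) \<partial>hl \<partial>hl)"
  proof (rule Bochner_Integration.integral_cong[OF refl])
    fix t assume "t \<in> space hl"
    then have t: "t > 0" by simp
    have "(\<integral>y. ?f y t \<partial>hl) = (\<integral>y. t powr (- 1 - \<sigma>) * (?eH y - ?eH y * exp (- t * y\<^sup>2)) \<partial>hl)"
      by (intro Bochner_Integration.integral_cong refl) (simp add: algebra_simps)
    also have "\<dots> = t powr (- 1 - \<sigma>) * (\<phi> x - (\<integral>z. heat_kernel lam t x z * \<phi> z \<partial>hl))"
      by (simp only: integral_mult_right_zero Bochner_Integration.integral_diff[OF i0 it[OF t]] hankel_inversion[OF x] heat_transform[OF t x])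
    also have "\<dots> = (\<integral>z. t powr (- 1 - \<sigma>) * (heat_kernel lam t x z * z powr lam * (Ps 0 x - Ps 0 z)) \<partial>hl)"
      by (simp only: heat_diff(2)[OF t x] integral_mult_right_zero)
    finally show "(\<integral>y. ?f y t \<partial>hl) = (\<integral>z. t powr (- 1 - \<sigma>) * (heat_kernel lam t x z * z powr lam * (Ps 0 x - Ps 0 z)) \<partial>hl)" .
  qed
  also have "\<dots> = (\<integral>z. \<integral>t. t powr (- 1 - \<sigma>) * (heat_kernel lam t x z * z powr lam * (Ps 0 x - Ps 0 z)) \<partial>hl \<partial>hl)"
  proof -
    let ?g = "\<lambda>t z. t powr (- 1 - \<sigma>) * (heat_kernel lam t x z * z powr lam * (Ps 0 x - Ps 0 z))"
    have mh: "(\<lambda>p. heat_kernel lam (fst p) x (snd p)) \<in> borel_measurable (hl \<Otimes>\<^sub>M hl)"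
      using measurable_heat_kernel(1)[OF lam x] by (simp add: split_beta')
    have mg: "case_prod ?g \<in> borel_measurable (hl \<Otimes>\<^sub>M hl)"
      unfolding split_beta' using mh measurable_compose[OF measurable_snd Ps_measurable[of 0]] by measurable
    obtain A where A: "A \<ge> 0"
      "\<And>t. 0 < t \<Longrightarrow> t \<le> 1 \<Longrightarrow> (\<integral>z. \<bar>heat_kernel lam t x z * z powr lam * (Ps 0 x - Ps 0 z)\<bar> \<partial>hl) \<le> A * sqrt t"
      "\<And>t. t > 0 \<Longrightarrow> (\<integral>z. \<bar>heat_kernel lam t x z * z powr lam * (Ps 0 x - Ps 0 z)\<bar> \<partial>hl) \<le> A"
      using heat_diff_bound[OF x] by blast
    let ?w = "\<lambda>t::real. if t \<le> 1 then A * t powr (- 1 / 2 - \<sigma>) else A * t powr (- 1 - \<sigma>)"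
    have iw: "integrable hl ?w"
      by (rule integrable_hl_powr_bound[where a="- 1 / 2 - \<sigma>" and b="- 1 - \<sigma>" and A=A and B=A]) (use A(1) s in auto)
    have "(\<integral>\<^sup>+t. \<integral>\<^sup>+z. ennreal \<bar>?g t z\<bar> \<partial>hl \<partial>hl) \<le> (\<integral>\<^sup>+t. ennreal (?w t) \<partial>hl)"
    proof (intro nn_integral_mono)
      fix t assume "t \<in> space hl"
      then have t: "t > 0" by simp
      let ?J = "\<integral>z. \<bar>heat_kernel lam t x z * z powr lam * (Ps 0 x - Ps 0 z)\<bar> \<partial>hl"
      have "(\<integral>\<^sup>+z. ennreal \<bar>?g t z\<bar> \<partial>hl) = (\<integral>\<^sup>+z. ennreal (t powr (- 1 - \<sigma>) * \<bar>heat_kernel lam t x z * z powr lam * (Ps 0 x - Ps 0 z)\<bar>) \<partial>hl)"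
        by (intro nn_integral_cong) (simp add: abs_mult)
      also have "\<dots> = ennreal (t powr (- 1 - \<sigma>) * ?J)"
        unfolding integral_mult_right_zero[symmetric]
        by (intro nn_integral_eq_integral integrable_mult_right integrable_abs heat_diff(1)[OF t x]) auto
      also have "\<dots> \<le> ennreal (?w t)"
      proof (rule ennreal_leI)
        show "t powr (- 1 - \<sigma>) * ?J \<le> ?w t"
        proof (cases "t \<le> 1")
          case True
          have "t powr (- 1 - \<sigma>) * ?J \<le> t powr (- 1 - \<sigma>) * (A * sqrt t)" using A(2)[OF t True] by (intro mult_left_mono) auto
          also have "\<dots> = A * (t powr (- 1 - \<sigma>) * t powr (1 / 2))" using t by (simp add: powr_half_sqrt)
          also have "t powr (- 1 - \<sigma>) * t powr (1 / 2) = t powr (- 1 / 2 - \<sigma>)" by (simp add: powr_add[symmetric])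
          finally show ?thesis using True by simp
        next
          case False
          have "t powr (- 1 - \<sigma>) * ?J \<le> t powr (- 1 - \<sigma>) * A" using A(3)[OF t] by (intro mult_left_mono) auto
          then show ?thesis using False by (simp add: mult.commute)
        qed
      qed
      finally show "(\<integral>\<^sup>+z. ennreal \<bar>?g t z\<bar> \<partial>hl) \<le> ennreal (?w t)" .
    qed
    also have "\<dots> < \<infinity>" by (rule integrable_nn_less_top[OF iw])
    finally show ?thesis by (rule fubini(4)[OF sigma_finite_hl sigma_finite_hl mg])
  qed
  also have "\<dots> = (\<integral>z. heat_const lam * invgamma_const (lam + 1 / 2 + \<sigma>) * (kern lam (lam + 1 / 2 + \<sigma>) x z * (z powr lam * (Ps 0 x - Ps 0 z))) \<partial>hl)"
  proof (rule integral_cong_AE)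
    have k [measurable]: "(\<lambda>z. kern lam (lam + 1 / 2 + \<sigma>) x z) \<in> borel_measurable hl" using lam by measurable
    show "(\<lambda>z. heat_const lam * invgamma_const (lam + 1 / 2 + \<sigma>) * (kern lam (lam + 1 / 2 + \<sigma>) x z * (z powr lam * (Ps 0 x - Ps 0 z)))) \<in> borel_measurable hl"
      by measurable
    have mh: "(\<lambda>p. heat_kernel lam (snd p) x (fst p)) \<in> borel_measurable (hl \<Otimes>\<^sub>M hl)"
      using measurable_compose[OF measurable_pair_swap' measurable_heat_kernel(1)[OF lam x]] by (simp add: split_beta')
    show "(\<lambda>z. \<integral>t. t powr (- 1 - \<sigma>) * (heat_kernel lam t x z * z powr lam * (Ps 0 x - Ps 0 z)) \<partial>hl) \<in> borel_measurable hl"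
      using mh measurable_compose[OF measurable_fst Ps_measurable[of 0]]
      by (intro hl.borel_measurable_lebesgue_integral) (simp add: split_beta', measurable)
    show "AE z in hl. (\<integral>t. t powr (- 1 - \<sigma>) * (heat_kernel lam t x z * z powr lam * (Ps 0 x - Ps 0 z)) \<partial>hl) =
      heat_const lam * invgamma_const (lam + 1 / 2 + \<sigma>) * (kern lam (lam + 1 / 2 + \<sigma>) x z * (z powr lam * (Ps 0 x - Ps 0 z)))"
      using AE_hl_neq[of x] AE_space
    proof eventually_elim
      case (elim z)
      then have z: "z > 0" "x \<noteq> z" by auto
      have "(\<integral>t. t powr (- 1 - \<sigma>) * (heat_kernel lam t x z * z powr lam * (Ps 0 x - Ps 0 z)) \<partial>hl) =
         (\<integral>t. (t powr (- 1 - \<sigma>) * heat_kernel lam t x z) * (z powr lam * (Ps 0 x - Ps 0 z)) \<partial>hl)" by (simp only: mult.assoc)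
      also have "\<dots> = (\<integral>t. t powr (- 1 - \<sigma>) * heat_kernel lam t x z \<partial>hl) * (z powr lam * (Ps 0 x - Ps 0 z))"
        by (rule integral_mult_left_zero)
      finally show ?case unfolding heat_t_integral[OF lam s(1) x z] by (simp only: mult.assoc)
    qed
  qed
  also have "\<dots> = heat_const lam * invgamma_const (lam + 1 / 2 + \<sigma>) * (\<integral>z. kern lam (lam + 1 / 2 + \<sigma>) x z * (z powr lam * (Ps 0 x - Ps 0 z)) \<partial>hl)"
    by (rule integral_mult_right_zero)
  finally show ?thesis unfolding pos_const_def using fp by (simp add: field_simps)
qed

end

subsection \<open>Positive powers\<close>

lemma Hol_cmult:
  assumes f: "Hol A a f"
  shows "Hol (\<bar>c\<bar> * A) a (\<lambda>x. c * f x)"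
  unfolding Hol_def
proof (intro conjI allI impI)
  show "0 \<le> \<bar>c\<bar> * A" using Hol_nonneg[OF f] by simp
  fix x :: real assume x: "x > 0"
  show "\<bar>c * f x\<bar> \<le> \<bar>c\<bar> * A * x powr a"
    using mult_left_mono[OF Hol_bound[OF f x], of "\<bar>c\<bar>"] by (simp only: abs_mult mult.assoc abs_ge_zero)
  fix y :: real assume y: "y > 0"
  show "\<bar>c * f x - c * f y\<bar> \<le> \<bar>c\<bar> * A * \<bar>x - y\<bar> powr a"
    using mult_left_mono[OF Hol_diff[OF f x y], of "\<bar>c\<bar>"]
    by (simp only: right_diff_distrib[symmetric] abs_mult mult.assoc abs_ge_zero)
qed

text \<open>Two estimates are merged by the minimum: decay alone, and Lipschitz continuity in x^2
  with the decay taken at the smaller point. The minimum tames the singularity of the kernel on the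
  diagonal, the weights give convergence at infinity.\<close>

lemma Sch_weight:
  assumes S: "Sch Ps"
  obtains C where "C \<ge> 0" "\<And>x y. x > 0 \<Longrightarrow> y > 0 \<Longrightarrow> \<bar>Ps 0 x - Ps 0 y\<bar> \<le> C * min 1 \<bar>x\<^sup>2 - y\<^sup>2\<bar> * ((1 + x) powr (- real m) + (1 + y) powr (- real m))"
proof -
  have "\<exists>C. \<forall>x>0. (1 + x) ^ m * \<bar>Ps k x\<bar> \<le> C" for k using S unfolding Sch_def by blast
  then obtain C where C: "\<And>k x. x > 0 \<Longrightarrow> (1 + x) ^ m * \<bar>Ps k x\<bar> \<le> C k" by metis
  let ?r = "\<lambda>x. (1 + x) powr (- real m)"
  have b: "\<bar>Ps k x\<bar> \<le> C k * ?r x" if "x > 0" for k x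
    using C[OF that, of k] that by (simp add: powr_minus powr_realpow field_simps)
  have C0: "C k \<ge> 0" for k using C[of 1 k] by (rule order_trans[rotated]) auto
  let ?C = "C 0 + C (Suc 0)"
  have lt: "\<bar>Ps 0 x - Ps 0 y\<bar> \<le> C (Suc 0) * \<bar>x\<^sup>2 - y\<^sup>2\<bar> * ?r x" if xy: "0 < x" "x < y" for x y
  proof -
    have "\<exists>u>x. u < y \<and> Ps 0 y - Ps 0 x = (y - x) * (u * Ps (Suc 0) u)"
      using xy by (intro MVT2 Sch_deriv[OF S]) auto
    then obtain u where u: "x < u" "u < y" "Ps 0 y - Ps 0 x = (y - x) * (u * Ps (Suc 0) u)" by blast
    have "\<bar>Ps (Suc 0) u\<bar> \<le> C (Suc 0) * ?r u" using u xy by (intro b) auto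
    also have "\<dots> \<le> C (Suc 0) * ?r x" using u xy C0 by (intro mult_left_mono powr_mono2') auto
    finally have "u * \<bar>Ps (Suc 0) u\<bar> \<le> (y + x) * (C (Suc 0) * ?r x)" using u xy by (intro mult_mono) auto
    then have "(y - x) * (u * \<bar>Ps (Suc 0) u\<bar>) \<le> (y - x) * ((y + x) * (C (Suc 0) * ?r x))" using xy by (intro mult_left_mono) auto
    moreover have "\<bar>Ps 0 x - Ps 0 y\<bar> = (y - x) * (u * \<bar>Ps (Suc 0) u\<bar>)"
      unfolding abs_minus_commute[of "Ps 0 x"] u(3) using u xy by (simp add: abs_mult)
    moreover have "\<bar>x\<^sup>2 - y\<^sup>2\<bar> = (y - x) * (y + x)"
      using xy power_strict_mono[of x y 2] by (simp add: power2_eq_square algebra_simps)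
    ultimately show ?thesis by (simp add: mult_ac)
  qed
  have "\<bar>Ps 0 x - Ps 0 y\<bar> \<le> ?C * min 1 \<bar>x\<^sup>2 - y\<^sup>2\<bar> * (?r x + ?r y)" if xy: "x > 0" "y > 0" for x y
  proof (cases "\<bar>x\<^sup>2 - y\<^sup>2\<bar> \<ge> 1")
    case True
    have "\<bar>Ps 0 x - Ps 0 y\<bar> \<le> C 0 * ?r x + C 0 * ?r y" using b[OF xy(1), of 0] b[OF xy(2), of 0] by linarith
    also have "\<dots> = C 0 * (?r x + ?r y)" by (simp only: distrib_left)
    also have "\<dots> \<le> ?C * (?r x + ?r y)" using C0 by (intro mult_right_mono) auto
    finally show ?thesis using True by simp
  next
    case False
    have "\<bar>Ps 0 x - Ps 0 y\<bar> \<le> C (Suc 0) * \<bar>x\<^sup>2 - y\<^sup>2\<bar> * (?r x + ?r y)"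
    proof (cases x y rule: linorder_cases)
      case less
      have "C (Suc 0) * \<bar>x\<^sup>2 - y\<^sup>2\<bar> * ?r x \<le> C (Suc 0) * \<bar>x\<^sup>2 - y\<^sup>2\<bar> * (?r x + ?r y)" using C0 by (intro mult_left_mono) auto
      then show ?thesis using lt[OF xy(1) less] by linarith
    next
      case greater
      have "C (Suc 0) * \<bar>y\<^sup>2 - x\<^sup>2\<bar> * ?r y \<le> C (Suc 0) * \<bar>y\<^sup>2 - x\<^sup>2\<bar> * (?r x + ?r y)" using C0 by (intro mult_left_mono) auto
      then show ?thesis using lt[OF xy(2) greater] by (simp add: abs_minus_commute)
    qed simp
    also have "\<dots> \<le> ?C * \<bar>x\<^sup>2 - y\<^sup>2\<bar> * (?r x + ?r y)" using C0 by (intro mult_right_mono) auto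
    finally show ?thesis using False by (simp add: min_def)
  qed
  then show ?thesis using that[of ?C] C0 by (simp add: add_nonneg_nonneg)
qed

text \<open>The factor 1 + x^2 is what remains when min(1, |x^2 - y^2|) is rescaled to the point 1;
  m has to beat it together with the power.\<close>

lemma weight_integrable:
  assumes "r > -1" "r + 3 < real m"
  shows "integrable hl (\<lambda>x. x powr r * (1 + x\<^sup>2) * (1 + x) powr (- real m))"
proof (rule integrable_hl_powr_bound[where a=r and b="r + 2 - real m" and A=2 and B=2])
  fix x :: real assume x: "0 < x" "x \<le> 1"
  have "(1 + x\<^sup>2) * (1 + x) powr (- real m) \<le> 2 * 1"
    using x powr_mono2'[of "- real m" 1 "1 + x"] by (intro mult_mono) (auto simp: power_le_one)
  then have "x powr r * ((1 + x\<^sup>2) * (1 + x) powr (- real m)) \<le> x powr r * (2 * 1)" by (intro mult_left_mono) auto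
  moreover have "0 \<le> x powr r * (1 + x\<^sup>2) * (1 + x) powr (- real m)" by (intro mult_nonneg_nonneg) auto
  ultimately show "\<bar>x powr r * (1 + x\<^sup>2) * (1 + x) powr (- real m)\<bar> \<le> 2 * x powr r" by (simp add: mult.assoc)
next
  fix x :: real assume x: "x \<ge> 1"
  have "1 + x\<^sup>2 \<le> 2 * x\<^sup>2" using x by (simp add: one_le_power)
  moreover have "(1 + x) powr (- real m) \<le> x powr (- real m)" using x by (intro powr_mono2') auto
  ultimately have "x powr r * ((1 + x\<^sup>2) * (1 + x) powr (- real m)) \<le> x powr r * (2 * x\<^sup>2 * x powr (- real m))"
    by (intro mult_left_mono mult_mono) auto
  also have "\<dots> = 2 * (x powr r * x powr 2 * x powr (- real m))" using x by simp
  also have "\<dots> = 2 * x powr (r + 2 - real m)" by (simp only: powr_add[symmetric]) simp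
  finally have "x powr r * ((1 + x\<^sup>2) * (1 + x) powr (- real m)) \<le> 2 * x powr (r + 2 - real m)" .
  moreover have "0 \<le> x powr r * (1 + x\<^sup>2) * (1 + x) powr (- real m)" by (intro mult_nonneg_nonneg) auto
  ultimately show "\<bar>x powr r * (1 + x\<^sup>2) * (1 + x) powr (- real m)\<bar> \<le> 2 * x powr (r + 2 - real m)" by (simp add: mult.assoc)
qed (use assms in auto)

text \<open>After scaling to the point 1, one fixed integrable majorant serves all x, and the
  dependence on x is an explicit power times B.\<close>

lemma (in frac_kernel) nn_integral_K_le:
  assumes x: "x > 0" and [measurable]: "w \<in> borel_measurable hl" and i: "integrable hl (\<lambda>z. K 1 z * v z)"
    and w0: "\<And>y. y > 0 \<Longrightarrow> 0 \<le> w y" and wv: "\<And>z. z > 0 \<Longrightarrow> w (x * z) \<le> B * v z"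
  shows "(\<integral>\<^sup>+y. ennreal (K x y * w y) \<partial>hl) \<le> ennreal (x powr tau * (B * (\<integral>z. K 1 z * v z \<partial>hl)))"
proof -
  have iB: "integrable hl (\<lambda>z. B * (K 1 z * v z))" by (intro integrable_mult_right i)
  have le: "K 1 z * w (x * z) \<le> B * (K 1 z * v z)" if "z > 0" for z
    using mult_left_mono[OF wv[OF that] K_nonneg[of 1 z]] by (simp add: mult_ac)
  have "(\<lambda>z. x * z) \<in> hl \<rightarrow>\<^sub>M hl"
    unfolding hl_def using x by (intro measurable_restrict_space3) auto
  then have "(\<lambda>z. w (x * z)) \<in> borel_measurable hl" by (rule measurable_compose) (rule assms(2))
  then have m: "(\<lambda>z. K 1 z * w (x * z)) \<in> borel_measurable hl" by measurable
  have iw: "integrable hl (\<lambda>z. K 1 z * w (x * z))"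
  proof (rule Bochner_Integration.integrable_bound[OF iB m])
    show "AE z in hl. norm (K 1 z * w (x * z)) \<le> norm (B * (K 1 z * v z))"
    proof (rule AE_I2)
      fix z assume "z \<in> space hl"
      then have z: "z > 0" by simp
      then have "0 \<le> K 1 z * w (x * z)" using x by (intro mult_nonneg_nonneg K_nonneg w0) auto
      then show "norm (K 1 z * w (x * z)) \<le> norm (B * (K 1 z * v z))" using le[OF z] by simp
    qed
  qed
  have nn: "(\<integral>\<^sup>+y. ennreal (K x y * w y) \<partial>hl) = ennreal (\<integral>y. K x y * w y \<partial>hl)"
    using iw w0 by (intro nn_integral_eq_integral AE_I2 mult_nonneg_nonneg K_nonneg) (auto simp: integrable_K_scale[OF x])
  have "(\<integral>y. K x y * w y \<partial>hl) = x powr tau * (\<integral>z. K 1 z * w (x * z) \<partial>hl)" by (rule integral_K_scale[OF x])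
  also have "\<dots> \<le> x powr tau * (\<integral>z. B * (K 1 z * v z) \<partial>hl)"
    by (intro mult_left_mono integral_mono iw iB) (auto intro: le)
  also have "(\<integral>z. B * (K 1 z * v z) \<partial>hl) = B * (\<integral>z. K 1 z * v z \<partial>hl)" by (rule integral_mult_right_zero)
  finally show ?thesis unfolding nn by (rule ennreal_leI)
qed

context
  fixes lam \<sigma> \<alpha> :: real
  assumes l1: "lam \<ge> 1" and sig: "0 < \<sigma>" and alp: "0 < \<alpha>" "\<alpha> < 1" and pos: "0 < \<alpha> - 2 * \<sigma>"
begin

interpretation frac_kernel lam "- (2 * \<sigma>)" \<alpha>
  using l1 sig alp pos by unfold_locales auto

lemma t0: "- (2 * \<sigma>) < 0" using sig by simp

text \<open>Both sides are double integrals against the same symmetric kernel, one compensated by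
  the test function and the other by u. Single terms diverge in general at the diagonal and cannot
  be moved alone. So absolute convergence is proved for each compensated integrand as a whole, and
  only their difference is symmetrised.\<close>

lemma duality:
  assumes u: "Hol N \<alpha> u" and S: "Sch Ps" and phi: "\<And>x. x > 0 \<Longrightarrow> \<phi> x = x powr lam * Ps 0 x"
  shows "integrable hl (\<lambda>x. u x * bessel_pos_power_test lam \<sigma> \<phi> x)"
    and "integrable hl (\<lambda>x. pos_const lam \<sigma> * V u x * \<phi> x)"
    and "(\<integral>x. u x * bessel_pos_power_test lam \<sigma> \<phi> x \<partial>hl) = (\<integral>x. pos_const lam \<sigma> * V u x * \<phi> x \<partial>hl)"
proof -
  interpret test_function lam Ps \<phi> using lam S phi by unfold_locales
  note [measurable] = Hol_measurable[OF u alp(1)]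
  note u1 = measurable_compose[OF measurable_fst Hol_measurable[OF u alp(1)]]
    and u2 = measurable_compose[OF measurable_snd Hol_measurable[OF u alp(1)]]
    and p1 = measurable_compose[OF measurable_fst phi_measurable] and p2 = measurable_compose[OF measurable_snd phi_measurable]
    and s1 = measurable_compose[OF measurable_fst Ps_measurable[of 0]] and s2 = measurable_compose[OF measurable_snd Ps_measurable[of 0]]
  have N: "N \<ge> 0" by (rule Hol_nonneg[OF u])
  have pp: "p = lam + 1 / 2 + \<sigma>" unfolding p_def by simp
  have sh: "\<sigma> < 1 / 2" using pos alp by simp
  let ?J = "\<lambda>x y. u x * (K x y * (y powr lam * (Ps 0 x - Ps 0 y)))"
  let ?L = "\<lambda>x y. \<phi> x * (K x y * (u x * (y / x) powr lam - u y))"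
  have mJ: "case_prod ?J \<in> borel_measurable (hl \<Otimes>\<^sub>M hl)"
    unfolding split_beta' using u1 s1 s2 by measurable
  have mL: "case_prod ?L \<in> borel_measurable (hl \<Otimes>\<^sub>M hl)"
    unfolding split_beta' using u1 u2 p1 by measurable
  have finL: "(\<integral>\<^sup>+x. \<integral>\<^sup>+y. ennreal \<bar>?L x y\<bar> \<partial>hl \<partial>hl) < \<infinity>"
  proof -
    \<comment> \<open>As in \<open>V_eq\<close>, the bracket splits into the part from (y / x)^lam
      and the Hoelder increment of u; each vanishes at the diagonal to sufficient order.\<close>
    let ?v = "\<lambda>z. \<bar>z powr lam - 1\<bar> + \<bar>z - 1\<bar> powr \<alpha>"
    have "integrable hl (\<lambda>z. \<bar>K 1 z * (z powr lam - 1)\<bar>)" by (intro integrable_abs VB_integrable t0 l1)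
    then have iv1: "integrable hl (\<lambda>z. K 1 z * \<bar>z powr lam - 1\<bar>)" by (simp add: abs_mult K_nonneg)
    have iv2: "integrable hl (\<lambda>z. K 1 z * \<bar>z - 1\<bar> powr \<alpha>)"
      by (rule integrable_K1[where g=\<alpha> and d=\<alpha> and D=1]) (use b in auto)
    have iv: "integrable hl (\<lambda>z. K 1 z * ?v z)" using iv1 iv2 by (simp add: distrib_left)
    define c where "c = (\<integral>z. K 1 z * ?v z \<partial>hl)"
    let ?h = "\<lambda>x. \<bar>\<phi> x\<bar> * (x powr (- (2 * \<sigma>)) * (N * x powr \<alpha> * c))"
    have c0: "c \<ge> 0" unfolding c_def by (intro Bochner_Integration.integral_nonneg mult_nonneg_nonneg K_nonneg) auto
    have ih: "integrable hl ?h"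
    proof (rule Sch_integrable[OF S, where a="lam - 2 * \<sigma> + \<alpha>" and C="N * c" and k=0])
      fix x :: real assume x: "x > 0"
      have "?h x = N * c * (x powr lam * x powr (- (2 * \<sigma>)) * x powr \<alpha>) * \<bar>Ps 0 x\<bar>" using x by (simp add: phi abs_mult)
      also have "x powr lam * x powr (- (2 * \<sigma>)) * x powr \<alpha> = x powr (lam - 2 * \<sigma> + \<alpha>)" by (simp only: powr_add[symmetric]) simp
      finally have "?h x = N * c * x powr (lam - 2 * \<sigma> + \<alpha>) * \<bar>Ps 0 x\<bar>" .
      moreover have "0 \<le> ?h x" using N c0 by (intro mult_nonneg_nonneg) auto
      ultimately show "\<bar>?h x\<bar> \<le> N * c * x powr (lam - 2 * \<sigma> + \<alpha>) * \<bar>Ps 0 x\<bar>" by linarith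
    qed (use N c0 lam pos in auto)
    have "(\<integral>\<^sup>+x. \<integral>\<^sup>+y. ennreal \<bar>?L x y\<bar> \<partial>hl \<partial>hl) \<le> (\<integral>\<^sup>+x. ennreal (?h x) \<partial>hl)"
    proof (intro nn_integral_mono)
      fix x assume "x \<in> space hl"
      then have x: "x > 0" by simp
      let ?w = "\<lambda>y. \<bar>u x * (y / x) powr lam - u y\<bar>"
      have "(\<integral>\<^sup>+y. ennreal \<bar>?L x y\<bar> \<partial>hl) = (\<integral>\<^sup>+y. ennreal \<bar>\<phi> x\<bar> * ennreal (K x y * ?w y) \<partial>hl)"
        by (intro nn_integral_cong) (simp add: abs_mult K_nonneg ennreal_mult'[symmetric])
      also have "\<dots> = ennreal \<bar>\<phi> x\<bar> * (\<integral>\<^sup>+y. ennreal (K x y * ?w y) \<partial>hl)"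
        by (rule nn_integral_cmult) measurable
      also have "\<dots> \<le> ennreal \<bar>\<phi> x\<bar> * ennreal (x powr (- (2 * \<sigma>)) * (N * x powr \<alpha> * c))"
        unfolding c_def
      proof (intro mult_left_mono nn_integral_K_le[OF x _ iv])
        fix z :: real assume z: "z > 0"
        have "\<bar>u x * (z powr lam - 1)\<bar> \<le> N * x powr \<alpha> * \<bar>z powr lam - 1\<bar>"
          unfolding abs_mult using Hol_bound[OF u x] by (intro mult_right_mono) auto
        moreover have "\<bar>u x - u (x * z)\<bar> \<le> N * x powr \<alpha> * \<bar>z - 1\<bar> powr \<alpha>"
          using Hol_diff[OF Hol_scale[OF u x], of 1 z] z by (simp add: abs_minus_commute)
        moreover have "u x * (x * z / x) powr lam - u (x * z) = u x * (z powr lam - 1) + (u x - u (x * z))"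
          using x by (simp add: algebra_simps)
        ultimately show "?w (x * z) \<le> N * x powr \<alpha> * ?v z" unfolding distrib_left by linarith
      qed (auto, measurable)
      also have "\<dots> = ennreal (?h x)" by (simp add: ennreal_mult'[symmetric])
      finally show "(\<integral>\<^sup>+y. ennreal \<bar>?L x y\<bar> \<partial>hl) \<le> ennreal (?h x)" .
    qed
    also have "\<dots> < \<infinity>" by (rule integrable_nn_less_top[OF ih])
    finally show ?thesis .
  qed
  have finJ: "(\<integral>\<^sup>+x. \<integral>\<^sup>+y. ennreal \<bar>?J x y\<bar> \<partial>hl \<partial>hl) < \<infinity>"
  proof -
    \<comment> \<open>Enough for \<open>weight_integrable\<close> with the power lam + \<alpha> - 2
      \<sigma>, which is below lam + 1.\<close>
    obtain m :: nat where m: "lam + 5 < real m" using reals_Archimedean2 by blast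
    obtain C where C: "C \<ge> 0" "\<And>x y. x > 0 \<Longrightarrow> y > 0 \<Longrightarrow> \<bar>Ps 0 x - Ps 0 y\<bar> \<le> C * min 1 \<bar>x\<^sup>2 - y\<^sup>2\<bar> * ((1 + x) powr (- real m) + (1 + y) powr (- real m))"
      using Sch_weight[OF S, of m] by blast
    let ?r = "\<lambda>x. (1 + x) powr (- real m)" and ?mi = "\<lambda>x y::real. min 1 \<bar>x\<^sup>2 - y\<^sup>2\<bar>"
    let ?v = "\<lambda>e z::real. z powr e * min 1 \<bar>1 - z\<^sup>2\<bar>"
    \<comment> \<open>Scaling costs x^2; the summand 1 covers the case in which the minimum on the
      right is 1.\<close>
    have ms: "?mi x (x * z) \<le> (1 + x\<^sup>2) * min 1 \<bar>1 - z\<^sup>2\<bar>" for x z :: real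
    proof -
      have "\<bar>x\<^sup>2 - (x * z)\<^sup>2\<bar> = x\<^sup>2 * \<bar>1 - z\<^sup>2\<bar>"
        by (simp add: power_mult_distrib right_diff_distrib[of "x\<^sup>2" 1, simplified, symmetric] abs_mult)
      moreover have "min 1 (s * q) \<le> (1 + s) * min 1 q" if "s \<ge> 0" "q \<ge> 0" for s q :: real
      proof (cases "q \<ge> 1")
        case False
        have "min 1 (s * q) \<le> s * q" by simp
        also have "\<dots> \<le> (1 + s) * q" using that by (intro mult_right_mono) auto
        finally show ?thesis using False by simp
      qed (use that in auto)
      ultimately show ?thesis by simp
    qed
    have iv: "integrable hl (\<lambda>z. K 1 z * ?v e z)" if e: "0 \<le> e" "e \<le> lam" for e
    proof (rule integrable_K1[where g=1 and d=e and D="2 powr e * 3"])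
      fix z :: real assume z: "z > 0" "z \<noteq> 1" "\<bar>z - 1\<bar> \<le> 1"
      have "z powr e \<le> 2 powr e" using z e by (intro powr_mono2) auto
      moreover have "min 1 \<bar>1 - z\<^sup>2\<bar> \<le> 3 * \<bar>z - 1\<bar>"
      proof -
        have "1 - z\<^sup>2 = (1 - z) * (1 + z)" by (simp add: power2_eq_square algebra_simps)
        then have "\<bar>1 - z\<^sup>2\<bar> = \<bar>z - 1\<bar> * \<bar>1 + z\<bar>" by (simp only: abs_mult abs_minus_commute)
        also have "\<dots> \<le> \<bar>z - 1\<bar> * 3" using z by (intro mult_left_mono) auto
        finally show ?thesis by simp
      qed
      ultimately have "z powr e * min 1 \<bar>1 - z\<^sup>2\<bar> \<le> 2 powr e * (3 * \<bar>z - 1\<bar>)" by (intro mult_mono) auto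
      then show "\<bar>?v e z\<bar> \<le> 2 powr e * 3 * \<bar>z - 1\<bar> powr 1" by (simp add: abs_mult)
    next
      fix z :: real assume z: "z > 0" "\<bar>z - 1\<bar> \<ge> 1"
      have "z powr e \<le> (2 * \<bar>z - 1\<bar>) powr e" using z e by (intro powr_mono2) auto
      also have "\<dots> = 2 powr e * \<bar>z - 1\<bar> powr e" by (rule powr_mult)
      finally have "z powr e * min 1 \<bar>1 - z\<^sup>2\<bar> \<le> 2 powr e * \<bar>z - 1\<bar> powr e * 3" by (intro mult_mono) auto
      then show "\<bar>?v e z\<bar> \<le> 2 powr e * 3 * \<bar>z - 1\<bar> powr e" by (simp add: abs_mult mult_ac)
    qed (use e sig tau in auto)
    define c where "c e = (\<integral>z. K 1 z * ?v e z \<partial>hl)" for e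
    have c0: "c e \<ge> 0" for e unfolding c_def by (intro Bochner_Integration.integral_nonneg mult_nonneg_nonneg K_nonneg) auto
    have inner: "(\<integral>\<^sup>+y. ennreal (K x y * (y powr e * ?mi x y)) \<partial>hl) \<le> ennreal (x powr (- (2 * \<sigma>)) * (x powr e * (1 + x\<^sup>2) * c e))"
      if x: "x > 0" and e: "0 \<le> e" "e \<le> lam" for x e
      unfolding c_def
    proof (rule nn_integral_K_le[OF x _ iv[OF e]])
      fix z :: real assume z: "z > 0"
      have "(x * z) powr e * ?mi x (x * z) \<le> (x * z) powr e * ((1 + x\<^sup>2) * min 1 \<bar>1 - z\<^sup>2\<bar>)"
        by (intro mult_left_mono ms) auto
      also have "\<dots> = x powr e * (1 + x\<^sup>2) * ?v e z" by (simp only: powr_mult mult_ac)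
      finally show "(x * z) powr e * ?mi x (x * z) \<le> x powr e * (1 + x\<^sup>2) * ?v e z" .
    qed auto
    have out: "integrable hl (\<lambda>x. ?r x * (x powr e' * (x powr (- (2 * \<sigma>)) * (x powr e * (1 + x\<^sup>2) * c e))))" if "e + e' = lam + \<alpha>" for e e'
    proof -
      have "integrable hl (\<lambda>x. c e * (x powr (lam + \<alpha> - 2 * \<sigma>) * (1 + x\<^sup>2) * ?r x))"
        using m lam sig pos alp by (intro integrable_mult_right weight_integrable) auto
      moreover have "?r x * (x powr e' * (x powr (- (2 * \<sigma>)) * (x powr e * (1 + x\<^sup>2) * c e))) = c e * (x powr (lam + \<alpha> - 2 * \<sigma>) * (1 + x\<^sup>2) * ?r x)" for x
      proof -
        have "x powr (lam + \<alpha> - 2 * \<sigma>) = x powr ((e + e') + - (2 * \<sigma>))" by (simp add: that)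
        also have "\<dots> = x powr e * x powr e' * x powr (- (2 * \<sigma>))" by (simp only: powr_add)
        finally show ?thesis by (simp only: mult_ac)
      qed
      ultimately show ?thesis by (simp only:)
    qed
    \<comment> \<open>One term for each decay weight. In \<open>?A\<close> the weight depends on the
      outer variable; in \<open>?B\<close> it depends on y, so the order of integration is exchanged
      first and the kernel is written with y as its first argument.\<close>
    let ?A = "\<lambda>x y. (?r x * x powr \<alpha>) * (K x y * (y powr lam * ?mi x y))"
    let ?B = "\<lambda>x y. (?r y * y powr lam) * (K y x * (x powr \<alpha> * ?mi y x))"
    have "(\<integral>\<^sup>+x. \<integral>\<^sup>+y. ennreal \<bar>?J x y\<bar> \<partial>hl \<partial>hl) \<le> (\<integral>\<^sup>+x. \<integral>\<^sup>+y. ennreal (N * C) * ennreal (?A x y) + ennreal (N * C) * ennreal (?B x y) \<partial>hl \<partial>hl)"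
    proof (intro nn_integral_mono)
      fix x y assume "x \<in> space hl" "y \<in> space hl"
      then have xy: "x > 0" "y > 0" by auto
      have "\<bar>?J x y\<bar> = \<bar>u x\<bar> * (K x y * y powr lam) * \<bar>Ps 0 x - Ps 0 y\<bar>" by (simp add: abs_mult K_nonneg)
      also have "\<dots> \<le> (N * x powr \<alpha>) * (K x y * y powr lam) * (C * ?mi x y * (?r x + ?r y))"
        using N K_nonneg[of x y] by (intro mult_mono mult_right_mono mult_nonneg_nonneg Hol_bound[OF u xy(1)] C(2)[OF xy]) auto
      also have "\<dots> = N * C * ?A x y + N * C * ?B x y"
      proof -
        have "K y x = K x y" "?mi y x = ?mi x y" by (simp_all add: K_commute[of y x] abs_minus_commute)
        then show ?thesis by (simp only:) (simp add: distrib_left mult_ac)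
      qed
      finally have "ennreal \<bar>?J x y\<bar> \<le> ennreal (N * C * ?A x y + N * C * ?B x y)" by (rule ennreal_leI)
      also have "\<dots> = ennreal (N * C) * ennreal (?A x y) + ennreal (N * C) * ennreal (?B x y)"
      proof -
        have "0 \<le> ?A x y" "0 \<le> ?B x y" using K_nonneg[of x y] K_nonneg[of y x] by (auto intro!: mult_nonneg_nonneg)
        then show ?thesis using N C(1) by (subst ennreal_plus) (auto simp: ennreal_mult intro!: mult_nonneg_nonneg)
      qed
      finally show "ennreal \<bar>?J x y\<bar> \<le> ennreal (N * C) * ennreal (?A x y) + ennreal (N * C) * ennreal (?B x y)" .
    qed
    also have "\<dots> = ennreal (N * C) * (\<integral>\<^sup>+x. \<integral>\<^sup>+y. ennreal (?A x y) \<partial>hl \<partial>hl) + ennreal (N * C) * (\<integral>\<^sup>+x. \<integral>\<^sup>+y. ennreal (?B x y) \<partial>hl \<partial>hl)"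
    proof -
      have mA: "(\<lambda>x. \<integral>\<^sup>+y. ennreal (?A x y) \<partial>hl) \<in> borel_measurable hl"
        by (rule hl.borel_measurable_nn_integral) (simp add: split_beta', measurable)
      have mB: "(\<lambda>x. \<integral>\<^sup>+y. ennreal (?B x y) \<partial>hl) \<in> borel_measurable hl"
        by (rule hl.borel_measurable_nn_integral) (simp add: split_beta', measurable)
      have "(\<integral>\<^sup>+y. ennreal (N * C) * ennreal (?A x y) + ennreal (N * C) * ennreal (?B x y) \<partial>hl) =
         ennreal (N * C) * (\<integral>\<^sup>+y. ennreal (?A x y) \<partial>hl) + ennreal (N * C) * (\<integral>\<^sup>+y. ennreal (?B x y) \<partial>hl)" for x
      proof -
        have 1: "(\<lambda>y. ennreal (?A x y)) \<in> borel_measurable hl" "(\<lambda>y. ennreal (?B x y)) \<in> borel_measurable hl" by measurable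
        show ?thesis by (subst nn_integral_add) (use 1 in \<open>auto simp: nn_integral_cmult\<close>)
      qed
      then show ?thesis using mA mB by (simp add: nn_integral_add nn_integral_cmult)
    qed
    also have "\<dots> < \<infinity>"
    proof -
      have A: "(\<integral>\<^sup>+x. \<integral>\<^sup>+y. ennreal (?A x y) \<partial>hl \<partial>hl) < \<infinity>"
      proof -
        have "(\<integral>\<^sup>+x. \<integral>\<^sup>+y. ennreal (?A x y) \<partial>hl \<partial>hl) \<le> (\<integral>\<^sup>+x. ennreal (?r x * (x powr \<alpha> * (x powr (- (2 * \<sigma>)) * (x powr lam * (1 + x\<^sup>2) * c lam)))) \<partial>hl)"
        proof (intro nn_integral_mono)
          fix x assume "x \<in> space hl"
          then have x: "x > 0" by simp
          have "(\<integral>\<^sup>+y. ennreal (?A x y) \<partial>hl) = (\<integral>\<^sup>+y. ennreal (?r x * x powr \<alpha>) * ennreal (K x y * (y powr lam * ?mi x y)) \<partial>hl)"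
            by (intro nn_integral_cong ennreal_mult') auto
          also have "\<dots> = ennreal (?r x * x powr \<alpha>) * (\<integral>\<^sup>+y. ennreal (K x y * (y powr lam * ?mi x y)) \<partial>hl)"
            by (rule nn_integral_cmult) measurable
          also have "\<dots> \<le> ennreal (?r x * x powr \<alpha>) * ennreal (x powr (- (2 * \<sigma>)) * (x powr lam * (1 + x\<^sup>2) * c lam))"
            using lam by (intro mult_left_mono inner x) auto
          also have "\<dots> = ennreal (?r x * (x powr \<alpha> * (x powr (- (2 * \<sigma>)) * (x powr lam * (1 + x\<^sup>2) * c lam))))"
            by (subst ennreal_mult'[symmetric]) (simp_all add: mult.assoc)
          finally show "(\<integral>\<^sup>+y. ennreal (?A x y) \<partial>hl) \<le> ennreal (?r x * (x powr \<alpha> * (x powr (- (2 * \<sigma>)) * (x powr lam * (1 + x\<^sup>2) * c lam))))" .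
        qed
        also have "\<dots> < \<infinity>" by (intro integrable_nn_less_top out) simp
        finally show ?thesis .
      qed
      have B: "(\<integral>\<^sup>+x. \<integral>\<^sup>+y. ennreal (?B x y) \<partial>hl \<partial>hl) < \<infinity>"
      proof -
        have mB: "(\<lambda>(y, x). ennreal (?B x y)) \<in> borel_measurable (hl \<Otimes>\<^sub>M hl)" unfolding split_beta' by measurable
        have "(\<integral>\<^sup>+x. \<integral>\<^sup>+y. ennreal (?B x y) \<partial>hl \<partial>hl) = (\<integral>\<^sup>+y. \<integral>\<^sup>+x. ennreal (?B x y) \<partial>hl \<partial>hl)"
          by (rule hl_hl.Fubini'[OF mB])
        also have "\<dots> \<le> (\<integral>\<^sup>+y. ennreal (?r y * (y powr lam * (y powr (- (2 * \<sigma>)) * (y powr \<alpha> * (1 + y\<^sup>2) * c \<alpha>)))) \<partial>hl)"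
        proof (intro nn_integral_mono)
          fix y assume "y \<in> space hl"
          then have y: "y > 0" by simp
          have "(\<integral>\<^sup>+x. ennreal (?B x y) \<partial>hl) = (\<integral>\<^sup>+x. ennreal (?r y * y powr lam) * ennreal (K y x * (x powr \<alpha> * ?mi y x)) \<partial>hl)"
            by (intro nn_integral_cong ennreal_mult') auto
          also have "\<dots> = ennreal (?r y * y powr lam) * (\<integral>\<^sup>+x. ennreal (K y x * (x powr \<alpha> * ?mi y x)) \<partial>hl)"
            by (rule nn_integral_cmult) measurable
          also have "\<dots> \<le> ennreal (?r y * y powr lam) * ennreal (y powr (- (2 * \<sigma>)) * (y powr \<alpha> * (1 + y\<^sup>2) * c \<alpha>))"
            using l1 alp by (intro mult_left_mono inner y) auto
          also have "\<dots> = ennreal (?r y * (y powr lam * (y powr (- (2 * \<sigma>)) * (y powr \<alpha> * (1 + y\<^sup>2) * c \<alpha>))))"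
            by (subst ennreal_mult'[symmetric]) (simp_all add: mult.assoc)
          finally show "(\<integral>\<^sup>+x. ennreal (?B x y) \<partial>hl) \<le> ennreal (?r y * (y powr lam * (y powr (- (2 * \<sigma>)) * (y powr \<alpha> * (1 + y\<^sup>2) * c \<alpha>))))" .
        qed
        also have "\<dots> < \<infinity>" by (intro integrable_nn_less_top out) simp
        finally show ?thesis .
      qed
      show ?thesis using A B by (simp add: ennreal_mult_less_top)
    qed
    finally show ?thesis .
  qed
  note FJ = fubini[OF sigma_finite_hl sigma_finite_hl mJ finJ]
  note FL = fubini[OF sigma_finite_hl sigma_finite_hl mL finL]
  let ?c = "pos_const lam \<sigma>"
  have eJ: "u x * bessel_pos_power_test lam \<sigma> \<phi> x = ?c * (\<integral>y. ?J x y \<partial>hl)" if "x \<in> space hl" for x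
    using pos_power_test_eq[OF sig sh, of x] that unfolding K_def pp by simp
  have eL: "?c * V u x * \<phi> x = ?c * (\<integral>y. ?L x y \<partial>hl)" for x
    unfolding V_def by simp
  show "integrable hl (\<lambda>x. u x * bessel_pos_power_test lam \<sigma> \<phi> x)"
    by (subst Bochner_Integration.integrable_cong[OF refl eJ], assumption) (intro integrable_mult_right FJ(2))
  show "integrable hl (\<lambda>x. ?c * V u x * \<phi> x)"
    unfolding eL by (intro integrable_mult_right FL(2))
  text \<open>The difference of the two integrands is antisymmetric and absolutely integrable.\<close>
  let ?D = "\<lambda>x y. ?J x y - ?L x y"
  have iD: "integrable (hl \<Otimes>\<^sub>M hl) (case_prod ?D)"
    using Bochner_Integration.integrable_diff[OF FJ(1) FL(1)] by (simp add: split_beta')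
  \<comment> \<open>The compensating parts of both integrands equal K(x, y) u(x)
    \<open>Ps 0 x\<close> y^lam and cancel, leaving K(x, y) (\<phi>(x) u(y) - u(x)
    \<phi>(y)).\<close>
  have anti: "?D x y = - ?D y x" if "x > 0" "y > 0" for x y
  proof -
    have "x powr lam * (y / x) powr lam = y powr lam" "y powr lam * (x / y) powr lam = x powr lam"
      using that by (simp_all add: powr_mult[symmetric])
    then have "?L x y = K x y * (Ps 0 x * u x * y powr lam - \<phi> x * u y)" "?L y x = K x y * (Ps 0 y * u y * x powr lam - \<phi> y * u x)"
      unfolding K_commute[of y x] using that by (simp_all add: phi algebra_simps)
    then show ?thesis unfolding K_commute[of y x] using that by (simp only: phi) (simp add: algebra_simps)
  qed
  have "(\<integral>y. \<integral>x. ?D x y \<partial>hl \<partial>hl) = (\<integral>x. \<integral>y. ?D x y \<partial>hl \<partial>hl)" by (rule hl_hl.Fubini_integral[OF iD])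
  moreover have "(\<integral>y. \<integral>x. ?D x y \<partial>hl \<partial>hl) = (\<integral>y. - (\<integral>x. ?D y x \<partial>hl) \<partial>hl)"
  proof (rule Bochner_Integration.integral_cong[OF refl])
    fix y assume "y \<in> space hl"
    then have y: "y > 0" by simp
    have "(\<integral>x. ?D x y \<partial>hl) = (\<integral>x. - ?D y x \<partial>hl)"
      by (rule Bochner_Integration.integral_cong[OF refl], rule anti) (use y in auto)
    then show "(\<integral>x. ?D x y \<partial>hl) = - (\<integral>x. ?D y x \<partial>hl)" by (simp only: integral_minus)
  qed
  ultimately have "(\<integral>x. \<integral>y. ?D x y \<partial>hl \<partial>hl) = 0" by (simp only: integral_minus)
  moreover have "(\<integral>x. \<integral>y. ?D x y \<partial>hl \<partial>hl) = (\<integral>x. (\<integral>y. ?J x y \<partial>hl) - (\<integral>y. ?L x y \<partial>hl) \<partial>hl)"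
  proof (rule integral_cong_AE)
    show "(\<lambda>x. \<integral>y. ?D x y \<partial>hl) \<in> borel_measurable hl"
      using hl_hl.integrable_fst'[OF iD] by (simp add: borel_measurable_integrable)
    show "(\<lambda>x. (\<integral>y. ?J x y \<partial>hl) - (\<integral>y. ?L x y \<partial>hl)) \<in> borel_measurable hl"
      using FJ(2) FL(2) by (intro borel_measurable_diff borel_measurable_integrable)
    show "AE x in hl. (\<integral>y. ?D x y \<partial>hl) = (\<integral>y. ?J x y \<partial>hl) - (\<integral>y. ?L x y \<partial>hl)"
      using FJ(5) FL(5) by eventually_elim (rule Bochner_Integration.integral_diff)
  qed
  ultimately have "(\<integral>x. \<integral>y. ?J x y \<partial>hl \<partial>hl) = (\<integral>x. \<integral>y. ?L x y \<partial>hl \<partial>hl)"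
    using Bochner_Integration.integral_diff[OF FJ(2) FL(2)] by simp
  moreover have "(\<integral>x. u x * bessel_pos_power_test lam \<sigma> \<phi> x \<partial>hl) = (\<integral>x. ?c * (\<integral>y. ?J x y \<partial>hl) \<partial>hl)"
    by (rule Bochner_Integration.integral_cong[OF refl eJ])
  ultimately show "(\<integral>x. u x * bessel_pos_power_test lam \<sigma> \<phi> x \<partial>hl) = (\<integral>x. ?c * V u x * \<phi> x \<partial>hl)"
    unfolding eL by (simp only: integral_mult_right_zero)
qed

text \<open>The function to be identified with the power is \<open>pos_const\<close> times
  \<open>V u\<close>, so the norm bound is \<open>V_Hol\<close>. Linearity and continuity of the
  functional are then read off from this representation, the growth of the function being absorbed
  by a seminorm.\<close>

lemma pos_power_bound:
  "\<exists>C>0. \<forall>u\<in>holder_space \<alpha> \<inter> L_space \<sigma>.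
     bessel_pos_power_defined lam \<sigma> u \<and>
     bessel_pos_power lam \<sigma> u \<in> S_dual lam \<and>
     (\<exists>g\<in>holder_space (\<alpha> - 2 * \<sigma>).
        identified_with lam (bessel_pos_power lam \<sigma> u) g \<and>
        holder_norm (\<alpha> - 2 * \<sigma>) g \<le> C * holder_norm \<alpha> u)"
proof -
  let ?b = "\<alpha> - 2 * \<sigma>" and ?c = "pos_const lam \<sigma>"
  obtain C where C: "C \<ge> 0" "\<And>N f. Hol N \<alpha> f \<Longrightarrow> Hol (C * N) (\<alpha> + - (2 * \<sigma>)) (V f)"
    using V_Hol[OF t0 l1] by blast
  show ?thesis
  proof (intro exI[of _ "2 * (\<bar>?c\<bar> * C) + 1"] conjI ballI)
    show "2 * (\<bar>?c\<bar> * C) + 1 > 0" using C(1) by (intro add_nonneg_pos) auto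
    fix u assume "u \<in> holder_space \<alpha> \<inter> L_space \<sigma>"
    then have u: "Hol (holder_norm \<alpha> u) \<alpha> u" by (auto intro: holder_space_Hol)
    let ?g = "\<lambda>x. ?c * V u x" and ?T = "bessel_pos_power lam \<sigma> u"
    define A where "A = \<bar>?c\<bar> * (C * holder_norm \<alpha> u)"
    have g: "Hol A ?b ?g" unfolding A_def using Hol_cmult[OF C(2)[OF u], of ?c] by simp
    have dual: "integrable hl (\<lambda>x. u x * bessel_pos_power_test lam \<sigma> \<phi> x)" "integrable hl (\<lambda>x. ?g x * \<phi> x)"
      "?T \<phi> = (\<integral>x. ?g x * \<phi> x \<partial>hl)" if f: "\<phi> \<in> S_space lam" for \<phi>
    proof -
      have "\<phi> x = x powr lam * ((Dx ^^ 0) (\<lambda>y. y powr (- lam) * \<phi> y)) x" if "x > 0" for x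
        using that by (simp add: powr_minus)
      note d = duality[OF u S_space_Sch[OF f] this]
      show "integrable hl (\<lambda>x. u x * bessel_pos_power_test lam \<sigma> \<phi> x)" by (rule d(1))
      show "integrable hl (\<lambda>x. ?g x * \<phi> x)" by (rule d(2))
      show "?T \<phi> = (\<integral>x. ?g x * \<phi> x \<partial>hl)" unfolding bessel_pos_power_def set_integral_hl by (rule d(3))
    qed
    show "bessel_pos_power_defined lam \<sigma> u"
      unfolding bessel_pos_power_defined_def set_integrable_hl using dual(1) by blast
    show "\<exists>g\<in>holder_space ?b. identified_with lam ?T g \<and> holder_norm ?b g \<le> (2 * (\<bar>?c\<bar> * C) + 1) * holder_norm \<alpha> u"
    proof (rule bexI[of _ ?g], rule conjI)
      show "?g \<in> holder_space ?b" by (rule Hol_holder_space(1)[OF g pos])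
      show "identified_with lam ?T ?g"
        unfolding identified_with_def set_integrable_hl set_integral_hl using dual by blast
      have "holder_norm ?b ?g \<le> 2 * A" by (rule Hol_holder_space(2)[OF g pos])
      also have "\<dots> \<le> (2 * (\<bar>?c\<bar> * C) + 1) * holder_norm \<alpha> u"
        unfolding A_def using Hol_nonneg[OF u] by (simp add: distrib_right)
      finally show "holder_norm ?b ?g \<le> (2 * (\<bar>?c\<bar> * C) + 1) * holder_norm \<alpha> u" .
    qed
    have lin: "?T (\<lambda>x. a * \<phi> x + b * \<psi> x) = a * ?T \<phi> + b * ?T \<psi>" if f: "\<phi> \<in> S_space lam" "\<psi> \<in> S_space lam" for a b \<phi> \<psi>
    proof -
      have "?T (\<lambda>x. a * \<phi> x + b * \<psi> x) = (\<integral>x. a * (?g x * \<phi> x) + b * (?g x * \<psi> x) \<partial>hl)"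
        unfolding dual(3)[OF S_space_lin[OF f]] by (intro Bochner_Integration.integral_cong refl) (simp add: algebra_simps)
      also have "\<dots> = a * ?T \<phi> + b * ?T \<psi>"
        unfolding dual(3)[OF f(1)] dual(3)[OF f(2)]
        by (simp only: Bochner_Integration.integral_add[OF integrable_mult_right[OF dual(2)[OF f(1)]] integrable_mult_right[OF dual(2)[OF f(2)]]] integral_mult_right_zero)
      finally show ?thesis .
    qed
    show "?T \<in> S_dual lam"
      unfolding S_dual_def mem_Collect_eq
    proof (intro conjI ballI allI impI)
      fix \<phi> \<psi> assume "\<phi> \<in> S_space lam" "\<psi> \<in> S_space lam"
      then show "?T (\<lambda>x. \<phi> x + \<psi> x) = ?T \<phi> + ?T \<psi>" using lin[of \<phi> \<psi> 1 1] by simp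
    next
      fix c \<phi> assume "\<phi> \<in> S_space lam"
      then show "?T (\<lambda>x. c * \<phi> x) = c * ?T \<phi>" using lin[of \<phi> \<phi> c 0] by simp
    next
      fix \<phi> and \<epsilon> :: real assume f: "\<phi> \<in> S_space lam" and e: "\<epsilon> > 0"
      \<comment> \<open>A single seminorm, of order m and without derivatives, dominates the
        functional: the weight \<open>(1 + x) powr (- real m)\<close> makes the growth of order
        \<alpha> - 2 \<sigma> + lam integrable.\<close>
      obtain m :: nat where m: "lam + 5 < real m" using reals_Archimedean2 by blast
      let ?w = "\<lambda>x. x powr (?b + lam) * (1 + x\<^sup>2) * (1 + x) powr (- real m)"
      have iw: "integrable hl ?w" using m pos sig alp lam by (intro weight_integrable) auto
      \<comment> \<open>The product bounds the functional by the seminorm; the added 1 makes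
        \<epsilon> / Q meaningful and the last inequality strict.\<close>
      define Q where "Q = A * integral\<^sup>L hl ?w + 1"
      have A0: "A \<ge> 0" by (rule Hol_nonneg[OF g])
      have Iw: "integral\<^sup>L hl ?w \<ge> 0" by (intro Bochner_Integration.integral_nonneg mult_nonneg_nonneg) auto
      have Q: "Q > 0" unfolding Q_def using A0 Iw by (intro add_nonneg_pos mult_nonneg_nonneg) auto
      show "\<exists>N. \<exists>\<delta>>0. \<forall>\<psi>\<in>S_space lam. (\<forall>m\<le>N. \<forall>k\<le>N. S_seminorm lam m k (\<lambda>x. \<psi> x - \<phi> x) < \<delta>) \<longrightarrow> \<bar>?T \<psi> - ?T \<phi>\<bar> < \<epsilon>"
      proof (intro exI[of _ m] exI[of _ "\<epsilon> / Q"] conjI ballI impI)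
        show "\<epsilon> / Q > 0" using e Q by simp
        fix \<psi> assume h: "\<psi> \<in> S_space lam" and sm: "\<forall>m'\<le>m. \<forall>k\<le>m. S_seminorm lam m' k (\<lambda>x. \<psi> x - \<phi> x) < \<epsilon> / Q"
        let ?d = "\<lambda>x. \<psi> x - \<phi> x"
        have d: "?d \<in> S_space lam" using S_space_lin[OF h f, of 1 "-1"] by simp
        have "?T \<psi> - ?T \<phi> = ?T ?d" using lin[OF h f, of 1 "-1"] by simp
        then have "\<bar>?T \<psi> - ?T \<phi>\<bar> = \<bar>\<integral>x. ?g x * ?d x \<partial>hl\<bar>" unfolding dual(3)[OF d] by simp
        also have "\<dots> \<le> (\<integral>x. \<bar>?g x * ?d x\<bar> \<partial>hl)" by (rule integral_abs_bound)
        also have "\<dots> \<le> (\<integral>x. A * (\<epsilon> / Q) * ?w x \<partial>hl)"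
        proof (rule integral_mono)
          show "integrable hl (\<lambda>x. \<bar>?g x * ?d x\<bar>)" by (intro integrable_abs dual(2)[OF d])
          show "integrable hl (\<lambda>x. A * (\<epsilon> / Q) * ?w x)" by (intro integrable_mult_right iw)
          fix x assume "x \<in> space hl"
          then have x: "x > 0" by simp
          have "(1 + x) ^ m * \<bar>x powr (- lam) * ?d x\<bar> \<le> S_seminorm lam m 0 ?d"
            using S_seminorm_bound[OF d x, of m 0] by simp
          moreover have "S_seminorm lam m 0 ?d < \<epsilon> / Q" using sm by blast
          ultimately have "(1 + x) ^ m * \<bar>x powr (- lam) * ?d x\<bar> \<le> \<epsilon> / Q" by linarith
          moreover have "(1 + x) ^ m = (1 + x) powr real m" using x by (simp add: powr_realpow)
          ultimately have "(1 + x) powr real m * (inverse (x powr lam) * \<bar>?d x\<bar>) \<le> \<epsilon> / Q"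
            by (simp only: abs_mult abs_inverse abs_of_nonneg powr_ge_zero powr_minus)
          moreover have "v \<le> q * (L * inverse P)" if "P * (inverse L * v) \<le> q" "P > 0" "L > 0" for P L v q :: real
            using that by (simp add: field_simps)
          ultimately have "\<bar>?d x\<bar> \<le> \<epsilon> / Q * (x powr lam * (1 + x) powr (- real m))"
            unfolding powr_minus[of "1 + x"] using x by (simp only: powr_gt_zero)
          then have "\<bar>?g x\<bar> * \<bar>?d x\<bar> \<le> (A * x powr ?b) * (\<epsilon> / Q * (x powr lam * (1 + x) powr (- real m)))"
            using A0 by (intro mult_mono Hol_bound[OF g x]) auto
          also have "\<dots> = A * (\<epsilon> / Q) * (x powr (?b + lam) * 1 * (1 + x) powr (- real m))"
            by (simp only: powr_add mult_ac mult_1_right)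
          also have "\<dots> \<le> A * (\<epsilon> / Q) * ?w x"
            using A0 e Q by (intro mult_left_mono mult_right_mono) auto
          finally show "\<bar>?g x * ?d x\<bar> \<le> A * (\<epsilon> / Q) * ?w x" by (simp only: abs_mult)
        qed
        also have "\<dots> = (A * integral\<^sup>L hl ?w) * (\<epsilon> / Q)" by (simp only: integral_mult_right_zero) (simp only: mult_ac)
        also have "\<dots> < Q * (\<epsilon> / Q)" using e Q unfolding Q_def by (intro mult_strict_right_mono) auto
        also have "\<dots> = \<epsilon>" using Q by simp
        finally show "\<bar>?T \<psi> - ?T \<phi>\<bar> < \<epsilon>" .
      qed
    qed
  qed
qed

end

theorem theorem1:
  fixes lam \<sigma> \<alpha> :: real
  assumes "lam > 0" and "0 < \<sigma>" and "\<sigma> < 1" and "0 < \<alpha>" and "\<alpha> < 1"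
  shows "(\<alpha> + 2 * \<sigma> < min lam 1 \<longrightarrow>
      (\<exists>C>0. \<forall>f\<in>holder_space \<alpha>.
         bessel_neg_power_defined lam \<sigma> f \<and>
         bessel_neg_power lam \<sigma> f \<in> holder_space (\<alpha> + 2 * \<sigma>) \<and>
         holder_norm (\<alpha> + 2 * \<sigma>) (bessel_neg_power lam \<sigma> f) \<le> C * holder_norm \<alpha> f)) \<and>
    (0 < \<alpha> - 2 * \<sigma> \<and> \<alpha> - 2 * \<sigma> < 1 \<and> lam \<ge> 1 \<longrightarrow>
      (\<exists>C>0. \<forall>u\<in>holder_space \<alpha> \<inter> L_space \<sigma>.
         bessel_pos_power_defined lam \<sigma> u \<and>
         bessel_pos_power lam \<sigma> u \<in> S_dual lam \<and>
         (\<exists>g\<in>holder_space (\<alpha> - 2 * \<sigma>).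
            identified_with lam (bessel_pos_power lam \<sigma> u) g \<and>
            holder_norm (\<alpha> - 2 * \<sigma>) g \<le> C * holder_norm \<alpha> u)))"
  using neg_power_bound[OF assms(1,2,4,5)] pos_power_bound[OF _ assms(2,4,5)] by auto

end
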